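(* Let $(X,\mu,S)$ be a finitely generated multiplicative system and $f\in\mathcal{M}^{\mathrm c}_{\mathrm{fg}}$. Then the following hold: (i) If $F\in L^2(X)$ is such that $P_fF$ is constant, then $$\lim_{N\to\infty}\frac1N\sum_{n=1}^N\overline{f(n)}\,S_nF=M(\overline f)\cdot\int_X F\,d\mu\qquad\text{in }L^2(X).\qquad(\ast)$$ Therefore, if for any non-constant $G\in L^2(X)$ we have $\mathbb{D}_G(S,f)=\infty$, then $(\ast)$ holds for all $F\in L^2(X)$. (ii) If a non-constant $F\in L^2(X)$ satisfies $\mathbb{D}_F(S,f)<\infty$, then $$\lim_{N\to\infty}\frac1N\sum_{n=1}^N\overline{f(n)}\,S_nF=\prod_{p\in\mathcal{P}}\Big(1-\frac1p\Big)\sum_{n\in\mathcal{Q}_{\mathcal{P}^{\mathrm c}}}\frac{\overline{f(n)}}{n}S_nF\qquad\text{in }L^2(X),$$ where $\mathcal{P}=\{p\in\mathbb{P}:S_pF\neq f(p)F\}$, and this limit is not equal to $M(\overline f)\cdot\int_X F\,d\mu$.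
   Context: $\mathbb{N}=\{1,2,\dots\}$, $\mathbb{P}$ is the set of primes, $\mathbb{S}^1$ the complex unit circle. Every probability space $(X,\mu)$ is assumed regular: $X$ is a compact metric space with its Borel $\sigma$-algebra. A multiplicative system $(X,\mu,S)$ consists of a probability space $(X,\mu)$ and a sequence $S=(S_n)_{n\in\mathbb{N}}$ of commuting invertible measure-preserving transformations of $(X,\mu)$ with $S_{nm}=S_n\circ S_m$ for all $n,m\in\mathbb{N}$. It is finitely generated if $\{S_p:p\in\mathbb{P}\}$ is finite. For $F\in L^2(X)$, $S_nF=F\circ S_n$. "Constant" means $\mu$-almost everywhere constant. $\mathcal{M}^{\mathrm c}_{\mathrm{fg}}$ is the set of completely multiplicative $f:\mathbb{N}\to\mathbb{S}^1$ with $\{f(p):p\in\mathbb{P}\}$ finite. $M(\overline f)=\lim_{N\to\infty}\frac1N\sum_{n=1}^N\overline{f(n)}$, which exists for such $f$ (by Hal\'asz's theorem). $\mathbb{D}_F(S,f)=\big(\frac12\sum_{p\in\mathbb{P}}\frac{\|S_pF-f(p)F\|_2^2}{p}\big)^{1/2}\in[0,\infty]$; $\mathcal{H}_f=\{F\in L^2(X):\mathbb{D}_F(S,f)<\infty\}$ is a linear subspace, and $P_f$ is the orthogonal projection of $L^2(X)$ onto $\overline{\mathcal{H}_f}$. For $\mathcal{P}\subseteq\mathbb{P}$, $\mathcal{P}^{\mathrm c}=\mathbb{P}\setminus\mathcal{P}$ and $\mathcal{Q}_{\mathcal{P}}=\{n\in\mathbb{N}:\text{no prime divisor of }n\text{ lies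 in }\mathcal{P}\}$; thus $\mathcal{Q}_{\mathcal{P}^{\mathrm c}}$ is the set of $n$ all of whose prime divisors lie in $\mathcal{P}$. *)

theory Defs
  imports "HOL-Probability.Probability" "HOL-Computational_Algebra.Primes"
begin

text \<open>
  Elements of $L^2$ are represented by square-integrable complex functions; equality in $L^2$
  is equality almost everywhere, so "constant" means almost everywhere constant.
\<close>

definition L2 :: "'a measure \<Rightarrow> ('a \<Rightarrow> complex) set" where
  "L2 M = {F. F \<in> borel_measurable M \<and> integrable M (\<lambda>x. (norm (F x))\<^sup>2)}"

definition L2_norm :: "'a measure \<Rightarrow> ('a \<Rightarrow> complex) \<Rightarrow> real" where
  "L2_norm M F = sqrt (\<integral>x. (norm (F x))\<^sup>2 \<partial>M)"

definition L2_inner :: "'a measure \<Rightarrow> ('a \<Rightarrow> complex) \<Rightarrow> ('a \<Rightarrow> complex) \<Rightarrow> complex" where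
  "L2_inner M F G = (\<integral>x. F x * cnj (G x) \<partial>M)"

definition L2_tendsto ::
    "'a measure \<Rightarrow> ('i \<Rightarrow> 'a \<Rightarrow> complex) \<Rightarrow> ('a \<Rightarrow> complex) \<Rightarrow> 'i filter \<Rightarrow> bool" where
  "L2_tendsto M u G \<F> \<longleftrightarrow> G \<in> L2 M \<and> ((\<lambda>i. L2_norm M (\<lambda>x. u i x - G x)) \<longlongrightarrow> 0) \<F>"

text \<open>Unconditional convergence of a series in $L^2$, as in \<^const>\<open>has_sum\<close>.\<close>

definition L2_has_sum ::
    "'a measure \<Rightarrow> ('i \<Rightarrow> 'a \<Rightarrow> complex) \<Rightarrow> 'i set \<Rightarrow> ('a \<Rightarrow> complex) \<Rightarrow> bool" where
  "L2_has_sum M u A G \<longleftrightarrow> L2_tendsto M (\<lambda>I x. \<Sum>i\<in>I. u i x) G (finite_subsets_at_top A)"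

definition L2_closure :: "'a measure \<Rightarrow> ('a \<Rightarrow> complex) set \<Rightarrow> ('a \<Rightarrow> complex) set" where
  "L2_closure M V =
    {G \<in> L2 M. \<forall>\<epsilon>>0. \<exists>H\<in>V. L2_norm M (\<lambda>x. G x - H x) < \<epsilon>}"

definition ae_constant :: "'a measure \<Rightarrow> ('a \<Rightarrow> complex) \<Rightarrow> bool" where
  "ae_constant M F \<longleftrightarrow> (\<exists>c. AE x in M. F x = c)"

text \<open>
  The space is a compact subset \<open>space M\<close> of the ambient metric space, with its Borel sets.
  The index \<open>0\<close> of \<open>S\<close> is unused. Commutativity of the \<open>S n\<close> follows from \<open>S_mult\<close>.
\<close>

locale multiplicative_system = prob_space M
  for M :: "'a::metric_space measure" and S :: "nat \<Rightarrow> 'a \<Rightarrow> 'a" +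
  assumes compact_space: "compact (space M)"
    and sets_borel: "sets M = sets (restrict_space borel (space M))"
    and S_bij: "\<And>n. n \<ge> 1 \<Longrightarrow> bij_betw (S n) (space M) (space M)"
    and S_measurable: "\<And>n. n \<ge> 1 \<Longrightarrow> S n \<in> measurable M M"
    and S_inv_measurable: "\<And>n. n \<ge> 1 \<Longrightarrow> the_inv_into (space M) (S n) \<in> measurable M M"
    and S_preserving: "\<And>n. n \<ge> 1 \<Longrightarrow> distr M M (S n) = M"
    and S_mult: "\<And>n m x. n \<ge> 1 \<Longrightarrow> m \<ge> 1 \<Longrightarrow> x \<in> space M \<Longrightarrow> S (n * m) x = S n (S m x)"

text \<open>The restriction discards irrelevant values of \<open>S p\<close> outside the space.\<close>

locale fg_multiplicative_system = multiplicative_system +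
  assumes finitely_generated: "finite ((\<lambda>p. restrict (S p) (space M)) ` {p. prime p})"

text \<open>Arithmetic functions are functions on \<^typ>\<open>nat\<close> whose value at \<open>0\<close> is unused.\<close>

definition M_c_fg :: "(nat \<Rightarrow> complex) set" where
  "M_c_fg = {f. (\<forall>n\<ge>1. norm (f n) = 1) \<and> (\<forall>n\<ge>1. \<forall>m\<ge>1. f (n * m) = f n * f m) \<and>
     finite (f ` {p. prime p})}"

definition mean_value :: "(nat \<Rightarrow> complex) \<Rightarrow> complex" where
  "mean_value g = lim (\<lambda>N. (\<Sum>n=1..N. g n) / of_nat N)"

text \<open>The value is infinite exactly when the series of nonnegative terms diverges.\<close>

definition pret_dist ::
    "'a measure \<Rightarrow> (nat \<Rightarrow> 'a \<Rightarrow> 'a) \<Rightarrow> (nat \<Rightarrow> complex) \<Rightarrow> ('a \<Rightarrow> complex) \<Rightarrow> ennreal" where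
  "pret_dist M S f F =
    (let a = (\<lambda>p. (L2_norm M (\<lambda>x. F (S p x) - f p * F x))\<^sup>2 / real p)
     in if a summable_on {p. prime p}
        then ennreal (sqrt (1 / 2 * (\<Sum>\<^sub>\<infinity>p\<in>{p. prime p}. a p))) else \<infinity>)"

definition pret_space ::
    "'a measure \<Rightarrow> (nat \<Rightarrow> 'a \<Rightarrow> 'a) \<Rightarrow> (nat \<Rightarrow> complex) \<Rightarrow> ('a \<Rightarrow> complex) set" where
  "pret_space M S f = {F \<in> L2 M. pret_dist M S f F < \<infinity>}"

text \<open>
  \<open>is_pret_proj M S f F G\<close>: the function \<open>G\<close> represents $P_f F$, the orthogonal projection of \<open>F\<close>
  onto the closure of \<^const>\<open>pret_space\<close>; it is determined up to null sets.
\<close>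

definition is_pret_proj ::
    "'a measure \<Rightarrow> (nat \<Rightarrow> 'a \<Rightarrow> 'a) \<Rightarrow> (nat \<Rightarrow> complex) \<Rightarrow> ('a \<Rightarrow> complex) \<Rightarrow> ('a \<Rightarrow> complex) \<Rightarrow> bool"
  where
  "is_pret_proj M S f F G \<longleftrightarrow>
    G \<in> L2_closure M (pret_space M S f) \<and>
    (\<forall>H \<in> L2_closure M (pret_space M S f). L2_inner M (\<lambda>x. F x - G x) H = 0)"

definition twisted_avg ::
    "(nat \<Rightarrow> 'a \<Rightarrow> 'a) \<Rightarrow> (nat \<Rightarrow> complex) \<Rightarrow> ('a \<Rightarrow> complex) \<Rightarrow> nat \<Rightarrow> 'a \<Rightarrow> complex" where
  "twisted_avg S f F N x = (\<Sum>n=1..N. cnj (f n) * F (S n x)) / of_nat N"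

definition Q_set :: "nat set \<Rightarrow> nat set" where
  "Q_set P = {n. n \<ge> 1 \<and> (\<forall>p. prime p \<and> p dvd n \<longrightarrow> p \<notin> P)}"

definition bad_primes ::
    "'a measure \<Rightarrow> (nat \<Rightarrow> 'a \<Rightarrow> 'a) \<Rightarrow> (nat \<Rightarrow> complex) \<Rightarrow> ('a \<Rightarrow> complex) \<Rightarrow> nat set" where
  "bad_primes M S f F = {p. prime p \<and> \<not> (AE x in M. F (S p x) = f p * F x)}"

end

theory Submission
  imports Defs "HOL-Complex_Analysis.Complex_Analysis"
begin

text \<open>
  Put \<open>U n F = cnj (f n) * (F \<circ> S n)\<close>. Up to sets of measure zero, \<open>U n\<close> depends only on how many
  prime factors of \<open>n\<close> belong to each of the finitely many colours, the fibres of
  \<open>p \<mapsto> (S p, f p)\<close>. If \<open>F\<close> is fixed by \<open>U p\<close> for every colour whose reciprocal sum diverges, then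
  the remaining primes are sparse, and the averages of \<open>U n F\<close> are evaluated by splitting \<open>n\<close> into
  a factor built from sparse primes and a factor free of them, which has a natural density. On the
  orthogonal complement, which lies in the closed span of the ranges of \<open>U q - 1\<close> for the divergent
  colours \<open>q\<close>, the averages tend to \<open>0\<close>. By finite Fourier analysis on large boxes of exponents this
  reduces to a form of Halasz's theorem: the mean of a completely multiplicative function which is a
  unimodular constant \<open>z q\<close> on each colour \<open>q\<close> tends to \<open>0\<close>, uniformly in \<open>z\<close>, as long as
  \<open>z q\<close> stays away from \<open>1\<close> for some divergent colour.

  For the latter, the Chebyshev bound reduces the mean to the logarithmic average of
  \<open>\<bar>\<Sum>n\<le>N. g n\<bar>\<^sup>2 / N\<^sup>2\<close>. This average is a quadratic form with kernel
  \<open>1 / max(n,m)\<^sup>2 = exp (- \<bar>ln n - ln m\<bar>) / (n m)\<close>, the Fourier transform of a Cauchy density. Removing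
  the primes up to a fixed bound \<open>y\<close> from the sum gains the factor
  \<open>\<Prod>p\<le>y. \<bar>1 - g p p\<^sup>-\<^sup>1\<^sup>-\<^sup>i\<^sup>t\<bar>\<^sup>-\<^sup>2 (1 - 1/p)\<^sup>2\<close>, which is small, uniformly for \<open>t\<close> in a compact
  interval, because \<open>\<Sum>(1 - Re (g p p\<^sup>-\<^sup>i\<^sup>t)) / p\<close> diverges.
\<close>

section \<open>Partial sums of completely multiplicative functions\<close>

text \<open>Uniformity in \<open>z\<close> is forced by the transference: an operator norm is
  bounded by a supremum over all \<open>z\<close>, and the function attached to the range of
  \<open>U q - 1\<close> is \<open>z q - 1\<close> times a mean. Where \<open>z q\<close> is near 1
  the first factor is small; elsewhere one threshold must serve all \<open>z\<close>. Compactness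
  supplies it: the sums over \<open>p \<le> y\<close> are continuous in \<open>(z, t)\<close> and
  increase with \<open>y\<close>, so pointwise divergence is uniform (Dini). For
  \<open>t \<noteq> 0\<close> the divergence uses that there are finitely many colours: some power
  \<open>m\<close> brings all \<open>z q\<close> near 1 simultaneously, so a \<open>z\<close>
  imitating \<open>p^(i t)\<close> would force \<open>p^(i m t)\<close> to be near 1 for most
  primes, against the boundedness of zeta near \<open>1 + i m t\<close>. The last claim of (ii)
  rests on an inversion. The limit is a non-zero multiple of a series \<open>G\<close> in the
  functions \<open>U a F\<close>; applying \<open>1 - U p / p\<close> for one sparse prime after
  another strips \<open>G\<close> down to \<open>F\<close>. Each step maps constants to constants,
  so a constant \<open>G\<close> would make \<open>F\<close> constant.\<close>

lemma prod_primes_dvd: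
  fixes m :: nat
  assumes "finite A" "\<And>p. p \<in> A \<Longrightarrow> prime p \<and> p dvd m"
  shows "\<Prod>A dvd m"
  using assms
proof (induction A rule: finite_induct)
  case (insert p A)
  have "coprime p (\<Prod>A)"
    by (rule prod_coprime_right) (use insert in \<open>metis insert_iff primes_coprime\<close>)
  then show ?case using insert by (simp add: divides_mult)
qed simp

text \<open>A prime in this range divides the factorial of \<open>2 n\<close> but not that of
  \<open>n\<close>, hence it divides the central binomial coefficient, which is at most
  \<open>4^n\<close>.\<close>

lemma theta_double:
  "(\<Sum>p | prime p \<and> n < p \<and> p \<le> 2 * n. ln (real p)) \<le> 2 * real n * ln 2"
proof -
  let ?A = "{p. prime p \<and> n < p \<and> p \<le> 2 * n}"
  have fin: "finite ?A" by simp
  have "\<Prod>?A dvd (2 * n) choose n"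
  proof (rule prod_primes_dvd[OF fin])
    fix p assume p: "p \<in> ?A"
    then have "p dvd fact (2 * n)" by (simp add: prime_dvd_fact_iff)
    also have "fact (2 * n) = fact n * fact n * ((2 * n) choose n)"
      using binomial_fact_lemma[of n "2 * n"] by simp
    finally show "prime p \<and> p dvd (2 * n) choose n"
      using p by (auto simp: prime_dvd_mult_iff prime_dvd_fact_iff)
  qed
  then have "\<Prod>?A \<le> (2 * n) choose n" by (rule dvd_imp_le) simp
  also have "\<dots> \<le> 2 ^ (2 * n)" by (rule binomial_le_pow2)
  finally have le: "\<Prod>?A \<le> 2 ^ (2 * n)" .
  have "(\<Sum>p\<in>?A. ln (real p)) = ln (\<Prod>p\<in>?A. real p)"
    by (rule ln_prod[symmetric]) (use fin in \<open>auto simp: prime_gt_0_nat\<close>)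
  also have "\<dots> = ln (real (\<Prod>?A))" by simp
  also have "\<dots> \<le> ln (real (2 ^ (2 * n)))"
    by (rule ln_mono) (use le in \<open>auto intro!: prod_pos simp: prime_gt_0_nat simp del: of_nat_prod of_nat_power\<close>)
  also have "\<dots> = 2 * real n * ln 2" by (simp add: ln_realpow)
  finally show ?thesis .
qed

lemma theta_bound: "(\<Sum>p | prime p \<and> p \<le> n. ln (real p)) \<le> 4 * real n"
proof -
  define th where "th n = (\<Sum>p | prime p \<and> p \<le> n. ln (real p))" for n :: nat
  have nn: "0 \<le> ln (real p)" if "prime p" for p :: nat
    using prime_ge_1_nat[OF that] by simp
  have split: "{p. prime p \<and> p \<le> 2 * n} = {p. prime p \<and> p \<le> n} \<union> {p. prime p \<and> n < p \<and> p \<le> 2 * n}"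
    for n :: nat by auto
  \<comment> \<open>The dyadic blocks form a geometric series. The 4 of the lemma is one factor 2
    from this series and one from rounding \<open>n\<close> up to a power of two.\<close>
  have pow: "th (2 ^ k) \<le> 2 ^ (k + 1) * ln 2" for k
  proof (induction k)
    case 0
    have "{p::nat. prime p \<and> p \<le> 1} = {}" by (auto dest: prime_ge_2_nat)
    then show ?case unfolding th_def power_0 by (simp only: sum.empty) simp
  next
    case (Suc k)
    have "{p::nat. prime p \<and> p \<le> 2 ^ Suc k} =
        {p. prime p \<and> p \<le> 2 ^ k} \<union> {p. prime p \<and> 2 ^ k < p \<and> p \<le> 2 * 2 ^ k}"
      unfolding power_Suc by (rule split)
    moreover have "sum (\<lambda>p. ln (real p)) ({p. prime p \<and> p \<le> 2 ^ k} \<union> {p. prime p \<and> 2 ^ k < p \<and> p \<le> 2 * 2 ^ k})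
        = th (2 ^ k) + (\<Sum>p | prime p \<and> 2 ^ k < p \<and> p \<le> 2 * 2 ^ k. ln (real p))"
      unfolding th_def by (rule sum.union_disjoint) auto
    ultimately have "th (2 ^ Suc k) = th (2 ^ k) + (\<Sum>p | prime p \<and> 2 ^ k < p \<and> p \<le> 2 * 2 ^ k. ln (real p))"
      by (simp only: th_def)
    with Suc theta_double[of "2 ^ k"] show ?case by (simp add: algebra_simps)
  qed
  show ?thesis
  proof (cases "n = 0")
    case False
    define k where "k = nat \<lceil>log 2 (real n)\<rceil>"
    have lg: "0 \<le> log 2 (real n)" using False by simp
    have "log 2 (real n) \<le> real k" unfolding k_def using lg by linarith
    then have "real n \<le> 2 powr real k" using False by (simp add: log_le_iff)
    then have "real n \<le> real (2 ^ k)" by (simp add: powr_realpow)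
    then have nk: "n \<le> 2 ^ k" by (simp only: of_nat_le_iff)
    have "real k \<le> log 2 (real n) + 1" unfolding k_def using lg by linarith
    then have "2 powr real k \<le> 2 powr (log 2 (real n) + 1)" by simp
    then have kn: "2 ^ k \<le> 2 * real n" using False by (simp add: powr_add powr_realpow)
    have "th n \<le> th (2 ^ k)" unfolding th_def
      by (rule sum_mono2) (use nk nn in auto)
    also have "\<dots> \<le> 2 ^ (k + 1) * ln 2" by (rule pow)
    also have "\<dots> \<le> 2 ^ (k + 1) * 1" by (intro mult_left_mono) (use ln_2_less_1 in auto)
    also have "\<dots> \<le> 4 * real n" using kn by simp
    finally show ?thesis by (simp add: th_def)
  qed simp
qed

section \<open>Logarithmic weights and partial sums of completely multiplicative functions\<close>

definition cmult :: "(nat \<Rightarrow> complex) \<Rightarrow> bool" where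
  "cmult g \<longleftrightarrow> g 1 = 1 \<and> (\<forall>m\<ge>1. \<forall>n\<ge>1. g (m * n) = g m * g n)"

lemma cmult_mult: "cmult g \<Longrightarrow> m \<ge> 1 \<Longrightarrow> n \<ge> 1 \<Longrightarrow> g (m * n) = g m * g n" by (simp add: cmult_def)

text \<open>The left side is \<open>ln (N^N / N!)\<close>, so this is the elementary half of
  Stirling's formula; the induction rests on \<open>N * ln (1 + 1/N) \<le> 1\<close>. It prices the
  replacement of the weight \<open>ln n\<close> by \<open>ln N\<close>.\<close>

lemma sum_ln_ratio: "(\<Sum>n=1..N. ln (real N) - ln (real n)) \<le> real N"
proof (induction N)
  case (Suc N)
  show ?case
  proof (cases "N = 0")
    case False
    have "(\<Sum>n=1..Suc N. ln (real (Suc N)) - ln (real n))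
        = (\<Sum>n=1..N. (ln (real (Suc N)) - ln (real N)) + (ln (real N) - ln (real n)))"
      by (simp add: sum.atLeast_Suc_atMost_Suc_shift)
    also have "\<dots> = real N * (ln (real (Suc N)) - ln (real N)) + (\<Sum>n=1..N. ln (real N) - ln (real n))"
      by (simp add: sum.distrib sum_subtractf algebra_simps)
    also have "ln (real (Suc N)) - ln (real N) = ln (1 + 1 / real N)"
      using False ln_div[of "real (Suc N)" "real N"] by (simp add: add_divide_distrib add.commute)
    also have "\<dots> \<le> 1 / real N" by (rule ln_add_one_self_le_self) simp
    then have "real N * ln (1 + 1 / real N) \<le> 1" using False by (simp add: field_simps)
    with Suc have "real N * ln (1 + 1 / real N) + (\<Sum>n=1..N. ln (real N) - ln (real n)) \<le> real (Suc N)" by simp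
    finally show ?thesis .
  qed simp
qed simp

text \<open>This is \<open>ln = 1 * \<Lambda>\<close> with the von Mangoldt function \<Lambda>. Both
  ranges run to a common \<open>N\<close> rather than to \<open>n\<close>, so that a sum over
  \<open>n\<close> can be exchanged with them.\<close>

lemma ln_eq_sum_prime_powers:
  assumes "1 \<le> n" "n \<le> N"
  shows "ln (real n) = (\<Sum>p | prime p \<and> p \<le> N. \<Sum>k=1..N. if p ^ k dvd n then ln (real p) else 0)"
proof -
  have inner: "(\<Sum>k=1..N. if p ^ k dvd n then ln (real p) else 0) = real (multiplicity p n) * ln (real p)"
    if p: "prime p" for p
  proof -
    \<comment> \<open>The crude chain \<open>k < 2^k \<le> p^k \<le> n\<close> keeps every exponent
      within \<open>{1..N}\<close>.\<close>
    have "multiplicity p n < 2 ^ multiplicity p n" by simp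
    also have "\<dots> \<le> p ^ multiplicity p n" using p by (intro power_mono) (auto dest: prime_ge_2_nat)
    also have "\<dots> \<le> n" using assms by (intro dvd_imp_le multiplicity_dvd) auto
    finally have m: "multiplicity p n \<le> N" using assms by simp
    have "{k\<in>{1..N}. p ^ k dvd n} = {1..multiplicity p n}"
    proof -
      have "p ^ k dvd n \<longleftrightarrow> k \<le> multiplicity p n" for k
        by (rule power_dvd_iff_le_multiplicity) (use assms p in auto)
      then have "{k\<in>{1..N}. p ^ k dvd n} = {k\<in>{1..N}. k \<le> multiplicity p n}" by (rule Collect_cong[OF conj_cong[OF refl]])
      also have "\<dots> = {1..multiplicity p n}" using m by auto
      finally show ?thesis .
    qed
    moreover have "(\<Sum>k=1..N. if p ^ k dvd n then ln (real p) else 0)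
        = (\<Sum>k\<in>{k\<in>{1..N}. p ^ k dvd n}. ln (real p))"
      by (rule sum.inter_filter[symmetric]) simp
    ultimately show ?thesis by simp
  qed
  have "real n = real (\<Prod>p\<in>prime_factors n. p ^ multiplicity p n)"
    using assms prime_factorization_nat[of n] by simp
  also have "\<dots> = (\<Prod>p\<in>prime_factors n. real p ^ multiplicity p n)" by simp
  finally have "ln (real n) = ln (\<Prod>p\<in>prime_factors n. real p ^ multiplicity p n)" by simp
  also have "\<dots> = (\<Sum>p\<in>prime_factors n. ln (real p ^ multiplicity p n))"
    by (rule ln_prod) (auto simp: prime_gt_0_nat in_prime_factors_iff)
  also have "\<dots> = (\<Sum>p\<in>prime_factors n. real (multiplicity p n) * ln (real p))"
    by (intro sum.cong) (auto simp: ln_realpow prime_gt_0_nat in_prime_factors_iff)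
  also have "\<dots> = (\<Sum>p | prime p \<and> p \<le> N. real (multiplicity p n) * ln (real p))"
  proof (rule sum.mono_neutral_left)
    show "prime_factors n \<subseteq> {p. prime p \<and> p \<le> N}"
      using assms by (auto simp: in_prime_factors_iff intro: order_trans[OF dvd_imp_le])
    show "\<forall>i\<in>{p. prime p \<and> p \<le> N} - prime_factors n. real (multiplicity i n) * ln (real i) = 0"
      using assms by (auto simp: in_prime_factors_iff not_dvd_imp_multiplicity_0)
  qed simp
  also have "\<dots> = (\<Sum>p | prime p \<and> p \<le> N. \<Sum>k=1..N. if p ^ k dvd n then ln (real p) else 0)"
    by (intro sum.cong refl) (use inner in auto)
  finally show ?thesis .
qed

lemma sum_over_multiples:
  fixes g :: "nat \<Rightarrow> 'b::comm_monoid_add"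
  assumes "d \<ge> 1"
  shows "(\<Sum>n=1..N. if d dvd n then g n else 0) = (\<Sum>m=1..N div d. g (d * m))"
proof -
  have "(\<Sum>n=1..N. if d dvd n then g n else 0) = (\<Sum>n\<in>{n\<in>{1..N}. d dvd n}. g n)"
    by (rule sum.inter_filter[symmetric]) simp
  also have "\<dots> = (\<Sum>m=1..N div d. g (d * m))"
    by (rule sum.reindex_bij_witness[of _ "\<lambda>m. d * m" "\<lambda>n. n div d"])
       (use assms in \<open>auto simp: div_le_mono Suc_le_eq less_eq_div_iff_mult_less_eq mult.commute dest: dvd_imp_le elim!: dvdE\<close>)
  finally show ?thesis .
qed

lemma sum_ln_over_square_bounded:
  obtains C where "C \<ge> 0" "\<And>A. finite A \<Longrightarrow> (\<Sum>n\<in>A. ln (real n) / real n ^ 2) \<le> C"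
proof -
  have nn: "0 \<le> ln (real n) / real n ^ 2" for n by (cases "n = 0") auto
  have sm: "summable (\<lambda>n. ln (real n) / real n ^ 2)"
  proof (rule summable_comparison_test')
    show "summable (\<lambda>n. 2 * real n powr (-3/2))"
      by (intro summable_mult) (simp add: summable_real_powr_iff)
    fix n :: nat assume n: "n \<ge> 1"
    have "ln (real n) \<le> real n powr (1/2) / (1/2)" by (rule ln_powr_bound) (use n in auto)
    then have "ln (real n) / real n ^ 2 \<le> 2 * real n powr (1/2) / real n powr 2"
      using n by (simp add: divide_right_mono powr_numeral)
    also have "\<dots> = 2 * real n powr (-3/2)" proof -
      have "real n powr (1/2) = real n powr (-3/2 + 2)" by simp
      also have "\<dots> = real n powr (-3/2) * real n powr 2" by (rule powr_add)
      finally have "real n powr (1/2) = real n powr (-3/2) * real n powr 2" .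
      then show ?thesis using n by simp
    qed
    finally show "norm (ln (real n) / real n ^ 2) \<le> 2 * real n powr (-3/2)" using nn[of n] by simp
  qed
  show ?thesis
  proof (rule that)
    show "0 \<le> (\<Sum>n. ln (real n) / real n ^ 2)" using sm nn by (rule suminf_nonneg)
    show "(\<Sum>n\<in>A. ln (real n) / real n ^ 2) \<le> (\<Sum>n. ln (real n) / real n ^ 2)" if "finite A" for A
      using sm that by (rule sum_le_suminf) (use nn in auto)
  qed
qed

lemma geometric_tail:
  assumes "p \<ge> (2::nat)"
  shows "(\<Sum>k=2..N. 1 / real p ^ k) \<le> 2 / real p ^ 2"
proof -
  \<comment> \<open>The subtracted term lets the induction close: a new summand is paid for by
    \<open>2 / p^(N+1) \<le> 1 / p^N\<close>.\<close>
  have "(\<Sum>k=2..N. 1 / real p ^ k) \<le> 2 / real p ^ 2 - (if N < 2 then 0 else 1 / real p ^ N)"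
  proof (induction N)
    case (Suc N)
    have "real p \<ge> 2" using assms by simp
    then have s: "2 / real p ^ Suc N \<le> 1 / real p ^ N" by (simp add: field_simps)
    consider "N = 0" | "N = 1" | "N \<ge> 2" by linarith
    then show ?case
    proof cases
      case 3 with Suc s show ?thesis by (simp add: add_divide_distrib[symmetric])
    qed (auto simp: numeral_2_eq_2)
  qed simp
  also have "\<dots> \<le> 2 / real p ^ 2" by simp
  finally show ?thesis .
qed

text \<open>Write \<open>ln n\<close> as a sum over prime powers dividing \<open>n\<close>; complete
  multiplicativity turns the sum over multiples of \<open>p^k\<close> into \<open>g (p^k)\<close>
  times a shorter partial sum. Only \<open>k = 1\<close> matters: by the trivial bound the powers
  \<open>k \<ge> 2\<close> contribute \<open>O(N)\<close>, since the sum of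
  \<open>ln p / p^2\<close> converges.\<close>

lemma partial_sum_log_bound:
  obtains C where "C \<ge> 0"
    "\<And>g N. cmult g \<Longrightarrow> (\<forall>n\<ge>1. norm (g n) = 1) \<Longrightarrow> N \<ge> 1 \<Longrightarrow>
       norm (\<Sum>n=1..N. g n) * ln (real N) \<le>
       (\<Sum>p | prime p \<and> p \<le> N. ln (real p) * norm (\<Sum>n=1..N div p. g n)) + C * real N"
proof -
  obtain K where K: "K \<ge> 0" "\<And>A. finite A \<Longrightarrow> (\<Sum>n\<in>A. ln (real n) / real n ^ 2) \<le> K"
    using sum_ln_over_square_bounded by blast
  show ?thesis
  proof (rule that)
    \<comment> \<open>\<open>2 * K\<close> covers the higher prime powers, the 2 being that of
      \<open>geometric_tail\<close>; the 1 covers the error \<open>ln N - ln n\<close>.\<close>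
    show "0 \<le> 2 * K + 1" using K by simp
    fix g :: "nat \<Rightarrow> complex" and N :: nat
    assume g: "cmult g" "\<forall>n\<ge>1. norm (g n) = 1" and N: "N \<ge> 1"
    define S where "S N = (\<Sum>n=1..N. g n)" for N
    define P where "P = {p. prime p \<and> p \<le> N}"
    have finP: "finite P" by (simp add: P_def)
    have nS: "norm (S m) \<le> real m" for m
    proof -
      have "norm (S m) \<le> (\<Sum>n=1..m. norm (g n))" unfolding S_def by (rule norm_sum)
      also have "\<dots> = real m" using g by simp
      finally show ?thesis .
    qed
    have "(\<Sum>n=1..N. g n * complex_of_real (ln (real n)))
        = (\<Sum>n=1..N. \<Sum>p\<in>P. \<Sum>k=1..N. if p ^ k dvd n then g n * complex_of_real (ln (real p)) else 0)"
    proof (rule sum.cong[OF refl])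
      fix n assume n: "n \<in> {1..N}"
      show "g n * complex_of_real (ln (real n)) =
         (\<Sum>p\<in>P. \<Sum>k=1..N. if p ^ k dvd n then g n * complex_of_real (ln (real p)) else 0)"
        unfolding P_def using n
        by (subst ln_eq_sum_prime_powers[of n N])
           (auto simp: sum_distrib_left if_distrib[of "\<lambda>x. _ * x"] if_distrib[of complex_of_real] cong: if_cong)
    qed
    also have "\<dots> = (\<Sum>p\<in>P. \<Sum>k=1..N. \<Sum>n=1..N. if p ^ k dvd n then g n * complex_of_real (ln (real p)) else 0)"
      by (subst sum.swap) (intro sum.cong refl sum.swap)
    also have "\<dots> = (\<Sum>p\<in>P. \<Sum>k=1..N. complex_of_real (ln (real p)) * g (p ^ k) * S (N div p ^ k))"
    proof (intro sum.cong refl)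
      fix p k assume p: "p \<in> P"
      then have pk: "p ^ k \<ge> 1" by (simp add: P_def prime_gt_0_nat Suc_le_eq)
      have "(\<Sum>n=1..N. if p ^ k dvd n then g n * complex_of_real (ln (real p)) else 0)
          = (\<Sum>m=1..N div p ^ k. g (p ^ k * m) * complex_of_real (ln (real p)))"
        by (rule sum_over_multiples[OF pk])
      also have "\<dots> = complex_of_real (ln (real p)) * g (p ^ k) * S (N div p ^ k)"
        unfolding S_def sum_distrib_left by (intro sum.cong refl) (use g pk in \<open>simp add: cmult_mult\<close>)
      finally show "(\<Sum>n=1..N. if p ^ k dvd n then g n * complex_of_real (ln (real p)) else 0)
         = complex_of_real (ln (real p)) * g (p ^ k) * S (N div p ^ k)" .
    qed
    finally have eq: "(\<Sum>n=1..N. g n * complex_of_real (ln (real n))) =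
        (\<Sum>p\<in>P. \<Sum>k=1..N. complex_of_real (ln (real p)) * g (p ^ k) * S (N div p ^ k))" .
    have "norm (\<Sum>n=1..N. g n * complex_of_real (ln (real n)))
        \<le> (\<Sum>p\<in>P. \<Sum>k=1..N. norm (complex_of_real (ln (real p)) * g (p ^ k) * S (N div p ^ k)))"
      unfolding eq by (intro order_trans[OF norm_sum] sum_mono norm_sum)
    also have "\<dots> \<le> (\<Sum>p\<in>P. ln (real p) * norm (S (N div p)) + real N * (2 * (ln (real p) / real p ^ 2)))"
    proof (rule sum_mono)
      fix p assume p: "p \<in> P"
      then have p2: "p \<ge> 2" by (simp add: P_def prime_ge_2_nat)
      then have l0: "ln (real p) \<ge> 0" by simp
      have nk: "norm (complex_of_real (ln (real p)) * g (p ^ k) * S (N div p ^ k)) = ln (real p) * norm (S (N div p ^ k))" for k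
        using g(2) p2 l0 by (simp add: norm_mult)
      have "(\<Sum>k=1..N. norm (complex_of_real (ln (real p)) * g (p ^ k) * S (N div p ^ k)))
          = ln (real p) * norm (S (N div p)) + (\<Sum>k=2..N. ln (real p) * norm (S (N div p ^ k)))"
        unfolding nk using N by (subst sum.atLeast_Suc_atMost) (auto simp: numeral_2_eq_2)
      also have "(\<Sum>k=2..N. ln (real p) * norm (S (N div p ^ k))) \<le> (\<Sum>k=2..N. ln (real p) * (real N * (1 / real p ^ k)))"
      proof (intro sum_mono mult_left_mono l0)
        fix k
        have "norm (S (N div p ^ k)) \<le> real (N div p ^ k)" by (rule nS)
        also have "\<dots> \<le> real N / real (p ^ k)" by (rule of_nat_div_le_of_nat)
        finally show "norm (S (N div p ^ k)) \<le> real N * (1 / real p ^ k)" by simp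
      qed
      also have "\<dots> = ln (real p) * real N * (\<Sum>k=2..N. 1 / real p ^ k)"
        by (simp add: sum_distrib_left mult.assoc)
      also have "\<dots> \<le> ln (real p) * real N * (2 / real p ^ 2)"
        by (intro mult_left_mono geometric_tail p2) (use l0 in auto)
      finally show "(\<Sum>k=1..N. norm (complex_of_real (ln (real p)) * g (p ^ k) * S (N div p ^ k)))
         \<le> ln (real p) * norm (S (N div p)) + real N * (2 * (ln (real p) / real p ^ 2))"
        by (simp add: algebra_simps)
    qed
    also have "\<dots> = (\<Sum>p\<in>P. ln (real p) * norm (S (N div p))) + 2 * real N * (\<Sum>p\<in>P. ln (real p) / real p ^ 2)"
      by (simp add: sum.distrib sum_distrib_left mult.assoc mult.left_commute)
    also have "\<dots> \<le> (\<Sum>p\<in>P. ln (real p) * norm (S (N div p))) + 2 * real N * K"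
      by (intro add_left_mono mult_left_mono K finP) simp
    finally have main: "norm (\<Sum>n=1..N. g n * complex_of_real (ln (real n)))
        \<le> (\<Sum>p\<in>P. ln (real p) * norm (S (N div p))) + 2 * real N * K" .
    have "norm (\<Sum>n=1..N. g n * complex_of_real (ln (real N) - ln (real n)))
        \<le> (\<Sum>n=1..N. norm (g n * complex_of_real (ln (real N) - ln (real n))))"
      by (rule norm_sum)
    also have "\<dots> = (\<Sum>n=1..N. ln (real N) - ln (real n))"
      by (intro sum.cong refl, subst norm_mult, subst norm_of_real) (use g in auto)
    also have "\<dots> \<le> real N" by (rule sum_ln_ratio)
    finally have rest: "norm (\<Sum>n=1..N. g n * complex_of_real (ln (real N) - ln (real n))) \<le> real N" .
    have "S N * complex_of_real (ln (real N)) = (\<Sum>n=1..N. g n * complex_of_real (ln (real n)))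
        + (\<Sum>n=1..N. g n * complex_of_real (ln (real N) - ln (real n)))"
      unfolding S_def sum_distrib_right sum.distrib[symmetric] by (intro sum.cong) (auto simp: algebra_simps)
    then have "norm (S N * complex_of_real (ln (real N))) \<le>
       norm (\<Sum>n=1..N. g n * complex_of_real (ln (real n)))
        + norm (\<Sum>n=1..N. g n * complex_of_real (ln (real N) - ln (real n)))"
      by (simp only: norm_triangle_ineq)
    also have "\<dots> \<le> (\<Sum>p\<in>P. ln (real p) * norm (S (N div p))) + 2 * real N * K + real N"
      using main rest by simp
    finally show "norm (\<Sum>n=1..N. g n) * ln (real N) \<le>
       (\<Sum>p | prime p \<and> p \<le> N. ln (real p) * norm (\<Sum>n=1..N div p. g n)) + (2 * K + 1) * real N"
      using N by (simp add: norm_mult S_def P_def algebra_simps)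
  qed
qed

text \<open>At most \<open>p\<close> integers \<open>n\<close> share a quotient
  \<open>m = n div p\<close>, and the quotient 0 costs nothing because
  \<open>s 0 = 0\<close>.\<close>

lemma sum_div_fiber_le:
  fixes s :: "nat \<Rightarrow> real"
  assumes "\<And>m. 0 \<le> s m" "p \<ge> 1" "s 0 = 0"
  shows "(\<Sum>n\<in>{N<..N+H}. s (n div p)) \<le> real p * (\<Sum>m=1..(N+H) div p. s m)"
proof -
  have "(\<Sum>n\<in>{N<..N+H}. s (n div p)) \<le> (\<Sum>n<p * (Suc ((N+H) div p)). s (n div p))"
  proof (rule sum_mono2)
    show "{N<..N+H} \<subseteq> {..<p * Suc ((N+H) div p)}"
      using assms(2) by (auto simp: dividend_less_times_div intro: le_less_trans)
  qed (use assms in auto)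
  also have "\<dots> = (\<Sum>m<Suc ((N+H) div p). \<Sum>n\<in>{m*p..<m*p+p}. s (n div p))"
    by (subst mult.commute) (rule sum.nat_group[symmetric])
  also have "\<dots> = (\<Sum>m<Suc ((N+H) div p). real p * s m)"
  proof (rule sum.cong[OF refl])
    fix m
    have "(\<Sum>n\<in>{m*p..<m*p+p}. s (n div p)) = (\<Sum>n\<in>{m*p..<m*p+p}. s m)"
    proof (rule sum.cong[OF refl])
      fix n assume "n \<in> {m*p..<m*p+p}"
      then have "n div p = m" by (intro div_nat_eqI) (auto simp: mult.commute)
      then show "s (n div p) = s m" by simp
    qed
    then show "(\<Sum>n\<in>{m*p..<m*p+p}. s (n div p)) = real p * s m" by simp
  qed
  also have "\<dots> = real p * (\<Sum>m=1..(N+H) div p. s m)"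
  proof -
    have "{..<Suc ((N+H) div p)} = insert 0 {1..(N+H) div p}" by auto
    then show ?thesis using assms(3) by (simp add: sum_distrib_left)
  qed
  finally show ?thesis .
qed

text \<open>Averaging over the short window \<open>{N<..N+H}\<close> makes the Chebyshev bound sufficient here.\<close>

lemma partial_sum_window_bound:
  obtains C where "C \<ge> 0"
    "\<And>g N H. cmult g \<Longrightarrow> (\<forall>n\<ge>1. norm (g n) = 1) \<Longrightarrow> 1 \<le> H \<Longrightarrow> H \<le> N \<Longrightarrow>
       real H * norm (\<Sum>n=1..N. g n) * ln (real N) \<le>
       16 * real N ^ 2 * (\<Sum>m=1..2*N. norm (\<Sum>n=1..m. g n) / real m ^ 2) + C * real H * real N + real H ^ 2 * ln (real N)"
proof -
  obtain C where C: "C \<ge> 0" and Cb: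
    "\<And>g N. cmult g \<Longrightarrow> (\<forall>n\<ge>1. norm (g n) = 1) \<Longrightarrow> N \<ge> 1 \<Longrightarrow>
       norm (\<Sum>n=1..N. g n) * ln (real N) \<le>
       (\<Sum>p | prime p \<and> p \<le> N. ln (real p) * norm (\<Sum>n=1..N div p. g n)) + C * real N"
    using partial_sum_log_bound by blast
  show ?thesis
  proof (rule that)
    show "0 \<le> 2 * C" using C by simp
    fix g :: "nat \<Rightarrow> complex" and N H :: nat
    assume g: "cmult g" "\<forall>n\<ge>1. norm (g n) = 1" and H: "1 \<le> H" "H \<le> N"
    define s where "s N = norm (\<Sum>n=1..N. g n)" for N
    define P where "P = {p. prime p \<and> p \<le> 2 * N}"
    have lnp: "0 \<le> ln (real p)" if "p \<in> P" for p
    proof -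
      have "1 \<le> p" using that prime_ge_1_nat by (auto simp: P_def)
      then show ?thesis by simp
    qed
    have finP: "finite P" by (simp add: P_def)
    have s0: "s 0 = 0" "\<And>m. 0 \<le> s m" by (auto simp: s_def)
    have lnN: "0 \<le> ln (real N)" using H by simp
    \<comment> \<open>Replacing \<open>N\<close> by a point \<open>n\<close> of the window changes
      the partial sum by at most \<open>H\<close>. The primes in \<open>P\<close> reach
      \<open>2 * N\<close>, so that one range serves every \<open>n\<close>.\<close>
    have step: "s N * ln (real N) \<le> (\<Sum>p\<in>P. ln (real p) * s (n div p)) + 2 * C * real N + real H * ln (real N)"
      if n: "n \<in> {N<..N+H}" for n
    proof -
      have "{1..n} = {1..N} \<union> {N<..n}" using n by auto
      then have "(\<Sum>n=1..n. g n) = (\<Sum>n=1..N. g n) + (\<Sum>n\<in>{N<..n}. g n)"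
        by (subst sum.union_disjoint[symmetric]) auto
      then have "(\<Sum>n=1..N. g n) = (\<Sum>n=1..n. g n) - (\<Sum>n\<in>{N<..n}. g n)" by simp
      then have "s N \<le> s n + norm (\<Sum>n\<in>{N<..n}. g n)" unfolding s_def by (simp only: norm_triangle_ineq4)
      also have "norm (\<Sum>n\<in>{N<..n}. g n) \<le> (\<Sum>n\<in>{N<..n}. norm (g n))" by (rule norm_sum)
      also have "\<dots> = real (n - N)" using g by simp
      also have "\<dots> \<le> real H" using n by simp
      finally have "s N \<le> s n + real H" by simp
      then have "s N * ln (real N) \<le> (s n + real H) * ln (real N)" using lnN by (rule mult_right_mono)
      also have "\<dots> \<le> s n * ln (real n) + real H * ln (real N)"
        using n H s0(2)[of n] by (simp add: distrib_right mult_left_mono)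
      also have "s n * ln (real n) \<le> (\<Sum>p | prime p \<and> p \<le> n. ln (real p) * s (n div p)) + C * real n"
        unfolding s_def by (rule Cb) (use g n in auto)
      also have "(\<Sum>p | prime p \<and> p \<le> n. ln (real p) * s (n div p)) \<le> (\<Sum>p\<in>P. ln (real p) * s (n div p))"
        by (rule sum_mono2) (use n H lnp s0 finP in \<open>auto simp: P_def intro!: mult_nonneg_nonneg\<close>)
      also have "C * real n \<le> C * (2 * real N)" by (rule mult_left_mono) (use n H C in auto)
      finally show ?thesis by simp
    qed
    have "real H * (s N * ln (real N)) = (\<Sum>n\<in>{N<..N+H}. s N * ln (real N))" by simp
    also have "\<dots> \<le> (\<Sum>n\<in>{N<..N+H}. (\<Sum>p\<in>P. ln (real p) * s (n div p)) + 2 * C * real N + real H * ln (real N))"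
      by (rule sum_mono) (rule step)
    also have "\<dots> = (\<Sum>n\<in>{N<..N+H}. \<Sum>p\<in>P. ln (real p) * s (n div p)) + real H * (2 * C * real N + real H * ln (real N))"
      by (simp add: sum.distrib algebra_simps)
    also have "(\<Sum>n\<in>{N<..N+H}. \<Sum>p\<in>P. ln (real p) * s (n div p)) = (\<Sum>p\<in>P. ln (real p) * (\<Sum>n\<in>{N<..N+H}. s (n div p)))"
      by (subst sum.swap) (simp add: sum_distrib_left)
    also have "\<dots> \<le> (\<Sum>p\<in>P. ln (real p) * (real p * (\<Sum>m=1..2*N. if p \<le> 2 * N div m then s m else 0)))"
    proof (intro sum_mono mult_left_mono lnp)
      fix p assume p: "p \<in> P"
      then have p1: "p \<ge> 1" using prime_ge_1_nat by (auto simp: P_def)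
      have "(\<Sum>n\<in>{N<..N+H}. s (n div p)) \<le> real p * (\<Sum>m=1..(N+H) div p. s m)"
        by (rule sum_div_fiber_le) (use s0 p1 in auto)
      also have "(\<Sum>m=1..(N+H) div p. s m) \<le> (\<Sum>m\<in>{m\<in>{1..2*N}. p \<le> 2 * N div m}. s m)"
      proof (rule sum_mono2)
        show "{1..(N + H) div p} \<subseteq> {m \<in> {1..2 * N}. p \<le> 2 * N div m}"
        proof
          fix m assume m: "m \<in> {1..(N + H) div p}"
          then have "m * p \<le> N + H" using p1 by (simp add: less_eq_div_iff_mult_less_eq)
          then have "m * p \<le> 2 * N" using H by simp
          moreover from this have "m \<le> 2 * N" using p1 by (metis le_trans mult_le_mono2 nat_mult_1_right)
          ultimately show "m \<in> {m \<in> {1..2 * N}. p \<le> 2 * N div m}"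
            using m by (simp add: less_eq_div_iff_mult_less_eq mult.commute)
        qed
      qed (use s0 in auto)
      also have "\<dots> = (\<Sum>m=1..2*N. if p \<le> 2 * N div m then s m else 0)" by (rule sum.inter_filter) simp
      finally show "(\<Sum>n\<in>{N<..N+H}. s (n div p)) \<le> real p * (\<Sum>m=1..2*N. if p \<le> 2 * N div m then s m else 0)"
        by (simp add: mult_left_mono)
    qed
    also have "\<dots> = (\<Sum>p\<in>P. \<Sum>m=1..2*N. if p \<le> 2 * N div m then s m * (real p * ln (real p)) else 0)"
      by (simp add: sum_distrib_left if_distrib[of "\<lambda>x. _ * x"] mult_ac cong: if_cong)
    also have "\<dots> = (\<Sum>m=1..2*N. \<Sum>p\<in>P. if p \<le> 2 * N div m then s m * (real p * ln (real p)) else 0)"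
      by (rule sum.swap)
    \<comment> \<open>A prime meets \<open>m\<close> only if \<open>p * m \<le> 2 * N\<close>.
      Bounding the factor \<open>p\<close> by \<open>2 * N / m\<close> and the sum of
      \<open>ln p\<close> by Chebyshev gives \<open>4 * (2 * N / m)^2\<close>, the source of the
      16.\<close>
    also have "\<dots> \<le> (\<Sum>m=1..2*N. s m * (4 * (real (2 * N) / real m) ^ 2))"
    proof (rule sum_mono)
      fix m assume m: "m \<in> {1..2*N}"
      let ?y = "2 * N div m"
      have "(\<Sum>p\<in>P. if p \<le> ?y then s m * (real p * ln (real p)) else 0)
          = (\<Sum>p\<in>{p\<in>P. p \<le> ?y}. s m * (real p * ln (real p)))"
        by (rule sum.inter_filter[symmetric]) (rule finP)
      also have "\<dots> \<le> (\<Sum>p\<in>{p\<in>P. p \<le> ?y}. s m * (real ?y * ln (real p)))"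
        by (intro sum_mono mult_left_mono mult_right_mono) (use s0 lnp in auto)
      also have "\<dots> = s m * (real ?y * (\<Sum>p\<in>{p\<in>P. p \<le> ?y}. ln (real p)))" by (simp add: sum_distrib_left)
      also have "(\<Sum>p\<in>{p\<in>P. p \<le> ?y}. ln (real p)) \<le> (\<Sum>p | prime p \<and> p \<le> ?y. ln (real p))"
      proof (rule sum_mono2)
        fix p assume "p \<in> {p. prime p \<and> p \<le> ?y} - {p\<in>P. p \<le> ?y}"
        then have "p \<ge> 1" using prime_ge_1_nat by auto
        then show "0 \<le> ln (real p)" by simp
      qed (auto simp: P_def)
      also have "\<dots> \<le> 4 * real ?y" by (rule theta_bound)
      finally have "(\<Sum>p\<in>P. if p \<le> ?y then s m * (real p * ln (real p)) else 0) \<le> s m * (real ?y * (4 * real ?y))"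
        using s0(2)[of m] by (simp add: mult_left_mono)
      also have "\<dots> = s m * (4 * real ?y ^ 2)" by (simp add: power2_eq_square)
      also have "real ?y \<le> real (2 * N) / real m" by (rule of_nat_div_le_of_nat)
      then have "s m * (4 * real ?y ^ 2) \<le> s m * (4 * (real (2 * N) / real m) ^ 2)"
        by (intro mult_left_mono power_mono s0) auto
      finally show "(\<Sum>p\<in>P. if p \<le> ?y then s m * (real p * ln (real p)) else 0) \<le> s m * (4 * (real (2 * N) / real m) ^ 2)" .
    qed
    also have "\<dots> = 16 * real N ^ 2 * (\<Sum>m=1..2*N. s m / real m ^ 2)"
      by (simp add: sum_distrib_left power_divide power_mult_distrib mult_ac)
    finally show "real H * norm (\<Sum>n=1..N. g n) * ln (real N) \<le>
       16 * real N ^ 2 * (\<Sum>m=1..2*N. norm (\<Sum>n=1..m. g n) / real m ^ 2) + (2 * C) * real H * real N + real H ^ 2 * ln (real N)"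
      by (simp add: s_def algebra_simps power2_eq_square)
  qed
qed

section \<open>From the mean to a logarithmic mean square\<close>

lemma sum_inverse_le_ln: "N \<ge> 1 \<Longrightarrow> (\<Sum>m=1..N. 1 / real m) \<le> ln (real N) + 1"
  using euler_mascheroni_sequence_decreasing[of 1 N] by (simp add: harm_def inverse_eq_divide)

text \<open>Cauchy-Schwarz with the weight \<open>1 / m\<close> passes from the first moment in the
  window bound to the second moment, which a quadratic form can control. With \<open>H\<close> about
  \<open>h * N\<close>, each of the three terms of the window bound is at most a third of
  \<open>e * H * N * ln N\<close>.\<close>

lemma mean_small_if_log_mean_small:
  fixes e :: real
  assumes "e > 0"
  obtains \<eta> N0 where "\<eta> > 0"
    "\<And>g N. cmult g \<Longrightarrow> (\<forall>n\<ge>1. norm (g n) = 1) \<Longrightarrow> N \<ge> N0 \<Longrightarrow>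
       (\<Sum>m=1..2*N. (norm (\<Sum>n=1..m. g n))\<^sup>2 / real m ^ 3) \<le> \<eta> * (ln (real (2*N)) + 1) \<Longrightarrow>
       norm (\<Sum>n=1..N. g n) \<le> e * real N"
proof -
  obtain C where C: "C \<ge> 0" and Cb:
    "\<And>g N H. cmult g \<Longrightarrow> (\<forall>n\<ge>1. norm (g n) = 1) \<Longrightarrow> 1 \<le> H \<Longrightarrow> H \<le> N \<Longrightarrow>
       real H * norm (\<Sum>n=1..N. g n) * ln (real N) \<le>
       16 * real N ^ 2 * (\<Sum>m=1..2*N. norm (\<Sum>n=1..m. g n) / real m ^ 2) + C * real H * real N + real H ^ 2 * ln (real N)"
    using partial_sum_window_bound by blast
  define h where "h = min 1 (e / 3)"
  have h: "0 < h" "h \<le> 1" "h \<le> e / 3" using assms by (auto simp: h_def)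
  \<comment> \<open>The first term becomes \<open>16 * N^2 * 3 * r * ln N\<close>. Since
    \<open>48 * r = (e / 3) * (h / 2)\<close> and \<open>H \<ge> h * N / 2\<close>, it fits into its
    third.\<close>
  define r where "r = e * h / 288"
  have r: "r > 0" using assms h by (simp add: r_def)
  \<comment> \<open>\<open>2 / h\<close> keeps the floor of \<open>h * N\<close> above half of
    \<open>h * N\<close> and above 0; the exponentials give \<open>ln N \<ge> 1\<close> and
    \<open>ln N \<ge> 3 * C / e\<close>.\<close>
  define N0 where "N0 = nat \<lceil>2 / h\<rceil> + nat \<lceil>exp 1 + exp (3 * C / e)\<rceil>"
  show ?thesis
  proof (rule that)
    show "r\<^sup>2 > 0" using r by simp
    fix g :: "nat \<Rightarrow> complex" and N :: nat
    assume g: "cmult g" "\<forall>n\<ge>1. norm (g n) = 1" and N: "N \<ge> N0"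
      and sm: "(\<Sum>m=1..2*N. (norm (\<Sum>n=1..m. g n))\<^sup>2 / real m ^ 3) \<le> r\<^sup>2 * (ln (real (2*N)) + 1)"
    define s where "s m = norm (\<Sum>n=1..m. g n)" for m
    have "2 / h \<le> real N0" "exp 1 + exp (3 * C / e) \<le> real N0"
      unfolding N0_def by linarith+
    moreover have "real N0 \<le> real N" using N by simp
    ultimately have N1: "2 / h \<le> real N" and N2: "exp 1 + exp (3 * C / e) \<le> real N" by linarith+
    have N3: "exp 1 \<le> real N" and N4: "exp (3 * C / e) \<le> real N"
      using N2 exp_gt_zero[of "1::real"] exp_gt_zero[of "3 * C / e"] by linarith+
    have Npos: "real N > 0" using N3 exp_gt_zero[of "1::real"] by linarith
    have l1: "ln (real N) \<ge> 1" using N3 Npos by (simp add: ln_ge_iff)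
    have l2: "ln (real N) \<ge> 3 * C / e" using N4 Npos by (simp add: ln_ge_iff)
    define H where "H = nat \<lfloor>h * real N\<rfloor>"
    have hN: "h * real N \<ge> 2" using N1 h by (simp add: field_simps)
    have H1: "real H \<le> h * real N" unfolding H_def using hN by linarith
    have H2: "h * real N / 2 \<le> real H" unfolding H_def using hN by linarith
    have "real H \<ge> 1" using H2 hN by linarith
    then have H3: "1 \<le> H" by simp
    have "h * real N \<le> 1 * real N" using h by (intro mult_right_mono) auto
    then have H4: "H \<le> N" using H1 by simp
    define L where "L = ln (real (2*N)) + 1"
    have "ln (real (2 * N)) = ln 2 + ln (real N)" using Npos by (simp add: ln_mult)
    then have L: "L \<le> 3 * ln (real N)" "L \<ge> 0" using l1 ln_2_less_1 ln2_ge_two_thirds unfolding L_def by linarith+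
    have "(\<Sum>m=1..2*N. s m / real m ^ 2) = (\<Sum>m=1..2*N. \<bar>sqrt ((s m)\<^sup>2 / real m ^ 3)\<bar> * \<bar>sqrt (1 / real m)\<bar>)"
    proof (rule sum.cong[OF refl])
      fix m assume m: "m \<in> {1..2*N}"
      have "sqrt ((s m)\<^sup>2 / real m ^ 3) * sqrt (1 / real m) = sqrt ((s m / real m ^ 2)\<^sup>2)"
        unfolding real_sqrt_mult[symmetric] by (simp add: power_divide power2_eq_square power3_eq_cube mult_ac)
      then show "s m / real m ^ 2 = \<bar>sqrt ((s m)\<^sup>2 / real m ^ 3)\<bar> * \<bar>sqrt (1 / real m)\<bar>" by (simp add: s_def)
    qed
    also have "\<dots> \<le> L2_set (\<lambda>m. sqrt ((s m)\<^sup>2 / real m ^ 3)) {1..2*N} * L2_set (\<lambda>m. sqrt (1 / real m)) {1..2*N}"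
      by (rule L2_set_mult_ineq)
    also have "\<dots> = sqrt (\<Sum>m=1..2*N. (s m)\<^sup>2 / real m ^ 3) * sqrt (\<Sum>m=1..2*N. 1 / real m)"
      by (simp add: L2_set_def)
    also have "\<dots> \<le> sqrt (r\<^sup>2 * L) * sqrt L"
    proof (intro mult_mono real_sqrt_le_mono)
      show "(\<Sum>m=1..2*N. (s m)\<^sup>2 / real m ^ 3) \<le> r\<^sup>2 * L" using sm by (simp add: s_def L_def)
      show "(\<Sum>m=1..2*N. 1 / real m) \<le> L" unfolding L_def by (rule sum_inverse_le_ln) (use Npos in simp)
    qed (use L in \<open>auto intro!: real_sqrt_ge_zero sum_nonneg\<close>)
    also have "\<dots> = r * L" using L r by (simp add: real_sqrt_mult)
    also have "\<dots> \<le> r * (3 * ln (real N))" using L r by simp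
    finally have S: "(\<Sum>m=1..2*N. s m / real m ^ 2) \<le> 3 * r * ln (real N)" by simp
    have "real H * s N * ln (real N) \<le> 16 * real N ^ 2 * (\<Sum>m=1..2*N. s m / real m ^ 2) + C * real H * real N + real H ^ 2 * ln (real N)"
      unfolding s_def by (rule Cb) (use g H3 H4 in auto)
    also have "16 * real N ^ 2 * (\<Sum>m=1..2*N. s m / real m ^ 2) \<le> 16 * real N ^ 2 * (3 * r * ln (real N))"
      by (intro mult_left_mono S) simp
    also have "\<dots> = (e / 3 * real N) * (h * real N / 2) * ln (real N)"
      by (simp add: r_def power2_eq_square)
    also have "\<dots> \<le> (e / 3 * real N) * real H * ln (real N)"
      by (intro mult_right_mono mult_left_mono H2) (use assms l1 in auto)
    also have "C * real H * real N \<le> (e / 3 * ln (real N)) * real H * real N"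
    proof (intro mult_right_mono)
      show "C \<le> e / 3 * ln (real N)" using l2 assms by (simp add: field_simps)
    qed auto
    also have "real H ^ 2 * ln (real N) \<le> real H * (e / 3 * real N) * ln (real N)"
    proof -
      have "real H \<le> e / 3 * real N" using H1 h Npos by (meson mult_right_mono order_trans less_imp_le)
      then show ?thesis unfolding power2_eq_square using l1 by (intro mult_right_mono mult_left_mono) auto
    qed
    finally have "real H * s N * ln (real N) \<le> real H * (e * real N) * ln (real N)" by (simp add: algebra_simps)
    moreover have "ln (real N) > 0" using l1 by simp
    ultimately have "real H * s N \<le> real H * (e * real N)" by (rule mult_right_le_imp_le)
    then show "norm (\<Sum>n=1..N. g n) \<le> e * real N" using H3 by (simp add: s_def)
  qed
qed

section \<open>A quadratic form with a Cauchy kernel\<close>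

text \<open>Residue calculus: the segment from \<open>-R\<close> to \<open>R\<close> is closed by a
  rectangle of height \<open>R\<close>. For \<open>\<xi> \<ge> 0\<close> the exponential is bounded
  by 1 in the upper half-plane, so the other three sides, of total length \<open>4 R\<close>,
  contribute at most \<open>4 T R / (R^2 - T^2)\<close>.\<close>

lemma cauchy_kernel_fourier_nonneg:
  fixes T \<xi> :: real
  assumes T: "T > 0" and x: "\<xi> \<ge> 0"
  shows "((\<lambda>R. integral {-R..R} (\<lambda>t. complex_of_real (T / (T\<^sup>2 + t\<^sup>2)) * cis (\<xi> * t)))
            \<longlongrightarrow> complex_of_real (pi * exp (- T * \<xi>))) at_top"
proof -
  define f where "f z = of_real T * exp (\<i> * of_real \<xi> * z) / (z\<^sup>2 + of_real T ^ 2)" for z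
  define h where "h z = of_real T * exp (\<i> * of_real \<xi> * z) / (z + \<i> * of_real T)" for z
  have fh: "f z = h z / (z - \<i> * of_real T)" for z
  proof -
    have "(z + \<i> * of_real T) * (z - \<i> * of_real T) = z\<^sup>2 + of_real T ^ 2"
      by (simp add: algebra_simps power2_eq_square)
    then show ?thesis unfolding f_def h_def by simp
  qed
  have bound: "norm (integral {-R..R} (\<lambda>t. complex_of_real (T / (T\<^sup>2 + t\<^sup>2)) * cis (\<xi> * t))
      - complex_of_real (pi * exp (- T * \<xi>))) \<le> 4 * T * R / (R\<^sup>2 - T\<^sup>2)" if R: "R > T" for R
  proof -
    have R0: "R > 0" using T R by simp
    \<comment> \<open>A convex region that contains the rectangle and the pole \<open>i T\<close> of
      \<open>f\<close> but not its pole \<open>-i T\<close>. There \<open>h\<close> is holomorphic,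
      and Cauchy's integral formula for \<open>h\<close> takes the place of the residue
      theorem.\<close>
    define S where "S = {z. Im z > - T}"
    define a1 a2 a3 a4 where "a1 = complex_of_real (-R)" and "a2 = complex_of_real R" and "a3 = Complex R R" and "a4 = Complex (-R) R"
    have rect: "rectpath a1 a3 = linepath a1 a2 +++ linepath a2 a3 +++ linepath a3 a4 +++ linepath a4 a1"
      by (simp add: rectpath_def Let_def a1_def a2_def a3_def a4_def complex_of_real_def)
    have c: "((\<lambda>w. h w / (w - \<i> * of_real T)) has_contour_integral (2 * pi * \<i> * winding_number (rectpath a1 a3) (\<i> * of_real T) * h (\<i> * of_real T))) (rectpath a1 a3)"
    proof (rule Cauchy_integral_formula_convex_simple)
      show "convex S" unfolding S_def by (rule convex_halfspace_Im_gt)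
      have "z + \<i> * of_real T \<noteq> 0" if "z \<in> S" for z using that by (auto simp: S_def complex_eq_iff)
      then show "h holomorphic_on S" unfolding h_def by (intro holomorphic_intros) auto
      have "open S" unfolding S_def by (rule open_halfspace_Im_gt)
      then show "\<i> * complex_of_real T \<in> interior S" using T by (simp add: interior_open S_def)
      show "path_image (rectpath a1 a3) \<subseteq> S - {\<i> * complex_of_real T}"
        using R R0 T by (subst path_image_rectpath) (auto simp: a1_def a3_def S_def)
    qed auto
    have w: "winding_number (rectpath a1 a3) (\<i> * of_real T) = 1"
      by (rule winding_number_rectpath) (use R R0 T in \<open>auto simp: in_box_complex_iff a1_def a3_def\<close>)
    have r: "2 * pi * \<i> * h (\<i> * of_real T) = complex_of_real (pi * exp (- T * \<xi>))"
      using T by (simp add: h_def exp_of_real[symmetric] mult_ac)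
    have ci: "(f has_contour_integral complex_of_real (pi * exp (- T * \<xi>))) (rectpath a1 a3)"
      using c unfolding w mult_1_right r fh[abs_def, symmetric] .
    have contf: "continuous_on A f" if "\<And>z. z \<in> A \<Longrightarrow> z\<^sup>2 + of_real T ^ 2 \<noteq> 0" for A
      unfolding f_def using that by (intro continuous_intros) auto
    have nz: "z\<^sup>2 + of_real T ^ 2 \<noteq> 0" if "z \<in> closed_segment a1 a2" for z :: complex
    proof -
      have "Im z = 0" using that by (auto simp: a1_def a2_def closed_segment_def)
      then have "Re (z\<^sup>2 + of_real T ^ 2) = (Re z)\<^sup>2 + T\<^sup>2" by (simp add: power2_eq_square)
      moreover have "(Re z)\<^sup>2 + T\<^sup>2 > 0" using T by (simp add: add_nonneg_pos)
      ultimately show ?thesis by (metis less_irrefl zero_complex.simps(1))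
    qed
    have big: "norm (f z) \<le> T / (R\<^sup>2 - T\<^sup>2)" "z\<^sup>2 + of_real T ^ 2 \<noteq> 0" if z: "norm z \<ge> R" "Im z \<ge> 0" for z
    proof -
      have "R\<^sup>2 \<le> (norm z)\<^sup>2" using z R0 by (intro power_mono) auto
      moreover have "norm (z\<^sup>2) - norm (of_real T ^ 2 :: complex) \<le> norm (z\<^sup>2 + of_real T ^ 2)"
        by (rule norm_diff_ineq)
      ultimately have d: "R\<^sup>2 - T\<^sup>2 \<le> norm (z\<^sup>2 + of_real T ^ 2)" using T by (simp add: norm_power)
      have p: "0 < R\<^sup>2 - T\<^sup>2" using R T by (simp add: power_strict_mono)
      then show "z\<^sup>2 + of_real T ^ 2 \<noteq> 0" using d by auto
      have "norm (exp (\<i> * of_real \<xi> * z)) \<le> 1" using z x by (simp add: norm_exp_eq_Re)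
      then have "norm (f z) \<le> T * 1 / norm (z\<^sup>2 + of_real T ^ 2)"
        unfolding f_def norm_divide norm_mult using T by (intro divide_right_mono mult_mono) auto
      also have "\<dots> \<le> T / (R\<^sup>2 - T\<^sup>2)" using d p T by (simp add: frac_le)
      finally show "norm (f z) \<le> T / (R\<^sup>2 - T\<^sup>2)" .
    qed
    have seg: "norm z \<ge> R \<and> Im z \<ge> 0" if "z \<in> closed_segment a2 a3 \<union> closed_segment a3 a4 \<union> closed_segment a4 a1" for z
    proof -
      have "Re z = R \<and> 0 \<le> Im z" if "z \<in> closed_segment a2 a3"
        using that R0 by (auto simp: closed_segment_def a2_def a3_def) (simp_all add: algebra_simps)?
      moreover have "Im z = R" if "z \<in> closed_segment a3 a4"
        using that R0 by (auto simp: closed_segment_def a3_def a4_def) (simp_all add: algebra_simps)?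
      moreover have "Re z = - R \<and> 0 \<le> Im z" if "z \<in> closed_segment a4 a1"
        using that R0 by (auto simp: closed_segment_def a1_def a4_def) (simp_all add: algebra_simps)?
      ultimately have "\<bar>Re z\<bar> = R \<and> Im z \<ge> 0 \<or> Im z = R" using that R0 by auto
      then show ?thesis using abs_Re_le_cmod[of z] abs_Im_le_cmod[of z] R0 by fastforce
    qed
    have int1: "f contour_integrable_on linepath a1 a2" using nz by (intro contour_integrable_continuous_linepath contf)
    have int2: "f contour_integrable_on linepath a2 a3" "f contour_integrable_on linepath a3 a4" "f contour_integrable_on linepath a4 a1"
      using seg big by (auto intro!: contour_integrable_continuous_linepath contf)
    have "complex_of_real (pi * exp (- T * \<xi>)) = contour_integral (rectpath a1 a3) f"
      using ci by (simp add: contour_integral_unique)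
    also have "\<dots> = contour_integral (linepath a1 a2) f + (contour_integral (linepath a2 a3) f + (contour_integral (linepath a3 a4) f + contour_integral (linepath a4 a1) f))"
      unfolding rect using int1 int2 by (simp add: contour_integrable_joinI)
    also have "contour_integral (linepath a1 a2) f = integral {-R..R} (\<lambda>t. f (of_real t))"
      using R0 by (subst contour_integral_linepath_Reals_eq) (auto simp: a1_def a2_def)
    also have "(\<lambda>t. f (of_real t)) = (\<lambda>t. complex_of_real (T / (T\<^sup>2 + t\<^sup>2)) * cis (\<xi> * t))"
      by (auto simp: f_def cis_conv_exp mult_ac add_ac)
    finally have eq: "integral {-R..R} (\<lambda>t. complex_of_real (T / (T\<^sup>2 + t\<^sup>2)) * cis (\<xi> * t)) - complex_of_real (pi * exp (- T * \<xi>))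
       = - (contour_integral (linepath a2 a3) f + (contour_integral (linepath a3 a4) f + contour_integral (linepath a4 a1) f))"
      by simp
    have p: "0 \<le> T / (R\<^sup>2 - T\<^sup>2)" using R T by (simp add: power_mono)
    have "norm (contour_integral (linepath a2 a3) f) \<le> T / (R\<^sup>2 - T\<^sup>2) * norm (a3 - a2)"
         "norm (contour_integral (linepath a3 a4) f) \<le> T / (R\<^sup>2 - T\<^sup>2) * norm (a4 - a3)"
         "norm (contour_integral (linepath a4 a1) f) \<le> T / (R\<^sup>2 - T\<^sup>2) * norm (a1 - a4)"
      using int2 seg big p by - (rule contour_integral_bound_linepath; blast)+
    moreover have "norm (a3 - a2) = R" "norm (a4 - a3) = 2 * R" "norm (a1 - a4) = R"
      using R0 by (auto simp: a1_def a2_def a3_def a4_def cmod_def real_sqrt_mult)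
    ultimately have "norm (contour_integral (linepath a2 a3) f + (contour_integral (linepath a3 a4) f + contour_integral (linepath a4 a1) f))
        \<le> T / (R\<^sup>2 - T\<^sup>2) * R + (T / (R\<^sup>2 - T\<^sup>2) * (2 * R) + T / (R\<^sup>2 - T\<^sup>2) * R)"
      by (smt (verit) norm_triangle_ineq)
    then show ?thesis unfolding eq norm_minus_cancel by (simp add: field_simps)
  qed
  have ev: "\<forall>\<^sub>F R in at_top. norm (integral {-R..R} (\<lambda>t. complex_of_real (T / (T\<^sup>2 + t\<^sup>2)) * cis (\<xi> * t))
      - complex_of_real (pi * exp (- T * \<xi>))) \<le> 4 * T * R / (R\<^sup>2 - T\<^sup>2)"
    using eventually_gt_at_top[of T] by (rule eventually_mono) (rule bound)
  have "((\<lambda>R. 4 * T * R / (R\<^sup>2 - T\<^sup>2)) \<longlongrightarrow> 0) at_top" by real_asymp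
  then have "((\<lambda>R. integral {-R..R} (\<lambda>t. complex_of_real (T / (T\<^sup>2 + t\<^sup>2)) * cis (\<xi> * t))
      - complex_of_real (pi * exp (- T * \<xi>))) \<longlongrightarrow> 0) at_top"
    using Lim_null_comparison[OF ev] by blast
  then show ?thesis by (simp add: LIM_zero_iff)
qed

lemma cauchy_kernel_fourier:
  fixes T \<xi> :: real
  assumes T: "T > 0"
  shows "((\<lambda>R. integral {-R..R} (\<lambda>t. complex_of_real (T / (T\<^sup>2 + t\<^sup>2)) * cis (\<xi> * t)))
            \<longlongrightarrow> complex_of_real (pi * exp (- T * \<bar>\<xi>\<bar>))) at_top"
proof (cases "\<xi> \<ge> 0")
  case True
  then show ?thesis using cauchy_kernel_fourier_nonneg[OF T True] by simp
next
  case False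
  have "integral {-R..R} (\<lambda>t. complex_of_real (T / (T\<^sup>2 + t\<^sup>2)) * cis (\<xi> * t))
      = integral {-R..R} (\<lambda>t. complex_of_real (T / (T\<^sup>2 + t\<^sup>2)) * cis (- \<xi> * t))" for R
    using Henstock_Kurzweil_Integration.integral_reflect_real[of R "-R" "\<lambda>t. complex_of_real (T / (T\<^sup>2 + t\<^sup>2)) * cis (- \<xi> * t)"] by simp
  then show ?thesis using cauchy_kernel_fourier_nonneg[OF T, of "- \<xi>"] False by simp
qed

section \<open>Truncated Euler products\<close>

definition smooth_set :: "nat set \<Rightarrow> nat \<Rightarrow> nat set" where
  "smooth_set B E = {n. n \<ge> 1 \<and> (\<forall>p. prime p \<and> p dvd n \<longrightarrow> p \<in> B) \<and> (\<forall>p\<in>B. multiplicity p n < E)}"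

lemma smooth_set_empty: "smooth_set {} E = {1}"
proof -
  have "n = 1" if "n \<in> smooth_set {} E" for n
    using that prime_factor_nat[of n] by (auto simp: smooth_set_def)
  then show ?thesis by (auto simp: smooth_set_def)
qed

lemma smooth_set_insert:
  assumes "finite B" "\<And>p. p \<in> insert q B \<Longrightarrow> prime p" "q \<notin> B"
  shows "bij_betw (\<lambda>(e, m). q ^ e * m) ({..<E} \<times> smooth_set B E) (smooth_set (insert q B) E)"
proof (rule bij_betwI[where g = "\<lambda>n. (multiplicity q n, n div q ^ multiplicity q n)"])
  have q: "prime q" and q0: "q > 0" using assms(2)[of q] by (auto simp: prime_gt_0_nat)
  have nq: "\<not> q dvd m" if "m \<in> smooth_set B E" for m
    using that assms q by (auto simp: smooth_set_def)
  have mulq: "multiplicity q (q ^ e * m) = e" if "m \<in> smooth_set B E" for e m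
  proof -
    have "m \<noteq> 0" using that by (auto simp: smooth_set_def)
    then show ?thesis
      using nq[OF that] q by (simp add: prime_elem_multiplicity_mult_distrib multiplicity_prime_power not_dvd_imp_multiplicity_0 prime_gt_0_nat)
  qed
  show "(\<lambda>(e, m). q ^ e * m) \<in> {..<E} \<times> smooth_set B E \<rightarrow> smooth_set (insert q B) E"
  proof (clarify)
    fix e m assume e: "e < E" and m: "m \<in> smooth_set B E"
    have m1: "m \<ge> 1" using m by (auto simp: smooth_set_def)
    have "multiplicity p (q ^ e * m) < E" if p: "p \<in> B" for p
    proof -
      have pp: "prime p" "p \<noteq> q" using assms p by auto
      then have "multiplicity p (q ^ e * m) = multiplicity p m"
        using q m1 by (simp add: prime_elem_multiplicity_mult_distrib multiplicity_distinct_prime_power prime_gt_0_nat)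
      then show ?thesis using m p by (auto simp: smooth_set_def)
    qed
    moreover have "p \<in> insert q B" if "prime p" "p dvd q ^ e * m" for p
    proof -
      from that have "p dvd q ^ e \<or> p dvd m" by (simp add: prime_dvd_mult_iff)
      then show ?thesis
      proof
        assume "p dvd q ^ e"
        then have "p dvd q" using that prime_dvd_power by blast
        then show ?thesis using primes_dvd_imp_eq that q by blast
      qed (use that m in \<open>auto simp: smooth_set_def\<close>)
    qed
    ultimately show "q ^ e * m \<in> smooth_set (insert q B) E"
      using e mulq[OF m] q0 m1 by (auto simp: smooth_set_def Suc_le_eq)
  qed
  show "(\<lambda>n. (multiplicity q n, n div q ^ multiplicity q n)) \<in> smooth_set (insert q B) E \<rightarrow> {..<E} \<times> smooth_set B E"
  proof
    fix n assume n: "n \<in> smooth_set (insert q B) E"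
    define m where "m = n div q ^ multiplicity q n"
    have n1: "n \<ge> 1" using n by (auto simp: smooth_set_def)
    have nm: "n = q ^ multiplicity q n * m" unfolding m_def by (simp add: multiplicity_dvd)
    have m1: "m \<ge> 1" using nm n1 by (cases m) auto
    have ndm: "\<not> q dvd m" unfolding m_def by (rule multiplicity_decompose) (use n1 q in auto)
    have "p \<in> B" if "prime p" "p dvd m" for p
    proof -
      have "p dvd n" using that nm by (metis dvd_mult)
      then have "p \<in> insert q B" using n that by (auto simp: smooth_set_def)
      then show ?thesis using that ndm by auto
    qed
    moreover have "multiplicity p m < E" if p: "p \<in> B" for p
    proof -
      have pp: "prime p" "p \<noteq> q" using assms p by auto
      have "multiplicity p m \<le> multiplicity p n" using n1 nm by (intro dvd_imp_multiplicity_le) (auto intro: dvdI[of n m] simp: mult.commute)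
      then show ?thesis using n p by (auto simp: smooth_set_def)
    qed
    ultimately have "m \<in> smooth_set B E" using m1 by (auto simp: smooth_set_def)
    then show "(multiplicity q n, n div q ^ multiplicity q n) \<in> {..<E} \<times> smooth_set B E"
      using n by (auto simp: smooth_set_def m_def)
  qed
  show "(multiplicity q (case x of (e, m) \<Rightarrow> q ^ e * m), (case x of (e, m) \<Rightarrow> q ^ e * m) div q ^ multiplicity q (case x of (e, m) \<Rightarrow> q ^ e * m)) = x"
    if "x \<in> {..<E} \<times> smooth_set B E" for x
    using that mulq q0 by (auto simp: mulq)
  show "(case (multiplicity q n, n div q ^ multiplicity q n) of (e, m) \<Rightarrow> q ^ e * m) = n"
    if "n \<in> smooth_set (insert q B) E" for n
    by (simp add: multiplicity_dvd)
qed

lemma finite_smooth_set: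
  assumes "finite B" "\<And>p. p \<in> B \<Longrightarrow> prime p"
  shows "finite (smooth_set B E)"
  using assms
proof (induction B rule: finite_induct)
  case (insert q B)
  have "finite ({..<E} \<times> smooth_set B E)" using insert by auto
  then show ?case using smooth_set_insert[of B q E] insert by (metis bij_betw_finite)
qed (simp add: smooth_set_empty)

text \<open>\<open>smooth_set B E\<close> is a box of exponent vectors, so the sum factors exactly
  into truncated geometric series and no question of convergence arises. The general semiring covers
  complex values, their norms, and counting with \<open>h = 1\<close>.\<close>

lemma euler_product_smooth:
  fixes h :: "nat \<Rightarrow> 'b::comm_semiring_1"
  assumes "finite B" "\<And>p. p \<in> B \<Longrightarrow> prime p"
    and h: "h 1 = 1" "\<And>m n. m \<ge> 1 \<Longrightarrow> n \<ge> 1 \<Longrightarrow> h (m * n) = h m * h n"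
  shows "(\<Sum>n\<in>smooth_set B E. h n) = (\<Prod>p\<in>B. \<Sum>e<E. h p ^ e)"
  using assms(1,2)
proof (induction B rule: finite_induct)
  case empty
  then show ?case using h by (simp add: smooth_set_empty)
next
  case (insert q B)
  have q1: "q \<ge> 1" using insert.prems[of q] by (simp add: prime_gt_0_nat Suc_le_eq)
  have hq: "h (q ^ e) = h q ^ e" for e
    by (induction e) (use h q1 in auto)
  have "(\<Sum>n\<in>smooth_set (insert q B) E. h n) = (\<Sum>x\<in>{..<E} \<times> smooth_set B E. h (case x of (e, m) \<Rightarrow> q ^ e * m))"
    by (rule sum.reindex_bij_betw[symmetric], rule smooth_set_insert) (use insert in auto)
  also have "\<dots> = (\<Sum>x\<in>{..<E} \<times> smooth_set B E. case x of (e, m) \<Rightarrow> h q ^ e * h m)"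
    by (intro sum.cong refl) (use h q1 in \<open>auto simp: hq[symmetric] smooth_set_def\<close>)
  also have "\<dots> = (\<Sum>e<E. h q ^ e) * (\<Sum>m\<in>smooth_set B E. h m)"
    by (simp add: sum_product sum.cartesian_product)
  finally show ?case using insert by simp
qed

text \<open>\<open>1 / max n m ^ 2\<close> telescopes into the sum of
  \<open>1 / N^2 - 1 / (N + 1)^2\<close> over \<open>N \<ge> max n m\<close>; stopping at
  \<open>X\<close> leaves the last term. The kernel thus encodes a mean square of the partial sums
  with weights of order \<open>N^(-3)\<close>.\<close>

lemma max_kernel_identity:
  fixes a :: "nat \<Rightarrow> complex"
  defines "C \<equiv> \<lambda>N. \<Sum>n=1..N. a n"
  shows "(\<Sum>n=1..X. \<Sum>m=1..X. a n * cnj (a m) * of_real (1 / real (max n m) ^ 2)) =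
     of_real ((\<Sum>N=1..X. (norm (C N))\<^sup>2 * (1 / real N ^ 2 - 1 / real (N + 1) ^ 2)) + (norm (C X))\<^sup>2 / real (X + 1) ^ 2)"
proof (induction X)
  case 0
  then show ?case by (simp add: C_def)
next
  case (Suc X)
  define k where "k n m = a n * cnj (a m) * complex_of_real (1 / real (max n m) ^ 2)" for n m
  have CS: "C (Suc X) = C X + a (Suc X)" by (simp add: C_def)
  have "(\<Sum>n=1..Suc X. \<Sum>m=1..Suc X. k n m) =
     (\<Sum>n=1..X. \<Sum>m=1..X. k n m) + (\<Sum>n=1..X. k n (Suc X)) + (\<Sum>m=1..X. k (Suc X) m) + k (Suc X) (Suc X)"
    by (simp add: sum.distrib)
  also have "(\<Sum>n=1..X. k n (Suc X)) = C X * cnj (a (Suc X)) * of_real (1 / real (Suc X) ^ 2)"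
    unfolding C_def sum_distrib_right k_def by (intro sum.cong refl) (auto simp: max_def)
  also have "(\<Sum>m=1..X. k (Suc X) m) = a (Suc X) * cnj (C X) * of_real (1 / real (Suc X) ^ 2)"
    unfolding C_def sum_distrib_right sum_distrib_left cnj_sum k_def by (intro sum.cong refl) (auto simp: max_def)
  also have "k (Suc X) (Suc X) = a (Suc X) * cnj (a (Suc X)) * of_real (1 / real (Suc X) ^ 2)" by (simp add: k_def)
  finally have "(\<Sum>n=1..Suc X. \<Sum>m=1..Suc X. k n m) = (\<Sum>n=1..X. \<Sum>m=1..X. k n m)
     + (C (Suc X) * cnj (C (Suc X)) - C X * cnj (C X)) * of_real (1 / real (Suc X) ^ 2)"
    by (simp add: CS algebra_simps)
  also have "(\<Sum>n=1..X. \<Sum>m=1..X. k n m) = of_real ((\<Sum>N=1..X. (norm (C N))\<^sup>2 * (1 / real N ^ 2 - 1 / real (N + 1) ^ 2)) + (norm (C X))\<^sup>2 / real (X + 1) ^ 2)"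
    using Suc by (simp add: k_def)
  also have "C (Suc X) * cnj (C (Suc X)) - C X * cnj (C X) = of_real ((norm (C (Suc X)))\<^sup>2 - (norm (C X))\<^sup>2)"
    by (simp add: complex_norm_square[symmetric])
  finally have E: "(\<Sum>n=1..Suc X. \<Sum>m=1..Suc X. k n m) =
     of_real ((\<Sum>N=1..X. (norm (C N))\<^sup>2 * (1 / real N ^ 2 - 1 / real (N + 1) ^ 2)) + (norm (C X))\<^sup>2 / real (X + 1) ^ 2
       + ((norm (C (Suc X)))\<^sup>2 - (norm (C X))\<^sup>2) * (1 / real (Suc X) ^ 2))"
    by (simp only: of_real_add of_real_mult)
  have "(\<Sum>N=1..X. (norm (C N))\<^sup>2 * (1 / real N ^ 2 - 1 / real (N + 1) ^ 2)) + (norm (C X))\<^sup>2 / real (X + 1) ^ 2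
       + ((norm (C (Suc X)))\<^sup>2 - (norm (C X))\<^sup>2) * (1 / real (Suc X) ^ 2)
     = (\<Sum>N=1..Suc X. (norm (C N))\<^sup>2 * (1 / real N ^ 2 - 1 / real (N + 1) ^ 2)) + (norm (C (Suc X)))\<^sup>2 / real (Suc X + 1) ^ 2"
    by (simp add: algebra_simps)
  then show ?case using E by (simp only: k_def)
qed

text \<open>Up to a factor \<pi> this is the mean square, against the density
  \<open>T / (T^2 + t^2)\<close>, of the Dirichlet polynomial with coefficients \<open>b\<close> on
  the imaginary axis. With \<open>b n = a n / n\<close> and \<open>T = 1\<close> it is the form with
  kernel \<open>1 / max n m ^ 2\<close>.\<close>

definition exp_form :: "real \<Rightarrow> nat set \<Rightarrow> (nat \<Rightarrow> complex) \<Rightarrow> real" where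
  "exp_form T W b = Re (\<Sum>n\<in>W. \<Sum>m\<in>W. b n * cnj (b m) * of_real (exp (- T * \<bar>ln (real m) - ln (real n)\<bar>)))"

text \<open>Expand the square: the pair \<open>(n, m)\<close> contributes the Fourier transform of
  the Cauchy kernel at \<open>ln m - ln n\<close>. As the limit is taken of truncated integrals,
  only finite sums are exchanged with integrals.\<close>

lemma exp_form_integral:
  assumes T: "T > 0" and fin: "finite W"
  shows "((\<lambda>R. integral {-R..R} (\<lambda>t. T / (T\<^sup>2 + t\<^sup>2) * (norm (\<Sum>n\<in>W. b n * cis (- t * ln (real n))))\<^sup>2))
           \<longlongrightarrow> pi * exp_form T W b) at_top"
proof -
  define k where "k = (\<lambda>\<xi> t. complex_of_real (T / (T\<^sup>2 + t\<^sup>2)) * cis (\<xi> * t))"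
  have nz: "T\<^sup>2 + t\<^sup>2 \<noteq> 0" for t using T by (simp add: sum_power2_eq_zero_iff)
  have contk: "continuous_on A (k \<xi>)" for A \<xi> unfolding k_def by (intro continuous_intros) (use nz in auto)
  have pt: "T / (T\<^sup>2 + t\<^sup>2) * (norm (\<Sum>n\<in>W. b n * cis (- t * ln (real n))))\<^sup>2
     = Re (\<Sum>n\<in>W. \<Sum>m\<in>W. b n * cnj (b m) * k (ln (real m) - ln (real n)) t)" for t
  proof -
    have "complex_of_real ((norm (\<Sum>n\<in>W. b n * cis (- t * ln (real n))))\<^sup>2) =
      (\<Sum>n\<in>W. b n * cis (- t * ln (real n))) * cnj (\<Sum>n\<in>W. b n * cis (- t * ln (real n)))"
      by (rule complex_norm_square)
    also have "\<dots> = (\<Sum>n\<in>W. \<Sum>m\<in>W. b n * cnj (b m) * cis ((ln (real m) - ln (real n)) * t))"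
    proof -
      have "(b n * cis (- t * ln (real n))) * cnj (b m * cis (- t * ln (real m))) = b n * cnj (b m) * cis ((ln (real m) - ln (real n)) * t)" for n m
      proof -
        have "cis (- t * ln (real n)) * cnj (cis (- t * ln (real m))) = cis ((ln (real m) - ln (real n)) * t)"
          unfolding cis_cnj cis_mult by (rule arg_cong[of _ _ cis]) (simp add: algebra_simps)
        then show ?thesis by (simp only: complex_cnj_mult mult_ac)
      qed
      then show ?thesis unfolding cnj_sum sum_product by (simp only:)
    qed
    finally have E: "complex_of_real ((norm (\<Sum>n\<in>W. b n * cis (- t * ln (real n))))\<^sup>2) =
      (\<Sum>n\<in>W. \<Sum>m\<in>W. b n * cnj (b m) * cis ((ln (real m) - ln (real n)) * t))" .
    have "T / (T\<^sup>2 + t\<^sup>2) * (norm (\<Sum>n\<in>W. b n * cis (- t * ln (real n))))\<^sup>2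
      = Re (complex_of_real (T / (T\<^sup>2 + t\<^sup>2)) * complex_of_real ((norm (\<Sum>n\<in>W. b n * cis (- t * ln (real n))))\<^sup>2))"
      by (simp only: of_real_mult[symmetric] Re_complex_of_real)
    also have "\<dots> = Re (\<Sum>n\<in>W. \<Sum>m\<in>W. b n * cnj (b m) * k (ln (real m) - ln (real n)) t)"
      unfolding E by (simp add: k_def sum_distrib_left mult_ac)
    finally show ?thesis .
  qed
  have int: "(\<lambda>t. b n * cnj (b m) * k (ln (real m) - ln (real n)) t) integrable_on {-R..R}" for n m R
    by (intro integrable_continuous_real continuous_intros contk)
  have "integral {-R..R} (\<lambda>t. T / (T\<^sup>2 + t\<^sup>2) * (norm (\<Sum>n\<in>W. b n * cis (- t * ln (real n))))\<^sup>2)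
      = Re (\<Sum>n\<in>W. \<Sum>m\<in>W. b n * cnj (b m) * integral {-R..R} (k (ln (real m) - ln (real n))))" for R
  proof -
    have "integral {-R..R} (\<lambda>t. T / (T\<^sup>2 + t\<^sup>2) * (norm (\<Sum>n\<in>W. b n * cis (- t * ln (real n))))\<^sup>2)
      = integral {-R..R} (Re \<circ> (\<lambda>t. \<Sum>n\<in>W. \<Sum>m\<in>W. b n * cnj (b m) * k (ln (real m) - ln (real n)) t))"
      unfolding pt o_def ..
    also have "\<dots> = Re (integral {-R..R} (\<lambda>t. \<Sum>n\<in>W. \<Sum>m\<in>W. b n * cnj (b m) * k (ln (real m) - ln (real n)) t))"
      by (rule integral_linear) (auto intro!: integrable_sum int fin bounded_linear_Re)
    also have "\<dots> = Re (\<Sum>n\<in>W. \<Sum>m\<in>W. b n * cnj (b m) * integral {-R..R} (k (ln (real m) - ln (real n))))"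
      using fin by (simp add: integral_sum int integrable_sum)
    finally show ?thesis .
  qed
  moreover have "((\<lambda>R. Re (\<Sum>n\<in>W. \<Sum>m\<in>W. b n * cnj (b m) * integral {-R..R} (k (ln (real m) - ln (real n)))))
     \<longlongrightarrow> Re (\<Sum>n\<in>W. \<Sum>m\<in>W. b n * cnj (b m) * complex_of_real (pi * exp (- T * \<bar>ln (real m) - ln (real n)\<bar>)))) at_top"
    unfolding k_def by (intro tendsto_intros cauchy_kernel_fourier T)
  moreover have "Re (\<Sum>n\<in>W. \<Sum>m\<in>W. b n * cnj (b m) * complex_of_real (pi * exp (- T * \<bar>ln (real m) - ln (real n)\<bar>))) = pi * exp_form T W b"
    unfolding exp_form_def Re_sum sum_distrib_left by (intro sum.cong refl) (simp add: algebra_simps)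
  ultimately show ?thesis by simp
qed

text \<open>On the Fourier side the product structure acts pointwise in \<open>t\<close>. For
  \<open>|t| > T\<close> one has \<open>1 / (1 + t^2) \<le> 2 / (T^2 + t^2)\<close>, so this range
  is dominated by the kernel of parameter \<open>T\<close> with an extra factor
  \<open>2 / T\<close>. The crude bound \<open>s2\<close> is good enough there, and the strong bound
  \<open>s1\<close> is asked for on a compact interval only.\<close>

lemma exp_form_product_bound:
  assumes T: "T \<ge> 1" and fin: "finite W" "finite V"
    and fac: "\<And>t. (\<Sum>n\<in>W. b n * cis (- t * ln (real n))) = \<beta> t * (\<Sum>n\<in>V. a n * cis (- t * ln (real n)))"
    and s1: "\<And>t. \<bar>t\<bar> \<le> T \<Longrightarrow> (norm (\<beta> t))\<^sup>2 \<le> s1" and s2: "\<And>t. (norm (\<beta> t))\<^sup>2 \<le> s2"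
  shows "exp_form 1 W b \<le> s1 * exp_form 1 V a + 2 * s2 / T * exp_form T V a"
proof -
  define A where "A t = (norm (\<Sum>n\<in>V. a n * cis (- t * ln (real n))))\<^sup>2" for t
  define D where "D t = (norm (\<Sum>n\<in>W. b n * cis (- t * ln (real n))))\<^sup>2" for t
  have A0: "A t \<ge> 0" for t by (simp add: A_def)
  have s10: "s1 \<ge> 0" using order_trans[OF zero_le_power2 s1[of 0]] T by simp
  have s20: "s2 \<ge> 0" by (rule order_trans[OF zero_le_power2 s2[of 0]])
  have nz: "T\<^sup>2 + t\<^sup>2 \<noteq> 0" "1\<^sup>2 + t\<^sup>2 \<noteq> 0" for t :: real
    using T by (simp_all add: sum_power2_eq_zero_iff add_nonneg_eq_0_iff)
  have pt: "1 / (1\<^sup>2 + t\<^sup>2) * D t \<le> s1 * (1 / (1\<^sup>2 + t\<^sup>2) * A t) + 2 * s2 / T * (T / (T\<^sup>2 + t\<^sup>2) * A t)" for t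
  proof -
    have D: "D t = (norm (\<beta> t))\<^sup>2 * A t" unfolding D_def A_def fac norm_mult power_mult_distrib ..
    have p1: "0 < 1 + t\<^sup>2" and p2: "0 < T\<^sup>2 + t\<^sup>2" using T by (auto intro: add_pos_nonneg)
    show ?thesis
    proof (cases "\<bar>t\<bar> \<le> T")
      case True
      have "1 / (1 + t\<^sup>2) * D t \<le> 1 / (1 + t\<^sup>2) * (s1 * A t)"
        unfolding D using s1[OF True] A0 p1 by (intro mult_left_mono mult_right_mono) auto
      moreover have "0 \<le> 2 * s2 / T * (T / (T\<^sup>2 + t\<^sup>2) * A t)" using s20 T A0 p2 by auto
      ultimately show ?thesis by simp
    next
      case False
      then have "T\<^sup>2 \<le> t\<^sup>2" using T by (simp add: abs_le_square_iff[symmetric])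
      then have "1 / (1 + t\<^sup>2) \<le> 2 / (T\<^sup>2 + t\<^sup>2)" using p1 p2 by (simp add: field_simps)
      then have "1 / (1 + t\<^sup>2) * D t \<le> 2 / (T\<^sup>2 + t\<^sup>2) * (s2 * A t)"
        unfolding D using s2 A0 p2 s20 by (intro mult_mono mult_right_mono) auto
      also have "\<dots> = 2 * s2 / T * (T / (T\<^sup>2 + t\<^sup>2) * A t)" using T by simp
      moreover have "0 \<le> s1 * (1 / (1 + t\<^sup>2) * A t)" using s10 A0 p1 by auto
      ultimately show ?thesis using T by simp
    qed
  qed
  have cA: "continuous_on S A" for S unfolding A_def by (intro continuous_intros)
  have cD: "continuous_on S D" for S unfolding D_def by (intro continuous_intros)
  have le: "integral {-R..R} (\<lambda>t. 1 / (1\<^sup>2 + t\<^sup>2) * D t) \<le>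
     s1 * integral {-R..R} (\<lambda>t. 1 / (1\<^sup>2 + t\<^sup>2) * A t) + 2 * s2 / T * integral {-R..R} (\<lambda>t. T / (T\<^sup>2 + t\<^sup>2) * A t)" for R
  proof -
    have i1: "(\<lambda>t. 1 / (1\<^sup>2 + t\<^sup>2) * D t) integrable_on {-R..R}"
      by (intro integrable_continuous_real continuous_intros cD) (use nz in auto)
    have i2: "(\<lambda>t. 1 / (1\<^sup>2 + t\<^sup>2) * A t) integrable_on {-R..R}"
      by (intro integrable_continuous_real continuous_intros cA) (use nz in auto)
    have i3: "(\<lambda>t. T / (T\<^sup>2 + t\<^sup>2) * A t) integrable_on {-R..R}"
      by (intro integrable_continuous_real continuous_intros cA) (use nz in auto)
    have "integral {-R..R} (\<lambda>t. 1 / (1\<^sup>2 + t\<^sup>2) * D t) \<le>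
      integral {-R..R} (\<lambda>t. s1 * (1 / (1\<^sup>2 + t\<^sup>2) * A t) + 2 * s2 / T * (T / (T\<^sup>2 + t\<^sup>2) * A t))"
      by (intro integral_le i1 integrable_add integrable_on_mult_right i2 i3 pt)
    also have "\<dots> = integral {-R..R} (\<lambda>t. s1 * (1 / (1\<^sup>2 + t\<^sup>2) * A t)) + integral {-R..R} (\<lambda>t. 2 * s2 / T * (T / (T\<^sup>2 + t\<^sup>2) * A t))"
      by (intro integral_add integrable_on_mult_right i2 i3)
    finally show ?thesis by (simp only: integral_mult_right)
  qed
  have "pi * exp_form 1 W b \<le> s1 * (pi * exp_form 1 V a) + 2 * s2 / T * (pi * exp_form T V a)"
  proof (rule tendsto_le[OF trivial_limit_at_top_linorder])
    show "((\<lambda>R. integral {-R..R} (\<lambda>t. 1 / (1\<^sup>2 + t\<^sup>2) * D t)) \<longlongrightarrow> pi * exp_form 1 W b) at_top"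
      unfolding D_def by (rule exp_form_integral) (use fin in auto)
    show "((\<lambda>R. s1 * integral {-R..R} (\<lambda>t. 1 / (1\<^sup>2 + t\<^sup>2) * A t) + 2 * s2 / T * integral {-R..R} (\<lambda>t. T / (T\<^sup>2 + t\<^sup>2) * A t))
      \<longlongrightarrow> s1 * (pi * exp_form 1 V a) + 2 * s2 / T * (pi * exp_form T V a)) at_top"
      unfolding A_def by (intro tendsto_intros exp_form_integral) (use fin T in auto)
  qed (use le in auto)
  also have "\<dots> = pi * (s1 * exp_form 1 V a + 2 * s2 / T * exp_form T V a)" by (simp add: algebra_simps)
  finally show ?thesis using pi_gt_zero by (simp only: mult_le_cancel_left_pos)
qed

section \<open>The quadratic form on integers free of small primes\<close>

lemma exp_kernel_eq_max_kernel:
  assumes "n \<ge> 1" "m \<ge> 1"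
  shows "exp (- \<bar>ln (real m) - ln (real n)\<bar>) / (real n * real m) = 1 / real (max n m) ^ 2"
proof -
  have *: "exp (- \<bar>ln (real m) - ln (real n)\<bar>) / (real n * real m) = 1 / real n ^ 2" if "1 \<le> m" "m \<le> n" for n m :: nat
  proof -
    have "- \<bar>ln (real m) - ln (real n)\<bar> = ln (real m / real n)" using that by (simp add: ln_div)
    then show ?thesis using that by (simp add: power2_eq_square)
  qed
  show ?thesis
  proof (cases "m \<le> n")
    case False
    then show ?thesis using *[of n m] assms by (simp add: max_def abs_minus_commute mult.commute)
  qed (use * assms in \<open>auto simp: max_def\<close>)
qed

text \<open>Legendre's sieve: passing from \<open>B\<close> to \<open>insert q B\<close> subtracts
  the count for \<open>B\<close> up to \<open>x / q\<close>, which doubles the error. The variable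
  \<open>x\<close> is real because \<open>x / q\<close> is rarely an integer.\<close>

lemma rough_count:
  assumes "finite B" "\<And>p. p \<in> B \<Longrightarrow> prime p" "x \<ge> 0"
  shows "\<bar>real (card {n \<in> Q_set B. real n \<le> x}) - (\<Prod>p\<in>B. 1 - 1 / real p) * x\<bar> \<le> 2 ^ card B"
  using assms
proof (induction B arbitrary: x rule: finite_induct)
  case empty
  have "{n \<in> Q_set {}. real n \<le> x} = {1..nat \<lfloor>x\<rfloor>}" using empty by (auto simp: Q_set_def le_nat_floor) linarith+
  moreover have "\<bar>real (nat \<lfloor>x\<rfloor>) - x\<bar> \<le> 1" using empty by linarith
  ultimately show ?case by simp
next
  case (insert q B)
  have q: "prime q" using insert by auto
  then have q0: "real q > 0" by (simp add: prime_gt_0_nat)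
  let ?c = "\<lambda>B x. {n \<in> Q_set B. real n \<le> x}"
  have fin: "finite (?c B x)" for B x
    by (rule finite_subset[of _ "{..nat \<lfloor>x\<rfloor>}"]) (auto simp: le_nat_floor)
  have "?c B x = ?c (insert q B) x \<union> (\<lambda>m. q * m) ` ?c B (x / real q)" (is "?L = ?R")
  proof
    show "?L \<subseteq> ?R"
    proof
      fix n assume n: "n \<in> ?L"
      show "n \<in> ?R"
      proof (cases "q dvd n")
        case True
        then obtain m where m: "n = q * m" by (elim dvdE)
        have "m \<in> ?c B (x / real q)" using n q0 unfolding m by (auto simp: Q_set_def field_simps)
        then show ?thesis using m by auto
      next
        case False
        then show ?thesis using n by (auto simp: Q_set_def)
      qed
    qed
    show "?R \<subseteq> ?L"
    proof -
      have "q * m \<in> ?c B x" if m: "m \<in> ?c B (x / real q)" for m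
      proof -
        have "p \<notin> B" if p: "prime p" "p dvd q * m" for p
        proof (cases "p dvd m")
          case True
          then show ?thesis using m p by (auto simp: Q_set_def)
        next
          case False
          then have "p dvd q" using p by (simp add: prime_dvd_mult_iff)
          then have "p = q" using p q by (simp add: primes_dvd_imp_eq)
          then show ?thesis using insert.hyps by simp
        qed
        moreover have "q * m \<ge> 1" using m q0 by (auto simp: Q_set_def Suc_le_eq)
        moreover have "real (q * m) \<le> x" using m q0 by (simp add: field_simps)
        ultimately show ?thesis by (auto simp: Q_set_def)
      qed
      then show ?thesis by (auto simp: Q_set_def)
    qed
  qed
  moreover have "?c (insert q B) x \<inter> (\<lambda>m. q * m) ` ?c B (x / real q) = {}"
    using q by (auto simp: Q_set_def)
  ultimately have "card (?c B x) = card (?c (insert q B) x) + card ((\<lambda>m. q * m) ` ?c B (x / real q))"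
    using fin by (simp add: card_Un_disjoint)
  also have "card ((\<lambda>m. q * m) ` ?c B (x / real q)) = card (?c B (x / real q))"
    by (rule card_image) (use q0 in \<open>auto simp: inj_on_def\<close>)
  finally have eq: "real (card (?c (insert q B) x)) = real (card (?c B x)) - real (card (?c B (x / real q)))" by simp
  define r where "r = (\<Prod>p\<in>B. 1 - 1 / real p)"
  have "\<bar>real (card (?c B x)) - r * x\<bar> \<le> 2 ^ card B" unfolding r_def by (rule insert.IH) (use insert in auto)
  moreover have "\<bar>real (card (?c B (x / real q))) - r * (x / real q)\<bar> \<le> 2 ^ card B" unfolding r_def by (rule insert.IH) (use insert in auto)
  moreover have "(\<Prod>p\<in>insert q B. 1 - 1 / real p) * x = r * x - r * (x / real q)"
    using insert by (simp add: r_def algebra_simps)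
  moreover have "card (insert q B) = Suc (card B)" using insert by simp
  ultimately show ?case unfolding eq by simp
qed

lemma sum_le_prod_one_plus:
  fixes x :: "'b \<Rightarrow> real"
  assumes "finite A" "\<And>i. i \<in> A \<Longrightarrow> 0 \<le> x i"
  shows "1 + (\<Sum>i\<in>A. x i) \<le> (\<Prod>i\<in>A. 1 + x i)"
  using assms
proof (induction A rule: finite_induct)
  case (insert i A)
  have "1 + (\<Sum>i\<in>insert i A. x i) \<le> (1 + x i) * (1 + (\<Sum>i\<in>A. x i))"
    using insert by (simp add: algebra_simps sum_nonneg)
  also have "\<dots> \<le> (1 + x i) * (\<Prod>i\<in>A. 1 + x i)" using insert by (intro mult_left_mono) auto
  finally show ?case using insert by simp
qed simp

lemma prod_one_plus_le_exp:
  fixes x :: "'b \<Rightarrow> real"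
  assumes "\<And>i. i \<in> A \<Longrightarrow> 0 \<le> x i" "finite A"
  shows "(\<Prod>i\<in>A. 1 + x i) \<le> exp (\<Sum>i\<in>A. x i)"
  unfolding exp_sum[OF assms(2)] by (rule prod_mono) (use assms in \<open>auto simp: exp_ge_add_one_self\<close>)

text \<open>Applied to two sets: the finitely many small primes in the mean value theorem, and the
  sparse primes of a pretentious function, of which there may be infinitely many.\<close>

lemma smooth_rough_decomposition:
  assumes "n \<ge> 1" "\<And>p. p \<in> B \<Longrightarrow> prime p"
  shows "\<exists>m r. n = m * r \<and> m \<ge> 1 \<and> (\<forall>p. prime p \<and> p dvd m \<longrightarrow> p \<in> B) \<and> r \<in> Q_set B"
  using assms(1)
proof (induction n rule: less_induct)
  case (less n)
  show ?case
  proof (cases "\<exists>p\<in>B. p dvd n")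
    case True
    then obtain p n' where p: "p \<in> B" "n = p * n'" by (auto elim!: dvdE)
    have pp: "prime p" using assms p by auto
    have n': "n' \<ge> 1" using p less.prems by (cases n') auto
    have "n' < n" using p prime_gt_1_nat[OF pp] n' by simp
    then obtain m r where mr: "n' = m * r" "m \<ge> 1" "\<forall>p. prime p \<and> p dvd m \<longrightarrow> p \<in> B" "r \<in> Q_set B"
      using less.IH[of n'] n' by blast
    have "q \<in> B" if "prime q" "q dvd p * m" for q
    proof (cases "q dvd m")
      case False
      then have "q dvd p" using that by (simp add: prime_dvd_mult_iff)
      then show ?thesis using that pp p primes_dvd_imp_eq by blast
    qed (use that mr in auto)
    then show ?thesis using mr p prime_gt_0_nat[OF pp] by (intro exI[of _ "p * m"] exI[of _ r]) (auto simp: mult_ac Suc_le_eq)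
  next
    case False
    then have "n \<in> Q_set B" using less.prems by (auto simp: Q_set_def)
    then show ?thesis by (intro exI[of _ 1] exI[of _ n]) auto
  qed
qed

lemma smooth_rough_inj:
  assumes "m \<ge> 1" "m' \<ge> 1" "\<forall>p. prime p \<and> p dvd m \<longrightarrow> p \<in> B" "\<forall>p. prime p \<and> p dvd m' \<longrightarrow> p \<in> B"
    "r \<in> Q_set B" "r' \<in> Q_set B" "m * r = m' * r'"
  shows "m = m' \<and> r = r'"
proof -
  have cop: "coprime m r" if "m \<ge> 1" "\<forall>p. prime p \<and> p dvd m \<longrightarrow> p \<in> B" "r \<in> Q_set B" for m r :: nat
  proof (rule ccontr)
    assume "\<not> coprime m r"
    then have "gcd m r \<noteq> 1" using coprime_iff_gcd_eq_1 by blast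
    then obtain p where "prime p" "p dvd gcd m r" using prime_factor_nat by blast
    then have "p \<in> B" "p \<notin> B" using that by (auto simp: Q_set_def)
    then show False by contradiction
  qed
  have "m dvd m' * r'" unfolding assms(7)[symmetric] by simp
  then have 1: "m dvd m'" using cop[OF assms(1,3,6)] coprime_dvd_mult_left_iff by blast
  have "m' dvd m * r" unfolding assms(7) by simp
  then have 2: "m' dvd m" using cop[OF assms(2,4,5)] coprime_dvd_mult_left_iff by blast
  have "m = m'" using 1 2 by (rule dvd_antisym)
  then show ?thesis using assms(1,7) by simp
qed

text \<open>The first bound extracts the average with weights \<open>N^(-3)\<close> from the form;
  the second bounds the form on a set of known density.\<close>

lemma kernel_difference_bounds:
  assumes "N \<ge> (1::nat)"
  shows "1 / (2 * real N ^ 3) \<le> 1 / real N ^ 2 - 1 / real (N + 1) ^ 2"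
    and "real N ^ 2 * (1 / real N ^ 2 - 1 / real (N + 1) ^ 2) \<le> 2 / real N"
proof -
  define x where "x = real N"
  have x: "x \<ge> 1" using assms by (simp add: x_def)
  have e: "1 / x ^ 2 - 1 / (x + 1) ^ 2 = (2 * x + 1) / (x ^ 2 * (x + 1) ^ 2)"
  proof -
    have "x ^ 2 \<noteq> 0" "(x + 1) ^ 2 \<noteq> 0" using x by auto
    then show ?thesis by (subst diff_frac_eq) (auto simp: power2_eq_square algebra_simps)
  qed
  have "x ^ 2 * (x + 1) ^ 2 \<le> 2 * x ^ 3 * (2 * x + 1)"
  proof -
    have "2 * x ^ 3 * (2 * x + 1) - x ^ 2 * (x + 1) ^ 2 = x ^ 2 * (3 * x\<^sup>2 - 1)"
      by (simp add: algebra_simps power2_eq_square power3_eq_cube)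
    moreover have "x ^ 2 * (3 * x\<^sup>2 - 1) \<ge> 0"
      using one_le_power[OF x, of 2] by (intro mult_nonneg_nonneg) auto
    ultimately show ?thesis by linarith
  qed
  then have "1 / (2 * x ^ 3) \<le> 1 / x ^ 2 - 1 / (x + 1) ^ 2" unfolding e using x by (simp add: field_simps)
  then show "1 / (2 * real N ^ 3) \<le> 1 / real N ^ 2 - 1 / real (N + 1) ^ 2" by (simp add: x_def add.commute)
  have "x ^ 2 * (1 / x ^ 2 - 1 / (x + 1) ^ 2) = (2 * x + 1) / (x + 1) ^ 2" unfolding e using x by simp
  also have "\<dots> \<le> 2 / x"
  proof (rule mult_imp_div_pos_le)
    have "(2 * x + 1) * x \<le> 2 * (x + 1) ^ 2" using x by (simp add: power2_eq_square algebra_simps)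
    then have "2 * x + 1 \<le> 2 * (x + 1) ^ 2 / x" using x by (intro mult_imp_le_div_pos) auto
    then show "2 * x + 1 \<le> 2 / x * (x + 1) ^ 2" by simp
  qed (use x in auto)
  finally show "real N ^ 2 * (1 / real N ^ 2 - 1 / real (N + 1) ^ 2) \<le> 2 / real N" by (simp add: x_def add.commute)
qed

text \<open>The integers free of primes of \<open>B\<close> have density \<rho>, so the form has
  size about \<open>\<rho>^2 * ln X\<close>. The factor \<open>\<rho>^2\<close> is the point: it
  cancels the \<open>1 / \<rho>^2\<close> lost in the Euler factors over \<open>B\<close>. The sieve
  error \<open>k\<close> enters only through terms independent of \<open>X\<close>.\<close>

lemma rough_max_kernel_bound:
  assumes B: "finite B" "\<And>p. p \<in> B \<Longrightarrow> prime p" and X: "X \<ge> 1"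
  defines "\<rho> \<equiv> \<Prod>p\<in>B. 1 - 1 / real p" and "k \<equiv> 2 ^ card B"
  defines "V \<equiv> {r \<in> Q_set B. r \<le> X}"
  shows "(\<Sum>r\<in>V. \<Sum>s\<in>V. 1 / real (max r s) ^ 2) \<le> 4 * \<rho>\<^sup>2 * (ln (real X) + 1) + 4 * k\<^sup>2 + 2"
proof -
  define a where "a n = (if n \<in> V then 1 else 0 :: complex)" for n
  define R where "R N = real (card {n \<in> Q_set B. real n \<le> real N})" for N
  define d where "d N = 1 / real N ^ 2 - 1 / real (N + 1) ^ 2" for N
  have VX: "V \<subseteq> {1..X}" by (auto simp: V_def Q_set_def)
  have rho: "0 \<le> \<rho>" "\<rho> \<le> 1"
  proof -
    have "0 \<le> 1 - 1 / real p \<and> 1 - 1 / real p \<le> 1" if "p \<in> B" for p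
      using prime_ge_2_nat[OF B(2)[OF that]] by auto
    then show "0 \<le> \<rho>" "\<rho> \<le> 1" unfolding \<rho>_def by (auto intro!: prod_nonneg prod_le_1)
  qed
  have Ca: "(norm (\<Sum>n=1..N. a n))\<^sup>2 = (R N)\<^sup>2" if "N \<le> X" for N
  proof -
    have "(\<Sum>n=1..N. a n) = (\<Sum>n\<in>{1..N} \<inter> V. 1)" unfolding a_def by (subst sum.inter_restrict) auto
    also have "\<dots> = of_nat (card ({1..N} \<inter> V))" by simp
    also have "{1..N} \<inter> V = {n \<in> Q_set B. real n \<le> real N}" using that by (auto simp: V_def Q_set_def)
    finally show ?thesis by (simp add: R_def)
  qed
  have R2: "(R N)\<^sup>2 \<le> 2 * \<rho>\<^sup>2 * real N ^ 2 + 2 * k\<^sup>2" for N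
  proof -
    have "\<bar>R N - \<rho> * real N\<bar> \<le> k" unfolding R_def \<rho>_def k_def by (rule rough_count) (use B in auto)
    then have "R N \<le> \<rho> * real N + k" "0 \<le> R N" by (auto simp: R_def)
    then have "(R N)\<^sup>2 \<le> (\<rho> * real N + k)\<^sup>2" by (intro power_mono)
    also have "\<dots> \<le> 2 * (\<rho> * real N)\<^sup>2 + 2 * k\<^sup>2" using zero_le_power2[of "\<rho> * real N - k"] by (simp add: power2_sum power2_diff)
    finally show ?thesis by (simp add: power_mult_distrib)
  qed
  have d0: "d N \<ge> 0" if "N \<ge> 1" for N using kernel_difference_bounds(1)[OF that] unfolding d_def by (rule order_trans[rotated]) simp
  have "complex_of_real (\<Sum>r\<in>V. \<Sum>s\<in>V. 1 / real (max r s) ^ 2)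
     = (\<Sum>n=1..X. \<Sum>m=1..X. a n * cnj (a m) * of_real (1 / real (max n m) ^ 2))"
  proof -
    have "complex_of_real (\<Sum>r\<in>V. \<Sum>s\<in>V. 1 / real (max r s) ^ 2) = (\<Sum>n\<in>V. \<Sum>m\<in>V. a n * cnj (a m) * of_real (1 / real (max n m) ^ 2))"
      unfolding of_real_sum by (intro sum.cong refl) (simp add: a_def)
    also have "\<dots> = (\<Sum>n\<in>V. \<Sum>m=1..X. a n * cnj (a m) * of_real (1 / real (max n m) ^ 2))"
      by (intro sum.cong refl sum.mono_neutral_left) (use VX in \<open>auto simp: a_def\<close>)
    also have "\<dots> = (\<Sum>n=1..X. \<Sum>m=1..X. a n * cnj (a m) * of_real (1 / real (max n m) ^ 2))"
      by (intro sum.mono_neutral_left) (use VX in \<open>auto simp: a_def\<close>)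
    finally show ?thesis .
  qed
  also have "\<dots> = of_real ((\<Sum>N=1..X. (norm (\<Sum>n=1..N. a n))\<^sup>2 * d N) + (norm (\<Sum>n=1..X. a n))\<^sup>2 / real (X + 1) ^ 2)"
    unfolding d_def by (rule max_kernel_identity)
  also have "(\<Sum>N=1..X. (norm (\<Sum>n=1..N. a n))\<^sup>2 * d N) = (\<Sum>N=1..X. (R N)\<^sup>2 * d N)"
    by (rule sum.cong[OF refl], subst Ca) auto
  also have "(norm (\<Sum>n=1..X. a n))\<^sup>2 = (R X)\<^sup>2" by (rule Ca) simp
  finally have "(\<Sum>r\<in>V. \<Sum>s\<in>V. 1 / real (max r s) ^ 2) = (\<Sum>N=1..X. (R N)\<^sup>2 * d N) + (R X)\<^sup>2 / real (X + 1) ^ 2"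
    by (simp only: of_real_eq_iff)
  also have "(\<Sum>N=1..X. (R N)\<^sup>2 * d N) \<le> (\<Sum>N=1..X. 2 * \<rho>\<^sup>2 * (2 * (1 / real N)) + 2 * k\<^sup>2 * d N)"
  proof (rule sum_mono)
    fix N assume N: "N \<in> {1..X}"
    have "(R N)\<^sup>2 * d N \<le> (2 * \<rho>\<^sup>2 * real N ^ 2 + 2 * k\<^sup>2) * d N" by (intro mult_right_mono R2 d0) (use N in auto)
    also have "\<dots> = 2 * \<rho>\<^sup>2 * (real N ^ 2 * d N) + 2 * k\<^sup>2 * d N" by (simp add: algebra_simps)
    also have "\<dots> \<le> 2 * \<rho>\<^sup>2 * (2 / real N) + 2 * k\<^sup>2 * d N"
      by (intro add_right_mono mult_left_mono) (use kernel_difference_bounds(2)[of N] N in \<open>auto simp: d_def\<close>)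
    finally show "(R N)\<^sup>2 * d N \<le> 2 * \<rho>\<^sup>2 * (2 * (1 / real N)) + 2 * k\<^sup>2 * d N" by simp
  qed
  also have "(\<Sum>N=1..X. 2 * \<rho>\<^sup>2 * (2 * (1 / real N)) + 2 * k\<^sup>2 * d N) = 4 * \<rho>\<^sup>2 * (\<Sum>N=1..X. 1 / real N) + 2 * k\<^sup>2 * (\<Sum>N=1..X. d N)"
    unfolding sum.distrib sum_distrib_left by (simp add: mult_ac)
  also have "(\<Sum>N=1..X. d N) = 1 - 1 / real (X + 1) ^ 2"
    unfolding d_def by (induction X) auto
  also have "4 * \<rho>\<^sup>2 * (\<Sum>N=1..X. 1 / real N) \<le> 4 * \<rho>\<^sup>2 * (ln (real X) + 1)"
    by (intro mult_left_mono sum_inverse_le_ln X) simp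
  also have "2 * k\<^sup>2 * (1 - 1 / real (X + 1) ^ 2) \<le> 2 * k\<^sup>2" by (simp add: mult_left_le)
  also have "(R X)\<^sup>2 / real (X + 1) ^ 2 \<le> 2 + 2 * k\<^sup>2"
  proof -
    have "(R X)\<^sup>2 \<le> 2 * \<rho>\<^sup>2 * real X ^ 2 + 2 * k\<^sup>2" by (rule R2)
    also have "\<dots> \<le> 2 * 1 * real (X + 1) ^ 2 + 2 * k\<^sup>2 * real (X + 1) ^ 2"
    proof (rule add_mono)
      show "2 * \<rho>\<^sup>2 * real X ^ 2 \<le> 2 * 1 * real (X + 1) ^ 2"
        by (intro mult_mono power_mono) (use rho in \<open>auto simp: power_le_one\<close>)
      have "2 * k\<^sup>2 * 1 \<le> 2 * k\<^sup>2 * real (X + 1) ^ 2"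
        by (intro mult_left_mono one_le_power) auto
      then show "2 * k\<^sup>2 \<le> 2 * k\<^sup>2 * real (X + 1) ^ 2" by simp
    qed
    finally have "(R X)\<^sup>2 \<le> (2 + 2 * k\<^sup>2) * real (X + 1) ^ 2" by (simp add: algebra_simps)
    then show ?thesis by (simp add: divide_le_eq)
  qed
  finally show ?thesis by simp
qed

text \<open>With \<open>w = u / p\<close>, the truncated geometric series times \<open>1 - w\<close>
  is \<open>1 - w^E\<close>. The second identity measures by how much \<open>|1 - w|\<close> exceeds
  its minimum \<open>1 - 1/p\<close>, attained at \<open>u = 1\<close>; this excess is the source of
  all savings.\<close>

lemma euler_factor_bound:
  fixes u :: complex and p E :: nat
  assumes p: "p \<ge> 2" and u: "norm u = 1"
  shows "(norm (\<Sum>e<E. (u / of_nat p) ^ e))\<^sup>2 * ((1 - 1 / real p)\<^sup>2 * (1 + 2 * ((1 - Re u) / real p)))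
    \<le> (1 + 1 / real p ^ E)\<^sup>2"
    and "(norm (1 - u / of_nat p))\<^sup>2 = (1 - 1 / real p)\<^sup>2 + 2 * ((1 - Re u) / real p)"
proof -
  define w where "w = u / of_nat p"
  have p0: "real p > 0" using p by simp
  have nw: "norm w = 1 / real p" using u by (simp add: w_def norm_divide)
  have "(norm (1 - w))\<^sup>2 = 1 - 2 * Re w + (norm w)\<^sup>2"
    unfolding cmod_power2 by (simp add: power2_eq_square algebra_simps)
  also have "Re w = Re u / real p" by (simp add: w_def)
  finally show eq: "(norm (1 - u / of_nat p))\<^sup>2 = (1 - 1 / real p)\<^sup>2 + 2 * ((1 - Re u) / real p)"
    unfolding nw w_def[symmetric] by (simp add: power2_eq_square algebra_simps diff_divide_distrib)
  have x0: "(1 - Re u) / real p \<ge> 0" using complex_Re_le_cmod[of u] u p0 by simp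
  have q: "0 \<le> 1 - 1 / real p" "1 - 1 / real p \<le> 1" using p by auto
  have "(1 - 1 / real p)\<^sup>2 * (1 + 2 * ((1 - Re u) / real p)) \<le> (norm (1 - w))\<^sup>2"
  proof -
    have "(1 - 1 / real p)\<^sup>2 * (2 * ((1 - Re u) / real p)) \<le> 1 * (2 * ((1 - Re u) / real p))"
      by (rule mult_right_mono[OF power_le_one[OF q] mult_nonneg_nonneg[OF _ x0]]) simp
    then show ?thesis unfolding w_def eq by (simp add: algebra_simps)
  qed
  then have "(norm (\<Sum>e<E. w ^ e))\<^sup>2 * ((1 - 1 / real p)\<^sup>2 * (1 + 2 * ((1 - Re u) / real p)))
     \<le> (norm (\<Sum>e<E. w ^ e))\<^sup>2 * (norm (1 - w))\<^sup>2" by (rule mult_left_mono) simp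
  also have "\<dots> = (norm (1 - w ^ E))\<^sup>2"
    by (simp add: one_diff_power_eq norm_mult power_mult_distrib mult.commute)
  also have "\<dots> \<le> (1 + 1 / real p ^ E)\<^sup>2"
  proof (rule power_mono)
    have "norm (1 - w ^ E) \<le> norm (1::complex) + norm (w ^ E)" by (rule norm_triangle_ineq4)
    also have "\<dots> = 1 + 1 / real p ^ E" by (simp add: norm_power nw power_divide)
    finally show "norm (1 - w ^ E) \<le> 1 + 1 / real p ^ E" .
  qed simp
  finally show "(norm (\<Sum>e<E. (u / of_nat p) ^ e))\<^sup>2 * ((1 - 1 / real p)\<^sup>2 * (1 + 2 * ((1 - Re u) / real p)))
    \<le> (1 + 1 / real p ^ E)\<^sup>2" by (simp only: w_def)
qed

text \<open>Of the product of the local gains only the first-order part is kept; it grows with the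
  pretentious sum, which suffices. The 9 is \<open>3^2\<close>: the truncation errors multiply to at
  most \<open>exp 1 \<le> 3\<close>.\<close>

lemma smooth_euler_product_bound:
  assumes B: "finite B" "\<And>p. p \<in> B \<Longrightarrow> prime p"
    and u: "\<And>p. p \<in> B \<Longrightarrow> norm (u p) = 1"
    and E: "(\<Sum>p\<in>B. 1 / real p ^ E) \<le> 1"
  shows "(norm (\<Prod>p\<in>B. \<Sum>e<E. (u p / of_nat p) ^ e))\<^sup>2
    \<le> 9 / (\<Prod>p\<in>B. 1 - 1 / real p)\<^sup>2 / (1 + 2 * (\<Sum>p\<in>B. (1 - Re (u p)) / real p))"
proof -
  define \<rho> where "\<rho> = (\<Prod>p\<in>B. 1 - 1 / real p)"
  define D where "D = (\<Sum>p\<in>B. (1 - Re (u p)) / real p)"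
  have p2: "p \<ge> 2" if "p \<in> B" for p using B that prime_ge_2_nat by blast
  have x0: "(1 - Re (u p)) / real p \<ge> 0" if "p \<in> B" for p
    using complex_Re_le_cmod[of "u p"] u[OF that] by simp
  have D0: "D \<ge> 0" unfolding D_def by (intro sum_nonneg x0)
  have rho: "\<rho> > 0" unfolding \<rho>_def
  proof (rule prod_pos)
    fix p assume "p \<in> B" then show "0 < 1 - 1 / real p" using p2[of p] by simp
  qed
  have "(norm (\<Prod>p\<in>B. \<Sum>e<E. (u p / of_nat p) ^ e))\<^sup>2 * (\<rho>\<^sup>2 * (1 + 2 * D))
    \<le> (norm (\<Prod>p\<in>B. \<Sum>e<E. (u p / of_nat p) ^ e))\<^sup>2 * (\<rho>\<^sup>2 * (\<Prod>p\<in>B. 1 + 2 * ((1 - Re (u p)) / real p)))"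
    unfolding D_def sum_distrib_left
    by (intro mult_left_mono sum_le_prod_one_plus B mult_nonneg_nonneg[OF _ x0]) auto
  also have "\<dots> = (\<Prod>p\<in>B. (norm (\<Sum>e<E. (u p / of_nat p) ^ e))\<^sup>2 * ((1 - 1 / real p)\<^sup>2 * (1 + 2 * ((1 - Re (u p)) / real p))))"
    unfolding \<rho>_def prod_norm[symmetric] prod_power_distrib prod.distrib ..
  also have "\<dots> \<le> (\<Prod>p\<in>B. (1 + 1 / real p ^ E)\<^sup>2)"
  proof (rule prod_mono)
    fix p assume p: "p \<in> B"
    have "0 \<le> (norm (\<Sum>e<E. (u p / of_nat p) ^ e))\<^sup>2 * ((1 - 1 / real p)\<^sup>2 * (1 + 2 * ((1 - Re (u p)) / real p)))"
      by (intro mult_nonneg_nonneg add_nonneg_nonneg x0 p) auto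
    then show "0 \<le> (norm (\<Sum>e<E. (u p / of_nat p) ^ e))\<^sup>2 * ((1 - 1 / real p)\<^sup>2 * (1 + 2 * ((1 - Re (u p)) / real p))) \<and>
       (norm (\<Sum>e<E. (u p / of_nat p) ^ e))\<^sup>2 * ((1 - 1 / real p)\<^sup>2 * (1 + 2 * ((1 - Re (u p)) / real p))) \<le> (1 + 1 / real p ^ E)\<^sup>2"
      using euler_factor_bound(1)[OF p2[OF p] u[OF p]] by simp
  qed
  also have "\<dots> = (\<Prod>p\<in>B. 1 + 1 / real p ^ E)\<^sup>2" by (rule prod_power_distrib[symmetric])
  also have "\<dots> \<le> 3\<^sup>2"
  proof (rule power_mono)
    have "(\<Prod>p\<in>B. 1 + 1 / real p ^ E) \<le> exp (\<Sum>p\<in>B. 1 / real p ^ E)" by (rule prod_one_plus_le_exp) (use B in auto)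
    also have "\<dots> \<le> exp 1" using E by simp
    also have "\<dots> \<le> 3" by (rule exp_le)
    finally show "(\<Prod>p\<in>B. 1 + 1 / real p ^ E) \<le> 3" .
    show "0 \<le> (\<Prod>p\<in>B. 1 + 1 / real p ^ E)" by (rule prod_nonneg) auto
  qed
  finally have "(norm (\<Prod>p\<in>B. \<Sum>e<E. (u p / of_nat p) ^ e))\<^sup>2 * (\<rho>\<^sup>2 * (1 + 2 * D)) \<le> 9" by simp
  then have "(norm (\<Prod>p\<in>B. \<Sum>e<E. (u p / of_nat p) ^ e))\<^sup>2 \<le> 9 / (\<rho>\<^sup>2 * (1 + 2 * D))"
    using rho D0 by (subst pos_le_divide_eq) auto
  then show ?thesis by (simp add: \<rho>_def D_def)
qed

text \<open>Each integer is split into a part built from \<open>B\<close> and a part free of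
  \<open>B\<close>, so the Dirichlet polynomial over \<open>W\<close> is \<beta> times the one over
  \<open>V\<close>. The factor \<beta> saves \<open>1 / (1 + 2 * K)\<close> for
  \<open>|t| \<le> T\<close>, larger \<open>t\<close> cost \<open>2 / T\<close>, and on
  \<open>V\<close> only the density enters. The term with \<kappa> pays for the integers divisible
  by some \<open>p^E\<close>.\<close>

lemma log_mean_bound:
  assumes g: "cmult g" "\<forall>n\<ge>1. norm (g n) = 1"
    and B: "finite B" "\<And>p. p \<in> B \<Longrightarrow> prime p"
    and E: "(\<Sum>p\<in>B. 1 / real p ^ E) \<le> \<kappa>" "\<kappa> \<le> 1"
    and T: "T \<ge> 1" and K: "K \<ge> 0"
    and D: "\<And>t. \<bar>t\<bar> \<le> T \<Longrightarrow> (\<Sum>p\<in>B. (1 - Re (g p * cis (- t * ln (real p)))) / real p) \<ge> K"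
    and X: "X \<ge> 1"
  defines "\<rho> \<equiv> \<Prod>p\<in>B. 1 - 1 / real p" and "k \<equiv> 2 ^ card B"
  shows "(\<Sum>m=1..X. (norm (\<Sum>n=1..m. g n))\<^sup>2 / real m ^ 3)
    \<le> 36 * (1 / (1 + 2 * K) + 2 / T) * (4 * (ln (real X) + 1) + (4 * k\<^sup>2 + 2) / \<rho>\<^sup>2) + 2 * \<kappa>\<^sup>2 * (ln (real X) + 1)"
proof -
  define V where "V = {r \<in> Q_set B. r \<le> X}"
  define M where "M = smooth_set B E"
  \<comment> \<open>Only the factor from \<open>V\<close> is cut at \<open>X\<close>. Cutting the
    product as well would destroy the factorisation \<open>fac\<close>, and elements of
    \<open>W\<close> beyond \<open>X\<close> do no harm because the form is a sum of nonnegative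
    terms.\<close>
  define W where "W = (\<lambda>(m, r). m * r) ` (M \<times> V)"
  define h where "h t n = g n / of_nat n * cis (- t * ln (real n))" for t n
  define \<beta> where "\<beta> t = (\<Sum>m\<in>M. h t m)" for t
  define Kv where "Kv = (\<Sum>r\<in>V. \<Sum>s\<in>V. 1 / real (max r s) ^ 2)"
  have finV: "finite V" by (rule finite_subset[of _ "{..X}"]) (auto simp: V_def)
  have finM: "finite M" unfolding M_def by (rule finite_smooth_set) (use B in auto)
  have finW: "finite W" unfolding W_def using finV finM by simp
  have M1: "m \<ge> 1" if "m \<in> M" for m using that by (auto simp: M_def smooth_set_def)
  have V1: "r \<ge> 1" if "r \<in> V" for r using that by (auto simp: V_def Q_set_def)
  have W1: "n \<ge> 1" if "n \<in> W" for n
    using that M1 V1 by (force simp: W_def)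
  have inj: "inj_on (\<lambda>(m, r). m * r) (M \<times> V)"
  proof (rule inj_onI, clarify)
    fix m r m' r' assume "m \<in> M" "r \<in> V" "m' \<in> M" "r' \<in> V" "m * r = m' * r'"
    then show "m = m' \<and> r = r'"
      by (intro smooth_rough_inj[of m m' B r r']) (auto simp: M_def V_def smooth_set_def)
  qed
  have rho: "\<rho> > 0" unfolding \<rho>_def
  proof (rule prod_pos)
    fix p assume "p \<in> B"
    then show "0 < 1 - 1 / real p" using prime_gt_1_nat[OF B(2), of p] by simp
  qed
  have h_mult: "h t (m * n) = h t m * h t n" if "m \<ge> 1" "n \<ge> 1" for t m n
  proof -
    have "cis (- t * ln (real (m * n))) = cis (- t * ln (real m)) * cis (- t * ln (real n))"
      unfolding cis_mult using that by (intro arg_cong[of _ _ cis]) (simp add: ln_mult algebra_simps)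
    then show ?thesis using that g by (simp add: h_def cmult_mult)
  qed
  have h1: "h t 1 = 1" for t using g by (simp add: h_def cmult_def)
  have fac: "(\<Sum>n\<in>W. g n / of_nat n * cis (- t * ln (real n))) = \<beta> t * (\<Sum>n\<in>V. g n / of_nat n * cis (- t * ln (real n)))" for t
  proof -
    have "(\<Sum>n\<in>W. h t n) = (\<Sum>(m, r)\<in>M \<times> V. h t (m * r))"
      unfolding W_def by (subst sum.reindex[OF inj]) (simp add: case_prod_unfold)
    also have "\<dots> = (\<Sum>(m, r)\<in>M \<times> V. h t m * h t r)"
      by (intro sum.cong refl) (use M1 V1 h_mult in auto)
    also have "\<dots> = \<beta> t * (\<Sum>r\<in>V. h t r)" by (simp add: \<beta>_def sum_product sum.cartesian_product)
    finally show ?thesis by (simp add: h_def)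
  qed
  have beta: "(norm (\<beta> t))\<^sup>2 \<le> 9 / \<rho>\<^sup>2 / (1 + 2 * (\<Sum>p\<in>B. (1 - Re (g p * cis (- t * ln (real p)))) / real p))" for t
  proof -
    have "\<beta> t = (\<Prod>p\<in>B. \<Sum>e<E. h t p ^ e)"
      unfolding \<beta>_def M_def by (rule euler_product_smooth[OF B h1 h_mult]) auto
    also have "\<dots> = (\<Prod>p\<in>B. \<Sum>e<E. (g p * cis (- t * ln (real p)) / of_nat p) ^ e)"
      by (simp add: h_def)
    finally show ?thesis unfolding \<rho>_def
      using smooth_euler_product_bound[of B "\<lambda>p. g p * cis (- t * ln (real p))" E] B E g prime_ge_1_nat
      by (auto simp: norm_mult)
  qed
  have D0: "(\<Sum>p\<in>B. (1 - Re (g p * cis (- t * ln (real p)))) / real p) \<ge> 0" for t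
  proof (intro sum_nonneg divide_nonneg_nonneg)
    fix p assume "p \<in> B"
    then have "norm (g p * cis (- t * ln (real p))) = 1" using g B prime_ge_1_nat by (simp add: norm_mult)
    then show "0 \<le> 1 - Re (g p * cis (- t * ln (real p)))" using complex_Re_le_cmod by (metis diff_ge_0_iff_ge)
  qed auto
  have s1: "(norm (\<beta> t))\<^sup>2 \<le> 9 / \<rho>\<^sup>2 / (1 + 2 * K)" if "\<bar>t\<bar> \<le> T" for t
    by (rule order_trans[OF beta], rule divide_left_mono) (use D[OF that] K in auto)
  have s2: "(norm (\<beta> t))\<^sup>2 \<le> 9 / \<rho>\<^sup>2" for t
  proof -
    have "9 / \<rho>\<^sup>2 / (1 + 2 * (\<Sum>p\<in>B. (1 - Re (g p * cis (- t * ln (real p)))) / real p)) \<le> 9 / \<rho>\<^sup>2 / 1"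
      by (rule divide_left_mono) (use D0[of t] in auto)
    then show ?thesis using beta[of t] by simp
  qed
  \<comment> \<open>The triangle inequality discards the unimodular values of \<open>g\<close>, and
    a larger parameter only shrinks the kernel.\<close>
  have form_le: "exp_form T' V (\<lambda>n. g n / of_nat n) \<le> Kv" if T': "T' \<ge> 1" for T'
    unfolding exp_form_def Re_sum Kv_def
  proof (intro sum_mono)
    fix n m assume n: "n \<in> V" and m: "m \<in> V"
    have "Re (g n / of_nat n * cnj (g m / of_nat m) * complex_of_real (exp (- T' * \<bar>ln (real m) - ln (real n)\<bar>)))
      \<le> norm (g n / of_nat n * cnj (g m / of_nat m) * complex_of_real (exp (- T' * \<bar>ln (real m) - ln (real n)\<bar>)))"
      by (rule complex_Re_le_cmod)
    also have "\<dots> = exp (- T' * \<bar>ln (real m) - ln (real n)\<bar>) / (real n * real m)"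
      using g V1 n m by (simp add: norm_mult norm_divide)
    also have "\<dots> \<le> exp (- \<bar>ln (real m) - ln (real n)\<bar>) / (real n * real m)"
    proof (rule divide_right_mono)
      have "1 * \<bar>ln (real m) - ln (real n)\<bar> \<le> T' * \<bar>ln (real m) - ln (real n)\<bar>" using T' by (rule mult_right_mono) simp
      then show "exp (- T' * \<bar>ln (real m) - ln (real n)\<bar>) \<le> exp (- \<bar>ln (real m) - ln (real n)\<bar>)" by simp
    qed simp
    also have "\<dots> = 1 / real (max n m) ^ 2" by (rule exp_kernel_eq_max_kernel) (use V1 n m in auto)
    finally show "Re (g n / of_nat n * cnj (g m / of_nat m) * complex_of_real (exp (- T' * \<bar>ln (real m) - ln (real n)\<bar>))) \<le> 1 / real (max n m) ^ 2" .
  qed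
  have "exp_form 1 W (\<lambda>n. g n / of_nat n) \<le> 9 / \<rho>\<^sup>2 / (1 + 2 * K) * exp_form 1 V (\<lambda>n. g n / of_nat n)
     + 2 * (9 / \<rho>\<^sup>2) / T * exp_form T V (\<lambda>n. g n / of_nat n)"
    by (rule exp_form_product_bound[OF T finW finV fac]) (use s1 s2 in auto)
  also have "\<dots> \<le> 9 / \<rho>\<^sup>2 / (1 + 2 * K) * Kv + 2 * (9 / \<rho>\<^sup>2) / T * Kv"
    by (intro add_mono mult_left_mono form_le) (use T K in auto)
  also have "\<dots> = 9 * (1 / (1 + 2 * K) + 2 / T) * (Kv / \<rho>\<^sup>2)" by (simp add: algebra_simps)
  also have "\<dots> \<le> 9 * (1 / (1 + 2 * K) + 2 / T) * (4 * (ln (real X) + 1) + (4 * k\<^sup>2 + 2) / \<rho>\<^sup>2)"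
  proof (rule mult_left_mono)
    have "Kv \<le> 4 * \<rho>\<^sup>2 * (ln (real X) + 1) + 4 * k\<^sup>2 + 2"
      unfolding Kv_def V_def \<rho>_def k_def by (rule rough_max_kernel_bound[OF B X])
    then have "Kv / \<rho>\<^sup>2 \<le> (4 * \<rho>\<^sup>2 * (ln (real X) + 1) + (4 * k\<^sup>2 + 2)) / \<rho>\<^sup>2" by (intro divide_right_mono) auto
    also have "\<dots> = 4 * (ln (real X) + 1) + (4 * k\<^sup>2 + 2) / \<rho>\<^sup>2" using rho by (simp add: add_divide_distrib)
    finally show "Kv / \<rho>\<^sup>2 \<le> 4 * (ln (real X) + 1) + (4 * k\<^sup>2 + 2) / \<rho>\<^sup>2" .
  qed (use T K in auto)
  finally have formW: "exp_form 1 W (\<lambda>n. g n / of_nat n) \<le> 9 * (1 / (1 + 2 * K) + 2 / T) * (4 * (ln (real X) + 1) + (4 * k\<^sup>2 + 2) / \<rho>\<^sup>2)" .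

  define c where "c n = (if n \<in> W then g n else 0)" for n
  define C where "C N = (\<Sum>n=1..N. c n)" for N
  define S where "S N = (\<Sum>n=1..N. g n)" for N
  define d where "d N = 1 / real N ^ 2 - 1 / real (N + 1) ^ 2" for N
  \<comment> \<open>The kernel identity is used up to a bound \<open>Y\<close> for all of
    \<open>W\<close>; afterwards only the terms with \<open>N \<le> X\<close> are kept.\<close>
  define Y where "Y = X + Max (insert 0 W)"
  have WY: "W \<subseteq> {1..Y}"
  proof
    fix n assume n: "n \<in> W"
    then have "n \<le> Max (insert 0 W)" using finW by (intro Max_ge) auto
    then show "n \<in> {1..Y}" using W1[OF n] by (simp add: Y_def)
  qed
  have "complex_of_real (exp_form 1 W (\<lambda>n. g n / of_nat n)) = of_real (Re (\<Sum>n=1..Y. \<Sum>m=1..Y. c n * cnj (c m) * of_real (1 / real (max n m) ^ 2)))"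
  proof -
    have "(\<Sum>n=1..Y. \<Sum>m=1..Y. c n * cnj (c m) * of_real (1 / real (max n m) ^ 2)) = (\<Sum>n\<in>W. \<Sum>m=1..Y. c n * cnj (c m) * of_real (1 / real (max n m) ^ 2))"
      by (intro sum.mono_neutral_right) (use WY in \<open>auto simp: c_def\<close>)
    also have "\<dots> = (\<Sum>n\<in>W. \<Sum>m\<in>W. c n * cnj (c m) * of_real (1 / real (max n m) ^ 2))"
      by (intro sum.cong refl sum.mono_neutral_right) (use WY in \<open>auto simp: c_def\<close>)
    also have "\<dots> = (\<Sum>n\<in>W. \<Sum>m\<in>W. g n / of_nat n * cnj (g m / of_nat m) * of_real (exp (- 1 * \<bar>ln (real m) - ln (real n)\<bar>)))"
    proof (intro sum.cong refl)
      fix n m assume nm: "n \<in> W" "m \<in> W"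
      then have "1 / real (max n m) ^ 2 = exp (- \<bar>ln (real m) - ln (real n)\<bar>) / (real n * real m)"
        by (intro exp_kernel_eq_max_kernel[symmetric] W1)
      then show "c n * cnj (c m) * of_real (1 / real (max n m) ^ 2) = g n / of_nat n * cnj (g m / of_nat m) * of_real (exp (- 1 * \<bar>ln (real m) - ln (real n)\<bar>))"
        using nm by (simp only: c_def if_True) simp
    qed
    finally show ?thesis by (simp only: exp_form_def)
  qed
  then have "exp_form 1 W (\<lambda>n. g n / of_nat n) = (\<Sum>N=1..Y. (norm (C N))\<^sup>2 * d N) + (norm (C Y))\<^sup>2 / real (Y + 1) ^ 2"
    unfolding max_kernel_identity C_def d_def Re_complex_of_real of_real_eq_iff .
  also have "\<dots> \<ge> (\<Sum>N=1..Y. (norm (C N))\<^sup>2 * d N)" by simp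
  finally have "(\<Sum>N=1..Y. (norm (C N))\<^sup>2 * d N) \<le> exp_form 1 W (\<lambda>n. g n / of_nat n)" .
  moreover have "(\<Sum>N=1..X. (norm (C N))\<^sup>2 * (1 / (2 * real N ^ 3))) \<le> (\<Sum>N=1..Y. (norm (C N))\<^sup>2 * d N)"
  proof -
    have dN: "1 / (2 * real N ^ 3) \<le> d N" if "N \<ge> 1" for N unfolding d_def using that by (rule kernel_difference_bounds)
    have d0: "0 \<le> d N" if "N \<ge> 1" for N by (rule order_trans[OF _ dN[OF that]]) simp
    have "(\<Sum>N=1..X. (norm (C N))\<^sup>2 * (1 / (2 * real N ^ 3))) \<le> (\<Sum>N=1..X. (norm (C N))\<^sup>2 * d N)"
      by (intro sum_mono mult_left_mono dN) auto
    also have "\<dots> \<le> (\<Sum>N=1..Y. (norm (C N))\<^sup>2 * d N)"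
      by (rule sum_mono2) (use d0 in \<open>auto simp: Y_def\<close>)
    finally show ?thesis .
  qed
  ultimately have C_bound: "(\<Sum>N=1..X. (norm (C N))\<^sup>2 * (1 / (2 * real N ^ 3))) \<le> exp_form 1 W (\<lambda>n. g n / of_nat n)" by linarith

  \<comment> \<open>If \<open>n \<le> X\<close> is missed by \<open>W\<close>, its part free of
    \<open>B\<close> still lies in \<open>V\<close>, so its other part has an exponent of at least
    \<open>E\<close> and some \<open>p^E\<close> divides \<open>n\<close>.\<close>
  have SC: "norm (S N - C N) \<le> \<kappa> * real N" if N: "N \<le> X" for N
  proof -
    have "S N - C N = (\<Sum>n=1..N. if n \<in> W then 0 else g n)"
      unfolding S_def C_def c_def sum_subtractf[symmetric] by (intro sum.cong) auto
    also have "norm \<dots> \<le> (\<Sum>n=1..N. norm (if n \<in> W then 0 else g n))" by (rule norm_sum)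
    also have "\<dots> \<le> (\<Sum>n=1..N. \<Sum>p\<in>B. if p ^ E dvd n then 1 else 0)"
    proof (rule sum_mono)
      fix n assume n: "n \<in> {1..N}"
      show "norm (if n \<in> W then 0 else g n) \<le> (\<Sum>p\<in>B. if p ^ E dvd n then 1 else 0)"
      proof (cases "n \<in> W")
        case False
        obtain m r where mr: "n = m * r" "m \<ge> 1" "\<forall>p. prime p \<and> p dvd m \<longrightarrow> p \<in> B" "r \<in> Q_set B"
          using smooth_rough_decomposition[of n B] n B by auto
        have "r \<le> n" using mr n by simp
        then have "r \<le> X" using n N by simp
        then have "r \<in> V" using mr by (simp add: V_def)
        then have "m \<notin> M" using False mr by (auto simp: W_def)
        then obtain p where p: "p \<in> B" "multiplicity p m \<ge> E" using mr by (force simp: M_def smooth_set_def)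
        have "p ^ E dvd m" using p(2) by (rule multiplicity_dvd')
        then have "p ^ E dvd n" using mr by simp
        then have "1 \<le> (\<Sum>p\<in>{p}. if p ^ E dvd n then 1 else 0 :: real)" by simp
        also have "\<dots> \<le> (\<Sum>p\<in>B. if p ^ E dvd n then 1 else 0)" by (rule sum_mono2) (use p B in auto)
        finally show ?thesis using g n False by simp
      qed (auto intro: sum_nonneg)
    qed
    also have "\<dots> = (\<Sum>p\<in>B. \<Sum>n=1..N. if p ^ E dvd n then 1 else 0)" by (rule sum.swap)
    also have "\<dots> \<le> (\<Sum>p\<in>B. real N * (1 / real p ^ E))"
    proof (rule sum_mono)
      fix p assume "p \<in> B"
      then have "p ^ E \<ge> 1" using B prime_gt_0_nat by (simp add: Suc_le_eq)
      then have "(\<Sum>n=1..N. if p ^ E dvd n then 1 else 0 :: real) = real (N div p ^ E)"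
        by (subst sum_over_multiples) auto
      also have "\<dots> \<le> real N / real (p ^ E)" by (rule of_nat_div_le_of_nat)
      finally show "(\<Sum>n=1..N. if p ^ E dvd n then 1 else 0) \<le> real N * (1 / real p ^ E)" by simp
    qed
    also have "\<dots> = real N * (\<Sum>p\<in>B. 1 / real p ^ E)" by (simp add: sum_distrib_left)
    also have "\<dots> \<le> real N * \<kappa>" by (rule mult_left_mono) (use E in auto)
    finally show ?thesis by (simp add: mult.commute)
  qed
  have "(\<Sum>m=1..X. (norm (S m))\<^sup>2 / real m ^ 3) \<le> (\<Sum>N=1..X. 4 * ((norm (C N))\<^sup>2 * (1 / (2 * real N ^ 3))) + 2 * \<kappa>\<^sup>2 * (1 / real N))"
  proof (rule sum_mono)
    fix N assume N: "N \<in> {1..X}"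
    have "norm (S N) \<le> norm (C N) + norm (S N - C N)" by (metis add.commute diff_add_cancel norm_triangle_ineq)
    also have "\<dots> \<le> norm (C N) + \<kappa> * real N" using SC N by simp
    finally have "(norm (S N))\<^sup>2 \<le> (norm (C N) + \<kappa> * real N)\<^sup>2" by (rule power_mono) simp
    also have "\<dots> \<le> 2 * (norm (C N))\<^sup>2 + 2 * (\<kappa> * real N)\<^sup>2"
      using zero_le_power2[of "norm (C N) - \<kappa> * real N"] by (simp add: power2_sum power2_diff)
    finally have "(norm (S N))\<^sup>2 / real N ^ 3 \<le> (2 * (norm (C N))\<^sup>2 + 2 * (\<kappa> * real N)\<^sup>2) / real N ^ 3"
      by (rule divide_right_mono) simp
    also have "\<dots> = 4 * ((norm (C N))\<^sup>2 * (1 / (2 * real N ^ 3))) + 2 * \<kappa>\<^sup>2 * (1 / real N)"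
      using N by (simp add: add_divide_distrib power_mult_distrib power2_eq_square power3_eq_cube)
    finally show "(norm (S N))\<^sup>2 / real N ^ 3 \<le> 4 * ((norm (C N))\<^sup>2 * (1 / (2 * real N ^ 3))) + 2 * \<kappa>\<^sup>2 * (1 / real N)" .
  qed
  also have "\<dots> = 4 * (\<Sum>N=1..X. (norm (C N))\<^sup>2 * (1 / (2 * real N ^ 3))) + 2 * \<kappa>\<^sup>2 * (\<Sum>N=1..X. 1 / real N)"
    unfolding sum.distrib sum_distrib_left ..
  also have "\<dots> \<le> 4 * (9 * (1 / (1 + 2 * K) + 2 / T) * (4 * (ln (real X) + 1) + (4 * k\<^sup>2 + 2) / \<rho>\<^sup>2)) + 2 * \<kappa>\<^sup>2 * (ln (real X) + 1)"
    by (intro add_mono mult_left_mono sum_inverse_le_ln X order_trans[OF C_bound formW]) auto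
  also have "4 * (9 * a * b) = 36 * a * b" for a b :: real by simp
  finally show ?thesis by (simp only: S_def)
qed

section \<open>Divergence of the pretentious distance\<close>

lemma sum_inverse_squares_le: "(\<Sum>n=1..N. 1 / real n ^ 2) \<le> 2"
proof -
  have "(\<Sum>n=1..N. 1 / real n ^ 2) \<le> 2 - 1 / real N" if "N \<ge> 1"
    using that
  proof (induction N rule: dec_induct)
    case (step N)
    have "1 / real (Suc N) ^ 2 \<le> 1 / real N - 1 / real (Suc N)"
    proof -
      have "1 / real (Suc N) ^ 2 \<le> 1 / (real N * real (Suc N))"
        using step by (intro divide_left_mono) (auto simp: power2_eq_square)
      also have "\<dots> = 1 / real N - 1 / real (Suc N)" using step by (simp add: field_simps)
      finally show ?thesis .
    qed
    then show ?case using step by simp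
  qed simp
  moreover have "0 \<le> 1 / real N" by simp
  ultimately show ?thesis by (cases "N = 0") (auto intro: order_trans[of _ "2 - 1 / real N"])
qed

text \<open>Taylor's formula of order two for \<open>z powr (1 - s)\<close> between \<open>n\<close>
  and \<open>n + 1\<close>: the mean value bound is applied first to the derivative, then to the
  function minus its linear part.\<close>

lemma complex_powr_difference_bound:
  fixes s :: complex and n :: nat
  assumes n: "n \<ge> 1" and s: "Re s > 1"
  shows "norm (of_nat (n + 1) powr (1 - s) - of_nat n powr (1 - s) - (1 - s) * of_nat n powr (- s))
     \<le> norm (1 - s) * norm s / real n ^ 2"
proof -
  define S where "S = closed_segment (of_nat n :: complex) (of_nat (n + 1))"
  have S: "\<exists>x. z = of_real x \<and> real n \<le> x \<and> x \<le> real n + 1" if "z \<in> S" for z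
  proof -
    have "S = of_real ` {real n..real n + 1}"
      using closed_segment_of_real[of "real n" "real (n + 1)", where 'a = complex] by (simp add: S_def closed_segment_eq_real_ivl add.commute)
    then show ?thesis using that by auto
  qed
  have convS: "convex S" by (simp add: S_def)
  have nS: "of_nat n \<in> S" "of_nat (n + 1) \<in> S" by (auto simp: S_def)
  have nR: "z \<notin> \<real>\<^sub>\<le>\<^sub>0" "z \<noteq> 0" if z: "z \<in> S" for z
  proof -
    obtain x where "z = of_real x" "real n \<le> x" using S[OF z] by blast
    then show "z \<notin> \<real>\<^sub>\<le>\<^sub>0" "z \<noteq> 0" using n by auto
  qed
  define B where "B = norm (1 - s) * norm s / real n ^ 2"
  have d1: "((\<lambda>z. (1 - s) * z powr (- s)) has_field_derivative (1 - s) * (- s * z powr (- s - 1))) (at z within S)" if "z \<in> S" for z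
    by (intro derivative_eq_intros DERIV_cmult) (use nR[OF that] in \<open>auto intro!: derivative_eq_intros\<close>)
  have b1: "norm ((1 - s) * (- s * z powr (- s - 1))) \<le> B" if z: "z \<in> S" for z
  proof -
    obtain x where x: "z = of_real x" "real n \<le> x" using S[OF z] by blast
    then have x1: "1 \<le> x" using n by linarith
    have "norm (z powr (- s - 1)) = x powr (- Re s - 1)"
      using x x1 by (simp add: norm_powr_real_powr)
    also have "\<dots> \<le> x powr (-2)" using s x1 by (intro powr_mono) auto
    also have "\<dots> \<le> real n powr (-2)" using x n by (intro powr_mono2') auto
    also have "\<dots> = 1 / real n ^ 2" using n by (simp add: powr_minus powr_numeral divide_simps)
    finally have "norm (1 - s) * (norm s * norm (z powr (- s - 1))) \<le> norm (1 - s) * (norm s * (1 / real n ^ 2))"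
      by (intro mult_left_mono) auto
    then show ?thesis by (simp add: B_def norm_mult)
  qed
  have B0: "B \<ge> 0" by (simp add: B_def)
  have d2: "((\<lambda>z. z powr (1 - s) - (1 - s) * of_nat n powr (- s) * z) has_field_derivative
     (1 - s) * z powr (- s) - (1 - s) * of_nat n powr (- s)) (at z within S)" if "z \<in> S" for z
    using nR[OF that] by (auto intro!: derivative_eq_intros)
  have b2: "norm ((1 - s) * z powr (- s) - (1 - s) * of_nat n powr (- s)) \<le> B" if z: "z \<in> S" for z
  proof -
    have "norm ((1 - s) * z powr (- s) - (1 - s) * of_nat n powr (- s)) \<le> B * norm (z - of_nat n)"
      by (rule field_differentiable_bound[OF convS d1 b1]) (use z nS in auto)
    also have "\<dots> \<le> B * 1"
    proof (rule mult_left_mono[OF _ B0])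
      obtain x where x: "z = of_real x" "real n \<le> x" "x \<le> real n + 1" using S[OF z] by blast
      have "z - of_nat n = of_real (x - real n)" using x by simp
      then have "norm (z - of_nat n) = \<bar>x - real n\<bar>" by (simp only: norm_of_real)
      then show "norm (z - of_nat n) \<le> 1" using x by simp
    qed
    finally show ?thesis by simp
  qed
  have "norm ((of_nat (n + 1) powr (1 - s) - (1 - s) * of_nat n powr (- s) * of_nat (n + 1))
      - (of_nat n powr (1 - s) - (1 - s) * of_nat n powr (- s) * of_nat n)) \<le> B * norm (of_nat (n + 1) - of_nat n :: complex)"
    by (rule field_differentiable_bound[OF convS d2 b2]) (use nS in auto)
  then show ?thesis by (simp add: B_def algebra_simps)
qed

text \<open>Telescoping \<open>n powr (1 - s)\<close> evaluates \<open>1 - s\<close> times the sum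
  up to an absolutely convergent error, and \<open>|1 - s| \<ge> |\<tau>|\<close> keeps the division
  harmless as \<sigma> tends to 0. This is the elementary counterpart of the regularity of zeta at
  \<open>1 + i \<tau>\<close>.\<close>

lemma zeta_partial_sums_bounded:
  fixes \<tau> :: real
  assumes "\<tau> \<noteq> 0"
  obtains C where "\<And>\<sigma> y. 0 < \<sigma> \<Longrightarrow> \<sigma> \<le> 1 \<Longrightarrow> norm (\<Sum>n=1..y. of_nat n powr (- Complex (1 + \<sigma>) \<tau>)) \<le> C"
proof (rule that)
  fix \<sigma> :: real and y :: nat
  assume \<sigma>: "0 < \<sigma>" "\<sigma> \<le> 1"
  define s where "s = Complex (1 + \<sigma>) \<tau>"
  define e where "e n = of_nat (n + 1) powr (1 - s) - of_nat n powr (1 - s) - (1 - s) * of_nat n powr (- s)" for n :: nat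
  have s1: "norm (1 - s) \<ge> \<bar>\<tau>\<bar>" using abs_Im_le_cmod[of "1 - s"] by (simp add: s_def)
  have s1': "norm (1 - s) > 0" using s1 assms by linarith
  have ns: "norm s \<le> 2 + \<bar>\<tau>\<bar>" using cmod_le[of s] \<sigma> by (simp add: s_def)
  have "(1 - s) * (\<Sum>n=1..y. of_nat n powr (- s)) = (\<Sum>n=1..y. (of_nat (n + 1) powr (1 - s) - of_nat n powr (1 - s)) - e n)"
    by (simp add: e_def sum_distrib_left)
  also have "\<dots> = (\<Sum>n=1..y. of_nat (Suc n) powr (1 - s) - of_nat n powr (1 - s)) - (\<Sum>n=1..y. e n)"
    by (simp add: sum_subtractf)
  also have "(\<Sum>n=1..y. of_nat (Suc n) powr (1 - s) - of_nat n powr (1 - s)) = of_nat (Suc y) powr (1 - s) - 1"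
    using sum_Suc_diff[of 1 y "\<lambda>n. of_nat n powr (1 - s)"] by simp
  finally have eq: "(1 - s) * (\<Sum>n=1..y. of_nat n powr (- s)) = of_nat (Suc y) powr (1 - s) - 1 - (\<Sum>n=1..y. e n)" .
  have "norm (\<Sum>n=1..y. e n) \<le> (\<Sum>n=1..y. norm (e n))" by (rule norm_sum)
  also have "\<dots> \<le> (\<Sum>n=1..y. norm (1 - s) * norm s * (1 / real n ^ 2))"
    unfolding e_def using \<sigma> by (intro sum_mono order_trans[OF complex_powr_difference_bound]) (auto simp: s_def)
  also have "\<dots> = norm (1 - s) * norm s * (\<Sum>n=1..y. 1 / real n ^ 2)" by (simp only: sum_distrib_left)
  also have "\<dots> \<le> norm (1 - s) * norm s * 2" by (intro mult_left_mono sum_inverse_squares_le) auto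
  finally have e: "norm (\<Sum>n=1..y. e n) \<le> norm (1 - s) * norm s * 2" .
  have "norm (of_nat (Suc y) powr (1 - s)) = real (Suc y) powr (- \<sigma>)"
    by (subst norm_powr_real_powr) (auto simp: s_def)
  also have "\<dots> \<le> real (Suc y) powr 0" using \<sigma> by (intro powr_mono) auto
  finally have "norm (of_nat (Suc y) powr (1 - s)) \<le> 1" by simp
  then have "norm (of_nat (Suc y) powr (1 - s) - 1 - (\<Sum>n=1..y. e n)) \<le> 1 + 1 + norm (1 - s) * norm s * 2"
    using e by (intro order_trans[OF norm_triangle_ineq4] add_mono order_trans[OF norm_triangle_ineq4]) auto
  then have "norm (1 - s) * norm (\<Sum>n=1..y. of_nat n powr (- s)) \<le> 2 + norm (1 - s) * norm s * 2"
    unfolding norm_mult[symmetric] eq by simp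
  then have "norm (\<Sum>n=1..y. of_nat n powr (- s)) \<le> (2 + norm (1 - s) * norm s * 2) / norm (1 - s)"
    using s1' by (simp add: pos_le_divide_eq mult.commute)
  also have "\<dots> = 2 / norm (1 - s) + 2 * norm s" using s1' by (simp add: add_divide_distrib)
  also have "\<dots> \<le> 2 / \<bar>\<tau>\<bar> + 2 * (2 + \<bar>\<tau>\<bar>)"
    using s1 assms ns by (intro add_mono divide_left_mono mult_pos_pos s1') auto
  finally show "norm (\<Sum>n=1..y. of_nat n powr (- Complex (1 + \<sigma>) \<tau>)) \<le> 2 / \<bar>\<tau>\<bar> + 2 * (2 + \<bar>\<tau>\<bar>)"
    by (simp add: s_def)
qed

lemma atLeastAtMost_subset_smooth_set:
  assumes "y < E"
  shows "{1..y} \<subseteq> smooth_set {p. prime p \<and> p \<le> y} E"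
proof
  fix n assume n: "n \<in> {1..y}"
  have "multiplicity p n < E" if p: "prime p" for p
  proof -
    have "multiplicity p n < 2 ^ multiplicity p n" by simp
    also have "\<dots> \<le> p ^ multiplicity p n" using prime_ge_2_nat[OF p] by (rule power_mono) simp
    also have "\<dots> \<le> n" using n by (intro dvd_imp_le multiplicity_dvd) auto
    also have "n < E" using n assms by simp
    finally show ?thesis .
  qed
  moreover have "p \<le> y" if "p dvd n" for p using dvd_imp_le[OF that] n by simp
  ultimately show "n \<in> smooth_set {p. prime p \<and> p \<le> y} E" using n by (auto simp: smooth_set_def)
qed

text \<open>As \<open>E\<close> tends to infinity, the Euler product over \<open>p \<le> y\<close>
  becomes the sum over all integers built from these primes. They include every
  \<open>n \<le> y\<close>; the others are absorbed by the tail of the absolute series.\<close>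

lemma euler_product_approx:
  fixes h :: "nat \<Rightarrow> complex" and y :: nat
  assumes h: "h 1 = 1" "\<And>m n. m \<ge> 1 \<Longrightarrow> n \<ge> 1 \<Longrightarrow> h (m * n) = h m * h n"
    and lt: "\<And>p. prime p \<Longrightarrow> norm (h p) < 1" and sm: "summable (\<lambda>n. norm (h n))"
  defines "P \<equiv> {p. prime p \<and> p \<le> y}"
  shows "norm (\<Prod>p\<in>P. 1 / (1 - h p)) \<le> norm (\<Sum>n=1..y. h n) + ((\<Sum>n. norm (h n)) - (\<Sum>n=1..y. norm (h n)))"
    and "(\<Sum>n=1..y. norm (h n)) \<le> (\<Prod>p\<in>P. 1 / (1 - norm (h p)))"
proof -
  define x where "x n = norm (h n)" for n
  have P: "finite P" "\<And>p. p \<in> P \<Longrightarrow> prime p" by (auto simp: P_def)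
  have x: "x 1 = 1" "\<And>m n. m \<ge> 1 \<Longrightarrow> n \<ge> 1 \<Longrightarrow> x (m * n) = x m * x n"
    using h by (auto simp: x_def norm_mult)
  have lim1: "(\<lambda>E. norm (\<Prod>p\<in>P. \<Sum>e<E. h p ^ e)) \<longlonglongrightarrow> norm (\<Prod>p\<in>P. 1 / (1 - h p))"
    by (intro tendsto_norm tendsto_prod) (use geometric_sums[OF lt] P in \<open>auto simp: sums_def\<close>)
  have lim2: "(\<lambda>E. \<Prod>p\<in>P. \<Sum>e<E. x p ^ e) \<longlonglongrightarrow> (\<Prod>p\<in>P. 1 / (1 - x p))"
  proof (rule tendsto_prod)
    fix p assume "p \<in> P"
    then have "norm (x p) < 1" using lt P by (simp add: x_def)
    then show "(\<lambda>E. \<Sum>e<E. x p ^ e) \<longlonglongrightarrow> 1 / (1 - x p)" using geometric_sums[of "x p"] by (simp add: sums_def)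
  qed
  have fin: "finite (smooth_set P E)" for E by (rule finite_smooth_set) (use P in auto)
  have e1: "(\<Prod>p\<in>P. \<Sum>e<E. h p ^ e) = (\<Sum>n\<in>smooth_set P E. h n)" for E
    by (rule euler_product_smooth[symmetric]) (use P h in auto)
  have e2: "(\<Prod>p\<in>P. \<Sum>e<E. x p ^ e) = (\<Sum>n\<in>smooth_set P E. x n)" for E
    by (rule euler_product_smooth[symmetric]) (use P x in auto)
  have le_Z: "(\<Sum>n\<in>smooth_set P E. x n) \<le> (\<Sum>n. x n)" for E
    by (rule sum_le_suminf) (use sm fin in \<open>auto simp: x_def\<close>)
  have sub: "{1..y} \<subseteq> smooth_set P E" if "y < E" for E
    unfolding P_def by (rule atLeastAtMost_subset_smooth_set[OF that])
  show "(\<Sum>n=1..y. norm (h n)) \<le> (\<Prod>p\<in>P. 1 / (1 - norm (h p)))"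
    unfolding x_def[symmetric]
  proof (rule tendsto_lowerbound[OF lim2])
    show "\<forall>\<^sub>F E in sequentially. (\<Sum>n=1..y. x n) \<le> (\<Prod>p\<in>P. \<Sum>e<E. x p ^ e)"
      using eventually_gt_at_top[of y]
    proof eventually_elim
      case (elim E)
      then show ?case unfolding e2 by (intro sum_mono2 fin sub) (auto simp: x_def)
    qed
  qed simp
  show "norm (\<Prod>p\<in>P. 1 / (1 - h p)) \<le> norm (\<Sum>n=1..y. h n) + ((\<Sum>n. norm (h n)) - (\<Sum>n=1..y. norm (h n)))"
    unfolding x_def[symmetric]
  proof (rule tendsto_upperbound[OF lim1])
    show "\<forall>\<^sub>F E in sequentially. norm (\<Prod>p\<in>P. \<Sum>e<E. h p ^ e) \<le> norm (\<Sum>n=1..y. h n) + ((\<Sum>n. x n) - (\<Sum>n=1..y. x n))"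
      using eventually_gt_at_top[of y]
    proof eventually_elim
      case (elim E)
      have "(\<Sum>n\<in>smooth_set P E. h n) = (\<Sum>n=1..y. h n) + (\<Sum>n\<in>smooth_set P E - {1..y}. h n)"
        using sum.subset_diff[OF sub[OF elim] fin] by (simp add: add.commute)
      then have "norm (\<Sum>n\<in>smooth_set P E. h n) \<le> norm (\<Sum>n=1..y. h n) + norm (\<Sum>n\<in>smooth_set P E - {1..y}. h n)"
        by (simp add: norm_triangle_ineq)
      also have "norm (\<Sum>n\<in>smooth_set P E - {1..y}. h n) \<le> (\<Sum>n\<in>smooth_set P E - {1..y}. x n)"
        unfolding x_def by (rule norm_sum)
      also have "\<dots> = (\<Sum>n\<in>smooth_set P E. x n) - (\<Sum>n=1..y. x n)"
        by (rule sum_diff[OF fin sub[OF elim]])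
      also have "\<dots> \<le> (\<Sum>n. x n) - (\<Sum>n=1..y. x n)" using le_Z by simp
      finally show ?case unfolding e1 by simp
    qed
  qed simp
qed

text \<open>Otherwise \<open>\<bar>\<zeta>(1+\<sigma>+i\<tau>)\<bar>\<close> would be at least of the order of \<open>\<zeta>(1+\<sigma>)\<close> to the power \<open>3/4\<close> as \<open>\<sigma>\<close> tends to \<open>0\<close>.\<close>

lemma primes_not_concentrated:
  fixes \<tau> C :: real
  assumes "\<tau> \<noteq> 0"
  shows "\<exists>\<sigma> B. 0 < \<sigma> \<and> \<sigma> \<le> 1 \<and> finite B \<and> (\<forall>p\<in>B. prime p) \<and>
    (\<Sum>p\<in>B. real p powr (- (1 + \<sigma>)) * (1 - cos (\<tau> * ln (real p)))) >
     (\<Sum>p\<in>B. real p powr (- (1 + \<sigma>))) / 4 + C"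
proof (rule ccontr)
  assume "\<not> ?thesis"
  then have hyp: "(\<Sum>p\<in>B. real p powr (- (1 + \<sigma>)) * (1 - cos (\<tau> * ln (real p)))) \<le> (\<Sum>p\<in>B. real p powr (- (1 + \<sigma>))) / 4 + C"
    if "0 < \<sigma>" "\<sigma> \<le> 1" "finite B" "\<And>p. p \<in> B \<Longrightarrow> prime p" for \<sigma> B
    using that by (meson not_less)
  obtain C1 where C1: "\<And>\<sigma> y. 0 < \<sigma> \<Longrightarrow> \<sigma> \<le> 1 \<Longrightarrow> norm (\<Sum>n=1..y. of_nat n powr (- Complex (1 + \<sigma>) \<tau>)) \<le> C1"
    using zeta_partial_sums_bounded[OF assms] by blast
  \<comment> \<open>\<open>4 * C + 96\<close> is twice \<open>2 * C + 24 * 2\<close>, because the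
    bound for \<open>G\<close> below is squared. Squaring also turns half the sum of
    \<open>x p\<close> into the whole sum, which is at most \<open>ln (1 / W)\<close>.\<close>
  define A where "A = exp (4 * C + 96)"
  have A0: "A > 0" by (simp add: A_def)
  have C10: "C1 \<ge> 0" using C1[of 1 0] by simp
  \<comment> \<open>Chosen to make \<open>1 / W\<close> at least \<open>A * (C1 + 1)^4 + 2\<close>,
    which will contradict the upper bound for \<open>1 / W^3\<close>.\<close>
  define H where "H = 2 * (A * (C1 + 1) ^ 4 + 2)"
  obtain M where M: "M \<ge> 2" "harm M \<ge> H"
  proof -
    have "\<forall>\<^sub>F n in sequentially. H \<le> harm n" using harm_at_top by (simp add: filterlim_at_top)
    then obtain M0 where "\<And>n. n \<ge> M0 \<Longrightarrow> H \<le> harm n" by (auto simp: eventually_sequentially)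
    then show ?thesis using that[of "max M0 2"] by auto
  qed
  \<comment> \<open>This choice gives \<open>n powr \<sigma> \<le> 2\<close> for all
    \<open>n \<le> M\<close>, so the sum of \<open>x n\<close> up to \<open>M\<close> is at least
    half the harmonic sum.\<close>
  define \<sigma> where "\<sigma> = min 1 (ln 2 / ln (real M))"
  have lnM: "ln (real M) > 0" using M by simp
  have \<sigma>: "0 < \<sigma>" "\<sigma> \<le> 1" using lnM by (auto simp: \<sigma>_def)
  define s where "s = Complex (1 + \<sigma>) \<tau>"
  define h where "h n = (of_nat n :: complex) powr (- s)" for n :: nat
  define x where "x n = real n powr (- (1 + \<sigma>))" for n
  have nh: "norm (h n) = x n" for n
    unfolding h_def x_def by (cases "n = 0") (auto simp: norm_powr_real_powr s_def)
  have h_cis: "h n = of_real (x n) * cis (- \<tau> * ln (real n))" if "n \<ge> 1" for n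
  proof -
    have "h n = exp (- s * of_real (ln (real n)))" using that by (simp add: h_def powr_def)
    also have "- s * of_real (ln (real n)) = of_real (- (1 + \<sigma>) * ln (real n)) + \<i> * of_real (- \<tau> * ln (real n))"
      by (simp add: s_def complex_eq_iff algebra_simps)
    also have "exp \<dots> = of_real (exp (- (1 + \<sigma>) * ln (real n))) * cis (- \<tau> * ln (real n))"
      unfolding exp_add cis_conv_exp by (simp only: exp_of_real)
    finally show ?thesis using that by (simp add: x_def powr_def)
  qed
  have h1: "h 1 = 1" by (simp add: h_def)
  have h_mult: "h (m * n) = h m * h n" if "m \<ge> 1" "n \<ge> 1" for m n
  proof -
    have "cis (- \<tau> * ln (real (m * n))) = cis (- \<tau> * ln (real m)) * cis (- \<tau> * ln (real n))"
      unfolding cis_mult using that by (intro arg_cong[of _ _ cis]) (simp add: ln_mult algebra_simps)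
    moreover have "x (m * n) = x m * x n" by (simp add: x_def powr_mult)
    ultimately show ?thesis using that by (simp add: h_cis)
  qed
  have x_half: "x p \<le> 1 / real p" "x p \<le> 1 / 2" "0 < x p" if "prime p" for p
  proof -
    have p2: "real p \<ge> 2" using prime_ge_2_nat[OF that] by simp
    have "x p \<le> real p powr (-1)" unfolding x_def using p2 \<sigma> by (intro powr_mono) auto
    also have "\<dots> = 1 / real p" using p2 by (simp add: powr_minus inverse_eq_divide)
    finally show "x p \<le> 1 / real p" .
    also have "1 / real p \<le> 1 / 2" using p2 by simp
    finally show "x p \<le> 1 / 2" .
    show "0 < x p" using p2 by (simp add: x_def)
  qed
  have lt: "norm (h p) < 1" if "prime p" for p using x_half[OF that] by (simp add: nh)
  have sm: "summable (\<lambda>n. norm (h n))" unfolding nh x_def using \<sigma> by (simp add: summable_real_powr_iff)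
  obtain y where y: "y \<ge> M" "(\<Sum>n. norm (h n)) - (\<Sum>n=1..y. norm (h n)) \<le> 1"
  proof -
    have "(\<lambda>N. \<Sum>n<N. norm (h n)) \<longlonglongrightarrow> (\<Sum>n. norm (h n))" using sm by (rule summable_LIMSEQ)
    then have "\<forall>\<^sub>F N in sequentially. (\<Sum>n<N. norm (h n)) > (\<Sum>n. norm (h n)) - 1" by (rule order_tendstoD) simp
    then obtain N0 where N0: "\<And>N. N \<ge> N0 \<Longrightarrow> (\<Sum>n<N. norm (h n)) > (\<Sum>n. norm (h n)) - 1" by (auto simp: eventually_sequentially)
    define y where "y = max N0 M"
    have "{..<Suc y} = insert 0 {1..y}" by auto
    then have "(\<Sum>n<Suc y. norm (h n)) = norm (h 0) + (\<Sum>n=1..y. norm (h n))" by simp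
    then have "(\<Sum>n=1..y. norm (h n)) > (\<Sum>n. norm (h n)) - 1" using N0[of "Suc y"] by (simp add: y_def h_def)
    then show ?thesis using that[of y] by (simp add: y_def)
  qed
  define P where "P = {p. prime p \<and> p \<le> y}"
  have P: "finite P" "\<And>p. p \<in> P \<Longrightarrow> prime p" by (auto simp: P_def)
  have ub: "norm (\<Prod>p\<in>P. 1 / (1 - h p)) \<le> C1 + 1"
    unfolding P_def by (rule order_trans[OF euler_product_approx(1)[OF h1 h_mult lt sm]])
      (use y C1[OF \<sigma>, of y] in \<open>auto simp: h_def s_def\<close>)
  define W where "W = (\<Prod>p\<in>P. 1 - x p)"
  have Pi0: "W > 0" unfolding W_def
  proof (rule prod_pos)
    fix p assume "p \<in> P"
    then show "0 < 1 - x p" using x_half(2)[OF P(2), of p] by linarith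
  qed
  have lb: "H / 2 \<le> 1 / W"
  proof -
    have "H / 2 \<le> harm M / 2" using M by simp
    also have "\<dots> = (\<Sum>n=1..M. 1 / real n * (1 / 2))" by (simp add: harm_def sum_distrib_right inverse_eq_divide)
    also have "\<dots> \<le> (\<Sum>n=1..M. x n)"
    proof (rule sum_mono)
      fix n assume n: "n \<in> {1..M}"
      have "real n powr \<sigma> \<le> real M powr \<sigma>" using n \<sigma> by (intro powr_mono2) auto
      also have "\<dots> \<le> real M powr (ln 2 / ln (real M))" using M by (intro powr_mono) (auto simp: \<sigma>_def)
      also have "\<dots> = 2" using lnM M by (simp add: powr_def)
      finally have n2: "real n powr \<sigma> \<le> 2" .
      have "x n = real n powr (-1) * real n powr (- \<sigma>)" unfolding x_def by (subst powr_add[symmetric]) simp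
      also have "\<dots> = 1 / real n * (1 / real n powr \<sigma>)" using n by (simp add: powr_minus inverse_eq_divide)
      also have "\<dots> \<ge> 1 / real n * (1 / 2)" using n2 n by (intro mult_left_mono divide_left_mono) auto
      finally show "1 / real n * (1 / 2) \<le> x n" .
    qed
    also have "\<dots> \<le> (\<Sum>n=1..y. x n)" by (rule sum_mono2) (use y in \<open>auto simp: x_def\<close>)
    also have "\<dots> \<le> (\<Prod>p\<in>P. 1 / (1 - x p))"
      using euler_product_approx(2)[OF h1 h_mult lt sm, of y] by (simp add: P_def nh)
    also have "\<dots> = 1 / W" by (simp add: W_def prod_dividef)
    finally show ?thesis .
  qed
  define c where "c p = 1 - cos (\<tau> * ln (real p))" for p :: nat
  have factor: "(norm (1 - h p))\<^sup>2 \<le> (1 - x p)\<^sup>2 * exp (2 * (x p * c p) + 24 * (1 / real p ^ 2))" if p: "p \<in> P" for p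
  proof -
    have xp: "x p \<le> 1 / real p" "x p \<le> 1 / 2" "0 < x p" using x_half[OF P(2)[OF p]] by auto
    have p1: "p \<ge> 1" using prime_gt_0_nat[OF P(2)[OF p]] by simp
    have c: "0 \<le> c p" "c p \<le> 2" unfolding c_def using cos_ge_minus_one[of "\<tau> * ln (real p)"] by auto
    have "(norm (1 - h p))\<^sup>2 = 1 - 2 * Re (h p) + (norm (h p))\<^sup>2"
      unfolding cmod_power2 by (simp add: power2_eq_square algebra_simps)
    also have "Re (h p) = x p * (1 - c p)" using h_cis[OF p1] by (simp add: c_def)
    also have "norm (h p) = x p" by (rule nh)
    finally have eq: "(norm (1 - h p))\<^sup>2 = (1 - x p)\<^sup>2 + 2 * (x p * c p)"
      by (simp add: power2_eq_square algebra_simps)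
    \<comment> \<open>For \<open>x \<le> 1/2\<close> this yields
      \<open>1 \<le> (1 + 6 x) * (1 - x)^2\<close>. Taking \<open>(1 - x)^2\<close> out of the
      excess \<open>2 x c\<close> thus costs \<open>12 x^2 c\<close>, at most
      \<open>24 / p^2\<close> and hence summable.\<close>
    have "(1 + 6 * x p) * (1 - x p)\<^sup>2 - 1 = x p * ((1 - 2 * x p) * (4 - 3 * x p))"
      by (simp add: power2_eq_square algebra_simps)
    moreover have "x p * ((1 - 2 * x p) * (4 - 3 * x p)) \<ge> 0" using xp by (intro mult_nonneg_nonneg) auto
    ultimately have q: "1 \<le> (1 + 6 * x p) * (1 - x p)\<^sup>2" by linarith
    have "2 * (x p * c p) * 1 \<le> 2 * (x p * c p) * ((1 + 6 * x p) * (1 - x p)\<^sup>2)"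
      by (intro mult_left_mono q mult_nonneg_nonneg) (use xp c in auto)
    then have "(norm (1 - h p))\<^sup>2 \<le> (1 - x p)\<^sup>2 * (1 + (2 * (x p * c p) + 12 * (x p * x p) * c p))"
      unfolding eq by (simp add: algebra_simps)
    also have "\<dots> \<le> (1 - x p)\<^sup>2 * exp (2 * (x p * c p) + 24 * (1 / real p ^ 2))"
    proof (rule mult_left_mono)
      have "12 * (x p * x p) * c p \<le> 12 * (1 / real p * (1 / real p)) * 2"
        using xp c by (intro mult_mono) auto
      then have "1 + (2 * (x p * c p) + 12 * (x p * x p) * c p) \<le> 1 + (2 * (x p * c p) + 24 * (1 / real p ^ 2))"
        by (simp add: power2_eq_square)
      also have "\<dots> \<le> exp (2 * (x p * c p) + 24 * (1 / real p ^ 2))" by (rule exp_ge_add_one_self)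
      finally show "1 + (2 * (x p * c p) + 12 * (x p * x p) * c p) \<le> exp (2 * (x p * c p) + 24 * (1 / real p ^ 2))" .
    qed simp
    finally show ?thesis .
  qed
  define G where "G = (\<Prod>p\<in>P. (norm (1 - h p))\<^sup>2)"
  have G_le: "G \<le> W\<^sup>2 * exp (2 * (\<Sum>p\<in>P. x p * c p) + 24 * (\<Sum>p\<in>P. 1 / real p ^ 2))"
  proof -
    have "G \<le> (\<Prod>p\<in>P. (1 - x p)\<^sup>2 * exp (2 * (x p * c p) + 24 * (1 / real p ^ 2)))"
      unfolding G_def by (rule prod_mono) (use factor in auto)
    also have "\<dots> = W\<^sup>2 * exp (\<Sum>p\<in>P. 2 * (x p * c p) + 24 * (1 / real p ^ 2))"
      by (simp add: prod.distrib exp_sum P W_def prod_power_distrib)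
    finally show ?thesis by (simp only: sum.distrib sum_distrib_left)
  qed
  have s1: "(\<Sum>p\<in>P. x p * c p) \<le> (\<Sum>p\<in>P. x p) / 4 + C"
    unfolding x_def c_def by (rule hyp) (use \<sigma> P in auto)
  have s2: "(\<Sum>p\<in>P. 1 / real p ^ 2) \<le> 2"
  proof -
    have "P \<subseteq> {1..y}" using prime_gt_0_nat by (auto simp: P_def Suc_le_eq)
    then have "(\<Sum>p\<in>P. 1 / real p ^ 2) \<le> (\<Sum>n=1..y. 1 / real n ^ 2)" by (intro sum_mono2) auto
    also have "\<dots> \<le> 2" by (rule sum_inverse_squares_le)
    finally show ?thesis .
  qed
  have s3: "exp (\<Sum>p\<in>P. x p) \<le> 1 / W"
  proof -
    have "exp (\<Sum>p\<in>P. x p) = (\<Prod>p\<in>P. exp (x p))" by (simp add: exp_sum P)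
    also have "\<dots> \<le> (\<Prod>p\<in>P. 1 / (1 - x p))"
    proof (rule prod_mono)
      fix p assume p: "p \<in> P"
      have "1 - x p \<le> exp (- x p)" using exp_ge_add_one_self[of "- x p"] by simp
      moreover have "1 - x p > 0" using x_half[OF P(2)[OF p]] by simp
      ultimately show "0 \<le> exp (x p) \<and> exp (x p) \<le> 1 / (1 - x p)" by (simp add: exp_minus field_simps)
    qed
    also have "\<dots> = 1 / W" by (simp add: W_def prod_dividef)
    finally show ?thesis .
  qed
  have G0: "G > 0" unfolding G_def
  proof (rule prod_pos)
    fix p assume "p \<in> P"
    then have "h p \<noteq> 1" using lt[of p] P by auto
    then show "0 < (norm (1 - h p))\<^sup>2" by simp
  qed
  have "G \<le> W\<^sup>2 * exp (2 * ((\<Sum>p\<in>P. x p) / 4 + C) + 24 * 2)"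
    using Pi0 s1 s2 by (intro order_trans[OF G_le] mult_left_mono) auto
  then have "G\<^sup>2 \<le> (W\<^sup>2 * exp (2 * ((\<Sum>p\<in>P. x p) / 4 + C) + 24 * 2))\<^sup>2" using G0 by (intro power_mono) auto
  also have "\<dots> = W ^ 4 * exp ((\<Sum>p\<in>P. x p)) * A"
    by (simp add: power_mult_distrib A_def exp_add[symmetric] exp_double[symmetric] algebra_simps)
  also have "\<dots> \<le> W ^ 4 * (1 / W) * A" using Pi0 A0 s3 by (intro mult_right_mono mult_left_mono) auto
  finally have G2: "G\<^sup>2 \<le> W ^ 3 * A" using Pi0 by (simp add: power4_eq_xxxx power3_eq_cube)
  \<comment> \<open>The decisive comparison: \<open>1 / G\<close> is the square of a finite Euler
    product that stays bounded, while \<open>G^2\<close> is at most of order \<open>W^3\<close>.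
    Hence \<open>W\<close> cannot be small.\<close>
  have "1 / G = (norm (\<Prod>p\<in>P. 1 / (1 - h p)))\<^sup>2"
    by (simp add: G_def prod_norm[symmetric] norm_divide prod_dividef prod_power_distrib[symmetric] power_divide)
  also have "\<dots> \<le> (C1 + 1)\<^sup>2" using ub by (intro power_mono) auto
  finally have "1 \<le> (C1 + 1)\<^sup>2 * G" using G0 by (simp add: divide_le_eq)
  then have "1\<^sup>2 \<le> ((C1 + 1)\<^sup>2 * G)\<^sup>2" by (rule power_mono) simp
  also have "\<dots> = (C1 + 1) ^ 4 * G\<^sup>2" by (simp add: power_mult_distrib)
  also have "\<dots> \<le> (C1 + 1) ^ 4 * (W ^ 3 * A)" by (intro mult_left_mono G2) simp
  finally have "1 / W ^ 3 \<le> A * (C1 + 1) ^ 4" using Pi0 by (simp add: divide_le_eq mult_ac)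
  moreover have "A * (C1 + 1) ^ 4 + 2 \<le> 1 / W" using lb by (simp add: H_def)
  moreover have "1 / W \<le> 1 / W ^ 3"
  proof -
    have "0 \<le> A * (C1 + 1) ^ 4" using A0 C10 by simp
    then have "1 \<le> 1 / W" using calculation(2) by linarith
    then have "(1 / W) ^ 1 \<le> (1 / W) ^ 3" by (intro power_increasing) auto
    then show ?thesis by (simp add: power_divide)
  qed
  ultimately show False by linarith
qed

section \<open>Divergence for functions with finitely many values at primes\<close>

lemma norm_cis_minus_one_le: "norm (cis x - 1) \<le> \<bar>x\<bar>"
proof -
  have "(norm (cis x - 1))\<^sup>2 = 2 - 2 * cos x"
    unfolding cmod_power2 using sin_cos_squared_add[of x] by (simp add: power2_eq_square algebra_simps)
  also have "\<dots> = 4 * (sin (x / 2))\<^sup>2" using cos_double_sin[of "x / 2"] by simp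
  also have "\<dots> \<le> 4 * (x / 2)\<^sup>2" using power_mono[OF abs_sin_x_le_abs_x[of "x / 2"], of 2] by (simp only: power2_abs abs_ge_zero) simp
  also have "\<dots> = \<bar>x\<bar>\<^sup>2" by (simp add: power_divide)
  finally show ?thesis by (rule power2_le_imp_le) simp
qed

text \<open>Dirichlet's simultaneous approximation, applied to the arguments. The 13 is the least
  integer \<open>k\<close> with \<open>2 * pi / k \<le> 1/2\<close>.\<close>

lemma simultaneous_power_near_one:
  fixes z :: "nat \<Rightarrow> complex"
  assumes "finite Q" "\<And>j. norm (z j) = 1"
  obtains m :: nat where "m \<ge> 1" "\<And>j. j \<in> Q \<Longrightarrow> norm (z j ^ m - 1) \<le> 1 / 2"
proof -
  obtain f where f: "bij_betw f {0..<card Q} Q" using ex_bij_betw_nat_finite assms(1) by blast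
  define \<theta> where "\<theta> i = Arg (z (f i)) / (2 * pi)" for i
  obtain q :: int and p where q: "0 < q" and qp: "\<And>i. i < card Q \<Longrightarrow> \<bar>of_int q * \<theta> i - of_int (p i)\<bar> < 1 / real 13"
    using Dirichlet_approx_simult[of 13 "card Q" \<theta>] by (metis zero_less_numeral)
  show ?thesis
  proof (rule that)
    show "nat q \<ge> 1" using q by simp
    fix j assume "j \<in> Q"
    then have "j \<in> f ` {0..<card Q}" using bij_betw_imp_surj_on[OF f] by simp
    then obtain i where i: "i < card Q" "j = f i" by auto
    have "z j = cis (Arg (z j))" using assms(2)[of j] by (subst cis_Arg) (auto simp: sgn_div_norm)
    from arg_cong[OF this, of "\<lambda>w. w ^ nat q"] have "z j ^ nat q = cis (real (nat q) * Arg (z j))" by (simp only: Complex.DeMoivre)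
    also have "real (nat q) * Arg (z j) = 2 * pi * (of_int q * \<theta> i - of_int (p i)) + 2 * pi * of_int (p i)"
      using q i by (simp add: \<theta>_def field_simps)
    also have "cis \<dots> = cis (2 * pi * (of_int q * \<theta> i - of_int (p i)))"
      unfolding cis_mult[symmetric] by (simp add: cis_multiple_2pi)
    finally have "norm (z j ^ nat q - 1) \<le> \<bar>2 * pi * (of_int q * \<theta> i - of_int (p i))\<bar>"
      using norm_cis_minus_one_le by simp
    also have "\<dots> = 2 * pi * \<bar>of_int q * \<theta> i - of_int (p i)\<bar>" by (simp add: abs_mult)
    also have "\<dots> \<le> 2 * pi * (1 / 13)" using qp[OF i(1)] by (intro mult_left_mono) auto
    also have "\<dots> \<le> 1 / 2" using pi_less_4 pi_approx by simp
    finally show "norm (z j ^ nat q - 1) \<le> 1 / 2" .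
  qed
qed

lemma pretentious_term_eq:
  fixes v c :: complex
  assumes "norm v = 1" "norm c = 1"
  shows "(norm (v - c))\<^sup>2 = 2 * (1 - Re (v * cnj c))"
proof -
  have "(norm (v - c))\<^sup>2 = (norm v)\<^sup>2 + (norm c)\<^sup>2 - 2 * Re (v * cnj c)"
    unfolding cmod_power2 by (simp add: power2_eq_square algebra_simps)
  then show ?thesis using assms by simp
qed

text \<open>If the sums stayed below \<open>K\<close>, the value \<open>z (col p)\<close> would be
  close to \<open>p^(i t)\<close> on average. Taking \<open>m\<close>-th powers with every
  \<open>z j ^ m\<close> within 1/2 of 1 brings \<open>p^(i m t)\<close> near 1 on average, against
  \<open>primes_not_concentrated\<close>.\<close>

lemma pretentious_divergence:
  fixes z :: "nat \<Rightarrow> complex" and col :: "nat \<Rightarrow> nat"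
  assumes z: "\<And>j. norm (z j) = 1" and fin: "finite (col ` {p. prime p})" and t: "t \<noteq> 0"
  shows "\<exists>y. (\<Sum>p | prime p \<and> p \<le> y. (1 - Re (z (col p) * cis (- t * ln (real p)))) / real p) \<ge> K"
proof (rule ccontr)
  define a where "a p = (1 - Re (z (col p) * cis (- t * ln (real p)))) / real p" for p
  assume "\<not> ?thesis"
  then have lt: "(\<Sum>p | prime p \<and> p \<le> y. a p) < K" for y by (auto simp: a_def not_le)
  have a0: "a p \<ge> 0" for p
    using complex_Re_le_cmod[of "z (col p) * cis (- t * ln (real p))"] z by (simp add: a_def norm_mult)
  obtain m where m: "m \<ge> 1" "\<And>j. j \<in> col ` {p. prime p} \<Longrightarrow> norm (z j ^ m - 1) \<le> 1 / 2"
    by (rule simultaneous_power_near_one[OF fin, of z]) (use z in auto)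
  have mt: "real m * t \<noteq> 0" using t m(1) by simp
  obtain \<sigma> B where B: "0 < \<sigma>" "\<sigma> \<le> 1" "finite B" "\<forall>p\<in>B. prime p"
    and gt: "(\<Sum>p\<in>B. real p powr (- (1 + \<sigma>)) * (1 - cos (real m * t * ln (real p)))) >
     (\<Sum>p\<in>B. real p powr (- (1 + \<sigma>))) / 4 + 2 * real m ^ 2 * K"
    using primes_not_concentrated[of "real m * t" "2 * real m ^ 2 * K"] mt by blast
  \<comment> \<open>The 1/4 has to match \<open>primes_not_concentrated\<close>: it is half of
    \<open>2 * (1/2)^2\<close>, where 1/2 is the distance of \<open>z j ^ m\<close> from 1. The
    remainder is a multiple of \<open>p * a p\<close>, whose weighted sum stays below a multiple of
    \<open>K\<close>.\<close>
  have cosb: "1 - cos (real m * t * ln (real p)) \<le> 1 / 4 + 2 * real m ^ 2 * (real p * a p)" if p: "prime p" for p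
  proof -
    define v c where "v = z (col p)" and "c = cis (t * ln (real p))"
    have vc: "norm v = 1" "norm c = 1" using z by (auto simp: v_def c_def)
    have p0: "real p > 0" using p by (simp add: prime_gt_0_nat)
    have "(norm (v - c))\<^sup>2 = 2 * (1 - Re (v * cnj c))" using vc by (rule pretentious_term_eq)
    also have "\<dots> = 2 * (real p * a p)" using p0 by (simp add: a_def v_def c_def cis_cnj)
    finally have d: "(norm (v - c))\<^sup>2 = 2 * (real p * a p)" .
    have cm: "c ^ m = cis (real m * t * ln (real p))" unfolding c_def Complex.DeMoivre by (simp only: mult.assoc)
    have "2 * (1 - cos (real m * t * ln (real p))) = (norm (1 - c ^ m))\<^sup>2"
      using pretentious_term_eq[of 1 "c ^ m"] vc by (simp add: cm)
    also have "\<dots> \<le> (1 / 2 + real m * norm (v - c))\<^sup>2"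
    proof (rule power_mono)
      have "norm (1 - c ^ m) \<le> norm (1 - v ^ m) + norm (v ^ m - c ^ m)"
        using norm_triangle_ineq[of "1 - v ^ m" "v ^ m - c ^ m"] by simp
      also have "norm (1 - v ^ m) \<le> 1 / 2" using m(2)[of "col p"] p by (simp add: v_def norm_minus_commute)
      also have "norm (v ^ m - c ^ m) \<le> real m * norm (v - c)" using vc by (intro norm_power_diff) auto
      finally show "norm (1 - c ^ m) \<le> 1 / 2 + real m * norm (v - c)" by simp
    qed simp
    also have "\<dots> \<le> 2 * (1 / 2)\<^sup>2 + 2 * (real m * norm (v - c))\<^sup>2"
      using zero_le_power2[of "1 / 2 - real m * norm (v - c)"] by (simp only: power2_sum power2_diff)
    also have "\<dots> = 1 / 2 + 2 * real m ^ 2 * (norm (v - c))\<^sup>2" by (simp add: power_mult_distrib power2_eq_square)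
    finally show ?thesis unfolding d by simp
  qed
  have "(\<Sum>p\<in>B. real p powr (- (1 + \<sigma>)) * (1 - cos (real m * t * ln (real p))))
     \<le> (\<Sum>p\<in>B. real p powr (- (1 + \<sigma>)) / 4 + 2 * real m ^ 2 * a p)"
  proof (rule sum_mono)
    fix p assume "p \<in> B"
    then have p: "prime p" using B by auto
    then have p1: "real p \<ge> 1" using prime_gt_0_nat by (simp add: Suc_le_eq)
    have "real p powr (- (1 + \<sigma>)) * (1 - cos (real m * t * ln (real p)))
       \<le> real p powr (- (1 + \<sigma>)) * (1 / 4 + 2 * real m ^ 2 * (real p * a p))"
      by (intro mult_left_mono cosb p) simp
    also have "\<dots> = real p powr (- (1 + \<sigma>)) / 4 + (real p powr (- (1 + \<sigma>)) * real p) * (2 * real m ^ 2 * a p)"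
      by (simp add: algebra_simps)
    also have "(real p powr (- (1 + \<sigma>)) * real p) * (2 * real m ^ 2 * a p) \<le> 1 * (2 * real m ^ 2 * a p)"
    proof (rule mult_right_mono)
      have "real p powr (- (1 + \<sigma>)) \<le> real p powr (-1)" using p1 B by (intro powr_mono) auto
      then show "real p powr (- (1 + \<sigma>)) * real p \<le> 1" using p1 by (simp add: powr_minus field_simps)
    qed (use a0 in auto)
    finally show "real p powr (- (1 + \<sigma>)) * (1 - cos (real m * t * ln (real p)))
       \<le> real p powr (- (1 + \<sigma>)) / 4 + 2 * real m ^ 2 * a p" by simp
  qed
  also have "\<dots> = (\<Sum>p\<in>B. real p powr (- (1 + \<sigma>))) / 4 + 2 * real m ^ 2 * (\<Sum>p\<in>B. a p)"
    by (simp add: sum.distrib sum_divide_distrib sum_distrib_left)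
  also have "(\<Sum>p\<in>B. a p) \<le> (\<Sum>p | prime p \<and> p \<le> Max (insert 0 B). a p)"
    by (rule sum_mono2) (use B a0 in auto)
  also have "\<dots> \<le> K" using lt by (simp add: less_imp_le)
  finally show False using gt by (simp add: mult_left_mono)
qed

text \<open>Tychonoff for the unit circle, intersected with a condition on one coordinate that is
  closed in the product topology.\<close>

lemma compact_unimodular_sequences:
  "compact {z :: nat \<Rightarrow> complex. (\<forall>j. norm (z j) = 1) \<and> norm (z q - 1) \<ge> \<delta>}"
proof -
  have "compactin (product_topology (\<lambda>i::nat. euclidean :: complex topology) UNIV) (PiE UNIV (\<lambda>_. sphere 0 1))"
    by (simp add: compactin_PiE)
  then have c: "compact (PiE UNIV (\<lambda>_::nat. sphere (0::complex) 1))"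
    by (simp add: euclidean_product_topology)
  have cl: "closed {z :: nat \<Rightarrow> complex. \<delta> \<le> norm (z q - 1)}"
    by (intro closed_Collect_le continuous_intros continuous_on_product_coordinates)
  have "PiE UNIV (\<lambda>_::nat. sphere (0::complex) 1) \<inter> {z. \<delta> \<le> norm (z q - 1)} =
     {z :: nat \<Rightarrow> complex. (\<forall>j. norm (z j) = 1) \<and> norm (z q - 1) \<ge> \<delta>}" by (auto simp: PiE_iff)
  then show ?thesis using compact_Int_closed[OF c cl] by simp
qed

text \<open>The sets where the sum up to \<open>y\<close> exceeds \<open>K\<close> are open,
  increase with \<open>y\<close> and cover a compact set, so one of them suffices. Away from
  \<open>t = 0\<close> the covering comes from \<open>pretentious_divergence\<close>, at
  \<open>t = 0\<close> from the colour \<open>q\<close>.\<close>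

lemma uniform_pretentious_divergence:
  fixes col :: "nat \<Rightarrow> nat" and \<delta> T K :: real
  assumes fin: "finite (col ` {p. prime p})"
    and div: "\<not> summable (\<lambda>p. if prime p \<and> col p = q then 1 / real p else 0)"
    and \<delta>: "\<delta> > 0"
  obtains y where "\<And>z t. (\<forall>j. norm (z j) = 1) \<Longrightarrow> norm (z q - 1) \<ge> \<delta> \<Longrightarrow> \<bar>t\<bar> \<le> T \<Longrightarrow>
     (\<Sum>p | prime p \<and> p \<le> y. (1 - Re (z (col p) * cis (- t * ln (real p)))) / real p) \<ge> K"
proof -
  define F where "F y w = (\<Sum>p | prime p \<and> p \<le> y. (1 - Re (fst w (col p) * cis (- snd w * ln (real p)))) / real p)"
    for y :: nat and w :: "(nat \<Rightarrow> complex) \<times> real"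
  define Z where "Z = {z :: nat \<Rightarrow> complex. (\<forall>j. norm (z j) = 1) \<and> norm (z q - 1) \<ge> \<delta>} \<times> {-T..T}"
  have Z: "compact Z" unfolding Z_def by (intro compact_Times compact_unimodular_sequences compact_Icc)
  have cont: "continuous_on UNIV (F y)" for y
  proof -
    have "continuous_on UNIV (\<lambda>w :: (nat \<Rightarrow> complex) \<times> real. fst w j)" for j
      using continuous_on_compose2[OF continuous_on_product_coordinates[of j] continuous_on_fst[OF continuous_on_id]] by auto
    then show ?thesis unfolding F_def by (intro continuous_intros) (auto simp: prime_gt_0_nat)
  qed
  have opn: "open {w. K < F y w}" for y by (intro open_Collect_less continuous_intros cont)
  have mono: "F y w \<le> F y' w" if "y \<le> y'" "w \<in> Z" for y y' w
    unfolding F_def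
  proof (rule sum_mono2)
    fix p
    have "norm (fst w (col p) * cis (- snd w * ln (real p))) = 1" using that by (auto simp: Z_def norm_mult)
    then show "0 \<le> (1 - Re (fst w (col p) * cis (- snd w * ln (real p)))) / real p"
      using complex_Re_le_cmod by (metis diff_ge_0_iff_ge divide_nonneg_nonneg of_nat_0_le_iff)
  qed (use that in auto)
  have "Z \<subseteq> (\<Union>y\<in>UNIV. {w. K < F y w})"
  proof
    fix w assume w: "w \<in> Z"
    obtain z t where wz: "w = (z, t)" by (cases w)
    have zz: "\<And>j. norm (z j) = 1" "norm (z q - 1) \<ge> \<delta>" using w by (auto simp: Z_def wz)
    \<comment> \<open>The extra 1 leaves room for the strict inequality that makes the covering sets
      open.\<close>
    have "\<exists>y. F y w \<ge> K + 1"
    proof (cases "t = 0")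
      case False
      then show ?thesis using pretentious_divergence[OF zz(1) fin False] by (simp add: F_def wz)
    next
      case True
      show ?thesis
      proof (rule ccontr)
        assume "\<not> ?thesis"
        then have lt: "F y w < K + 1" for y by (simp add: not_le)
        \<comment> \<open>At \<open>t = 0\<close> each prime of colour \<open>q\<close> contributes
          at least \<open>\<delta>^2 / (2 p)\<close>, so bounded sums would make the reciprocals of
          this colour summable.\<close>
        have bnd: "norm (\<Sum>p\<in>I. if prime p \<and> col p = q then 1 / real p else 0) \<le> (K + 1) * (2 / \<delta>\<^sup>2)" if "finite I" for I
        proof -
          have "norm (\<Sum>p\<in>I. if prime p \<and> col p = q then 1 / real p else 0) = (\<Sum>p\<in>I. if prime p \<and> col p = q then 1 / real p else 0)"
            by (simp add: sum_nonneg)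
          also have "\<dots> = (\<Sum>p\<in>{p\<in>I. prime p \<and> col p = q}. 1 / real p)"
            by (rule sum.inter_filter[symmetric, OF that])
          also have "\<dots> \<le> (\<Sum>p\<in>{p\<in>I. prime p \<and> col p = q}. (1 - Re (z (col p))) / real p * (2 / \<delta>\<^sup>2))"
          proof (rule sum_mono)
            fix p assume p: "p \<in> {p\<in>I. prime p \<and> col p = q}"
            have "2 * (1 - Re (z q)) = (norm (z q - 1))\<^sup>2" using pretentious_term_eq[of "z q" 1] zz by simp
            also have "\<dots> \<ge> \<delta>\<^sup>2" using zz \<delta> by (intro power_mono) auto
            finally have "1 \<le> (1 - Re (z q)) * (2 / \<delta>\<^sup>2)" using \<delta> by (simp add: field_simps)
            then have "1 / real p \<le> (1 - Re (z q)) * (2 / \<delta>\<^sup>2) / real p" by (rule divide_right_mono) simp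
            then show "1 / real p \<le> (1 - Re (z (col p))) / real p * (2 / \<delta>\<^sup>2)" using p by (simp add: mult.commute)
          qed
          also have "\<dots> = (\<Sum>p\<in>{p\<in>I. prime p \<and> col p = q}. (1 - Re (z (col p))) / real p) * (2 / \<delta>\<^sup>2)"
            by (simp only: sum_distrib_right)
          also have "\<dots> \<le> (\<Sum>p | prime p \<and> p \<le> Max (insert 0 I). (1 - Re (z (col p))) / real p) * (2 / \<delta>\<^sup>2)"
          proof (rule mult_right_mono[OF sum_mono2])
            fix p show "0 \<le> (1 - Re (z (col p))) / real p" using complex_Re_le_cmod[of "z (col p)"] zz by simp
          qed (use that in auto)
          also have "\<dots> = F (Max (insert 0 I)) w * (2 / \<delta>\<^sup>2)" by (simp add: F_def wz True)
          also have "\<dots> \<le> (K + 1) * (2 / \<delta>\<^sup>2)" using lt by (intro mult_right_mono) (auto simp: less_imp_le)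
          finally show ?thesis .
        qed
        have "summable (\<lambda>p. if prime p \<and> col p = q then 1 / real p else 0)"
        proof (rule summableI_nonneg_bounded)
          fix n
          show "(\<Sum>p<n. if prime p \<and> col p = q then 1 / real p else 0) \<le> (K + 1) * (2 / \<delta>\<^sup>2)"
            using bnd[of "{..<n}"] by (simp add: sum_nonneg)
        qed auto
        then show False using div by contradiction
      qed
    qed
    then obtain y where "F y w \<ge> K + 1" by blast
    then have "K < F y w" by linarith
    then show "w \<in> (\<Union>y\<in>UNIV. {w. K < F y w})" by blast
  qed
  then obtain D where D: "finite D" "Z \<subseteq> (\<Union>y\<in>D. {w. K < F y w})"
    by (rule compactE_image[OF Z opn])
  show ?thesis
  proof (rule that[of "Max (insert 0 D)"])
    fix z :: "nat \<Rightarrow> complex" and t :: real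
    assume zt: "\<forall>j. norm (z j) = 1" "norm (z q - 1) \<ge> \<delta>" "\<bar>t\<bar> \<le> T"
    then have w: "(z, t) \<in> Z" by (auto simp: Z_def)
    then obtain y where y: "y \<in> D" "K < F y (z, t)" using D by blast
    have "K \<le> F (Max (insert 0 D)) (z, t)" using y D by (intro order_trans[OF less_imp_le[OF y(2)] mono] w) auto
    then show "(\<Sum>p | prime p \<and> p \<le> Max (insert 0 D). (1 - Re (z (col p) * cis (- t * ln (real p)))) / real p) \<ge> K"
      by (simp add: F_def)
  qed
qed

text \<open>These are the characters of the free commutative monoid on the colours, pulled back to
  the integers. \<open>prime_factorization 0\<close> is empty, so the value at 0 is 1.\<close>

definition colour_char :: "(nat \<Rightarrow> nat) \<Rightarrow> (nat \<Rightarrow> complex) \<Rightarrow> nat \<Rightarrow> complex" where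
  "colour_char col z n = (\<Prod>p\<in>#prime_factorization n. z (col p))"

lemma colour_char_1 [simp]: "colour_char col z (Suc 0) = 1"
  by (simp add: colour_char_def)

lemma colour_char_mult: "m \<ge> 1 \<Longrightarrow> n \<ge> 1 \<Longrightarrow> colour_char col z (m * n) = colour_char col z m * colour_char col z n"
  by (simp add: colour_char_def prime_factorization_mult)

lemma cmult_colour_char: "cmult (colour_char col z)"
  by (simp add: cmult_def colour_char_mult)

lemma colour_char_prime: "prime p \<Longrightarrow> colour_char col z p = z (col p)"
  by (simp add: colour_char_def prime_factorization_prime)

lemma norm_colour_char:
  assumes "\<forall>j. norm (z j) = 1"
  shows "norm (colour_char col z n) = 1"
proof -
  have "norm (\<Prod>p\<in>#A. z (col p)) = 1" for A by (induction A) (use assms in \<open>auto simp: norm_mult\<close>)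
  then show ?thesis by (simp add: colour_char_def)
qed

text \<open>Everything is chosen before \<open>z\<close>: first \<open>y\<close> from the uniform
  divergence, then \<open>E\<close>, then the threshold for \<open>N\<close>. So
  \<open>log_mean_bound\<close> makes the logarithmic mean square small, and
  \<open>mean_small_if_log_mean_small\<close> returns to the mean.\<close>

theorem uniform_mean_value_zero:
  fixes col :: "nat \<Rightarrow> nat" and \<delta> e :: real
  assumes fin: "finite (col ` {p. prime p})"
    and div: "\<not> summable (\<lambda>p. if prime p \<and> col p = q then 1 / real p else 0)"
    and \<delta>: "\<delta> > 0" and e: "e > 0"
  obtains N0 where "\<And>N z. N \<ge> N0 \<Longrightarrow> (\<forall>j. norm (z j) = 1) \<Longrightarrow> norm (z q - 1) \<ge> \<delta> \<Longrightarrow>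
     norm (\<Sum>n=1..N. colour_char col z n) \<le> e * real N"
proof -
  obtain \<eta> N1 where \<eta>: "\<eta> > 0" and N1:
    "\<And>g N. cmult g \<Longrightarrow> (\<forall>n\<ge>1. norm (g n) = 1) \<Longrightarrow> N \<ge> N1 \<Longrightarrow>
       (\<Sum>m=1..2*N. (norm (\<Sum>n=1..m. g n))\<^sup>2 / real m ^ 3) \<le> \<eta> * (ln (real (2*N)) + 1) \<Longrightarrow>
       norm (\<Sum>n=1..N. g n) \<le> e * real N"
    using mean_small_if_log_mean_small[OF e] by blast
  \<comment> \<open>The first two choices make \<open>1 / (1 + 2 * K)\<close> and
    \<open>2 / T\<close> at most \<open>\<eta> / 540\<close>. The final bound is then \<open>36 *
    (\<eta> / 540 + \<eta> / 540) * 5 * L + 2 * (\<eta> / 6) * L\<close>, which equals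
    \<open>\<eta> * L\<close>.\<close>
  define K T \<kappa> where "K = 270 / \<eta>" and "T = max 1 (1080 / \<eta>)" and "\<kappa> = min 1 (\<eta> / 6)"
  have K: "K \<ge> 0" "1 / (1 + 2 * K) \<le> \<eta> / 540" using \<eta> by (auto simp: K_def field_simps)
  have T: "T \<ge> 1" "1080 / \<eta> \<le> T" by (auto simp: T_def)
  have T2: "2 / T \<le> \<eta> / 540" using T \<eta> by (simp add: field_simps)
  have \<kappa>: "0 < \<kappa>" "\<kappa> \<le> 1" "\<kappa> \<le> \<eta> / 6" using \<eta> by (auto simp: \<kappa>_def)
  obtain y where y: "\<And>z t. (\<forall>j. norm (z j) = 1) \<Longrightarrow> norm (z q - 1) \<ge> \<delta> \<Longrightarrow> \<bar>t\<bar> \<le> T \<Longrightarrow>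
     (\<Sum>p | prime p \<and> p \<le> y. (1 - Re (z (col p) * cis (- t * ln (real p)))) / real p) \<ge> K"
    using uniform_pretentious_divergence[OF fin div \<delta>] by blast
  define B where "B = {p. prime p \<and> p \<le> y}"
  have B: "finite B" "\<And>p. p \<in> B \<Longrightarrow> prime p" by (auto simp: B_def)
  obtain E where E: "(\<Sum>p\<in>B. 1 / real p ^ E) \<le> \<kappa>"
  proof -
    have "(\<lambda>E. \<Sum>p\<in>B. (1 / real p) ^ E) \<longlonglongrightarrow> (\<Sum>p\<in>B. 0)"
    proof (rule tendsto_sum)
      fix p assume "p \<in> B"
      then have "real p > 1" using B prime_gt_1_nat by auto
      then show "(\<lambda>E. (1 / real p) ^ E) \<longlonglongrightarrow> 0" by (intro LIMSEQ_realpow_zero) auto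
    qed
    then have "\<forall>\<^sub>F E in sequentially. (\<Sum>p\<in>B. (1 / real p) ^ E) < \<kappa>" using \<kappa> by (intro order_tendstoD) auto
    then obtain E where "(\<Sum>p\<in>B. (1 / real p) ^ E) < \<kappa>" by (auto simp: eventually_sequentially)
    then show ?thesis using that[of E] by (simp add: power_divide)
  qed
  define R where "R = (4 * (2 ^ card B)\<^sup>2 + 2) / (\<Prod>p\<in>B. 1 - 1 / real p)\<^sup>2"
  show ?thesis
  \<comment> \<open>Beyond \<open>exp R\<close> the part of the bound that does not grow is at most
    \<open>L\<close>, so that \<open>4 * L + R \<le> 5 * L\<close>.\<close>
  proof (rule that[of "max N1 (nat \<lceil>exp R\<rceil> + 1)"])
    fix N :: nat and z :: "nat \<Rightarrow> complex"
    assume N: "N \<ge> max N1 (nat \<lceil>exp R\<rceil> + 1)" and z: "\<forall>j. norm (z j) = 1" "norm (z q - 1) \<ge> \<delta>"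
    define L where "L = ln (real (2 * N)) + 1"
    have "exp R \<le> real N" using N by linarith
    also have "real N \<le> real (2 * N)" by simp
    finally have "R \<le> ln (real (2 * N))" using N by (subst ln_ge_iff) auto
    then have RL: "R \<le> L" by (simp add: L_def)
    have L0: "L \<ge> 0" using N by (simp add: L_def)
    have "(\<Sum>m=1..2*N. (norm (\<Sum>n=1..m. colour_char col z n))\<^sup>2 / real m ^ 3)
       \<le> 36 * (1 / (1 + 2 * K) + 2 / T) * (4 * L + R) + 2 * \<kappa>\<^sup>2 * L"
      unfolding L_def R_def
    proof (rule log_mean_bound[OF _ _ B E \<kappa>(2) T(1) K(1)])
      show "cmult (colour_char col z)" by (rule cmult_colour_char)
      show "\<forall>n\<ge>1. norm (colour_char col z n) = 1" using norm_colour_char z by auto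
      fix t assume "\<bar>t\<bar> \<le> T"
      then have "(\<Sum>p\<in>B. (1 - Re (z (col p) * cis (- t * ln (real p)))) / real p) \<ge> K"
        unfolding B_def using z by (intro y) auto
      also have "(\<Sum>p\<in>B. (1 - Re (z (col p) * cis (- t * ln (real p)))) / real p)
         = (\<Sum>p\<in>B. (1 - Re (colour_char col z p * cis (- t * ln (real p)))) / real p)"
        by (intro sum.cong refl) (use B in \<open>simp add: colour_char_prime\<close>)
      finally show "K \<le> (\<Sum>p\<in>B. (1 - Re (colour_char col z p * cis (- t * ln (real p)))) / real p)" .
    qed (use N in auto)
    also have "\<dots> \<le> 36 * (\<eta> / 540 + \<eta> / 540) * (4 * L + L) + 2 * (\<eta> / 6) * L"
    proof (intro add_mono mult_mono mult_left_mono K(2) T2 RL)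
      have "\<kappa>\<^sup>2 \<le> \<kappa> * 1" unfolding power2_eq_square using \<kappa> by (intro mult_left_mono) auto
      then show "\<kappa>\<^sup>2 \<le> \<eta> / 6" using \<kappa> by simp
      show "0 \<le> 4 * L + R" using L0 by (simp add: R_def)
    qed (use \<eta> L0 K(1) T(1) in auto)
    also have "\<dots> = \<eta> * L" by (simp add: field_simps)
    finally show "norm (\<Sum>n=1..N. colour_char col z n) \<le> e * real N"
      unfolding L_def by (intro N1) (use N cmult_colour_char norm_colour_char z in auto)
  qed
qed

section \<open>Transference from the torus\<close>

text \<open>Used for both orthogonality relations of a finite abelian group, with the roles of
  points and characters exchanged.\<close>

lemma parseval_orthogonal_system:
  fixes K :: "'l \<Rightarrow> 'b \<Rightarrow> complex" and c :: real
  assumes "finite A" "finite L"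
    and orth: "\<And>b b'. b \<in> A \<Longrightarrow> b' \<in> A \<Longrightarrow> (\<Sum>l\<in>L. K l b * cnj (K l b')) = (if b = b' then of_real c else 0)"
  shows "(\<Sum>l\<in>L. (norm (\<Sum>b\<in>A. \<phi> b * K l b))\<^sup>2) = c * (\<Sum>b\<in>A. (norm (\<phi> b))\<^sup>2)"
proof -
  have "complex_of_real (\<Sum>l\<in>L. (norm (\<Sum>b\<in>A. \<phi> b * K l b))\<^sup>2)
     = (\<Sum>l\<in>L. \<Sum>b\<in>A. \<Sum>b'\<in>A. (\<phi> b * cnj (\<phi> b')) * (K l b * cnj (K l b')))"
    unfolding of_real_sum complex_norm_square cnj_sum sum_product by (simp add: mult_ac)
  also have "\<dots> = (\<Sum>b\<in>A. \<Sum>l\<in>L. \<Sum>b'\<in>A. (\<phi> b * cnj (\<phi> b')) * (K l b * cnj (K l b')))" by (rule sum.swap)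
  also have "\<dots> = (\<Sum>b\<in>A. \<Sum>b'\<in>A. \<Sum>l\<in>L. (\<phi> b * cnj (\<phi> b')) * (K l b * cnj (K l b')))"
    by (intro sum.cong refl sum.swap)
  also have "\<dots> = (\<Sum>b\<in>A. \<Sum>b'\<in>A. (\<phi> b * cnj (\<phi> b')) * (if b = b' then of_real c else 0))"
    unfolding sum_distrib_left[symmetric] by (intro sum.cong refl) (simp add: orth)
  also have "\<dots> = (\<Sum>b\<in>A. (\<phi> b * cnj (\<phi> b)) * of_real c)"
    using assms(1) by (simp add: if_distrib[of "\<lambda>x. _ * x"] sum.delta cong: if_cong)
  also have "\<dots> = of_real (c * (\<Sum>b\<in>A. (norm (\<phi> b))\<^sup>2))"
    by (simp add: complex_norm_square[symmetric] sum_distrib_left mult.commute)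
  finally show ?thesis by (simp only: of_real_eq_iff)
qed

lemma root_of_unity_sum:
  fixes a b m :: nat
  assumes "a < m" "b < m"
  shows "(\<Sum>j<m. (cis (2 * pi * real a / real m) * cnj (cis (2 * pi * real b / real m))) ^ j) = (if a = b then of_nat m else 0)"
proof (cases "a = b")
  case True
  then show ?thesis by (simp add: complex_norm_square[symmetric])
next
  case False
  define w where "w = cis (2 * pi * real a / real m) * cnj (cis (2 * pi * real b / real m))"
  have m0: "real m > 0" using assms by simp
  have w: "w = cis (2 * pi * ((real a - real b) / real m))"
    unfolding w_def cis_cnj cis_mult by (intro arg_cong[of _ _ cis]) (simp add: algebra_simps diff_divide_distrib)
  have "w ^ m = cis (real m * (2 * pi * ((real a - real b) / real m)))" unfolding w by (rule Complex.DeMoivre)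
  also have "real m * (2 * pi * ((real a - real b) / real m)) = 2 * pi * of_int (int a - int b)" using m0 by simp
  finally have wm: "w ^ m = 1" by (simp only: cis_multiple_2pi Ints_of_int)
  have "w \<noteq> 1"
  proof
    assume "w = 1"
    then have "cos (2 * pi * ((real a - real b) / real m)) = 1" unfolding w by (simp add: complex_eq_iff)
    then obtain n :: int where "2 * pi * ((real a - real b) / real m) = of_int n * 2 * pi"
      using cos_one_2pi_int by blast
    then have "2 * pi * ((real a - real b) / real m) = 2 * pi * of_int n" by (simp only: mult.commute mult.left_commute)
    then have "(real a - real b) / real m = of_int n" using pi_gt_zero by (subst (asm) mult_cancel_left) auto
    then have "real a - real b = of_int n * real m" using m0 by (simp add: field_simps)
    then have "of_int (int a - int b) = (of_int (n * int m) :: real)" by simp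
    then have eq: "int a - int b = n * int m" by (simp only: of_int_eq_iff)
    have "\<bar>n * int m\<bar> < int m" using eq[symmetric] assms by linarith
    then have "\<bar>n\<bar> * int m < 1 * int m" by (simp add: abs_mult)
    then have "n = 0" using assms by (simp add: mult_less_cancel_right)
    then show False using eq False by simp
  qed
  then have "(\<Sum>j<m. w ^ j) = (w ^ m - 1) / (w - 1)" by (rule geometric_sum)
  then show ?thesis using wm False by (simp add: w_def)
qed

text \<open>When \<open>col\<close> sends each prime to a chosen prime of its colour, the result
  acts like \<open>n\<close> but has its prime factors in a finite set, so it lives in a box of
  exponents.\<close>

definition recolour :: "(nat \<Rightarrow> nat) \<Rightarrow> nat \<Rightarrow> nat" where
  "recolour col n = (\<Prod>p\<in>#prime_factorization n. col p)"

lemma colour_char_eq_prod: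
  assumes "n \<in> smooth_set Q E" "finite Q" "\<And>p. p \<in> Q \<Longrightarrow> prime p"
  shows "colour_char (\<lambda>p. p) z n = (\<Prod>q\<in>Q. z q ^ multiplicity q n)"
proof -
  have n0: "n \<noteq> 0" using assms by (auto simp: smooth_set_def)
  have "colour_char (\<lambda>p. p) z n = (\<Prod>p\<in>prime_factors n. z p ^ count (prime_factorization n) p)"
    by (simp add: colour_char_def image_prod_mset_multiplicity)
  also have "\<dots> = (\<Prod>p\<in>prime_factors n. z p ^ multiplicity p n)"
    by (intro prod.cong refl) (auto simp: count_prime_factorization_prime in_prime_factors_iff)
  also have "\<dots> = (\<Prod>q\<in>Q. z q ^ multiplicity q n)"
    using assms n0 by (intro prod.mono_neutral_left) (auto simp: smooth_set_def in_prime_factors_iff not_dvd_imp_multiplicity_0)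
  finally show ?thesis .
qed

lemma recolour_pos:
  assumes "\<And>p. prime p \<Longrightarrow> prime (col p)"
  shows "recolour col n \<ge> 1"
proof -
  have "(\<Prod>p\<in>#A. col p) \<ge> 1" if "\<And>p. p \<in># A \<Longrightarrow> prime p" for A
    using that assms prime_gt_0_nat by (induction A) (auto simp: Suc_le_eq)
  from this[of "prime_factorization n"] show ?thesis unfolding recolour_def by (simp add: in_prime_factors_iff)
qed

lemma prime_factorization_recolour:
  assumes "\<And>p. prime p \<Longrightarrow> prime (col p)"
  shows "prime_factorization (recolour col n) = image_mset col (prime_factorization n)"
  unfolding recolour_def
  by (rule prime_factorization_prod_mset_primes) (use assms in \<open>auto simp: in_prime_factors_iff\<close>)

lemma colour_char_recolour:
  assumes "\<And>p. prime p \<Longrightarrow> prime (col p)"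
  shows "colour_char (\<lambda>p. p) z (recolour col n) = colour_char col z n"
  by (simp add: colour_char_def prime_factorization_recolour[OF assms] multiset.map_comp o_def)

lemma smooth_set_mult:
  assumes "r \<in> smooth_set Q R" "\<And>p. prime p \<Longrightarrow> p dvd n \<Longrightarrow> p \<in> Q" "n \<ge> 1" "\<And>q. q \<in> Q \<Longrightarrow> multiplicity q n \<le> D"
    "\<And>p. p \<in> Q \<Longrightarrow> prime p"
  shows "r * n \<in> smooth_set Q (R + D)"
proof -
  have r: "r \<ge> 1" "\<And>p. prime p \<Longrightarrow> p dvd r \<Longrightarrow> p \<in> Q" "\<And>q. q \<in> Q \<Longrightarrow> multiplicity q r < R"
    using assms(1) by (auto simp: smooth_set_def)
  have "multiplicity q (r * n) < R + D" if q: "q \<in> Q" for q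
  proof -
    have "prime_elem q" "r \<noteq> 0" "n \<noteq> 0" using assms(3,5) q r by auto
    then have "multiplicity q (r * n) = multiplicity q r + multiplicity q n"
      by (rule prime_elem_multiplicity_mult_distrib)
    then show ?thesis using assms(4)[OF q] r(3)[OF q] by linarith
  qed
  moreover have "p \<in> Q" if p: "prime p" "p dvd r * n" for p
  proof -
    have "p dvd r \<or> p dvd n" using p by (simp add: prime_dvd_mult_iff)
    then show ?thesis using r(2) assms(2) p by blast
  qed
  moreover have "r * n \<ge> 1" using assms(3) r by simp
  ultimately show ?thesis by (simp add: smooth_set_def)
qed

text \<open>Multiplication by \<open>recolour col (\<nu> n)\<close> translates exponent vectors. On
  the finite group of exponents modulo \<open>m\<close> the operator becomes multiplication by its
  symbol \<open>C l\<close>, which is one of the character sums bounded by \<open>s\<close>.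
  Parseval is used once in each direction.\<close>

lemma scalar_transference:
  fixes Q :: "nat set" and c :: "'i \<Rightarrow> complex" and \<nu> :: "'i \<Rightarrow> nat"
  assumes Q: "finite Q" "\<And>q. q \<in> Q \<Longrightarrow> prime q" and col: "\<And>p. prime p \<Longrightarrow> col p \<in> Q"
    and I: "finite I" and R: "R \<ge> 1"
    and D: "\<And>n q. n \<in> I \<Longrightarrow> q \<in> Q \<Longrightarrow> multiplicity q (recolour col (\<nu> n)) \<le> D"
    and s: "\<And>z. (\<forall>j. norm (z j) = 1) \<Longrightarrow> norm (\<Sum>n\<in>I. c n * colour_char col z (\<nu> n)) \<le> s"
  shows "(\<Sum>r\<in>smooth_set Q R. (norm (\<Sum>n\<in>I. c n * \<phi> (r * recolour col (\<nu> n))))\<^sup>2)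
    \<le> s\<^sup>2 * (\<Sum>b\<in>smooth_set Q (R + D). (norm (\<phi> b))\<^sup>2)"
proof -
  \<comment> \<open>Larger than every exponent of \<open>r * recolour col (\<nu> n)\<close> with
    \<open>r\<close> in the small box, so that the translation does not wrap around.\<close>
  define m where "m = R + D"
  define G where "G = smooth_set Q m"
  define L where "L = PiE Q (\<lambda>_. {..<m})"
  define ch where "ch l n = colour_char (\<lambda>p. p) (\<lambda>j. cis (2 * pi * real (l j) / real m)) n" for l :: "nat \<Rightarrow> nat" and n
  define A where "A = real m ^ card Q"
  have m0: "m > 0" using R by (simp add: m_def)
  have A0: "A > 0" using m0 by (simp add: A_def)
  have finG: "finite G" unfolding G_def using Q by (rule finite_smooth_set)
  have finL: "finite L" unfolding L_def using Q by (intro finite_PiE) auto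
  have pcol: "prime (col p)" if "prime p" for p using col[OF that] Q by blast
  have chi_prod: "ch l n = (\<Prod>q\<in>Q. cis (2 * pi * real (l q) / real m) ^ multiplicity q n)" if "n \<in> G" for l n
    unfolding ch_def using that Q unfolding G_def by (intro colour_char_eq_prod) auto
  have Gpos: "b > 0" if "b \<in> G" for b using that by (simp add: G_def smooth_set_def)
  have orth1: "(\<Sum>l\<in>L. cnj (ch l b) * cnj (cnj (ch l b'))) = (if b = b' then of_real A else 0)" if b: "b \<in> G" "b' \<in> G" for b b'
  proof -
    have "(\<Sum>l\<in>L. cnj (ch l b) * cnj (cnj (ch l b'))) =
       (\<Sum>l\<in>L. \<Prod>q\<in>Q. (cis (2 * pi * real (multiplicity q b') / real m) * cnj (cis (2 * pi * real (multiplicity q b) / real m))) ^ l q)"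
    proof (rule sum.cong[OF refl])
      fix l :: "nat \<Rightarrow> nat"
      have sw: "cis (2 * pi * real (l q) / real m) ^ k = cis (2 * pi * real k / real m) ^ l q" for q k
        unfolding Complex.DeMoivre by (simp add: mult_ac)
      show "cnj (ch l b) * cnj (cnj (ch l b')) = (\<Prod>q\<in>Q. (cis (2 * pi * real (multiplicity q b') / real m) * cnj (cis (2 * pi * real (multiplicity q b) / real m))) ^ l q)"
        unfolding chi_prod[OF b(1)] chi_prod[OF b(2)] sw by (simp add: prod.distrib power_mult_distrib mult.commute)
    qed
    also have "\<dots> = (\<Prod>q\<in>Q. \<Sum>j<m. (cis (2 * pi * real (multiplicity q b') / real m) * cnj (cis (2 * pi * real (multiplicity q b) / real m))) ^ j)"
      unfolding L_def by (rule prod_sum_PiE[symmetric]) (use Q in auto)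
    also have "\<dots> = (\<Prod>q\<in>Q. if multiplicity q b' = multiplicity q b then of_nat m else 0)"
      by (intro prod.cong refl root_of_unity_sum) (use b in \<open>auto simp: G_def smooth_set_def\<close>)
    also have "\<dots> = (if b = b' then of_real A else 0)"
    proof (cases "b = b'")
      case True
      then show ?thesis by (simp add: A_def)
    next
      case False
      have "\<exists>q\<in>Q. multiplicity q b' \<noteq> multiplicity q b"
      proof (rule ccontr)
        assume "\<not> ?thesis"
        then have e: "multiplicity q b' = multiplicity q b" if "q \<in> Q" for q using that by blast
        have "multiplicity q b = multiplicity q b'" if "prime q" for q
        proof (cases "q \<in> Q")
          case False
          then have "\<not> q dvd b" "\<not> q dvd b'" using b that by (auto simp: G_def smooth_set_def)
          then show ?thesis by (simp add: not_dvd_imp_multiplicity_0)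
        qed (use e in auto)
        then have "b = b'" by (rule multiplicity_eq_nat[OF Gpos[OF b(1)] Gpos[OF b(2)]])
        then show False using False by simp
      qed
      then have "(\<Prod>q\<in>Q. if multiplicity q b' = multiplicity q b then of_nat m else 0 :: complex) = 0" using Q by auto
      then show ?thesis using False by simp
    qed
    finally show ?thesis .
  qed
  have orth2: "(\<Sum>b\<in>G. ch l b * cnj (ch l' b)) = (if l = l' then of_real A else 0)" if l: "l \<in> L" "l' \<in> L" for l l'
  proof -
    have "(\<Sum>b\<in>G. ch l b * cnj (ch l' b)) = (\<Prod>q\<in>Q. \<Sum>e<m. (ch l q * cnj (ch l' q)) ^ e)"
      unfolding G_def using Q by (intro euler_product_smooth) (auto simp: ch_def colour_char_mult)
    also have "\<dots> = (\<Prod>q\<in>Q. \<Sum>e<m. (cis (2 * pi * real (l q) / real m) * cnj (cis (2 * pi * real (l' q) / real m))) ^ e)"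
      by (intro prod.cong refl) (use Q in \<open>auto simp: ch_def colour_char_prime\<close>)
    also have "\<dots> = (\<Prod>q\<in>Q. if l q = l' q then of_nat m else 0)"
      by (intro prod.cong refl root_of_unity_sum) (use l in \<open>auto simp: L_def PiE_iff\<close>)
    also have "\<dots> = (if l = l' then of_real A else 0)"
    proof (cases "l = l'")
      case True
      then show ?thesis by (simp add: A_def)
    next
      case False
      then have "\<exists>q\<in>Q. l q \<noteq> l' q" using l unfolding L_def by (meson PiE_ext)
      then have "(\<Prod>q\<in>Q. if l q = l' q then of_nat m else 0 :: complex) = 0" using Q by auto
      then show ?thesis using False by simp
    qed
    finally show ?thesis .
  qed
  define ph where "ph l = (\<Sum>b\<in>G. \<phi> b * cnj (ch l b))" for l
  define C where "C l = (\<Sum>n\<in>I. c n * ch l (recolour col (\<nu> n)))" for l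
  have cr: "colour_char (\<lambda>p. p) z (recolour col n) = colour_char col z n" for z n
    by (rule colour_char_recolour) (rule pcol)
  have rc1: "recolour col n \<ge> 1" for n by (rule recolour_pos) (rule pcol)
  have rcf: "prime_factorization (recolour col n) = image_mset col (prime_factorization n)" for n
    by (rule prime_factorization_recolour) (rule pcol)
  have C_le: "norm (C l) \<le> s" for l
    unfolding C_def ch_def cr by (rule s) auto
  \<comment> \<open>Fourier inversion: on the small box, the transform of \<phi> times the symbol
    gives back the operator. Points of the large box outside it merely add nonnegative terms
    below.\<close>
  have conv: "(\<Sum>l\<in>L. C l * ph l * ch l r) = of_real A * (\<Sum>n\<in>I. c n * \<phi> (r * recolour col (\<nu> n)))" if r: "r \<in> smooth_set Q R" for r
  proof -
    have r1: "r \<ge> 1" using r by (auto simp: smooth_set_def)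
    have chm: "ch l (r * recolour col (\<nu> n)) = ch l r * ch l (recolour col (\<nu> n))" for l n
      unfolding ch_def by (rule colour_char_mult[OF r1 rc1])
    have "(\<Sum>l\<in>L. C l * ph l * ch l r) = (\<Sum>l\<in>L. \<Sum>n\<in>I. \<Sum>b\<in>G. c n * \<phi> b * (cnj (ch l b) * cnj (cnj (ch l (r * recolour col (\<nu> n))))))"
      unfolding C_def ph_def sum_product unfolding sum_distrib_right
      by (intro sum.cong refl) (simp add: chm mult_ac)
    also have "\<dots> = (\<Sum>n\<in>I. \<Sum>l\<in>L. \<Sum>b\<in>G. c n * \<phi> b * (cnj (ch l b) * cnj (cnj (ch l (r * recolour col (\<nu> n))))))"
      by (rule sum.swap)
    also have "\<dots> = (\<Sum>n\<in>I. \<Sum>b\<in>G. \<Sum>l\<in>L. c n * \<phi> b * (cnj (ch l b) * cnj (cnj (ch l (r * recolour col (\<nu> n))))))"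
      by (intro sum.cong refl sum.swap)
    also have "\<dots> = (\<Sum>n\<in>I. \<Sum>b\<in>G. c n * \<phi> b * (if b = r * recolour col (\<nu> n) then of_real A else 0))"
    proof (intro sum.cong refl)
      fix n b assume n: "n \<in> I" and b: "b \<in> G"
      have "p \<in> Q" if p: "prime p" "p dvd recolour col (\<nu> n)" for p
      proof -
        have "p \<in># prime_factorization (recolour col (\<nu> n))"
          using p rc1[of "\<nu> n"] by (simp add: in_prime_factors_iff)
        then show ?thesis using col unfolding rcf by (auto simp: in_prime_factors_iff)
      qed
      then have "r * recolour col (\<nu> n) \<in> G" unfolding G_def m_def
        by (intro smooth_set_mult[OF r _ rc1] D[OF n] Q)
      then show "(\<Sum>l\<in>L. c n * \<phi> b * (cnj (ch l b) * cnj (cnj (ch l (r * recolour col (\<nu> n)))))) = c n * \<phi> b * (if b = r * recolour col (\<nu> n) then of_real A else 0)"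
        unfolding sum_distrib_left[symmetric] using orth1[OF b] by simp
    qed
    also have "\<dots> = (\<Sum>n\<in>I. c n * \<phi> (r * recolour col (\<nu> n)) * of_real A)"
    proof (intro sum.cong refl)
      fix n assume n: "n \<in> I"
      have "p \<in> Q" if p: "prime p" "p dvd recolour col (\<nu> n)" for p
      proof -
        have "p \<in># prime_factorization (recolour col (\<nu> n))"
          using p rc1[of "\<nu> n"] by (simp add: in_prime_factors_iff)
        then show ?thesis using col unfolding rcf by (auto simp: in_prime_factors_iff)
      qed
      then have "r * recolour col (\<nu> n) \<in> G" unfolding G_def m_def
        by (intro smooth_set_mult[OF r _ rc1] D[OF n] Q)
      then show "(\<Sum>b\<in>G. c n * \<phi> b * (if b = r * recolour col (\<nu> n) then of_real A else 0)) = c n * \<phi> (r * recolour col (\<nu> n)) * of_real A"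
        using finG by (simp add: if_distrib[of "\<lambda>x. _ * x"] sum.delta cong: if_cong)
    qed
    finally show ?thesis by (simp add: sum_distrib_left mult_ac)
  qed
  have sub: "smooth_set Q R \<subseteq> G"
    unfolding G_def smooth_set_def m_def by (intro Collect_mono) (meson trans_less_add1)
  have "A\<^sup>2 * (\<Sum>r\<in>smooth_set Q R. (norm (\<Sum>n\<in>I. c n * \<phi> (r * recolour col (\<nu> n))))\<^sup>2)
     = (\<Sum>r\<in>smooth_set Q R. (norm (\<Sum>l\<in>L. C l * ph l * ch l r))\<^sup>2)"
    unfolding sum_distrib_left using A0 by (intro sum.cong refl) (simp add: conv norm_mult power_mult_distrib)
  also have "\<dots> \<le> (\<Sum>r\<in>G. (norm (\<Sum>l\<in>L. C l * ph l * ch l r))\<^sup>2)"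
    by (rule sum_mono2[OF finG sub]) simp
  also have "\<dots> = A * (\<Sum>l\<in>L. (norm (C l * ph l))\<^sup>2)"
    by (rule parseval_orthogonal_system[OF finL finG orth2])
  also have "\<dots> \<le> A * (\<Sum>l\<in>L. s\<^sup>2 * (norm (ph l))\<^sup>2)"
    using A0 C_le by (intro mult_left_mono sum_mono) (auto simp: norm_mult power_mult_distrib intro!: mult_right_mono power_mono)
  also have "\<dots> = A * s\<^sup>2 * (\<Sum>l\<in>L. (norm (ph l))\<^sup>2)" by (simp add: sum_distrib_left mult.assoc)
  also have "(\<Sum>l\<in>L. (norm (ph l))\<^sup>2) = A * (\<Sum>b\<in>G. (norm (\<phi> b))\<^sup>2)"
    unfolding ph_def by (rule parseval_orthogonal_system[OF finG finL orth1])
  finally have "A\<^sup>2 * (\<Sum>r\<in>smooth_set Q R. (norm (\<Sum>n\<in>I. c n * \<phi> (r * recolour col (\<nu> n))))\<^sup>2)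
     \<le> A\<^sup>2 * (s\<^sup>2 * (\<Sum>b\<in>G. (norm (\<phi> b))\<^sup>2))" by (simp add: power2_eq_square mult_ac)
  moreover have "A\<^sup>2 > 0" using A0 by simp
  ultimately show ?thesis unfolding G_def m_def by (simp only: mult_le_cancel_left_pos)
qed

lemma card_smooth_set:
  assumes "finite B" "\<And>p. p \<in> B \<Longrightarrow> prime p"
  shows "card (smooth_set B E) = E ^ card B"
  using euler_product_smooth[OF assms, of "\<lambda>_. 1 :: nat" E] by simp

section \<open>The space \<open>L\<^sup>2\<close>\<close>

lemma L2_measurable: "F \<in> L2 M \<Longrightarrow> F \<in> borel_measurable M"
  by (simp add: L2_def)

lemma L2_integrable_sq: "F \<in> L2 M \<Longrightarrow> integrable M (\<lambda>x. (norm (F x))\<^sup>2)"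
  by (simp add: L2_def)

lemma norm_add_sq_le: "(norm (a + b))\<^sup>2 \<le> 2 * (norm a)\<^sup>2 + 2 * (norm (b::'b::real_normed_vector))\<^sup>2"
proof -
  have "(norm (a + b))\<^sup>2 \<le> (norm a + norm b)\<^sup>2" by (rule power_mono[OF norm_triangle_ineq]) simp
  also have "\<dots> \<le> 2 * (norm a)\<^sup>2 + 2 * (norm b)\<^sup>2"
    using zero_le_power2[of "norm a - norm b"] by (simp add: power2_sum power2_diff)
  finally show ?thesis .
qed

lemma L2_add:
  assumes "F \<in> L2 M" "G \<in> L2 M"
  shows "(\<lambda>x. F x + G x) \<in> L2 M"
proof -
  have [measurable]: "F \<in> borel_measurable M" "G \<in> borel_measurable M" using assms by (auto intro: L2_measurable)
  have "integrable M (\<lambda>x. 2 * (norm (F x))\<^sup>2 + 2 * (norm (G x))\<^sup>2)"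
    using assms by (intro Bochner_Integration.integrable_add integrable_mult_right L2_integrable_sq)
  then have "integrable M (\<lambda>x. (norm (F x + G x))\<^sup>2)"
    by (rule Bochner_Integration.integrable_bound) (auto intro!: AE_I2 order_trans[OF norm_add_sq_le])
  then show ?thesis by (simp add: L2_def)
qed

lemma L2_cmult: "F \<in> L2 M \<Longrightarrow> (\<lambda>x. c * F x) \<in> L2 M"
  by (auto simp: L2_def norm_mult power_mult_distrib)

lemma L2_zero [simp]: "(\<lambda>x. 0) \<in> L2 M"
  by (simp add: L2_def)

lemma L2_diff:
  assumes "F \<in> L2 M" "G \<in> L2 M"
  shows "(\<lambda>x. F x - G x) \<in> L2 M"
  using L2_add[OF assms(1) L2_cmult[OF assms(2), of "-1"]] by simp

lemma L2_sum: "(\<And>i. i \<in> I \<Longrightarrow> F i \<in> L2 M) \<Longrightarrow> (\<lambda>x. \<Sum>i\<in>I. F i x) \<in> L2 M"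
  by (induction I rule: infinite_finite_induct) (auto intro: L2_add)

lemma (in finite_measure) L2_const [simp]: "(\<lambda>x. c) \<in> L2 M"
  by (simp add: L2_def)

lemma L2_norm_nonneg [simp]: "0 \<le> L2_norm M F"
  by (simp add: L2_norm_def)

lemma L2_norm_sq: "(L2_norm M F)\<^sup>2 = (\<integral>x. (norm (F x))\<^sup>2 \<partial>M)"
  by (simp add: L2_norm_def)

lemma L2_norm_cmult: "L2_norm M (\<lambda>x. c * F x) = norm c * L2_norm M F"
  by (simp add: L2_norm_def norm_mult power_mult_distrib real_sqrt_mult)

lemma L2_norm_minus_commute: "L2_norm M (\<lambda>x. F x - G x) = L2_norm M (\<lambda>x. G x - F x)"
  by (simp add: L2_norm_def norm_minus_commute)

lemma L2_norm_zero [simp]: "L2_norm M (\<lambda>x. 0) = 0"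
  by (simp add: L2_norm_def)

lemma L2_norm_cong_AE:
  assumes "F \<in> borel_measurable M" "G \<in> borel_measurable M" "AE x in M. F x = G x"
  shows "L2_norm M F = L2_norm M G"
  unfolding L2_norm_def
  by (rule arg_cong[of _ _ sqrt], rule integral_cong_AE) (use assms in auto)

lemma L2_norm_eq_0_iff:
  assumes "F \<in> L2 M"
  shows "L2_norm M F = 0 \<longleftrightarrow> (AE x in M. F x = 0)"
proof -
  have "L2_norm M F = 0 \<longleftrightarrow> (\<integral>x. (norm (F x))\<^sup>2 \<partial>M) = 0" by (simp add: L2_norm_def)
  also have "\<dots> \<longleftrightarrow> (AE x in M. (norm (F x))\<^sup>2 = 0)"
    by (rule integral_nonneg_eq_0_iff_AE) (use assms in \<open>auto simp: L2_def\<close>)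
  finally show ?thesis by simp
qed

lemma L2_product_integrable:
  assumes "F \<in> L2 M" "G \<in> L2 M"
  shows "integrable M (\<lambda>x. F x * cnj (G x))" "integrable M (\<lambda>x. norm (F x) * norm (G x))"
proof -
  have [measurable]: "F \<in> borel_measurable M" "G \<in> borel_measurable M" using assms by (auto intro: L2_measurable)
  have le: "norm a * norm b \<le> (norm a)\<^sup>2 + (norm b)\<^sup>2" for a b :: complex
  proof -
    have "2 * (norm a * norm b) \<le> (norm a)\<^sup>2 + (norm b)\<^sup>2"
      using zero_le_power2[of "norm a - norm b"] by (simp add: power2_diff)
    moreover have "0 \<le> norm a * norm b" by simp
    ultimately show ?thesis by linarith
  qed
  have s: "integrable M (\<lambda>x. (norm (F x))\<^sup>2 + (norm (G x))\<^sup>2)"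
    using assms by (intro Bochner_Integration.integrable_add L2_integrable_sq)
  show "integrable M (\<lambda>x. norm (F x) * norm (G x))"
    by (rule Bochner_Integration.integrable_bound[OF s]) (auto intro!: AE_I2 simp: le)
  show "integrable M (\<lambda>x. F x * cnj (G x))"
  proof (rule Bochner_Integration.integrable_bound[OF s])
    show "(\<lambda>x. F x * cnj (G x)) \<in> borel_measurable M"
      by (intro borel_measurable_times borel_measurable_continuous_on[of cnj] continuous_intros) auto
  qed (auto intro!: AE_I2 simp: norm_mult le)
qed

lemma Cauchy_Schwarz_L2:
  assumes "F \<in> L2 M" "G \<in> L2 M"
  shows "(\<integral>x. norm (F x) * norm (G x) \<partial>M) \<le> L2_norm M F * L2_norm M G"
proof -
  define I where "I = (\<integral>x. norm (F x) * norm (G x) \<partial>M)"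
  define A where "A = L2_norm M F"
  define B where "B = L2_norm M G"
  have key: "2 * I \<le> a * A\<^sup>2 + B\<^sup>2 / a" if a: "a > 0" for a
  proof -
    have "2 * I = (\<integral>x. 2 * (norm (F x) * norm (G x)) \<partial>M)" by (simp add: I_def)
    also have "\<dots> \<le> (\<integral>x. a * (norm (F x))\<^sup>2 + (norm (G x))\<^sup>2 / a \<partial>M)"
    proof (rule integral_mono)
      show "integrable M (\<lambda>x. 2 * (norm (F x) * norm (G x)))" using L2_product_integrable[OF assms] by simp
      show "integrable M (\<lambda>x. a * (norm (F x))\<^sup>2 + (norm (G x))\<^sup>2 / a)"
        using assms by (intro Bochner_Integration.integrable_add integrable_mult_right integrable_divide L2_integrable_sq)
      fix x
      have "0 \<le> (a * norm (F x) - norm (G x))\<^sup>2 / a" using a by simp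
      also have "\<dots> = a * (norm (F x))\<^sup>2 + (norm (G x))\<^sup>2 / a - 2 * (norm (F x) * norm (G x))"
        using a by (simp add: power2_eq_square field_simps)
      finally show "2 * (norm (F x) * norm (G x)) \<le> a * (norm (F x))\<^sup>2 + (norm (G x))\<^sup>2 / a" by simp
    qed
    also have "\<dots> = a * A\<^sup>2 + B\<^sup>2 / a"
      using assms unfolding A_def B_def L2_norm_sq
      by (subst Bochner_Integration.integral_add) (auto intro: L2_integrable_sq)
    finally show ?thesis .
  qed
  have A0: "A \<ge> 0" "B \<ge> 0" by (auto simp: A_def B_def)
  have "I \<le> A * B"
  proof (rule field_le_epsilon)
    fix e :: real assume e: "e > 0"
    \<comment> \<open>The optimal weight in \<open>key\<close> is \<open>B / A\<close>. Adding
      \<open>d\<close> to both norms avoids division by 0, and this \<open>d\<close> keeps the loss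
      \<open>d * (A + B) / 2\<close> below \<open>e\<close>.\<close>
    define d where "d = e / (A + B + 1)"
    have d: "d > 0" using e A0 by (simp add: d_def)
    define a where "a = (B + d) / (A + d)"
    have a: "a > 0" using A0 d by (simp add: a_def)
    have "a * A\<^sup>2 \<le> a * (A * (A + d))" using a A0 d by (intro mult_left_mono) (auto simp: power2_eq_square mult_left_mono)
    also have "\<dots> = A * (B + d)" using A0 d by (simp add: a_def)
    finally have 1: "a * A\<^sup>2 \<le> A * (B + d)" .
    have "B\<^sup>2 / a \<le> (B * (B + d)) / a" using a A0 d by (intro divide_right_mono) (auto simp: power2_eq_square mult_left_mono)
    also have "\<dots> = B * (A + d)" using A0 d by (simp add: a_def)
    finally have "2 * I \<le> A * (B + d) + B * (A + d)" using key[OF a] 1 by linarith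
    then have "I \<le> A * B + d * (A + B) / 2" by (simp add: field_simps)
    also have "d * (A + B) / 2 \<le> e"
    proof -
      have "d * (A + B) \<le> d * (A + B + 1)" using d by (intro mult_left_mono) auto
      also have "\<dots> = e" using A0 by (simp add: d_def)
      finally show ?thesis using e by simp
    qed
    finally show "I \<le> A * B + e" by simp
  qed
  then show ?thesis by (simp add: I_def A_def B_def)
qed

lemma L2_inner_le:
  assumes "F \<in> L2 M" "G \<in> L2 M"
  shows "norm (L2_inner M F G) \<le> L2_norm M F * L2_norm M G"
proof -
  have "norm (L2_inner M F G) \<le> (\<integral>x. norm (F x * cnj (G x)) \<partial>M)" unfolding L2_inner_def by (rule integral_norm_bound)
  also have "\<dots> = (\<integral>x. norm (F x) * norm (G x) \<partial>M)" by (simp add: norm_mult)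
  also have "\<dots> \<le> L2_norm M F * L2_norm M G" by (rule Cauchy_Schwarz_L2[OF assms])
  finally show ?thesis .
qed

lemma L2_inner_diff_left: "F \<in> L2 M \<Longrightarrow> G \<in> L2 M \<Longrightarrow> H \<in> L2 M \<Longrightarrow>
    L2_inner M (\<lambda>x. F x - G x) H = L2_inner M F H - L2_inner M G H"
  unfolding L2_inner_def left_diff_distrib by (intro Bochner_Integration.integral_diff L2_product_integrable)

lemma L2_inner_cmult_left: "L2_inner M (\<lambda>x. c * F x) H = c * L2_inner M F H"
  by (simp add: L2_inner_def mult.assoc)

lemma L2_inner_commute: "L2_inner M G F = cnj (L2_inner M F G)"
  by (simp add: L2_inner_def Bochner_Integration.integral_cnj[symmetric] mult.commute)

lemma L2_inner_self: "L2_inner M F F = of_real ((L2_norm M F)\<^sup>2)"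
  unfolding L2_inner_def L2_norm_sq complex_norm_square[symmetric] by (rule integral_complex_of_real)

lemma L2_norm_sq_diff:
  assumes "F \<in> L2 M" "G \<in> L2 M"
  shows "(L2_norm M (\<lambda>x. F x - G x))\<^sup>2 = (L2_norm M F)\<^sup>2 - 2 * Re (L2_inner M F G) + (L2_norm M G)\<^sup>2"
proof -
  have D: "(\<lambda>x. F x - G x) \<in> L2 M" using assms by (rule L2_diff)
  have "complex_of_real ((L2_norm M (\<lambda>x. F x - G x))\<^sup>2) = L2_inner M F (\<lambda>x. F x - G x) - L2_inner M G (\<lambda>x. F x - G x)"
    unfolding L2_inner_self[symmetric] using assms D by (rule L2_inner_diff_left)
  also have "L2_inner M F (\<lambda>x. F x - G x) = cnj (L2_inner M F F - L2_inner M G F)"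
    by (subst L2_inner_commute) (use assms in \<open>simp add: L2_inner_diff_left\<close>)
  also have "L2_inner M G (\<lambda>x. F x - G x) = cnj (L2_inner M F G - L2_inner M G G)"
    by (subst L2_inner_commute) (use assms in \<open>simp add: L2_inner_diff_left\<close>)
  finally have "complex_of_real ((L2_norm M (\<lambda>x. F x - G x))\<^sup>2) =
      cnj (L2_inner M F F) - cnj (L2_inner M G F) - (cnj (L2_inner M F G) - cnj (L2_inner M G G))" by simp
  then have "Re (complex_of_real ((L2_norm M (\<lambda>x. F x - G x))\<^sup>2)) =
      Re (L2_inner M F F) - Re (L2_inner M G F) - (Re (L2_inner M F G) - Re (L2_inner M G G))" by simp
  moreover have "Re (L2_inner M G F) = Re (L2_inner M F G)" by (subst L2_inner_commute) simp
  ultimately show ?thesis by (simp add: L2_inner_self)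
qed

lemma L2_norm_triangle:
  assumes "F \<in> L2 M" "G \<in> L2 M"
  shows "L2_norm M (\<lambda>x. F x + G x) \<le> L2_norm M F + L2_norm M G"
proof (rule power2_le_imp_le)
  have G': "(\<lambda>x. - 1 * G x) \<in> L2 M" using assms(2) by (rule L2_cmult)
  have "(L2_norm M (\<lambda>x. F x + G x))\<^sup>2 = (L2_norm M (\<lambda>x. F x - (- 1 * G x)))\<^sup>2" by simp
  also have "\<dots> = (L2_norm M F)\<^sup>2 - 2 * Re (L2_inner M F (\<lambda>x. - 1 * G x)) + (L2_norm M (\<lambda>x. - 1 * G x))\<^sup>2"
    by (rule L2_norm_sq_diff[OF assms(1) G'])
  also have "L2_norm M (\<lambda>x. - 1 * G x) = L2_norm M G" by (subst L2_norm_cmult) simp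
  also have "- Re (L2_inner M F (\<lambda>x. - 1 * G x)) \<le> L2_norm M F * L2_norm M G"
  proof -
    have "- Re (L2_inner M F (\<lambda>x. - 1 * G x)) \<le> norm (L2_inner M F (\<lambda>x. - 1 * G x))"
      using abs_Re_le_cmod[of "L2_inner M F (\<lambda>x. - 1 * G x)"] by linarith
    also have "\<dots> \<le> L2_norm M F * L2_norm M (\<lambda>x. - 1 * G x)" by (rule L2_inner_le[OF assms(1) G'])
    also have "L2_norm M (\<lambda>x. - 1 * G x) = L2_norm M G" by (subst L2_norm_cmult) simp
    finally show ?thesis .
  qed
  then have "(L2_norm M F)\<^sup>2 - 2 * Re (L2_inner M F (\<lambda>x. - 1 * G x)) + (L2_norm M G)\<^sup>2
     \<le> (L2_norm M F)\<^sup>2 + 2 * (L2_norm M F * L2_norm M G) + (L2_norm M G)\<^sup>2" by linarith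
  also have "\<dots> = (L2_norm M F + L2_norm M G)\<^sup>2" by (simp add: power2_sum)
  finally show "(L2_norm M (\<lambda>x. F x + G x))\<^sup>2 \<le> (L2_norm M F + L2_norm M G)\<^sup>2" .
qed simp

lemma L2_norm_triangle_diff:
  assumes "F \<in> L2 M" "G \<in> L2 M" "H \<in> L2 M"
  shows "L2_norm M (\<lambda>x. F x - H x) \<le> L2_norm M (\<lambda>x. F x - G x) + L2_norm M (\<lambda>x. G x - H x)"
  using L2_norm_triangle[OF L2_diff[OF assms(1,2)] L2_diff[OF assms(2,3)]] by simp

lemma L2_norm_sum_le:
  "(\<And>i. i \<in> I \<Longrightarrow> F i \<in> L2 M) \<Longrightarrow> L2_norm M (\<lambda>x. \<Sum>i\<in>I. F i x) \<le> (\<Sum>i\<in>I. L2_norm M (F i))"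
proof (induction I rule: infinite_finite_induct)
  case (insert i I)
  have "L2_norm M (\<lambda>x. F i x + (\<Sum>i\<in>I. F i x)) \<le> L2_norm M (F i) + L2_norm M (\<lambda>x. \<Sum>i\<in>I. F i x)"
    using insert by (intro L2_norm_triangle L2_sum) auto
  then show ?case using insert by auto
qed auto

section \<open>Completeness and orthogonal projection\<close>

lemma (in prob_space) L2_integrable:
  assumes "F \<in> L2 M"
  shows "integrable M F" "(\<integral>x. norm (F x) \<partial>M) \<le> L2_norm M F"
proof -
  have o: "(\<lambda>x. 1) \<in> L2 M" by simp
  show "integrable M F" using L2_product_integrable(1)[OF assms o] by simp
  have "L2_norm M (\<lambda>x. 1) = 1" by (simp add: L2_norm_def prob_space)
  then show "(\<integral>x. norm (F x) \<partial>M) \<le> L2_norm M F" using Cauchy_Schwarz_L2[OF assms o] by simp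
qed

text \<open>Riesz-Fischer. On a probability space the norm of L1 is at most that of L2, so the
  series converges absolutely almost everywhere, and Fatou's lemma gives the tail bound. The
  pointwise clause is kept because the series is later rearranged point by point.\<close>

lemma (in prob_space) L2_series:
  assumes u: "\<And>k. u k \<in> L2 M" and sm: "summable (\<lambda>k. L2_norm M (u k))"
  obtains G where "G \<in> L2 M" "AE x in M. summable (\<lambda>k. norm (u k x)) \<and> G x = (\<Sum>k. u k x)"
    "\<And>n. L2_norm M (\<lambda>x. G x - (\<Sum>k<n. u k x)) \<le> (\<Sum>k. L2_norm M (u (k + n)))"
proof -
  have [measurable]: "u k \<in> borel_measurable M" for k using u by (rule L2_measurable)
  have "(\<integral>\<^sup>+x. (\<Sum>k. ennreal (norm (u k x))) \<partial>M) = (\<Sum>k. \<integral>\<^sup>+x. ennreal (norm (u k x)) \<partial>M)"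
    by (rule nn_integral_suminf) simp
  also have "\<dots> \<le> (\<Sum>k. ennreal (L2_norm M (u k)))"
  proof (rule suminf_le)
    fix k
    have "(\<integral>\<^sup>+x. ennreal (norm (u k x)) \<partial>M) = ennreal (\<integral>x. norm (u k x) \<partial>M)"
      by (rule nn_integral_eq_integral) (use L2_integrable(1)[OF u] in auto)
    also have "\<dots> \<le> ennreal (L2_norm M (u k))" by (intro ennreal_leI L2_integrable(2) u)
    finally show "(\<integral>\<^sup>+x. ennreal (norm (u k x)) \<partial>M) \<le> ennreal (L2_norm M (u k))" .
  qed auto
  also have "\<dots> = ennreal (\<Sum>k. L2_norm M (u k))" by (rule suminf_ennreal2) (use sm in auto)
  finally have "(\<integral>\<^sup>+x. (\<Sum>k. ennreal (norm (u k x))) \<partial>M) \<noteq> \<infinity>" by (auto simp: top_unique)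
  then have "AE x in M. (\<Sum>k. ennreal (norm (u k x))) \<noteq> \<infinity>" by (intro nn_integral_PInf_AE) simp
  then have smx: "AE x in M. summable (\<lambda>k. norm (u k x))"
    by (rule AE_mp) (auto intro!: AE_I2 summable_suminf_not_top)
  define G where "G x = (\<Sum>k. u k x)" for x
  have [measurable]: "G \<in> borel_measurable M" unfolding G_def by measurable
  define B where "B n = (\<Sum>k. L2_norm M (u (k + n)))" for n
  have B0: "B n \<ge> 0" for n unfolding B_def by (intro suminf_nonneg summable_ignore_initial_segment[OF sm]) auto
  have fin: "L2_norm M (\<lambda>x. \<Sum>k\<in>{n..<n+j}. u k x) \<le> B n" for n j
  proof -
    have "L2_norm M (\<lambda>x. \<Sum>k\<in>{n..<n+j}. u k x) \<le> (\<Sum>k\<in>{n..<n+j}. L2_norm M (u k))"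
      by (intro L2_norm_sum_le u)
    also have "\<dots> = (\<Sum>k<j. L2_norm M (u (k + n)))"
      using sum.shift_bounds_nat_ivl[of "\<lambda>k. L2_norm M (u k)" 0 n j] by (simp add: lessThan_atLeast0 add.commute)
    also have "\<dots> \<le> B n" unfolding B_def by (rule sum_le_suminf[OF summable_ignore_initial_segment[OF sm]]) auto
    finally show ?thesis .
  qed
  have fatou: "(\<integral>\<^sup>+x. ennreal ((norm (G x - (\<Sum>k<n. u k x)))\<^sup>2) \<partial>M) \<le> ennreal ((B n)\<^sup>2)" for n
  proof -
    have "(\<integral>\<^sup>+x. ennreal ((norm (G x - (\<Sum>k<n. u k x)))\<^sup>2) \<partial>M) =
        (\<integral>\<^sup>+x. liminf (\<lambda>j. ennreal ((norm (\<Sum>k\<in>{n..<n+j}. u k x))\<^sup>2)) \<partial>M)"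
    proof (rule nn_integral_cong_AE)
      show "AE x in M. ennreal ((norm (G x - (\<Sum>k<n. u k x)))\<^sup>2) = liminf (\<lambda>j. ennreal ((norm (\<Sum>k\<in>{n..<n+j}. u k x))\<^sup>2))"
        using smx
      proof (rule AE_mp, intro AE_I2 impI)
        fix x assume "summable (\<lambda>k. norm (u k x))"
        then have "(\<lambda>m. \<Sum>k<m. u k x) \<longlonglongrightarrow> G x" unfolding G_def by (rule summable_LIMSEQ[OF summable_norm_cancel])
        then have "(\<lambda>j. \<Sum>k<n+j. u k x) \<longlonglongrightarrow> G x"
          using LIMSEQ_ignore_initial_segment[of "\<lambda>m. \<Sum>k<m. u k x" _ n] by (simp add: add.commute)
        then have "(\<lambda>j. (\<Sum>k<n+j. u k x) - (\<Sum>k<n. u k x)) \<longlonglongrightarrow> G x - (\<Sum>k<n. u k x)" by (intro tendsto_intros)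
        moreover have "(\<Sum>k<n+j. u k x) - (\<Sum>k<n. u k x) = (\<Sum>k\<in>{n..<n+j}. u k x)" for j
          using sum_diff_nat_ivl[of 0 n "n + j" "\<lambda>k. u k x"] by (simp add: lessThan_atLeast0)
        ultimately have "(\<lambda>j. \<Sum>k\<in>{n..<n+j}. u k x) \<longlonglongrightarrow> G x - (\<Sum>k<n. u k x)" by simp
        then have "(\<lambda>j. ennreal ((norm (\<Sum>k\<in>{n..<n+j}. u k x))\<^sup>2)) \<longlonglongrightarrow> ennreal ((norm (G x - (\<Sum>k<n. u k x)))\<^sup>2)"
          by (intro tendsto_intros tendsto_ennrealI)
        then show "ennreal ((norm (G x - (\<Sum>k<n. u k x)))\<^sup>2) = liminf (\<lambda>j. ennreal ((norm (\<Sum>k\<in>{n..<n+j}. u k x))\<^sup>2))"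
          by (intro lim_imp_Liminf[symmetric]) auto
      qed
    qed
    also have "\<dots> \<le> liminf (\<lambda>j. \<integral>\<^sup>+x. ennreal ((norm (\<Sum>k\<in>{n..<n+j}. u k x))\<^sup>2) \<partial>M)"
      by (rule nn_integral_liminf) simp
    also have "\<dots> \<le> liminf (\<lambda>j. ennreal ((B n)\<^sup>2))"
    proof (rule Liminf_mono, rule always_eventually, rule allI)
      fix j
      have "(\<integral>\<^sup>+x. ennreal ((norm (\<Sum>k\<in>{n..<n+j}. u k x))\<^sup>2) \<partial>M) = ennreal ((L2_norm M (\<lambda>x. \<Sum>k\<in>{n..<n+j}. u k x))\<^sup>2)"
        unfolding L2_norm_sq by (rule nn_integral_eq_integral) (use L2_integrable_sq[OF L2_sum[OF u]] in auto)
      also have "\<dots> \<le> ennreal ((B n)\<^sup>2)" by (intro ennreal_leI power_mono fin) auto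
      finally show "(\<integral>\<^sup>+x. ennreal ((norm (\<Sum>k\<in>{n..<n+j}. u k x))\<^sup>2) \<partial>M) \<le> ennreal ((B n)\<^sup>2)" .
    qed
    also have "\<dots> = ennreal ((B n)\<^sup>2)" by (rule Liminf_const) simp
    finally show ?thesis .
  qed
  have GL: "(\<lambda>x. G x - (\<Sum>k<n. u k x)) \<in> L2 M" for n
  proof -
    have "integrable M (\<lambda>x. (norm (G x - (\<Sum>k<n. u k x)))\<^sup>2)"
    proof (rule integrableI_nonneg)
      show "(\<integral>\<^sup>+x. ennreal ((norm (G x - (\<Sum>k<n. u k x)))\<^sup>2) \<partial>M) < \<infinity>" using fatou[of n] by (rule le_less_trans) simp
    qed auto
    then show ?thesis by (simp add: L2_def)
  qed
  show ?thesis
  proof (rule that)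
    show "G \<in> L2 M" using GL[of 0] by simp
    show "AE x in M. summable (\<lambda>k. norm (u k x)) \<and> G x = (\<Sum>k. u k x)" using smx by (simp add: G_def)
    fix n
    have "ennreal ((L2_norm M (\<lambda>x. G x - (\<Sum>k<n. u k x)))\<^sup>2) \<le> ennreal ((B n)\<^sup>2)"
      unfolding L2_norm_sq by (subst nn_integral_eq_integral[symmetric]) (use L2_integrable_sq[OF GL] fatou in auto)
    then have "(L2_norm M (\<lambda>x. G x - (\<Sum>k<n. u k x)))\<^sup>2 \<le> (B n)\<^sup>2" by (subst (asm) ennreal_le_iff) auto
    then show "L2_norm M (\<lambda>x. G x - (\<Sum>k<n. u k x)) \<le> (\<Sum>k. L2_norm M (u (k + n)))"
      unfolding B_def[symmetric] by (rule power2_le_imp_le) (rule B0)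
  qed
qed

lemma (in prob_space) L2_complete:
  assumes v: "\<And>k. v k \<in> L2 M" and d: "\<And>k. L2_norm M (\<lambda>x. v (Suc k) x - v k x) \<le> (1 / 2) ^ k"
  obtains P where "P \<in> L2 M" "\<And>k. L2_norm M (\<lambda>x. P x - v k x) \<le> 2 * (1 / 2) ^ k"
proof -
  define u where "u k = (\<lambda>x. v (Suc k) x - v k x)" for k
  have uL: "u k \<in> L2 M" for k unfolding u_def by (intro L2_diff v)
  have ud: "L2_norm M (u k) \<le> (1 / 2) ^ k" for k using d by (simp add: u_def)
  have geo: "summable (\<lambda>k. (1 / 2 :: real) ^ (k + n))" for n
    by (rule summable_ignore_initial_segment) (simp add: summable_geometric)
  have smu: "summable (\<lambda>k. L2_norm M (u k))"
    by (rule summable_comparison_test'[OF geo[of 0]]) (use ud in auto)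
  obtain G where G: "G \<in> L2 M" "\<And>n. L2_norm M (\<lambda>x. G x - (\<Sum>k<n. u k x)) \<le> (\<Sum>k. L2_norm M (u (k + n)))"
    using L2_series[OF uL smu] by blast
  show ?thesis
  proof (rule that)
    show "(\<lambda>x. G x + v 0 x) \<in> L2 M" by (intro L2_add G v)
    fix k
    have tel: "(\<Sum>i<k. u i x) = v k x - v 0 x" for x
      unfolding u_def by (rule sum_lessThan_telescope)
    have "L2_norm M (\<lambda>x. G x + v 0 x - v k x) = L2_norm M (\<lambda>x. G x - (\<Sum>i<k. u i x))"
      unfolding tel by (rule arg_cong[of _ _ "L2_norm M"]) (auto simp: fun_eq_iff)
    also have "\<dots> \<le> (\<Sum>i. L2_norm M (u (i + k)))" by (rule G)
    also have "\<dots> \<le> (\<Sum>i. (1 / 2) ^ (i + k))"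
      by (rule suminf_le[OF ud summable_ignore_initial_segment[OF smu] geo])
    also have "\<dots> = (\<Sum>i. (1 / 2) ^ i * (1 / 2) ^ k)" by (simp add: power_add)
    also have "\<dots> = (\<Sum>i. (1 / 2 :: real) ^ i) * (1 / 2) ^ k"
      by (rule suminf_mult2[symmetric]) (simp add: summable_geometric)
    also have "\<dots> = 2 * (1 / 2) ^ k" by (subst suminf_geometric) auto
    finally show "L2_norm M (\<lambda>x. G x + v 0 x - v k x) \<le> 2 * (1 / 2) ^ k" .
  qed
qed

lemma L2_parallelogram:
  assumes "F \<in> L2 M" "G \<in> L2 M"
  shows "(L2_norm M (\<lambda>x. F x - G x))\<^sup>2 + (L2_norm M (\<lambda>x. F x + G x))\<^sup>2 = 2 * (L2_norm M F)\<^sup>2 + 2 * (L2_norm M G)\<^sup>2"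
proof -
  have pt: "(norm (a - b))\<^sup>2 + (norm (a + b))\<^sup>2 = 2 * (norm a)\<^sup>2 + 2 * (norm b)\<^sup>2" for a b :: complex
    unfolding cmod_power2 by (simp add: power2_eq_square algebra_simps)
  have "(L2_norm M (\<lambda>x. F x - G x))\<^sup>2 + (L2_norm M (\<lambda>x. F x + G x))\<^sup>2
     = (\<integral>x. (norm (F x - G x))\<^sup>2 + (norm (F x + G x))\<^sup>2 \<partial>M)"
    unfolding L2_norm_sq by (intro Bochner_Integration.integral_add[symmetric] L2_integrable_sq L2_add L2_diff assms)
  also have "\<dots> = (\<integral>x. 2 * (norm (F x))\<^sup>2 + 2 * (norm (G x))\<^sup>2 \<partial>M)"
    by (simp only: pt)
  also have "\<dots> = 2 * (L2_norm M F)\<^sup>2 + 2 * (L2_norm M G)\<^sup>2"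
    unfolding L2_norm_sq by (subst Bochner_Integration.integral_add) (auto intro: L2_integrable_sq assms)
  finally show ?thesis .
qed

text \<open>\<open>P\<close> is the component of \<open>F\<close> orthogonal to \<open>V\<close>. As
  \<open>V\<close> may fail to be closed, the membership of \<open>F - P\<close> in its closure is
  expressed by approximation. A minimising sequence is Cauchy by the parallelogram law.\<close>

lemma (in prob_space) L2_projection:
  assumes V: "V \<subseteq> L2 M" "(\<lambda>x. 0) \<in> V" "\<And>A B. A \<in> V \<Longrightarrow> B \<in> V \<Longrightarrow> (\<lambda>x. A x + B x) \<in> V"
    "\<And>c A. A \<in> V \<Longrightarrow> (\<lambda>x. c * A x) \<in> V"
    and F: "F \<in> L2 M"
  obtains P where "P \<in> L2 M" "\<And>W. W \<in> V \<Longrightarrow> L2_inner M P W = 0"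
    "\<And>e. e > 0 \<Longrightarrow> \<exists>W\<in>V. L2_norm M (\<lambda>x. F x - W x - P x) < e"
proof -
  define d where "d = Inf ((\<lambda>W. (L2_norm M (\<lambda>x. F x - W x))\<^sup>2) ` V)"
  have bdd: "bdd_below ((\<lambda>W. (L2_norm M (\<lambda>x. F x - W x))\<^sup>2) ` V)" by (rule bdd_belowI[of _ 0]) auto
  have d_le: "d \<le> (L2_norm M (\<lambda>x. F x - W x))\<^sup>2" if "W \<in> V" for W
    unfolding d_def by (rule cINF_lower[OF bdd that])
  have d0: "d \<ge> 0" unfolding d_def by (rule cINF_greatest) (use V in auto)
  \<comment> \<open>With this margin the parallelogram law bounds the squared distance of
    consecutive terms by \<open>(1/8 + 1/2) * (1/4)^k\<close>, so the distances are at most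
    \<open>(1/2)^k\<close>.\<close>
  have "\<exists>W\<in>V. (L2_norm M (\<lambda>x. F x - W x))\<^sup>2 < d + (1 / 4) ^ k / 4" for k
  proof -
    have "d < d + (1 / 4) ^ k / 4" by simp
    then show ?thesis unfolding d_def using cINF_less_iff[OF _ bdd] V(2) by blast
  qed
  then obtain W where W: "\<And>k. W k \<in> V" "\<And>k. (L2_norm M (\<lambda>x. F x - W k x))\<^sup>2 < d + (1 / 4) ^ k / 4" by metis
  have VL: "A \<in> L2 M" if "A \<in> V" for A using V that by blast
  define v where "v k = (\<lambda>x. F x - W k x)" for k
  have vL: "v k \<in> L2 M" for k unfolding v_def by (intro L2_diff F VL W)
  have vd: "L2_norm M (\<lambda>x. v (Suc k) x - v k x) \<le> (1 / 2) ^ k" for k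
  proof (rule power2_le_imp_le)
    have mid: "(\<lambda>x. 1 / 2 * (W (Suc k) x + W k x)) \<in> V" by (rule V(4)[OF V(3)[OF W(1) W(1)]])
    have "4 * d \<le> 4 * (L2_norm M (\<lambda>x. F x - 1 / 2 * (W (Suc k) x + W k x)))\<^sup>2" using d_le[OF mid] by simp
    also have "\<dots> = (L2_norm M (\<lambda>x. 2 * (F x - 1 / 2 * (W (Suc k) x + W k x))))\<^sup>2"
      by (subst L2_norm_cmult) (simp add: power_mult_distrib)
    also have "(\<lambda>x. 2 * (F x - 1 / 2 * (W (Suc k) x + W k x))) = (\<lambda>x. v (Suc k) x + v k x)"
      by (simp add: v_def fun_eq_iff algebra_simps)
    finally have "4 * d \<le> (L2_norm M (\<lambda>x. v (Suc k) x + v k x))\<^sup>2" .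
    moreover have "(L2_norm M (\<lambda>x. v (Suc k) x - v k x))\<^sup>2 + (L2_norm M (\<lambda>x. v (Suc k) x + v k x))\<^sup>2
       = 2 * (L2_norm M (v (Suc k)))\<^sup>2 + 2 * (L2_norm M (v k))\<^sup>2" by (rule L2_parallelogram[OF vL vL])
    moreover have "(L2_norm M (v (Suc k)))\<^sup>2 < d + (1 / 4) ^ k / 16" "(L2_norm M (v k))\<^sup>2 < d + (1 / 4) ^ k / 4"
      using W(2)[of "Suc k"] W(2)[of k] by (auto simp: v_def)
    ultimately have "(L2_norm M (\<lambda>x. v (Suc k) x - v k x))\<^sup>2 \<le> (1 / 4) ^ k" using zero_le_power[of "1/4::real" k] by linarith
    also have "(1 / 4) ^ k = ((1 / 2 :: real) ^ k)\<^sup>2" unfolding power2_eq_square power_mult_distrib[symmetric] by simp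
    finally show "(L2_norm M (\<lambda>x. v (Suc k) x - v k x))\<^sup>2 \<le> ((1 / 2) ^ k)\<^sup>2" .
  qed simp
  obtain P where P: "P \<in> L2 M" "\<And>k. L2_norm M (\<lambda>x. P x - v k x) \<le> 2 * (1 / 2) ^ k"
    using L2_complete[OF vL vd] by blast
  have lim0: "(\<lambda>k. 2 * (1 / 2 :: real) ^ k) \<longlonglongrightarrow> 0"
    using tendsto_mult_right[OF LIMSEQ_realpow_zero[of "1/2::real"], of 2] by simp
  have P_le: "(L2_norm M P)\<^sup>2 \<le> d"
  proof -
    have "L2_norm M P \<le> sqrt (d + 0) + 0"
    proof (rule tendsto_lowerbound)
      have "(\<lambda>k. (1 / 4 :: real) ^ k / 4) \<longlonglongrightarrow> 0 / 4" by (intro tendsto_divide LIMSEQ_realpow_zero) auto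
      then show "(\<lambda>k. sqrt (d + (1 / 4) ^ k / 4) + 2 * (1 / 2) ^ k) \<longlonglongrightarrow> sqrt (d + 0) + 0"
        by (intro tendsto_intros lim0) simp
      show "\<forall>\<^sub>F k in sequentially. L2_norm M P \<le> sqrt (d + (1 / 4) ^ k / 4) + 2 * (1 / 2) ^ k"
      proof (rule always_eventually, rule allI)
        fix k
        have "L2_norm M P = L2_norm M (\<lambda>x. v k x + (P x - v k x))" by simp
        also have "\<dots> \<le> L2_norm M (v k) + L2_norm M (\<lambda>x. P x - v k x)" by (intro L2_norm_triangle L2_diff vL P)
        also have "L2_norm M (v k) \<le> sqrt (d + (1 / 4) ^ k / 4)"
          by (rule real_le_rsqrt) (use W(2)[of k] in \<open>simp add: v_def\<close>)
        finally show "L2_norm M P \<le> sqrt (d + (1 / 4) ^ k / 4) + 2 * (1 / 2) ^ k" using P(2)[of k] by simp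
      qed
    qed simp
    then have "(L2_norm M P)\<^sup>2 \<le> (sqrt d)\<^sup>2" by (intro power_mono) auto
    then show ?thesis using d0 by simp
  qed
  have P_ge: "d \<le> (L2_norm M (\<lambda>x. P x - A x))\<^sup>2" if A: "A \<in> V" for A
  proof -
    have "sqrt d \<le> L2_norm M (\<lambda>x. P x - A x) + 0"
    proof (rule tendsto_lowerbound)
      show "(\<lambda>k. L2_norm M (\<lambda>x. P x - A x) + 2 * (1 / 2) ^ k) \<longlonglongrightarrow> L2_norm M (\<lambda>x. P x - A x) + 0"
        by (intro tendsto_intros lim0)
      show "\<forall>\<^sub>F k in sequentially. sqrt d \<le> L2_norm M (\<lambda>x. P x - A x) + 2 * (1 / 2) ^ k"
      proof (rule always_eventually, rule allI)
        fix k
        have "d \<le> (L2_norm M (\<lambda>x. F x - (W k x + A x)))\<^sup>2" by (intro d_le V(3) W(1) A)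
        then have "sqrt d \<le> L2_norm M (\<lambda>x. F x - (W k x + A x))" by (intro real_le_lsqrt) auto
        also have "\<dots> = L2_norm M (\<lambda>x. (P x - A x) + (v k x - P x))" by (simp add: v_def algebra_simps)
        also have "\<dots> \<le> L2_norm M (\<lambda>x. P x - A x) + L2_norm M (\<lambda>x. v k x - P x)"
          by (intro L2_norm_triangle L2_diff vL P VL A)
        also have "L2_norm M (\<lambda>x. v k x - P x) \<le> 2 * (1 / 2) ^ k" using P(2)[of k] by (subst L2_norm_minus_commute)
        finally show "sqrt d \<le> L2_norm M (\<lambda>x. P x - A x) + 2 * (1 / 2) ^ k" by simp
      qed
    qed simp
    then have "(sqrt d)\<^sup>2 \<le> (L2_norm M (\<lambda>x. P x - A x))\<^sup>2" using d0 by (intro power_mono) auto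
    then show ?thesis using d0 by simp
  qed
  show ?thesis
  proof (rule that[OF P(1)])
    fix A assume A: "A \<in> V"
    define i where "i = L2_inner M P A"
    define B where "B = (L2_norm M A)\<^sup>2"
    \<comment> \<open>Minimality is tested against the multiple \<open>s * i\<close> of
      \<open>A\<close>: the first-order gain \<open>2 * s * |i|^2\<close> beats the second-order
      cost \<open>s^2 * |i|^2 * B\<close> because \<open>s * B < 1\<close>.\<close>
    define s where "s = 1 / (B + 1)"
    have B: "B \<ge> 0" by (simp add: B_def)
    have s: "s > 0" "s * B < 1" using B by (auto simp: s_def)
    have "L2_inner M P (\<lambda>x. (of_real s * i) * A x) = cnj (of_real s * i) * i"
      by (subst L2_inner_commute) (simp add: L2_inner_cmult_left, simp add: L2_inner_commute[of M P A] i_def)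
    also have "\<dots> = of_real (s * (norm i)\<^sup>2)"
      unfolding of_real_mult complex_norm_square by (simp add: mult_ac)
    finally have ii: "Re (L2_inner M P (\<lambda>x. (of_real s * i) * A x)) = s * (norm i)\<^sup>2" by (simp only: Re_complex_of_real)
    have "(L2_norm M P)\<^sup>2 \<le> (L2_norm M (\<lambda>x. P x - (of_real s * i) * A x))\<^sup>2"
      using P_le P_ge[OF V(4)[OF A]] by (rule order_trans)
    also have "\<dots> = (L2_norm M P)\<^sup>2 - 2 * (s * (norm i)\<^sup>2) + (L2_norm M (\<lambda>x. (of_real s * i) * A x))\<^sup>2"
      by (subst L2_norm_sq_diff[OF P(1) VL[OF V(4)[OF A]]]) (simp only: ii)
    also have "(L2_norm M (\<lambda>x. (of_real s * i) * A x))\<^sup>2 = s * (norm i)\<^sup>2 * (s * B)"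
      using s by (subst L2_norm_cmult) (simp add: B_def norm_mult power_mult_distrib power2_eq_square)
    finally have "s * (norm i)\<^sup>2 * (2 - s * B) \<le> 0" by (simp add: algebra_simps)
    moreover have "s * (2 - s * B) > 0" using s by simp
    ultimately have "(norm i)\<^sup>2 \<le> 0" by (metis mult.assoc mult.commute mult_le_0_iff not_less zero_le_power2 order_antisym)
    then show "L2_inner M P A = 0" by (simp add: i_def)
  next
    fix e :: real assume "e > 0"
    then have "\<forall>\<^sub>F k in sequentially. 2 * (1 / 2 :: real) ^ k < e" using lim0 by (intro order_tendstoD) auto
    then obtain k where k: "2 * (1 / 2 :: real) ^ k < e" by (auto simp: eventually_sequentially)
    have "L2_norm M (\<lambda>x. F x - W k x - P x) = L2_norm M (\<lambda>x. P x - v k x)"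
      by (subst L2_norm_minus_commute) (simp add: v_def)
    also have "\<dots> < e" using P(2)[of k] k by simp
    finally show "\<exists>W\<in>V. L2_norm M (\<lambda>x. F x - W x - P x) < e" using W(1) by blast
  qed
qed

section \<open>Twisted averages\<close>

lemma M_c_fg_D:
  assumes "f \<in> M_c_fg"
  shows "n \<ge> 1 \<Longrightarrow> norm (f n) = 1" "n \<ge> 1 \<Longrightarrow> m \<ge> 1 \<Longrightarrow> f (n * m) = f n * f m"
    "finite (f ` {p. prime p})" "f (Suc 0) = 1"
proof -
  show n: "n \<ge> 1 \<Longrightarrow> norm (f n) = 1" and m: "n \<ge> 1 \<Longrightarrow> m \<ge> 1 \<Longrightarrow> f (n * m) = f n * f m" for n m
    using assms by (auto simp: M_c_fg_def)
  show "finite (f ` {p. prime p})" using assms by (simp add: M_c_fg_def)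
  have "f 1 * f 1 = f 1 * 1" using m[of 1 1] by simp
  moreover have "f 1 \<noteq> 0" using n[of 1] by auto
  ultimately show "f (Suc 0) = 1" by (simp del: mult_cancel_right1 mult_1_right)
qed

locale twisted_system = fg_multiplicative_system M S for M :: "'a::metric_space measure" and S +
  fixes f :: "nat \<Rightarrow> complex"
  assumes f: "f \<in> M_c_fg"
begin

lemmas norm_f = M_c_fg_D(1)[OF f] and f_mult = M_c_fg_D(2)[OF f] and f_1 = M_c_fg_D(4)[OF f]

text \<open>A Koopman operator twisted so that, by \<open>|f p| = 1\<close>, the relation
  \<open>F (S p x) = f p * F x\<close> becomes the fixed-point equation
  \<open>U p F = F\<close>.\<close>

definition U :: "nat \<Rightarrow> ('a \<Rightarrow> complex) \<Rightarrow> 'a \<Rightarrow> complex" where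
  "U n F x = cnj (f n) * F (S n x)"

lemma S_space: "n \<ge> 1 \<Longrightarrow> x \<in> space M \<Longrightarrow> S n x \<in> space M"
  using S_measurable by (rule measurable_space)

lemma S_1: "x \<in> space M \<Longrightarrow> S 1 x = x"
proof -
  assume x: "x \<in> space M"
  have "S 1 (S 1 x) = S 1 x" using S_mult[of 1 1 x] x by simp
  moreover have "inj_on (S 1) (space M)" using S_bij[of 1] by (simp add: bij_betw_def)
  ultimately show ?thesis using S_space[of 1 x] x by (auto dest: inj_onD)
qed

lemma AE_S: "n \<ge> 1 \<Longrightarrow> AE x in M. P x \<Longrightarrow> AE x in M. P (S n x)"
  by (rule AE_distrD[OF S_measurable], assumption, subst S_preserving)

lemma integral_S:
  fixes h :: "'a \<Rightarrow> 'b::{banach, second_countable_topology}"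
  assumes "n \<ge> 1" "h \<in> borel_measurable M"
  shows "(\<integral>x. h (S n x) \<partial>M) = (\<integral>x. h x \<partial>M)"
  using integral_distr[OF S_measurable[OF assms(1)], of h] assms S_preserving[of n] by simp

lemma integrable_S:
  fixes h :: "'a \<Rightarrow> 'b::{banach, second_countable_topology}"
  assumes "n \<ge> 1" "integrable M h"
  shows "integrable M (\<lambda>x. h (S n x))"
  using integrable_distr[OF S_measurable[OF assms(1)], of h] assms S_preserving[of n] by simp

lemma measurable_S: "n \<ge> 1 \<Longrightarrow> F \<in> borel_measurable M \<Longrightarrow> (\<lambda>x. F (S n x)) \<in> borel_measurable M"
  using measurable_compose[OF S_measurable] by blast

lemma U_L2:
  assumes "n \<ge> 1" "F \<in> L2 M"
  shows "U n F \<in> L2 M"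
proof -
  have "(\<lambda>x. F (S n x)) \<in> L2 M"
    using measurable_S[OF assms(1) L2_measurable[OF assms(2)]] integrable_S[OF assms(1) L2_integrable_sq[OF assms(2)]]
    by (simp add: L2_def)
  then show ?thesis unfolding U_def[abs_def] by (rule L2_cmult)
qed

lemma U_norm:
  assumes "n \<ge> 1" "F \<in> L2 M"
  shows "L2_norm M (U n F) = L2_norm M F"
proof -
  have "(\<integral>x. (norm (F (S n x)))\<^sup>2 \<partial>M) = (\<integral>x. (norm (F x))\<^sup>2 \<partial>M)"
    by (rule integral_S[OF assms(1)]) (use L2_measurable[OF assms(2)] in auto)
  then show ?thesis using assms by (simp add: L2_norm_def U_def norm_mult norm_f)
qed

lemma U_mult: "n \<ge> 1 \<Longrightarrow> m \<ge> 1 \<Longrightarrow> x \<in> space M \<Longrightarrow> U (m * n) F x = U n (U m F) x"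
  by (simp add: U_def f_mult S_mult mult_ac)

lemma U_1: "x \<in> space M \<Longrightarrow> U 1 F x = F x"
  using S_1 by (simp add: U_def f_1)

lemma U_diff: "U n (\<lambda>x. F x - G x) x = U n F x - U n G x"
  by (simp add: U_def algebra_simps)

lemma U_cong_AE: "n \<ge> 1 \<Longrightarrow> AE x in M. F x = G x \<Longrightarrow> AE x in M. U n F x = U n G x"
  unfolding U_def by (drule (1) AE_S) auto

text \<open>Each colour is named by its least prime. A colour is thus itself a prime that acts like
  all members of its class, and \<open>col\<close> is idempotent on primes.\<close>

definition col :: "nat \<Rightarrow> nat" where
  "col p = (LEAST q. prime q \<and> (\<forall>x\<in>space M. S q x = S p x) \<and> f q = f p)"

lemma col:
  assumes "prime p"
  shows "prime (col p)" "x \<in> space M \<Longrightarrow> S (col p) x = S p x" "f (col p) = f p"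
proof -
  have "prime (col p) \<and> (\<forall>x\<in>space M. S (col p) x = S p x) \<and> f (col p) = f p"
    unfolding col_def by (rule LeastI[of _ p]) (use assms in auto)
  then show "prime (col p)" "x \<in> space M \<Longrightarrow> S (col p) x = S p x" "f (col p) = f p" by auto
qed

lemma col_cong:
  assumes "\<forall>x\<in>space M. S p x = S p' x" "f p = f p'"
  shows "col p = col p'"
proof -
  have "(prime q \<and> (\<forall>x\<in>space M. S q x = S p x) \<and> f q = f p) = (prime q \<and> (\<forall>x\<in>space M. S q x = S p' x) \<and> f q = f p')" for q
    using assms by auto
  then show ?thesis unfolding col_def by simp
qed

lemma col_col: "prime p \<Longrightarrow> col (col p) = col p"
  by (rule col_cong) (auto simp: col)

definition Q :: "nat set" where "Q = col ` {p. prime p}"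

lemma Q_prime: "q \<in> Q \<Longrightarrow> prime q"
  by (auto simp: Q_def col)

lemma col_Q: "q \<in> Q \<Longrightarrow> col q = q"
  by (auto simp: Q_def col_col)

lemma finite_Q: "finite Q"
proof -
  define key where "key p = (restrict (S p) (space M), f p)" for p
  have "key ` {p. prime p} \<subseteq> ((\<lambda>p. restrict (S p) (space M)) ` {p. prime p}) \<times> (f ` {p. prime p})"
    by (auto simp: key_def)
  then have fin: "finite (key ` {p. prime p})"
    by (rule finite_subset) (use finitely_generated M_c_fg_D(3)[OF f] in auto)
  define g where "g k = col (SOME p. prime p \<and> key p = k)" for k
  have "col p = g (key p)" if "prime p" for p
  proof -
    have "prime (SOME p'. prime p' \<and> key p' = key p) \<and> key (SOME p'. prime p' \<and> key p' = key p) = key p"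
      by (rule someI[of _ p]) (use that in auto)
    define p' where "p' = (SOME p'. prime p' \<and> key p' = key p)"
    have k: "key p' = key p" unfolding p'_def by (rule conjunct2) fact
    have r: "restrict (S p) (space M) = restrict (S p') (space M)" "f p = f p'"
      using k unfolding key_def by auto
    have "S p x = S p' x" if "x \<in> space M" for x
      using fun_cong[OF r(1), of x] that by simp
    then show ?thesis unfolding g_def p'_def[symmetric] using r(2) by (intro col_cong) auto
  qed
  then have "Q \<subseteq> g ` key ` {p. prime p}" by (auto simp: Q_def)
  then show ?thesis using fin by (rule finite_subset[OF _ finite_imageI])
qed

lemma recolour_eq:
  assumes "n \<ge> 1"
  shows "f (recolour col n) = f n" "x \<in> space M \<Longrightarrow> S (recolour col n) x = S n x" "recolour col n \<ge> 1"
proof -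
  have *: "prod_mset A \<ge> 1 \<and> prod_mset (image_mset col A) \<ge> 1 \<and> f (prod_mset (image_mset col A)) = f (prod_mset A) \<and>
     (\<forall>x\<in>space M. S (prod_mset (image_mset col A)) x = S (prod_mset A) x)" if "\<forall>p\<in>#A. prime p" for A
    using that
  proof (induction A)
    case (add p A)
    then have p: "prime p" and A: "prod_mset A \<ge> 1" "prod_mset (image_mset col A) \<ge> 1"
       "f (prod_mset (image_mset col A)) = f (prod_mset A)" "\<forall>x\<in>space M. S (prod_mset (image_mset col A)) x = S (prod_mset A) x"
      by auto
    have p1: "p \<ge> 1" "col p \<ge> 1" using p col(1)[OF p] by (auto simp: prime_gt_0_nat Suc_le_eq)
    have "f (col p * prod_mset (image_mset col A)) = f (p * prod_mset A)"
      using p1 A p by (simp add: f_mult col)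
    moreover have "S (col p * prod_mset (image_mset col A)) x = S (p * prod_mset A) x" if x: "x \<in> space M" for x
      using p1 A p x S_space[OF A(1) x] by (simp add: S_mult col)
    moreover have "p * prod_mset A \<ge> 1" "col p * prod_mset (image_mset col A) \<ge> 1"
      using p1 A by (auto simp: Suc_le_eq)
    ultimately show ?case by simp
  qed simp
  have "prod_mset (prime_factorization n) = n" using assms by (simp add: prod_mset_prime_factorization_nat)
  moreover have "\<forall>p\<in>#prime_factorization n. prime p" by auto
  ultimately show "f (recolour col n) = f n" "x \<in> space M \<Longrightarrow> S (recolour col n) x = S n x" "recolour col n \<ge> 1"
    using *[of "prime_factorization n"] unfolding recolour_def by auto
qed

lemma U_recolour: "n \<ge> 1 \<Longrightarrow> x \<in> space M \<Longrightarrow> U (recolour col n) F x = U n F x"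
  by (simp add: U_def recolour_eq)

text \<open>The boxes \<open>smooth_set Q R\<close> are almost invariant under translation as \<open>R\<close> tends to infinity.\<close>

lemma L2_transference:
  fixes \<nu> :: "'i \<Rightarrow> nat" and c :: "'i \<Rightarrow> complex"
  assumes F: "F \<in> L2 M" and I: "finite I" and \<nu>: "\<And>i. i \<in> I \<Longrightarrow> \<nu> i \<ge> 1"
    and s: "\<And>z. (\<forall>j. norm (z j) = 1) \<Longrightarrow> norm (\<Sum>i\<in>I. c i * colour_char col z (\<nu> i)) \<le> s"
  shows "L2_norm M (\<lambda>x. \<Sum>i\<in>I. c i * U (\<nu> i) F x) \<le> s * L2_norm M F"
proof -
  define A where "A x = (\<Sum>i\<in>I. c i * U (\<nu> i) F x)" for x
  have AL: "A \<in> L2 M" unfolding A_def using \<nu> F by (intro L2_sum L2_cmult U_L2)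
  have s0: "s \<ge> 0" using order_trans[OF norm_ge_zero s[of "\<lambda>_. 1"]] by simp
  \<comment> \<open>A bound for the exponents by which any \<open>\<nu> i\<close> shifts a box; a
    sum serves as well as a maximum.\<close>
  define D where "D = (\<Sum>i\<in>I. \<Sum>q\<in>Q. multiplicity q (recolour col (\<nu> i)))"
  have D: "multiplicity q (recolour col (\<nu> i)) \<le> D" if "i \<in> I" "q \<in> Q" for i q
  proof -
    have "multiplicity q (recolour col (\<nu> i)) \<le> (\<Sum>q\<in>Q. multiplicity q (recolour col (\<nu> i)))"
      using that finite_Q by (intro member_le_sum) auto
    also have "\<dots> \<le> D" unfolding D_def using that I by (intro member_le_sum[where f = "\<lambda>i. \<Sum>q\<in>Q. multiplicity q (recolour col (\<nu> i))"]) auto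
    finally show ?thesis .
  qed
  have main: "real R ^ card Q * (L2_norm M A)\<^sup>2 \<le> s\<^sup>2 * (real (R + D) ^ card Q * (L2_norm M F)\<^sup>2)" if R: "R \<ge> 1" for R
  proof -
    define \<Gamma> where "\<Gamma> R = smooth_set Q R" for R
    have fin: "finite (\<Gamma> R)" for R unfolding \<Gamma>_def by (rule finite_smooth_set[OF finite_Q Q_prime])
    have cd: "card (\<Gamma> R) = R ^ card Q" for R unfolding \<Gamma>_def by (rule card_smooth_set[OF finite_Q Q_prime])
    have pos: "r \<ge> 1" if "r \<in> \<Gamma> R" for r R using that by (auto simp: \<Gamma>_def smooth_set_def)
    \<comment> \<open>For fixed \<open>x\<close> the numbers \<open>U b F x\<close> play the role of
      \<phi> in \<open>scalar_transference\<close>, and the operator sum at \<open>r\<close> is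
      \<open>U r A x\<close>. Integration over \<open>x\<close> restores the norms, as each
      \<open>U r\<close> is isometric.\<close>
    have shift: "(\<Sum>i\<in>I. c i * U (r * recolour col (\<nu> i)) F x) = U r A x" if r: "r \<ge> 1" and x: "x \<in> space M" for r x
    proof -
      have "U (r * recolour col (\<nu> i)) F x = cnj (f r) * U (\<nu> i) F (S r x)" if i: "i \<in> I" for i
      proof -
        have "U (r * recolour col (\<nu> i)) F x = U (recolour col (\<nu> i) * r) F x" by (simp add: mult.commute)
        also have "\<dots> = U r (U (recolour col (\<nu> i)) F) x" by (rule U_mult[OF r recolour_eq(3)[OF \<nu>[OF i]] x])
        also have "\<dots> = cnj (f r) * U (\<nu> i) F (S r x)"
          unfolding U_def[of r] using U_recolour[OF \<nu>[OF i] S_space[OF r x]] by simp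
        finally show ?thesis .
      qed
      then show ?thesis unfolding U_def[of r A] A_def sum_distrib_left by (intro sum.cong refl) simp
    qed
    have "real R ^ card Q * (L2_norm M A)\<^sup>2 = (\<Sum>r\<in>\<Gamma> R. (L2_norm M A)\<^sup>2)" by (simp add: cd)
    also have "\<dots> = (\<Sum>r\<in>\<Gamma> R. (\<integral>x. (norm (U r A x))\<^sup>2 \<partial>M))"
      by (intro sum.cong refl) (simp add: U_norm[OF pos AL, symmetric] L2_norm_sq)
    also have "\<dots> = (\<integral>x. (\<Sum>r\<in>\<Gamma> R. (norm (U r A x))\<^sup>2) \<partial>M)"
      by (rule Bochner_Integration.integral_sum[symmetric]) (intro L2_integrable_sq U_L2 pos AL)
    also have "\<dots> \<le> (\<integral>x. s\<^sup>2 * (\<Sum>b\<in>\<Gamma> (R + D). (norm (U b F x))\<^sup>2) \<partial>M)"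
    proof (rule integral_mono_AE)
      show "integrable M (\<lambda>x. \<Sum>r\<in>\<Gamma> R. (norm (U r A x))\<^sup>2)"
        by (intro Bochner_Integration.integrable_sum L2_integrable_sq U_L2 pos AL)
      show "integrable M (\<lambda>x. s\<^sup>2 * (\<Sum>b\<in>\<Gamma> (R + D). (norm (U b F x))\<^sup>2))"
        by (intro integrable_mult_right Bochner_Integration.integrable_sum L2_integrable_sq U_L2 pos F)
      show "AE x in M. (\<Sum>r\<in>\<Gamma> R. (norm (U r A x))\<^sup>2) \<le> s\<^sup>2 * (\<Sum>b\<in>\<Gamma> (R + D). (norm (U b F x))\<^sup>2)"
      proof (rule AE_I2)
        fix x assume x: "x \<in> space M"
        have "(\<Sum>r\<in>\<Gamma> R. (norm (U r A x))\<^sup>2) = (\<Sum>r\<in>\<Gamma> R. (norm (\<Sum>i\<in>I. c i * U (r * recolour col (\<nu> i)) F x))\<^sup>2)"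
          by (intro sum.cong refl) (simp add: shift[OF pos x])
        also have "\<dots> \<le> s\<^sup>2 * (\<Sum>b\<in>\<Gamma> (R + D). (norm (U b F x))\<^sup>2)"
          unfolding \<Gamma>_def
          by (rule scalar_transference[where \<phi> = "\<lambda>b. U b F x", OF finite_Q Q_prime _ I R D s]) (auto simp: Q_def)
        finally show "(\<Sum>r\<in>\<Gamma> R. (norm (U r A x))\<^sup>2) \<le> s\<^sup>2 * (\<Sum>b\<in>\<Gamma> (R + D). (norm (U b F x))\<^sup>2)" .
      qed
    qed
    also have "\<dots> = s\<^sup>2 * (\<integral>x. (\<Sum>b\<in>\<Gamma> (R + D). (norm (U b F x))\<^sup>2) \<partial>M)" by simp
    also have "(\<integral>x. (\<Sum>b\<in>\<Gamma> (R + D). (norm (U b F x))\<^sup>2) \<partial>M) = (\<Sum>b\<in>\<Gamma> (R + D). (\<integral>x. (norm (U b F x))\<^sup>2 \<partial>M))"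
      by (rule Bochner_Integration.integral_sum) (intro L2_integrable_sq U_L2 pos F)
    also have "\<dots> = (\<Sum>b\<in>\<Gamma> (R + D). (L2_norm M F)\<^sup>2)"
      by (intro sum.cong refl) (simp add: U_norm[OF pos F, symmetric] L2_norm_sq)
    also have "\<dots> = real (R + D) ^ card Q * (L2_norm M F)\<^sup>2" by (simp add: cd)
    finally show ?thesis .
  qed
  \<comment> \<open>Division by \<open>R ^ card Q\<close> leaves the factor
    \<open>((R + D) / R) ^ card Q\<close>, which tends to 1.\<close>
  have "(L2_norm M A)\<^sup>2 \<le> s\<^sup>2 * (1 ^ card Q * (L2_norm M F)\<^sup>2)"
  proof (rule tendsto_lowerbound)
    have "(\<lambda>R. real (R + D) / real R) \<longlonglongrightarrow> 1" by real_asymp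
    then show "(\<lambda>R. s\<^sup>2 * ((real (R + D) / real R) ^ card Q * (L2_norm M F)\<^sup>2)) \<longlonglongrightarrow> s\<^sup>2 * (1 ^ card Q * (L2_norm M F)\<^sup>2)"
      by (intro tendsto_intros)
    show "\<forall>\<^sub>F R in sequentially. (L2_norm M A)\<^sup>2 \<le> s\<^sup>2 * ((real (R + D) / real R) ^ card Q * (L2_norm M F)\<^sup>2)"
      using eventually_ge_at_top[of 1]
    proof eventually_elim
      case (elim R)
      have "real R ^ card Q > 0" using elim by simp
      then show ?case using main[OF elim] by (simp add: power_divide field_simps)
    qed
  qed simp
  also have "\<dots> = (s * L2_norm M F)\<^sup>2" by (simp add: power_mult_distrib)
  finally have "L2_norm M A \<le> s * L2_norm M F" by (rule power2_le_imp_le) (use s0 in auto)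
  then show ?thesis by (simp add: A_def[abs_def])
qed

section \<open>Averages and the ranges of \<open>U q - 1\<close>\<close>

lemma twisted_avg_eq: "twisted_avg S f F N x = (\<Sum>n=1..N. 1 / of_nat N * U n F x)"
  by (simp add: twisted_avg_def U_def sum_divide_distrib)

lemma twisted_avg_L2: "F \<in> L2 M \<Longrightarrow> twisted_avg S f F N \<in> L2 M"
  unfolding twisted_avg_eq[abs_def] by (intro L2_sum L2_cmult U_L2) auto

lemma twisted_avg_norm_le:
  assumes "F \<in> L2 M"
  shows "L2_norm M (twisted_avg S f F N) \<le> L2_norm M F"
proof -
  have "L2_norm M (twisted_avg S f F N) \<le> (\<Sum>n=1..N. L2_norm M (\<lambda>x. 1 / of_nat N * U n F x))"
    unfolding twisted_avg_eq[abs_def] by (intro L2_norm_sum_le L2_cmult U_L2 assms) auto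
  also have "\<dots> = (\<Sum>n=1..N. 1 / real N * L2_norm M F)"
    by (intro sum.cong refl, subst L2_norm_cmult) (simp add: U_norm assms norm_divide)
  also have "\<dots> \<le> L2_norm M F" by (cases "N = 0") auto
  finally show ?thesis .
qed

lemma twisted_avg_diff: "twisted_avg S f (\<lambda>x. F x - G x) N x = twisted_avg S f F N x - twisted_avg S f G N x"
  by (simp add: twisted_avg_eq U_diff sum_subtractf diff_divide_distrib)

lemma twisted_avg_add: "twisted_avg S f (\<lambda>x. F x + G x) N x = twisted_avg S f F N x + twisted_avg S f G N x"
  by (simp add: twisted_avg_def algebra_simps sum.distrib add_divide_distrib)

lemma twisted_avg_cmult: "twisted_avg S f (\<lambda>x. c * F x) N x = c * twisted_avg S f F N x"
  by (simp add: twisted_avg_def sum_distrib_left mult_ac)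

text \<open>The character sum attached to this average is \<open>z q - 1\<close> times the mean of
  \<open>colour_char col z\<close>. If \<open>z q\<close> is within \<open>d\<close> of 1 the first
  factor is small, otherwise the mean is, by \<open>uniform_mean_value_zero\<close>. Transference
  turns this uniform bound into a bound in L2.\<close>

lemma twisted_avg_range_tendsto_0:
  assumes G: "G \<in> L2 M" and q: "q \<in> Q"
    and div: "\<not> summable (\<lambda>p. if prime p \<and> col p = q then 1 / real p else 0)"
  shows "(\<lambda>N. L2_norm M (twisted_avg S f (\<lambda>x. U q G x - G x) N)) \<longlonglongrightarrow> 0"
proof (rule LIMSEQ_I)
  fix e :: real assume e: "e > 0"
  have q1: "q \<ge> 1" using Q_prime[OF q] by (simp add: prime_gt_0_nat Suc_le_eq)
  define d where "d = e / (2 * (L2_norm M G + 1))"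
  have d: "d > 0" unfolding d_def using e by (intro divide_pos_pos) (auto simp: add_nonneg_pos)
  have finc: "finite (col ` {p. prime p})" using finite_Q by (simp add: Q_def)
  obtain N0 where N0: "\<And>N z. N \<ge> N0 \<Longrightarrow> (\<forall>j. norm (z j) = 1) \<Longrightarrow> norm (z q - 1) \<ge> d \<Longrightarrow>
     norm (\<Sum>n=1..N. colour_char col z n) \<le> d / 2 * real N"
    using uniform_mean_value_zero[OF finc div d half_gt_zero[OF d]] by blast
  have "L2_norm M (twisted_avg S f (\<lambda>x. U q G x - G x) N) \<le> d * L2_norm M G" if N: "N \<ge> max N0 1" for N
  proof -
    \<comment> \<open>The Boolean tag writes the difference of the averages over
      \<open>q * n\<close> and over \<open>n\<close> as one linear combination, the form that
      \<open>L2_transference\<close> accepts.\<close>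
    define I where "I = {1..N} \<times> (UNIV :: bool set)"
    define \<nu> where "\<nu> = (\<lambda>(n, b). if b then q * n else n)"
    define c where "c = (\<lambda>(n :: nat, b). (if b then 1 else -1) / complex_of_nat N)"
    have sumI: "(\<Sum>i\<in>I. c i * g (\<nu> i)) = (\<Sum>n=1..N. 1 / of_nat N * (g (q * n) - g n))" for g :: "nat \<Rightarrow> complex"
    proof -
      have "(\<Sum>i\<in>I. c i * g (\<nu> i)) = (\<Sum>n=1..N. \<Sum>b\<in>UNIV. c (n, b) * g (\<nu> (n, b)))"
        unfolding I_def by (subst sum.cartesian_product) (simp add: case_prod_unfold)
      also have "\<dots> = (\<Sum>n=1..N. 1 / of_nat N * (g (q * n) - g n))"
        by (intro sum.cong refl) (simp add: UNIV_bool c_def \<nu>_def algebra_simps diff_divide_distrib)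
      finally show ?thesis .
    qed
    have "L2_norm M (\<lambda>x. \<Sum>i\<in>I. c i * U (\<nu> i) G x) \<le> d * L2_norm M G"
    proof (rule L2_transference[OF G])
      show "finite I" by (simp add: I_def)
      show "\<nu> i \<ge> 1" if "i \<in> I" for i using that q1 by (auto simp: I_def \<nu>_def Suc_le_eq)
      fix z :: "nat \<Rightarrow> complex" assume z: "\<forall>j. norm (z j) = 1"
      have "(\<Sum>i\<in>I. c i * colour_char col z (\<nu> i)) = (\<Sum>n=1..N. (z q - 1) * (colour_char col z n / of_nat N))"
        unfolding sumI
      proof (intro sum.cong refl)
        fix n assume "n \<in> {1..N}"
        then have "colour_char col z (q * n) = z q * colour_char col z n"
          using q1 Q_prime[OF q] col_Q[OF q] by (subst colour_char_mult) (auto simp: colour_char_prime)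
        then show "1 / of_nat N * (colour_char col z (q * n) - colour_char col z n) = (z q - 1) * (colour_char col z n / of_nat N)"
          by (simp add: algebra_simps diff_divide_distrib)
      qed
      also have "\<dots> = (z q - 1) * ((\<Sum>n=1..N. colour_char col z n) / of_nat N)"
        by (simp only: sum_distrib_left sum_divide_distrib)
      finally have eq: "norm (\<Sum>i\<in>I. c i * colour_char col z (\<nu> i)) = norm (z q - 1) * (norm (\<Sum>n=1..N. colour_char col z n) / real N)"
        by (simp add: norm_mult norm_divide)
      show "norm (\<Sum>i\<in>I. c i * colour_char col z (\<nu> i)) \<le> d"
      proof (cases "norm (z q - 1) \<ge> d")
        case True
        have "norm (\<Sum>n=1..N. colour_char col z n) \<le> d / 2 * real N" using N z True by (intro N0) auto
        then have "norm (\<Sum>n=1..N. colour_char col z n) / real N \<le> d / 2" using N by (simp add: divide_le_eq)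
        moreover have "norm (z q - 1) \<le> 2" using norm_triangle_ineq4[of "z q" 1] z by simp
        ultimately have "norm (z q - 1) * (norm (\<Sum>n=1..N. colour_char col z n) / real N) \<le> 2 * (d / 2)"
          by (intro mult_mono) auto
        then show ?thesis unfolding eq by simp
      next
        case False
        have "norm (\<Sum>n=1..N. colour_char col z n) \<le> (\<Sum>n=1..N. norm (colour_char col z n))" by (rule norm_sum)
        also have "\<dots> = real N" using z by (simp add: norm_colour_char)
        finally have "norm (\<Sum>n=1..N. colour_char col z n) / real N \<le> 1" using N by (simp add: divide_le_eq)
        then have "norm (z q - 1) * (norm (\<Sum>n=1..N. colour_char col z n) / real N) \<le> d * 1"
          using False d by (intro mult_mono) auto
        then show ?thesis unfolding eq by simp
      qed
    qed
    also have "L2_norm M (\<lambda>x. \<Sum>i\<in>I. c i * U (\<nu> i) G x) = L2_norm M (twisted_avg S f (\<lambda>x. U q G x - G x) N)"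
    proof (rule L2_norm_cong_AE)
      show "(\<lambda>x. \<Sum>i\<in>I. c i * U (\<nu> i) G x) \<in> borel_measurable M"
        by (intro L2_measurable L2_sum L2_cmult U_L2 G) (use q1 in \<open>auto simp: I_def \<nu>_def Suc_le_eq\<close>)
      show "twisted_avg S f (\<lambda>x. U q G x - G x) N \<in> borel_measurable M"
        by (intro L2_measurable twisted_avg_L2 L2_diff U_L2 G q1)
      show "AE x in M. (\<Sum>i\<in>I. c i * U (\<nu> i) G x) = twisted_avg S f (\<lambda>x. U q G x - G x) N x"
      proof (rule AE_I2)
        fix x assume x: "x \<in> space M"
        show "(\<Sum>i\<in>I. c i * U (\<nu> i) G x) = twisted_avg S f (\<lambda>x. U q G x - G x) N x"
          unfolding sumI[of "\<lambda>n. U n G x"] twisted_avg_eq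
          by (intro sum.cong refl) (use q1 x in \<open>simp add: U_diff U_mult\<close>)
      qed
    qed
    finally show ?thesis .
  qed
  moreover have "d * L2_norm M G < e"
  proof -
    have "d * L2_norm M G \<le> d * (L2_norm M G + 1)" using d by (intro mult_left_mono) auto
    also have "\<dots> = e / 2" using L2_norm_nonneg[of M G] by (simp add: d_def add_nonneg_eq_0_iff field_simps)
    finally show ?thesis using e by simp
  qed
  ultimately show "\<exists>N0. \<forall>N\<ge>N0. norm (L2_norm M (twisted_avg S f (\<lambda>x. U q G x - G x) N) - 0) < e"
    by (intro exI[of _ "max N0 1"]) (auto intro: le_less_trans)
qed

end

section \<open>The pretentious case\<close>

text \<open>The integers in question have all prime factors in \<open>P\<close>. Their reciprocal
  sum is bounded by an Euler product with factors \<open>1 / (1 - 1/p) \<le> 1 + 2/p\<close>, hence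
  by the exponential of twice the convergent sum.\<close>

lemma smooth_numbers_summable:
  fixes P :: "nat set"
  assumes P: "\<And>p. p \<in> P \<Longrightarrow> prime p" and sm: "summable (\<lambda>p. if p \<in> P then 1 / real p else 0)"
  shows "summable (\<lambda>a. if a \<in> Q_set ({p. prime p} - P) then 1 / real a else 0)"
proof (rule summableI_nonneg_bounded)
  fix n
  define B where "B = P \<inter> {..n}"
  have B: "finite B" "\<And>p. p \<in> B \<Longrightarrow> prime p" using P by (auto simp: B_def)
  have "(\<Sum>a<n. if a \<in> Q_set ({p. prime p} - P) then 1 / real a else 0)
     = (\<Sum>a\<in>{a\<in>{..<n}. a \<in> Q_set ({p. prime p} - P)}. 1 / real a)"
    by (rule sum.inter_filter[symmetric]) simp
  also have "\<dots> \<le> (\<Sum>a\<in>smooth_set B (Suc n). 1 / real a)"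
  proof (rule sum_mono2[OF finite_smooth_set[OF B]])
    show "{a \<in> {..<n}. a \<in> Q_set ({p. prime p} - P)} \<subseteq> smooth_set B (Suc n)"
    proof
      fix a assume a: "a \<in> {a \<in> {..<n}. a \<in> Q_set ({p. prime p} - P)}"
      then have "a \<in> {1..n}" by (auto simp: Q_set_def)
      then have "a \<in> smooth_set {p. prime p \<and> p \<le> n} (Suc n)"
        using atLeastAtMost_subset_smooth_set[of n "Suc n"] by blast
      then have s: "1 \<le> a" "\<And>p. prime p \<Longrightarrow> p dvd a \<Longrightarrow> p \<le> n"
          "\<And>p. prime p \<Longrightarrow> p \<le> n \<Longrightarrow> multiplicity p a < Suc n"
        unfolding smooth_set_def by blast+
      have "p \<in> P" if "prime p" "p dvd a" for p using a that unfolding Q_set_def by blast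
      then have "\<forall>p. prime p \<and> p dvd a \<longrightarrow> p \<in> B" using s(2) unfolding B_def by blast
      moreover have "\<forall>p\<in>B. multiplicity p a < Suc n" using s(3) B(2) unfolding B_def by blast
      ultimately show "a \<in> smooth_set B (Suc n)" using s(1) unfolding smooth_set_def by blast
    qed
  qed auto
  also have "\<dots> = (\<Prod>p\<in>B. \<Sum>e<Suc n. (1 / real p) ^ e)"
    by (rule euler_product_smooth) (use B in auto)
  also have "\<dots> \<le> (\<Prod>p\<in>B. 1 + 2 * (1 / real p))"
  proof (rule prod_mono)
    fix p assume "p \<in> B"
    then have p: "real p \<ge> 2" using B prime_ge_2_nat by simp
    define x where "x = 1 / real p"
    have x: "0 < x" "x \<le> 1 / 2" using p by (auto simp: x_def)
    have "(\<Sum>e<Suc n. x ^ e) \<le> (\<Sum>e. x ^ e)" by (rule sum_le_suminf) (use x in \<open>auto intro: summable_geometric\<close>)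
    also have "\<dots> = 1 / (1 - x)" using x by (intro suminf_geometric) auto
    also have "\<dots> \<le> 1 + 2 * x"
    proof -
      have "0 \<le> x * (1 - 2 * x)" using x by (intro mult_nonneg_nonneg) auto
      then have "1 \<le> (1 + 2 * x) * (1 - x)" by (simp add: algebra_simps)
      then show ?thesis using x by (simp add: divide_le_eq)
    qed
    finally have "(\<Sum>e<Suc n. x ^ e) \<le> 1 + 2 * x" .
    moreover have "0 \<le> (\<Sum>e<Suc n. x ^ e)" by (rule sum_nonneg) (use x in auto)
    ultimately show "0 \<le> (\<Sum>e<Suc n. (1 / real p) ^ e) \<and> (\<Sum>e<Suc n. (1 / real p) ^ e) \<le> 1 + 2 * (1 / real p)"
      by (simp only: x_def)
  qed
  also have "\<dots> \<le> exp (\<Sum>p\<in>B. 2 * (1 / real p))" by (rule prod_one_plus_le_exp) (use B in auto)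
  also have "\<dots> \<le> exp (2 * (\<Sum>p. if p \<in> P then 1 / real p else 0))"
  proof -
    have "(\<Sum>p\<in>B. 1 / real p) = (\<Sum>p\<in>B. if p \<in> P then 1 / real p else 0)" by (intro sum.cong) (auto simp: B_def)
    also have "\<dots> \<le> (\<Sum>p. if p \<in> P then 1 / real p else 0)" by (rule sum_le_suminf[OF sm]) (use B in auto)
    finally show ?thesis unfolding sum_distrib_left[symmetric] by simp
  qed
  finally show "(\<Sum>a<n. if a \<in> Q_set ({p. prime p} - P) then 1 / real a else 0)
     \<le> exp (2 * (\<Sum>p. if p \<in> P then 1 / real p else 0))" .
qed auto

text \<open>The primes of \<open>P\<close> up to \<open>y\<close> are handled by the finite sieve;
  the larger ones remove at most the proportion \<open>\<tau> y\<close>, a tail of the convergent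
  sum. Absolute convergence with non-zero factors makes \<open>c\<close> non-zero. The limit is over
  real \<open>x\<close> because it will be taken at \<open>N / a\<close>.\<close>

lemma rough_density:
  fixes P :: "nat set"
  assumes P: "\<And>p. p \<in> P \<Longrightarrow> prime p" and sm: "summable (\<lambda>p. if p \<in> P then 1 / real p else 0)"
  obtains c :: complex where "(\<lambda>p. if p \<in> P then 1 - 1 / of_nat p else 1) has_prod c" "c \<noteq> 0"
    "((\<lambda>x. complex_of_real (real (card {b \<in> Q_set P. real b \<le> x}) / x)) \<longlongrightarrow> c) at_top"
proof -
  define h :: "nat \<Rightarrow> complex" where "h p = (if p \<in> P then 1 - 1 / of_nat p else 1)" for p
  have "norm (h p - 1) = (if p \<in> P then 1 / real p else 0)" for p
    by (simp add: h_def norm_divide)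
  then have "abs_convergent_prod h" using sm by (subst abs_convergent_prod_conv_summable) simp
  then have conv: "convergent_prod h" by (rule abs_convergent_prod_imp_convergent_prod)
  define c where "c = prodinf h"
  have hp: "h has_prod c" unfolding c_def using conv by (rule convergent_prod_has_prod)
  have "h p \<noteq> 0" for p
  proof (cases "p \<in> P")
    case True
    then have "p \<noteq> 1" using P[OF True] by auto
    then have "complex_of_nat p \<noteq> 1" by (simp only: of_nat_eq_1_iff not_False_eq_True)
    then show ?thesis using True by (auto simp: h_def divide_eq_1_iff)
  qed (simp add: h_def)
  then have c0: "c \<noteq> 0" using has_prod_eq_0_iff[OF hp] by auto
  have plim: "(\<lambda>n. \<Prod>i\<le>n. h i) \<longlonglongrightarrow> c" unfolding c_def by (rule convergent_prod_LIMSEQ[OF conv])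
  define i where "i p = (if p \<in> P then 1 / real p else 0)" for p
  have i0: "i p \<ge> 0" for p by (simp add: i_def)
  have smi: "summable i" unfolding i_def by (rule sm)
  define \<tau> where "\<tau> y = (\<Sum>p. i (p + Suc y))" for y
  have "(\<lambda>y. suminf i - (\<Sum>p<Suc y. i p)) \<longlonglongrightarrow> suminf i - suminf i"
    by (intro tendsto_intros LIMSEQ_Suc summable_LIMSEQ smi)
  moreover have "suminf i - (\<Sum>p<Suc y. i p) = \<tau> y" for y
    unfolding \<tau>_def by (subst suminf_minus_initial_segment[OF smi]) simp
  ultimately have tau: "\<tau> \<longlonglongrightarrow> 0" by simp
  have close: "norm (complex_of_real (real (card {b \<in> Q_set P. real b \<le> x}) / x) - (\<Prod>i\<le>y. h i))
      \<le> 2 ^ card (P \<inter> {..y}) / x + \<tau> y" if x: "x \<ge> 1" for x y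
  proof -
    define B where "B = P \<inter> {..y}"
    have B: "finite B" "\<And>p. p \<in> B \<Longrightarrow> prime p" using P by (auto simp: B_def)
    define \<rho> where "\<rho> = (\<Prod>p\<in>B. 1 - 1 / real p)"
    have "(\<Prod>i\<le>y. h i) = (\<Prod>i\<in>{i\<in>{..y}. i \<in> P}. 1 - 1 / of_nat i)"
      unfolding h_def by (rule prod.inter_filter[symmetric]) simp
    also have "{i\<in>{..y}. i \<in> P} = B" by (auto simp: B_def)
    finally have hr: "(\<Prod>i\<le>y. h i) = of_real \<rho>" by (simp add: \<rho>_def)
    define K where "K = {b \<in> Q_set P. real b \<le> x}"
    define L where "L = {b \<in> Q_set B. real b \<le> x}"
    have fin: "finite {b::nat. real b \<le> x}"
      by (rule finite_subset[of _ "{..nat \<lfloor>x\<rfloor>}"]) (auto simp: le_nat_floor)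
    have finL: "finite L" unfolding L_def by (rule finite_subset[OF _ fin]) auto
    have KL: "K \<subseteq> L" by (auto simp: K_def L_def Q_set_def B_def)
    \<comment> \<open>What the finite sieve keeps in excess is divisible by a prime of
      \<open>P\<close> above \<open>y\<close>.\<close>
    have "L - K \<subseteq> (\<Union>p\<in>{p\<in>P. y < p \<and> real p \<le> x}. (\<lambda>m. p * m) ` {1..nat \<lfloor>x / real p\<rfloor>})"
    proof
      fix b assume b: "b \<in> L - K"
      then obtain p where p: "prime p" "p dvd b" "p \<in> P" "p \<notin> B" by (auto simp: L_def K_def Q_set_def)
      then obtain m where m: "b = p * m" by (elim dvdE)
      have bx: "1 \<le> b" "real b \<le> x" using b by (auto simp: L_def Q_set_def)
      have m1: "m \<ge> 1" using bx m by (cases m) auto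
      have p0: "real p > 0" using p by (simp add: prime_gt_0_nat)
      have "real m \<le> x / real p" using bx m p0 by (simp add: field_simps)
      then have "m \<le> nat \<lfloor>x / real p\<rfloor>" by (rule le_nat_floor)
      moreover have "p \<le> b" using m m1 by simp
      then have "real p \<le> x" using bx by linarith
      ultimately show "b \<in> (\<Union>p\<in>{p\<in>P. y < p \<and> real p \<le> x}. (\<lambda>m. p * m) ` {1..nat \<lfloor>x / real p\<rfloor>})"
        using p m m1 by (auto simp: B_def)
    qed
    moreover have finP: "finite {p\<in>P. y < p \<and> real p \<le> x}" by (rule finite_subset[OF _ fin]) auto
    ultimately have "card (L - K) \<le> card (\<Union>p\<in>{p\<in>P. y < p \<and> real p \<le> x}. (\<lambda>m. p * m) ` {1..nat \<lfloor>x / real p\<rfloor>})"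
      by (intro card_mono) auto
    also have "\<dots> \<le> (\<Sum>p\<in>{p\<in>P. y < p \<and> real p \<le> x}. card ((\<lambda>m. p * m) ` {1..nat \<lfloor>x / real p\<rfloor>}))"
      by (rule card_UN_le[OF finP])
    also have "\<dots> \<le> (\<Sum>p\<in>{p\<in>P. y < p \<and> real p \<le> x}. nat \<lfloor>x / real p\<rfloor>)"
      by (intro sum_mono order_trans[OF card_image_le]) auto
    finally have "real (card (L - K)) \<le> real (\<Sum>p\<in>{p\<in>P. y < p \<and> real p \<le> x}. nat \<lfloor>x / real p\<rfloor>)" by (simp only: of_nat_le_iff)
    also have "\<dots> = (\<Sum>p\<in>{p\<in>P. y < p \<and> real p \<le> x}. real (nat \<lfloor>x / real p\<rfloor>))" by simp
    also have "\<dots> \<le> (\<Sum>p\<in>{p\<in>P. y < p \<and> real p \<le> x}. x * i p)"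
    proof (rule sum_mono)
      fix p assume "p \<in> {p\<in>P. y < p \<and> real p \<le> x}"
      moreover have "real (nat \<lfloor>x / real p\<rfloor>) \<le> x / real p" using x by simp
      ultimately show "real (nat \<lfloor>x / real p\<rfloor>) \<le> x * i p" by (simp add: i_def)
    qed
    also have "\<dots> = x * (\<Sum>p\<in>{p\<in>P. y < p \<and> real p \<le> x}. i p)" by (simp add: sum_distrib_left)
    also have "(\<Sum>p\<in>{p\<in>P. y < p \<and> real p \<le> x}. i p) = (\<Sum>q\<in>(\<lambda>p. p - Suc y) ` {p\<in>P. y < p \<and> real p \<le> x}. i (q + Suc y))"
      by (subst sum.reindex) (auto simp: inj_on_def intro!: sum.cong)
    also have "\<dots> \<le> \<tau> y" unfolding \<tau>_def
      by (rule sum_le_suminf[OF summable_ignore_initial_segment[OF smi]]) (use finP i0 in auto)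
    finally have LK: "real (card (L - K)) \<le> x * \<tau> y" using x by simp
    have cK: "real (card K) = real (card L) - real (card (L - K))"
      using card_Diff_subset[OF finite_subset[OF KL finL] KL] card_mono[OF finL KL] by simp
    have rc: "\<bar>real (card L) - \<rho> * x\<bar> \<le> 2 ^ card B" unfolding L_def \<rho>_def by (rule rough_count[OF B]) (use x in auto)
    have "norm (complex_of_real (real (card K) / x) - (\<Prod>i\<le>y. h i)) = \<bar>real (card K) / x - \<rho>\<bar>"
      unfolding hr of_real_diff[symmetric] norm_of_real ..
    also have "\<dots> = \<bar>real (card K) - \<rho> * x\<bar> / x" 
    proof -
      have "real (card K) / x - \<rho> = (real (card K) - \<rho> * x) / x" using x by (simp add: diff_divide_distrib)
      then show ?thesis using x by (simp add: abs_divide)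
    qed
    also have "\<dots> \<le> (2 ^ card B + x * \<tau> y) / x" using x rc LK unfolding cK by (intro divide_right_mono) auto
    also have "\<dots> = 2 ^ card B / x + \<tau> y" using x by (simp add: add_divide_distrib)
    finally show ?thesis by (simp add: K_def B_def)
  qed
  have "((\<lambda>x. complex_of_real (real (card {b \<in> Q_set P. real b \<le> x}) / x)) \<longlongrightarrow> c) at_top"
  proof (rule tendstoI)
    fix e :: real assume e: "e > 0"
    have "\<forall>\<^sub>F y in sequentially. dist (\<Prod>i\<le>y. h i) c < e / 3" using plim e by (intro tendstoD) auto
    moreover have "\<forall>\<^sub>F y in sequentially. \<tau> y < e / 3" using tau e by (intro order_tendstoD) auto
    ultimately have "\<forall>\<^sub>F y in sequentially. dist (\<Prod>i\<le>y. h i) c < e / 3 \<and> \<tau> y < e / 3" by eventually_elim auto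
    then obtain y where y: "dist (\<Prod>i\<le>y. h i) c < e / 3" "\<tau> y < e / 3" by (auto simp: eventually_sequentially)
    have "((\<lambda>x. 2 ^ card (P \<inter> {..y}) / x :: real) \<longlongrightarrow> 0) at_top" by real_asymp
    then have "\<forall>\<^sub>F x :: real in at_top. 2 ^ card (P \<inter> {..y}) / x < e / 3" using e by (intro order_tendstoD) auto
    then show "\<forall>\<^sub>F x in at_top. dist (complex_of_real (real (card {b \<in> Q_set P. real b \<le> x}) / x)) c < e"
      using eventually_ge_at_top[of 1]
    proof eventually_elim
      case (elim x)
      have "dist (complex_of_real (real (card {b \<in> Q_set P. real b \<le> x}) / x)) c \<le>
         dist (complex_of_real (real (card {b \<in> Q_set P. real b \<le> x}) / x)) (\<Prod>i\<le>y. h i) + dist (\<Prod>i\<le>y. h i) c"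
        by (rule dist_triangle)
      also have "dist (complex_of_real (real (card {b \<in> Q_set P. real b \<le> x}) / x)) (\<Prod>i\<le>y. h i) \<le> 2 ^ card (P \<inter> {..y}) / x + \<tau> y"
        unfolding dist_norm by (rule close) (use elim in auto)
      finally show ?case using elim y by linarith
    qed
  qed
  then show ?thesis using that[of c] hp c0 by (simp add: h_def[abs_def])
qed

section \<open>The fixed space of the divergent colours\<close>

context twisted_system
begin

definition divergent_colour :: "nat \<Rightarrow> bool" where
  "divergent_colour q \<longleftrightarrow> \<not> summable (\<lambda>p. if prime p \<and> col p = q then 1 / real p else 0)"

text \<open>Only colours with a convergent reciprocal sum may fail to fix such a function. This puts
  the space inside \<open>pret_space\<close> and makes it the orthogonal complement of the ranges of
  \<open>U q - 1\<close> for divergent \<open>q\<close>.\<close>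

definition fixed_space :: "('a \<Rightarrow> complex) set" where
  "fixed_space = {P \<in> L2 M. \<forall>q\<in>Q. divergent_colour q \<longrightarrow> (AE x in M. U q P x = P x)}"

lemma Q_ge_1: "q \<in> Q \<Longrightarrow> q \<ge> 1"
  using Q_prime by (auto simp: prime_gt_0_nat Suc_le_eq)

text \<open>Mean ergodic argument: the functions whose averages vanish form a subspace
  \<open>Z\<close> that contains the ranges of \<open>U q - 1\<close> for divergent
  \<open>q\<close>. The component \<open>P\<close> of \<open>F\<close> orthogonal to
  \<open>Z\<close> is therefore fixed, hence orthogonal to \<open>F\<close>, which forces
  \<open>P = 0\<close>. So \<open>F\<close> is a limit of elements of \<open>Z\<close>, and the
  averages are contractions.\<close>

lemma twisted_avg_tendsto_0:
  assumes F: "F \<in> L2 M" and orth: "\<And>P. P \<in> fixed_space \<Longrightarrow> L2_inner M F P = 0"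
  shows "(\<lambda>N. L2_norm M (twisted_avg S f F N)) \<longlonglongrightarrow> 0"
proof -
  define Z where "Z = {W \<in> L2 M. (\<lambda>N. L2_norm M (twisted_avg S f W N)) \<longlonglongrightarrow> 0}"
  have "twisted_avg S f (\<lambda>x. 0) N = (\<lambda>x. 0)" for N by (simp add: fun_eq_iff twisted_avg_def)
  then have Z0: "(\<lambda>x. 0) \<in> Z" by (simp add: Z_def)
  have Zadd: "(\<lambda>x. A x + B x) \<in> Z" if "A \<in> Z" "B \<in> Z" for A B
  proof -
    have AB: "A \<in> L2 M" "B \<in> L2 M" using that by (auto simp: Z_def)
    have "(\<lambda>N. L2_norm M (twisted_avg S f (\<lambda>x. A x + B x) N)) \<longlonglongrightarrow> 0"
    proof (rule Lim_null_comparison)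
      show "(\<lambda>N. L2_norm M (twisted_avg S f A N) + L2_norm M (twisted_avg S f B N)) \<longlonglongrightarrow> 0"
        using that tendsto_add[of "\<lambda>N. L2_norm M (twisted_avg S f A N)" 0] by (auto simp: Z_def)
      have "L2_norm M (twisted_avg S f (\<lambda>x. A x + B x) N) \<le> L2_norm M (twisted_avg S f A N) + L2_norm M (twisted_avg S f B N)" for N
        unfolding twisted_avg_add[abs_def] by (rule L2_norm_triangle[OF twisted_avg_L2[OF AB(1)] twisted_avg_L2[OF AB(2)]])
      then show "\<forall>\<^sub>F N in sequentially. norm (L2_norm M (twisted_avg S f (\<lambda>x. A x + B x) N)) \<le>
          L2_norm M (twisted_avg S f A N) + L2_norm M (twisted_avg S f B N)" by simp
    qed
    then show ?thesis using L2_add[OF AB] by (simp add: Z_def)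
  qed
  have Zcm: "(\<lambda>x. c * A x) \<in> Z" if "A \<in> Z" for c A
  proof -
    have "L2_norm M (twisted_avg S f (\<lambda>x. c * A x) N) = norm c * L2_norm M (twisted_avg S f A N)" for N
      unfolding twisted_avg_cmult[abs_def] by (rule L2_norm_cmult)
    then show ?thesis using that tendsto_mult_right_zero[of "\<lambda>N. L2_norm M (twisted_avg S f A N)" sequentially "norm c"]
      by (auto simp: Z_def intro: L2_cmult)
  qed
  obtain P where P: "P \<in> L2 M" "\<And>W. W \<in> Z \<Longrightarrow> L2_inner M P W = 0"
    and close: "\<And>e. e > 0 \<Longrightarrow> \<exists>W\<in>Z. L2_norm M (\<lambda>x. F x - W x - P x) < e"
    by (rule L2_projection[OF _ Z0 Zadd Zcm F]) (auto simp: Z_def)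
  have "AE x in M. U q P x = P x" if q: "q \<in> Q" and div: "divergent_colour q" for q
  proof -
    have UP: "U q P \<in> L2 M" by (rule U_L2[OF Q_ge_1[OF q] P(1)])
    have D: "(\<lambda>x. U q P x - P x) \<in> L2 M" by (rule L2_diff[OF UP P(1)])
    have "(\<lambda>x. U q P x - P x) \<in> Z"
      using twisted_avg_range_tendsto_0[OF P(1) q] div D by (simp add: Z_def divergent_colour_def)
    then have "L2_inner M P (\<lambda>x. U q P x - P x) = 0" by (rule P(2))
    then have "L2_inner M (\<lambda>x. U q P x - P x) P = 0" by (subst L2_inner_commute) simp
    \<comment> \<open>The inner product of \<open>U q P\<close> and \<open>P\<close> equals the
      square of their common norm: the equality case of Cauchy-Schwarz.\<close>
    then have "L2_inner M (U q P) P = L2_inner M P P" by (simp add: L2_inner_diff_left[OF UP P(1) P(1)])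
    then have "(L2_norm M (\<lambda>x. U q P x - P x))\<^sup>2 = 0"
      by (simp add: L2_norm_sq_diff[OF UP P(1)] L2_inner_self U_norm[OF Q_ge_1[OF q] P(1)])
    then have "AE x in M. U q P x - P x = 0" using L2_norm_eq_0_iff[OF D] by simp
    then show ?thesis by simp
  qed
  then have "P \<in> fixed_space" using P(1) by (simp add: fixed_space_def)
  then have FP: "L2_inner M F P = 0" by (rule orth)
  have WL: "W \<in> L2 M" if "W \<in> Z" for W using that by (simp add: Z_def)
  have nP: "L2_norm M P = 0"
  proof (rule ccontr)
    assume "L2_norm M P \<noteq> 0"
    then have n: "L2_norm M P > 0" using L2_norm_nonneg[of M P] by linarith
    obtain W where W: "W \<in> Z" "L2_norm M (\<lambda>x. F x - W x - P x) < L2_norm M P" using close[OF n] by blast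
    have "L2_inner M (\<lambda>x. F x - W x - P x) P = L2_inner M F P - L2_inner M W P - L2_inner M P P"
      using F WL[OF W(1)] P(1) by (simp add: L2_inner_diff_left L2_diff)
    moreover have "L2_inner M W P = 0" by (subst L2_inner_commute) (simp add: P(2)[OF W(1)])
    ultimately have "norm (L2_inner M (\<lambda>x. F x - W x - P x) P) = (L2_norm M P)\<^sup>2"
      by (simp add: FP L2_inner_self norm_power)
    then have "L2_norm M P * L2_norm M P \<le> L2_norm M (\<lambda>x. F x - W x - P x) * L2_norm M P"
      using L2_inner_le[OF L2_diff[OF L2_diff[OF F WL[OF W(1)]] P(1)] P(1)] by (simp add: power2_eq_square)
    then show False using W(2) n by simp
  qed
  show ?thesis
  proof (rule LIMSEQ_I)
    fix e :: real assume e: "e > 0"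
    obtain W where W: "W \<in> Z" "L2_norm M (\<lambda>x. F x - W x - P x) < e / 2" using close[of "e / 2"] e by auto
    have FW: "(\<lambda>x. F x - W x) \<in> L2 M" by (rule L2_diff[OF F WL[OF W(1)]])
    have "L2_norm M (\<lambda>x. F x - W x) = L2_norm M (\<lambda>x. (F x - W x - P x) + P x)" by simp
    also have "\<dots> \<le> L2_norm M (\<lambda>x. F x - W x - P x) + L2_norm M P" by (intro L2_norm_triangle L2_diff FW P)
    finally have fw: "L2_norm M (\<lambda>x. F x - W x) < e / 2" using W nP by simp
    have "\<forall>\<^sub>F N in sequentially. L2_norm M (twisted_avg S f W N) < e / 2"
      using W(1) e unfolding Z_def by (intro order_tendstoD) auto
    then obtain N0 where N0: "\<And>N. N \<ge> N0 \<Longrightarrow> L2_norm M (twisted_avg S f W N) < e / 2" by (auto simp: eventually_sequentially)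
    show "\<exists>N0. \<forall>N\<ge>N0. norm (L2_norm M (twisted_avg S f F N) - 0) < e"
    proof (intro exI[of _ N0] allI impI)
      fix N assume N: "N \<ge> N0"
      have "twisted_avg S f F N = (\<lambda>x. twisted_avg S f (\<lambda>x. F x - W x) N x + twisted_avg S f W N x)"
        by (simp add: fun_eq_iff twisted_avg_diff)
      then have "L2_norm M (twisted_avg S f F N) \<le> L2_norm M (twisted_avg S f (\<lambda>x. F x - W x) N) + L2_norm M (twisted_avg S f W N)"
        using L2_norm_triangle[OF twisted_avg_L2[OF FW] twisted_avg_L2[OF WL[OF W(1)]]] by simp
      also have "L2_norm M (twisted_avg S f (\<lambda>x. F x - W x) N) \<le> L2_norm M (\<lambda>x. F x - W x)" by (rule twisted_avg_norm_le[OF FW])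
      finally show "norm (L2_norm M (twisted_avg S f F N) - 0) < e" using fw N0[OF N] by simp
    qed
  qed
qed

lemma AE_eigen_iff:
  assumes "n \<ge> 1"
  shows "(AE x in M. F (S n x) = f n * F x) \<longleftrightarrow> (AE x in M. U n F x = F x)"
proof -
  have ff: "f n * cnj (f n) = 1" "f n \<noteq> 0"
    using norm_f[OF assms] by (auto simp: complex_norm_square[symmetric])
  have "F (S n x) = f n * F x \<longleftrightarrow> U n F x = F x" for x
  proof
    assume "F (S n x) = f n * F x"
    then have "U n F x = (f n * cnj (f n)) * F x" by (simp add: U_def mult_ac)
    then show "U n F x = F x" by (simp add: ff)
  next
    assume "U n F x = F x"
    then have "f n * F x = (f n * cnj (f n)) * F (S n x)" by (simp add: U_def mult_ac flip: \<open>U n F x = F x\<close>)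
    then show "F (S n x) = f n * F x" by (simp add: ff)
  qed
  then show ?thesis by simp
qed

lemma eigen_col: "prime p \<Longrightarrow> (AE x in M. U (col p) F x = F x) \<longleftrightarrow> (AE x in M. U p F x = F x)"
  by (intro AE_cong) (simp add: U_def col)

lemma bad_primes_iff: "p \<in> bad_primes M S f F \<longleftrightarrow> prime p \<and> \<not> (AE x in M. U p F x = F x)"
  using AE_eigen_iff[of p F] by (auto simp: bad_primes_def prime_gt_0_nat Suc_le_eq)

text \<open>The quantity \<open>e p\<close> depends only on the colour of \<open>p\<close> and so
  takes finitely many values. Where it is non-zero it lies between two positive constants, so the
  series is comparable to that of the reciprocals of the bad primes.\<close>

lemma pret_dist_finite_iff:
  assumes F: "F \<in> L2 M"
  shows "pret_dist M S f F < \<infinity> \<longleftrightarrow> summable (\<lambda>p. if p \<in> bad_primes M S f F then 1 / real p else 0)"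
proof -
  define e where "e p = (L2_norm M (\<lambda>x. F (S p x) - f p * F x))\<^sup>2" for p
  have ecol: "e (col p) = e p" if "prime p" for p
    unfolding e_def L2_norm_def using that
    by (intro arg_cong[of _ _ "\<lambda>x. (sqrt x)\<^sup>2"] Bochner_Integration.integral_cong refl) (simp add: col)
  have bad: "p \<in> bad_primes M S f F \<longleftrightarrow> prime p \<and> e p \<noteq> 0" for p
  proof (cases "prime p")
    case True
    then have p1: "p \<ge> 1" by (simp add: prime_gt_0_nat Suc_le_eq)
    have "(\<lambda>x. F (S p x)) \<in> L2 M"
      using measurable_S[OF p1 L2_measurable[OF F]] integrable_S[OF p1 L2_integrable_sq[OF F]] by (simp add: L2_def)
    then have "(\<lambda>x. F (S p x) - f p * F x) \<in> L2 M" by (intro L2_diff L2_cmult F)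
    then show ?thesis using True by (simp add: e_def bad_primes_def L2_norm_eq_0_iff)
  qed (simp add: bad_primes_def)
  have e0: "e p \<ge> 0" for p by (simp add: e_def)
  have eQ: "e p \<in> e ` Q" if "prime p" for p using ecol[OF that] that by (metis Q_def image_eqI mem_Collect_eq)
  define m where "m = Min (insert 1 (e ` Q - {0}))"
  define b where "b = Max (insert 0 (e ` Q))"
  have fin: "finite (e ` Q)" using finite_Q by simp
  have m0: "m > 0" unfolding m_def using fin e0 by (subst Min_gr_iff) (auto simp: less_le)
  have mle: "m \<le> e p" if "prime p" "e p \<noteq> 0" for p
    unfolding m_def using fin eQ[OF that(1)] that(2) by (intro Min_le) auto
  have ble: "e p \<le> b" if "prime p" for p
    unfolding b_def using fin eQ[OF that] by (intro Max_ge) auto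
  have "pret_dist M S f F < \<infinity> \<longleftrightarrow> (\<lambda>p. e p / real p) summable_on {p. prime p}"
    by (auto simp: pret_dist_def e_def Let_def)
  also have "\<dots> \<longleftrightarrow> (\<lambda>p. if prime p then e p / real p else 0) summable_on UNIV"
    by (rule summable_on_cong_neutral) auto
  also have "\<dots> \<longleftrightarrow> summable (\<lambda>p. if prime p then e p / real p else 0)"
  proof
    assume "summable (\<lambda>p. if prime p then e p / real p else 0)"
    moreover have "norm (if prime p then e p / real p else 0) = (if prime p then e p / real p else 0)" for p
      using e0[of p] by simp
    ultimately show "(\<lambda>p. if prime p then e p / real p else 0) summable_on UNIV"
      by (intro norm_summable_imp_summable_on) simp
  qed (rule summable_on_imp_summable)
  also have "\<dots> \<longleftrightarrow> summable (\<lambda>p. if p \<in> bad_primes M S f F then 1 / real p else 0)"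
  proof
    assume s: "summable (\<lambda>p. if prime p then e p / real p else 0)"
    show "summable (\<lambda>p. if p \<in> bad_primes M S f F then 1 / real p else 0)"
    proof (rule summable_comparison_test')
      show "summable (\<lambda>p. 1 / m * (if prime p then e p / real p else 0))" by (rule summable_mult[OF s])
      fix p :: nat
      have "1 / real p \<le> 1 / m * (e p / real p)" if "prime p" "e p \<noteq> 0"
      proof -
        have "1 / real p = 1 / m * (m / real p)" using m0 by simp
        also have "\<dots> \<le> 1 / m * (e p / real p)" using m0 mle[OF that] by (intro mult_left_mono divide_right_mono) auto
        finally show ?thesis .
      qed
      then show "norm (if p \<in> bad_primes M S f F then 1 / real p else 0) \<le> 1 / m * (if prime p then e p / real p else 0)"
        using e0[of p] m0 by (auto simp: bad mult.commute)
    qed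
  next
    assume s: "summable (\<lambda>p. if p \<in> bad_primes M S f F then 1 / real p else 0)"
    show "summable (\<lambda>p. if prime p then e p / real p else 0)"
    proof (rule summable_comparison_test')
      show "summable (\<lambda>p. b * (if p \<in> bad_primes M S f F then 1 / real p else 0))" by (rule summable_mult[OF s])
      fix p :: nat
      have "e p / real p \<le> b / real p" if "prime p" using ble[OF that] by (rule divide_right_mono) simp
      then show "norm (if prime p then e p / real p else 0) \<le> b * (if p \<in> bad_primes M S f F then 1 / real p else 0)"
        using e0[of p] by (auto simp: bad)
    qed
  qed
  finally show ?thesis .
qed

text \<open>Every bad prime of such a function has a colour with convergent reciprocal sum, and
  there are finitely many colours.\<close>

lemma fixed_space_pret_dist:
  assumes P: "P \<in> fixed_space"
  shows "pret_dist M S f P < \<infinity>"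
proof -
  have PL: "P \<in> L2 M" using P by (simp add: fixed_space_def)
  have "summable (\<lambda>p. if p \<in> bad_primes M S f P then 1 / real p else 0)"
  proof (rule summable_comparison_test')
    show "summable (\<lambda>p. \<Sum>q\<in>{q\<in>Q. \<not> divergent_colour q}. if prime p \<and> col p = q then 1 / real p else 0)"
      by (rule summable_sum) (simp add: divergent_colour_def)
    fix p :: nat
    show "norm (if p \<in> bad_primes M S f P then 1 / real p else 0)
      \<le> (\<Sum>q\<in>{q\<in>Q. \<not> divergent_colour q}. if prime p \<and> col p = q then 1 / real p else 0)"
    proof (cases "p \<in> bad_primes M S f P")
      case True
      then have p: "prime p" "\<not> (AE x in M. U (col p) P x = P x)" by (auto simp: bad_primes_iff eigen_col)
      have cQ: "col p \<in> Q" using p by (auto simp: Q_def)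
      then have "\<not> divergent_colour (col p)" using P p by (auto simp: fixed_space_def)
      then have "(\<Sum>q\<in>{col p}. if prime p \<and> col p = q then 1 / real p else 0)
        \<le> (\<Sum>q\<in>{q\<in>Q. \<not> divergent_colour q}. if prime p \<and> col p = q then 1 / real p else 0)"
        using cQ finite_Q by (intro sum_mono2) auto
      then show ?thesis using True p by simp
    qed (simp add: sum_nonneg)
  qed
  then show ?thesis using pret_dist_finite_iff[OF PL] by blast
qed

lemma U_rough_fixed:
  assumes "b \<in> Q_set (bad_primes M S f F)"
  shows "AE x in M. U b F x = F x"
proof -
  have *: "prod_mset A \<ge> 1 \<and> (AE x in M. U (prod_mset A) F x = F x)" if "\<forall>p\<in>#A. prime p \<and> p \<notin> bad_primes M S f F" for A
    using that
  proof (induction A)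
    case empty
    have "AE x in M. U 1 F x = F x" by (rule AE_I2) (rule U_1)
    then show ?case by simp
  next
    case (add p A)
    then have p: "prime p" "AE x in M. U p F x = F x" and A: "prod_mset A \<ge> 1" "AE x in M. U (prod_mset A) F x = F x"
      by (auto simp: bad_primes_iff)
    have p1: "p \<ge> 1" using p by (simp add: prime_gt_0_nat Suc_le_eq)
    have "AE x in M. U (p * prod_mset A) F x = U (prod_mset A) (U p F) x"
      by (rule AE_I2) (rule U_mult[OF A(1) p1])
    moreover have "AE x in M. U (prod_mset A) (U p F) x = U (prod_mset A) F x" by (rule U_cong_AE[OF A(1) p(2)])
    ultimately have "AE x in M. U (p * prod_mset A) F x = F x" using A(2) by eventually_elim simp
    then show ?case using p1 A by (auto simp: Suc_le_eq)
  qed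
  have "b \<ge> 1" using assms by (simp add: Q_set_def)
  then have "prod_mset (prime_factorization b) = b" by (simp add: prod_mset_prime_factorization_nat)
  then show ?thesis using *[of "prime_factorization b"] assms by (auto simp: Q_set_def in_prime_factors_iff)
qed

end

section \<open>Functions with sparse bad primes\<close>

lemma sum_le_suminf_tail:
  fixes w :: "nat \<Rightarrow> real"
  assumes sm: "summable w" and w: "\<And>a. 0 \<le> w a" and X: "finite X" "\<And>a. a \<in> X \<Longrightarrow> n \<le> a"
  shows "(\<Sum>a\<in>X. w a) \<le> (\<Sum>k. w (k + n))"
proof -
  have "(\<Sum>a\<in>X. w a) = (\<Sum>k\<in>(\<lambda>a. a - n) ` X. w (k + n))"
    by (subst sum.reindex) (use X in \<open>auto simp: inj_on_def intro!: sum.cong\<close>, metis eq_diff_iff)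
  also have "\<dots> \<le> (\<Sum>k. w (k + n))"
    by (rule sum_le_suminf[OF summable_ignore_initial_segment[OF sm]]) (use X w in auto)
  finally show ?thesis .
qed

lemma suminf_tail_tendsto_0:
  fixes w :: "nat \<Rightarrow> 'b::real_normed_vector"
  assumes sm: "summable w"
  shows "(\<lambda>n. \<Sum>k. w (k + n)) \<longlonglongrightarrow> 0"
proof -
  have "(\<lambda>n. suminf w - (\<Sum>k<n. w k)) \<longlonglongrightarrow> suminf w - suminf w"
    by (intro tendsto_intros summable_LIMSEQ sm)
  then show ?thesis by (simp add: suminf_minus_initial_segment[OF sm])
qed

lemma infsum_UNIV_eq_suminf:
  fixes h :: "nat \<Rightarrow> 'b::banach"
  assumes "summable (\<lambda>n. norm (h n))"
  shows "infsum h UNIV = suminf h"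
  by (rule infsumI[OF norm_summable_imp_has_sum[OF assms summable_sums[OF summable_norm_cancel[OF assms]]]])

context twisted_system
begin

text \<open>Every \<open>n\<close> is uniquely \<open>a * b\<close> with \<open>a\<close> built from
  bad primes and \<open>b\<close> free of them, and \<open>U (a * b) F = U a F\<close> almost
  everywhere because \<open>U b F = F\<close>.\<close>

lemma twisted_avg_decomposition:
  fixes F :: "'a \<Rightarrow> complex" and N :: nat
  defines "P \<equiv> bad_primes M S f F"
  defines "A \<equiv> Q_set ({p. prime p} - P)"
  shows "AE x in M. twisted_avg S f F N x =
    (\<Sum>a\<in>A \<inter> {..N}. of_real (real (card {b \<in> Q_set P. a * b \<le> N}) / real N) * U a F x)"
proof -
  have AP: "p \<in> P" if "a \<in> A" "prime p" "p dvd a" for a p using that unfolding A_def Q_set_def by blast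
  have A1: "a \<ge> 1" if "a \<in> A" for a using that by (simp add: A_def Q_set_def)
  have Pp: "prime p" if "p \<in> P" for p using that by (simp add: P_def bad_primes_iff)
  \<comment> \<open>The side conditions stand inside the almost-everywhere statement, so that it
    holds for all \<open>a\<close> and \<open>b\<close> and countability yields one common null
    set.\<close>
  have "AE x in M. a \<ge> 1 \<longrightarrow> b \<in> Q_set P \<longrightarrow> U (a * b) F x = U a F x" for a b
  proof (cases "a \<ge> 1 \<and> b \<in> Q_set P")
    case True
    then have ab: "a \<ge> 1" "b \<ge> 1" by (auto simp: Q_set_def)
    have "AE x in M. U (b * a) F x = U a (U b F) x" by (rule AE_I2) (rule U_mult[OF ab])
    moreover have "AE x in M. U a (U b F) x = U a F x"
      using True by (intro U_cong_AE[OF ab(1)] U_rough_fixed) (simp add: P_def)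
    ultimately show ?thesis by eventually_elim (simp add: mult.commute)
  next
    case False
    then show ?thesis by (intro AE_I2) blast
  qed
  then have "AE x in M. \<forall>a b. a \<ge> 1 \<longrightarrow> b \<in> Q_set P \<longrightarrow> U (a * b) F x = U a F x"
    by (simp add: AE_all_countable)
  then show ?thesis
  proof eventually_elim
    case (elim x)
    define T where "T = Sigma (A \<inter> {..N}) (\<lambda>a. {b \<in> Q_set P. a * b \<le> N})"
    have bij: "bij_betw (\<lambda>(a, b). a * b) T {1..N}"
    proof (rule bij_betw_imageI)
      show "inj_on (\<lambda>(a, b). a * b) T"
      proof (rule inj_onI)
        fix s t assume st: "s \<in> T" "t \<in> T" "(case s of (a, b) \<Rightarrow> a * b) = (case t of (a, b) \<Rightarrow> a * b)"
        obtain a b a' b' where s: "s = (a, b)" and t: "t = (a', b')" by (cases s, cases t) auto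
        have "a = a' \<and> b = b'"
          using st A1 AP by (intro smooth_rough_inj[of a a' P b b']) (auto simp: s t T_def)
        then show "s = t" by (simp add: s t)
      qed
      show "(\<lambda>(a, b). a * b) ` T = {1..N}"
      proof
        show "(\<lambda>(a, b). a * b) ` T \<subseteq> {1..N}" using A1 by (force simp: T_def Q_set_def)
        show "{1..N} \<subseteq> (\<lambda>(a, b). a * b) ` T"
        proof
          fix n assume n: "n \<in> {1..N}"
          obtain m r where mr: "n = m * r" "m \<ge> 1" "\<forall>p. prime p \<and> p dvd m \<longrightarrow> p \<in> P" "r \<in> Q_set P"
            using smooth_rough_decomposition[of n P] n Pp by auto
          have "m \<in> A" using mr by (auto simp: A_def Q_set_def)
          moreover have "r \<ge> 1" using mr by (simp add: Q_set_def)
          then have "m * 1 \<le> m * r" by (rule mult_le_mono2)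
          then have "m \<le> n" unfolding mr(1) by simp
          then have "m \<le> N" using n by simp
          ultimately have "(m, r) \<in> T" using mr n by (auto simp: T_def)
          then show "n \<in> (\<lambda>(a, b). a * b) ` T" using mr by force
        qed
      qed
    qed
    have fin: "finite {b \<in> Q_set P. a * b \<le> N}" if "a \<ge> 1" for a
    proof (rule finite_subset)
      show "{b \<in> Q_set P. a * b \<le> N} \<subseteq> {..N}"
      proof
        fix b assume b: "b \<in> {b \<in> Q_set P. a * b \<le> N}"
        have "1 * b \<le> a * b" using that by (rule mult_le_mono1)
        moreover have "a * b \<le> N" using b by simp
        ultimately have "b \<le> N" unfolding mult_1 by (rule order_trans)
        then show "b \<in> {..N}" by simp
      qed
    qed simp
    have "(\<Sum>n=1..N. U n F x) = (\<Sum>(a, b)\<in>T. U (a * b) F x)"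
      using sum.reindex_bij_betw[OF bij, of "\<lambda>n. U n F x"] by (simp add: case_prod_unfold)
    also have "\<dots> = (\<Sum>(a, b)\<in>T. U a F x)"
      by (intro sum.cong refl) (use elim A1 in \<open>auto simp: T_def\<close>)
    also have "\<dots> = (\<Sum>a\<in>A \<inter> {..N}. \<Sum>b\<in>{b \<in> Q_set P. a * b \<le> N}. U a F x)"
      unfolding T_def by (rule sum.Sigma[symmetric]) (use fin A1 in auto)
    also have "\<dots> = (\<Sum>a\<in>A \<inter> {..N}. of_nat (card {b \<in> Q_set P. a * b \<le> N}) * U a F x)" by simp
    finally have "(\<Sum>n=1..N. U n F x) = (\<Sum>a\<in>A \<inter> {..N}. of_nat (card {b \<in> Q_set P. a * b \<le> N}) * U a F x)" .
    then show ?case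
      unfolding twisted_avg_eq sum_distrib_left[symmetric] by (simp add: sum_distrib_left)
  qed
qed

text \<open>Dominated convergence over \<open>a\<close>: the weight of \<open>U a F\<close> in the
  average is the number of admissible \<open>b \<le> N / a\<close> divided by \<open>N\<close>. It
  is at most \<open>1 / a\<close>, which is summable over \<open>A\<close>, and tends to
  \<open>c / a\<close>. The last clause comes from inverting the series.\<close>

lemma pretentious_limit:
  assumes F: "F \<in> L2 M" and sm: "summable (\<lambda>p. if p \<in> bad_primes M S f F then 1 / real p else 0)"
  defines "P \<equiv> bad_primes M S f F"
  defines "A \<equiv> Q_set ({p. prime p} - P)"
  obtains c G where "(\<lambda>p. if p \<in> P then 1 - 1 / of_nat p else 1) has_prod (c :: complex)" "c \<noteq> 0"
    "L2_has_sum M (\<lambda>n x. cnj (f n) / of_nat n * F (S n x)) A G"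
    "L2_tendsto M (twisted_avg S f F) (\<lambda>x. c * G x) sequentially"
    "ae_constant M G \<Longrightarrow> ae_constant M F"
proof -
  have Pp: "prime p" if "p \<in> P" for p using that by (simp add: P_def bad_primes_iff)
  have smP: "summable (\<lambda>p. if p \<in> P then 1 / real p else 0)" using sm by (simp add: P_def)
  have AP: "p \<in> P" if "a \<in> A" "prime p" "p dvd a" for a p using that unfolding A_def Q_set_def by blast
  have A1: "a \<ge> 1" if "a \<in> A" for a using that by (simp add: A_def Q_set_def)
  define w where "w a = (if a \<in> A then 1 / real a else 0)" for a
  have w0: "w a \<ge> 0" for a by (simp add: w_def)
  have smw: "summable w" unfolding w_def[abs_def] A_def by (rule smooth_numbers_summable[OF Pp smP])
  define nF where "nF = L2_norm M F"
  have nF0: "nF \<ge> 0" by (simp add: nF_def)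
  define tl where "tl n = (\<Sum>k. w (k + n))" for n
  have tl0: "tl \<longlonglongrightarrow> 0" unfolding tl_def by (rule suminf_tail_tendsto_0[OF smw])
  have tl_nn: "tl n \<ge> 0" for n unfolding tl_def by (intro suminf_nonneg summable_ignore_initial_segment[OF smw] w0)
  define u where "u a = (\<lambda>x. if a \<in> A then 1 / of_nat a * U a F x else 0)" for a
  have uA: "u a = (\<lambda>x. 1 / of_nat a * U a F x)" if "a \<in> A" for a using that by (simp add: u_def)
  have uL: "u a \<in> L2 M" for a
  proof (cases "a \<in> A")
    case True
    show ?thesis unfolding uA[OF True] by (intro L2_cmult U_L2 A1[OF True] F)
  qed (simp add: u_def)
  have un: "L2_norm M (u a) = w a * nF" for a
  proof (cases "a \<in> A")
    case True
    show ?thesis unfolding uA[OF True]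
      by (subst L2_norm_cmult) (simp add: U_norm[OF A1[OF True] F] nF_def w_def True norm_divide)
  qed (simp add: u_def w_def)
  have smu: "summable (\<lambda>a. L2_norm M (u a))" unfolding un by (rule summable_mult2[OF smw])
  obtain G where G: "G \<in> L2 M" and GAE: "AE x in M. summable (\<lambda>k. norm (u k x)) \<and> G x = (\<Sum>k. u k x)"
    and Gtail0: "\<And>n. L2_norm M (\<lambda>x. G x - (\<Sum>k<n. u k x)) \<le> (\<Sum>k. L2_norm M (u (k + n)))"
    using L2_series[OF uL smu] by blast
  have Gtail: "L2_norm M (\<lambda>x. (\<Sum>k<n. u k x) - G x) \<le> tl n * nF" for n
  proof -
    have "(\<Sum>k. L2_norm M (u (k + n))) = tl n * nF"
      unfolding un tl_def by (rule suminf_mult2[symmetric, OF summable_ignore_initial_segment[OF smw]])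
    then show ?thesis using Gtail0[of n] by (subst L2_norm_minus_commute) simp
  qed
  obtain c :: complex where c: "(\<lambda>p. if p \<in> P then 1 - 1 / of_nat p else 1) has_prod c" "c \<noteq> 0"
    and dens: "((\<lambda>x. complex_of_real (real (card {b \<in> Q_set P. real b \<le> x}) / x)) \<longlongrightarrow> c) at_top"
    by (rule rough_density[OF Pp smP])

  have has_sum: "L2_has_sum M (\<lambda>n x. cnj (f n) / of_nat n * F (S n x)) A G"
    unfolding L2_has_sum_def L2_tendsto_def
  proof (intro conjI G tendstoI)
    fix e :: real assume e: "e > 0"
    \<comment> \<open>The tail is paid twice: once for \<open>G\<close> against its partial sum,
      once for the elements of \<open>I\<close> from \<open>n\<close> on.\<close>
    have "(\<lambda>n. 2 * (tl n * nF)) \<longlonglongrightarrow> 2 * (0 * nF)" by (intro tendsto_intros tl0)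
    then have "\<forall>\<^sub>F n in sequentially. 2 * (tl n * nF) < e" using e by (intro order_tendstoD) auto
    then obtain n where n: "2 * (tl n * nF) < e" by (auto simp: eventually_sequentially)
    have "L2_norm M (\<lambda>x. (\<Sum>i\<in>I. cnj (f i) / of_nat i * F (S i x)) - G x) < e"
      if I: "finite I" "A \<inter> {..<n} \<subseteq> I" "I \<subseteq> A" for I
    proof -
      have "(\<Sum>i\<in>I. cnj (f i) / of_nat i * F (S i x)) = (\<Sum>k<n. u k x) + (\<Sum>i\<in>I - {..<n}. u i x)" for x
      proof -
        have "(\<Sum>i\<in>I. cnj (f i) / of_nat i * F (S i x)) = (\<Sum>i\<in>I. u i x)"
          using I by (intro sum.cong refl) (auto simp: u_def U_def)
        also have "\<dots> = (\<Sum>i\<in>I \<inter> {..<n}. u i x) + (\<Sum>i\<in>I - {..<n}. u i x)"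
          using I by (subst sum.union_disjoint[symmetric]) (auto intro!: sum.cong)
        also have "(\<Sum>i\<in>I \<inter> {..<n}. u i x) = (\<Sum>k<n. u k x)"
          using I by (intro sum.mono_neutral_left) (auto simp: u_def)
        finally show ?thesis .
      qed
      then have "L2_norm M (\<lambda>x. (\<Sum>i\<in>I. cnj (f i) / of_nat i * F (S i x)) - G x)
         = L2_norm M (\<lambda>x. ((\<Sum>k<n. u k x) - G x) + (\<Sum>i\<in>I - {..<n}. u i x))" by (simp add: algebra_simps)
      also have "\<dots> \<le> L2_norm M (\<lambda>x. (\<Sum>k<n. u k x) - G x) + L2_norm M (\<lambda>x. \<Sum>i\<in>I - {..<n}. u i x)"
        by (intro L2_norm_triangle L2_diff L2_sum uL G)
      also have "L2_norm M (\<lambda>x. \<Sum>i\<in>I - {..<n}. u i x) \<le> (\<Sum>i\<in>I - {..<n}. L2_norm M (u i))" by (intro L2_norm_sum_le uL)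
      also have "\<dots> = (\<Sum>i\<in>I - {..<n}. w i) * nF" by (simp add: un sum_distrib_right)
      also have "\<dots> \<le> tl n * nF"
        unfolding tl_def using I by (intro mult_right_mono sum_le_suminf_tail smw w0 nF0) auto
      finally show ?thesis using Gtail[of n] n by linarith
    qed
    then show "\<forall>\<^sub>F I in finite_subsets_at_top A. dist (L2_norm M (\<lambda>x. (\<Sum>i\<in>I. cnj (f i) / of_nat i * F (S i x)) - G x)) 0 < e"
      unfolding eventually_finite_subsets_at_top by (intro exI[of _ "A \<inter> {..<n}"]) auto
  qed

  define \<beta> where "\<beta> N a = real (card {b \<in> Q_set P. a * b \<le> N}) / real N" for N a
  have beta0: "\<beta> N a \<ge> 0" for N a by (simp add: \<beta>_def)
  have beta_le: "\<beta> N a \<le> w a" if a: "a \<in> A" for N a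
  proof (cases "N = 0")
    case False
    have "{b \<in> Q_set P. a * b \<le> N} \<subseteq> {1..N div a}"
      using A1[OF a] by (auto simp: Q_set_def less_eq_div_iff_mult_less_eq mult.commute)
    then have "card {b \<in> Q_set P. a * b \<le> N} \<le> card {1..N div a}" by (intro card_mono) auto
    then have "real (card {b \<in> Q_set P. a * b \<le> N}) \<le> real (N div a)" by simp
    also have "\<dots> \<le> real N / real a" by (rule of_nat_div_le_of_nat)
    finally show ?thesis using False a by (simp add: \<beta>_def w_def field_simps)
  qed (use w0 in \<open>simp add: \<beta>_def\<close>)
  have beta_lim: "(\<lambda>N. complex_of_real (\<beta> N a)) \<longlonglongrightarrow> c * (1 / of_nat a)" if a: "a \<in> A" for a
  proof -
    have a0: "real a > 0" using A1[OF a] by simp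
    have "filterlim (\<lambda>N. real N / real a) at_top sequentially" using a0 by real_asymp
    from filterlim_compose[OF dens this]
    have "(\<lambda>N. complex_of_real (real (card {b \<in> Q_set P. real b \<le> real N / real a}) / (real N / real a)) * (1 / of_nat a)) \<longlonglongrightarrow> c * (1 / of_nat a)"
      by (intro tendsto_intros)
    moreover have "complex_of_real (real (card {b \<in> Q_set P. real b \<le> real N / real a}) / (real N / real a)) * (1 / of_nat a) = complex_of_real (\<beta> N a)" for N
    proof -
      have "real b \<le> real N / real a \<longleftrightarrow> a * b \<le> N" for b
      proof -
        have "real b \<le> real N / real a \<longleftrightarrow> real (a * b) \<le> real N" using a0 by (simp add: field_simps)
        then show ?thesis by (simp only: of_nat_le_iff)
      qed
      then show ?thesis using a0 by (simp add: \<beta>_def)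
    qed
    ultimately show ?thesis by simp
  qed
  \<comment> \<open>Terms with \<open>a < n\<close> are compared individually with their limits;
    those with \<open>a \<ge> n\<close> are bounded by the tail of \<open>w\<close>.\<close>
  have avg: "L2_norm M (\<lambda>x. twisted_avg S f F N x - c * (\<Sum>k<n. u k x))
      \<le> ((\<Sum>a\<in>A \<inter> {..<n}. norm (complex_of_real (\<beta> N a) - c * (1 / of_nat a))) + tl n) * nF" if N: "N \<ge> n" for N n
  proof -
    define \<kappa> where "\<kappa> a = complex_of_real (\<beta> N a) - (if a < n then c * (1 / of_nat a) else 0)" for a
    have "L2_norm M (\<lambda>x. twisted_avg S f F N x - c * (\<Sum>k<n. u k x)) = L2_norm M (\<lambda>x. \<Sum>a\<in>A \<inter> {..N}. \<kappa> a * U a F x)"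
    proof (rule L2_norm_cong_AE)
      show "(\<lambda>x. twisted_avg S f F N x - c * (\<Sum>k<n. u k x)) \<in> borel_measurable M"
        by (intro L2_measurable L2_diff L2_cmult L2_sum uL) (use twisted_avg_L2[OF F] in simp)
      show "(\<lambda>x. \<Sum>a\<in>A \<inter> {..N}. \<kappa> a * U a F x) \<in> borel_measurable M"
        by (intro L2_measurable L2_sum L2_cmult U_L2 F) (use A1 in auto)
      show "AE x in M. twisted_avg S f F N x - c * (\<Sum>k<n. u k x) = (\<Sum>a\<in>A \<inter> {..N}. \<kappa> a * U a F x)"
        using twisted_avg_decomposition[of F N]
      proof eventually_elim
        case (elim x)
        have "c * (\<Sum>k<n. u k x) = (\<Sum>k<n. c * u k x)" by (rule sum_distrib_left)
        also have "\<dots> = (\<Sum>a\<in>A \<inter> {..<n}. c * u a x)" by (rule sum.mono_neutral_right) (auto simp: u_def)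
        also have "\<dots> = (\<Sum>a\<in>A \<inter> {..<n}. (if a < n then c * (1 / of_nat a) else 0) * U a F x)"
          by (intro sum.cong refl) (auto simp: u_def)
        also have "\<dots> = (\<Sum>a\<in>A \<inter> {..N}. (if a < n then c * (1 / of_nat a) else 0) * U a F x)"
          by (rule sum.mono_neutral_left) (use N in auto)
        finally have 1: "c * (\<Sum>k<n. u k x) = (\<Sum>a\<in>A \<inter> {..N}. (if a < n then c * (1 / of_nat a) else 0) * U a F x)" .
        have 2: "twisted_avg S f F N x = (\<Sum>a\<in>A \<inter> {..N}. complex_of_real (\<beta> N a) * U a F x)"
          using elim by (simp only: \<beta>_def A_def P_def)
        show ?case unfolding 1 2 \<kappa>_def by (simp only: sum_subtractf left_diff_distrib)
      qed
    qed
    also have "\<dots> \<le> (\<Sum>a\<in>A \<inter> {..N}. L2_norm M (\<lambda>x. \<kappa> a * U a F x))"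
      by (intro L2_norm_sum_le L2_cmult U_L2 F) (use A1 in auto)
    also have "\<dots> = (\<Sum>a\<in>A \<inter> {..N}. norm (\<kappa> a)) * nF"
      unfolding sum_distrib_right by (intro sum.cong refl, subst L2_norm_cmult) (use A1 in \<open>simp add: U_norm F nF_def\<close>)
    also have "(\<Sum>a\<in>A \<inter> {..N}. norm (\<kappa> a)) = (\<Sum>a\<in>A \<inter> {..<n}. norm (\<kappa> a)) + (\<Sum>a\<in>A \<inter> {n..N}. norm (\<kappa> a))"
      using N by (subst sum.union_disjoint[symmetric]) (auto intro!: sum.cong)
    also have "(\<Sum>a\<in>A \<inter> {..<n}. norm (\<kappa> a)) = (\<Sum>a\<in>A \<inter> {..<n}. norm (complex_of_real (\<beta> N a) - c * (1 / of_nat a)))"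
      by (intro sum.cong refl) (simp add: \<kappa>_def)
    also have "(\<Sum>a\<in>A \<inter> {n..N}. norm (\<kappa> a)) \<le> (\<Sum>a\<in>A \<inter> {n..N}. w a)"
      by (rule sum_mono) (use beta_le beta0 in \<open>auto simp: \<kappa>_def\<close>)
    also have "\<dots> \<le> tl n" unfolding tl_def by (rule sum_le_suminf_tail[OF smw w0]) auto
    finally show ?thesis using nF0 by (simp add: mult_right_mono)
  qed
  have tends: "L2_tendsto M (twisted_avg S f F) (\<lambda>x. c * G x) sequentially"
    unfolding L2_tendsto_def
  proof (intro conjI L2_cmult G LIMSEQ_I)
    fix e :: real assume e: "e > 0"
    have "(\<lambda>n. (1 + norm c) * (tl n * nF)) \<longlonglongrightarrow> (1 + norm c) * (0 * nF)" by (intro tendsto_intros tl0)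
    then have "\<forall>\<^sub>F n in sequentially. (1 + norm c) * (tl n * nF) < e / 2" using e by (intro order_tendstoD) auto
    then obtain n where n: "(1 + norm c) * (tl n * nF) < e / 2" by (auto simp: eventually_sequentially)
    have "(\<lambda>N. (\<Sum>a\<in>A \<inter> {..<n}. norm (complex_of_real (\<beta> N a) - c * (1 / of_nat a))) * nF)
       \<longlonglongrightarrow> (\<Sum>a\<in>A \<inter> {..<n}. norm (c * (1 / of_nat a) - c * (1 / of_nat a))) * nF"
      by (intro tendsto_mult_right tendsto_sum tendsto_norm tendsto_diff tendsto_const beta_lim) auto
    then have "\<forall>\<^sub>F N in sequentially. (\<Sum>a\<in>A \<inter> {..<n}. norm (complex_of_real (\<beta> N a) - c * (1 / of_nat a))) * nF < e / 2"
      using e by (intro order_tendstoD) auto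
    then obtain N0 where N0: "\<And>N. N \<ge> N0 \<Longrightarrow> (\<Sum>a\<in>A \<inter> {..<n}. norm (complex_of_real (\<beta> N a) - c * (1 / of_nat a))) * nF < e / 2"
      by (auto simp: eventually_sequentially)
    show "\<exists>N0. \<forall>N\<ge>N0. norm (L2_norm M (\<lambda>x. twisted_avg S f F N x - c * G x) - 0) < e"
    proof (intro exI[of _ "max n N0"] allI impI)
      fix N assume N: "max n N0 \<le> N"
      have "L2_norm M (\<lambda>x. twisted_avg S f F N x - c * G x) \<le>
         L2_norm M (\<lambda>x. twisted_avg S f F N x - c * (\<Sum>k<n. u k x)) + L2_norm M (\<lambda>x. c * (\<Sum>k<n. u k x) - c * G x)"
        by (rule L2_norm_triangle_diff[OF twisted_avg_L2[OF F] L2_cmult[OF L2_sum[OF uL]] L2_cmult[OF G]])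
      also have "L2_norm M (\<lambda>x. c * (\<Sum>k<n. u k x) - c * G x) = norm c * L2_norm M (\<lambda>x. (\<Sum>k<n. u k x) - G x)"
        by (subst L2_norm_cmult[symmetric]) (simp add: right_diff_distrib)
      also have "\<dots> \<le> norm c * (tl n * nF)" by (intro mult_left_mono Gtail) auto
      also have "L2_norm M (\<lambda>x. twisted_avg S f F N x - c * (\<Sum>k<n. u k x)) \<le>
         (\<Sum>a\<in>A \<inter> {..<n}. norm (complex_of_real (\<beta> N a) - c * (1 / of_nat a))) * nF + tl n * nF"
        using avg[of n N] N by (simp add: distrib_right)
      also have "(\<Sum>a\<in>A \<inter> {..<n}. norm (complex_of_real (\<beta> N a) - c * (1 / of_nat a))) * nF < e / 2" using N by (intro N0) simp
      finally show "norm (L2_norm M (\<lambda>x. twisted_avg S f F N x - c * G x) - 0) < e" using n by (simp add: distrib_right)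
    qed
  qed

  have const: "ae_constant M F" if cG: "ae_constant M G"
  proof -
    \<comment> \<open>\<open>Gy y\<close> is the part of the series over those \<open>a\<close>
      whose prime factors are all at least \<open>y\<close>. It starts as \<open>G\<close> and tends
      to the term of \<open>a = 1\<close>, which is \<open>F\<close>.\<close>
    define Ay where "Ay y = {a \<in> A. \<forall>p. prime p \<and> p dvd a \<longrightarrow> y \<le> p}" for y :: nat
    define Gy where "Gy y x = infsum (\<lambda>a. u a x) (Ay y)" for y x
    have so: "(\<lambda>a. u a x) summable_on X" if "summable (\<lambda>k. norm (u k x))" for x X
      using summable_on_subset_banach[OF norm_summable_imp_summable_on[OF that]] by blast
    \<comment> \<open>Removing a bad prime \<open>y\<close> is the operator
      \<open>1 - U y / y\<close>, the inverse of one Euler factor; for any other \<open>y\<close>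
      nothing changes.\<close>
    have step: "\<exists>k. \<forall>x\<in>space M. summable (\<lambda>k. norm (u k x)) \<longrightarrow> Gy (Suc y) x = Gy y x - k * Gy y (S y x)" for y
    proof (cases "y \<in> P")
      case False
      have "Ay (Suc y) = Ay y"
      proof
        show "Ay y \<subseteq> Ay (Suc y)"
        proof
          fix a assume a: "a \<in> Ay y"
          have "Suc y \<le> p" if "prime p" "p dvd a" for p
          proof -
            have "y \<le> p" "p \<in> P" using a that AP by (auto simp: Ay_def)
            then show ?thesis using False by (metis Suc_leI le_neq_implies_less)
          qed
          then show "a \<in> Ay (Suc y)" using a by (simp add: Ay_def)
        qed
      qed (auto simp: Ay_def)
      then show ?thesis by (intro exI[of _ 0]) (simp add: Gy_def)
    next
      case True
      then have y: "prime y" by (rule Pp)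
      then have y1: "y \<ge> 1" by (simp add: prime_gt_0_nat Suc_le_eq)
      have mA: "y * a \<in> A" if "a \<in> A" for a
        using that y1 True y by (auto simp: A_def Q_set_def prime_dvd_mult_iff primes_dvd_imp_eq Suc_le_eq dest: primes_dvd_imp_eq)
      \<comment> \<open>Either \<open>y\<close> does not divide \<open>a\<close>, or
        \<open>a = y * a'\<close> with \<open>a'\<close> again in \<open>Ay y\<close>, where further
        factors \<open>y\<close> are allowed.\<close>
      have split: "Ay y = Ay (Suc y) \<union> (\<lambda>a. y * a) ` Ay y"
      proof
        show "Ay y \<subseteq> Ay (Suc y) \<union> (\<lambda>a. y * a) ` Ay y"
        proof
          fix a assume a: "a \<in> Ay y"
          show "a \<in> Ay (Suc y) \<union> (\<lambda>a. y * a) ` Ay y"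
          proof (cases "y dvd a")
            case True
            then obtain a' where a': "a = y * a'" by (elim dvdE)
            have aa: "a \<in> A" "\<And>p. prime p \<Longrightarrow> p dvd a \<Longrightarrow> y \<le> p" using a by (auto simp: Ay_def)
            have dv: "p dvd a" if "p dvd a'" for p using that by (simp add: a')
            have "a' \<ge> 1" using A1[OF aa(1)] a' by (cases a') auto
            then have "a' \<in> A" using AP[OF aa(1)] dv unfolding A_def Q_set_def by blast
            then have "a' \<in> Ay y" using aa(2) dv unfolding Ay_def by blast
            then show ?thesis using a' by blast
          next
            case False
            have "Suc y \<le> p" if "prime p" "p dvd a" for p
            proof -
              have "y \<le> p" using a that by (auto simp: Ay_def)
              moreover have "p \<noteq> y" using that False by auto
              ultimately show ?thesis by simp
            qed
            then show ?thesis using a by (simp add: Ay_def)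
          qed
        qed
        have "y * a \<in> Ay y" if a: "a \<in> Ay y" for a
        proof -
          have "y \<le> p" if "prime p" "p dvd y * a" for p
          proof -
            have "p dvd y \<or> p dvd a" using that by (simp add: prime_dvd_mult_iff)
            then show ?thesis
            proof
              assume "p dvd y"
              then show ?thesis using that y primes_dvd_imp_eq by blast
            next
              assume "p dvd a"
              then show ?thesis using a that unfolding Ay_def by blast
            qed
          qed
          then show ?thesis using a mA unfolding Ay_def by blast
        qed
        moreover have "Ay (Suc y) \<subseteq> Ay y" unfolding Ay_def using Suc_leD by blast
        ultimately show "Ay (Suc y) \<union> (\<lambda>a. y * a) ` Ay y \<subseteq> Ay y" by blast
      qed
      have disj: "Ay (Suc y) \<inter> (\<lambda>a. y * a) ` Ay y = {}"
      proof -
        have "y * a \<notin> Ay (Suc y)" for a using y unfolding Ay_def by (auto intro!: exI[of _ y])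
        then show ?thesis by blast
      qed
      have inj: "inj_on (\<lambda>a. y * a) (Ay y)" using y1 by (auto simp: inj_on_def)
      show ?thesis
      proof (intro exI[of _ "cnj (f y) / of_nat y"] ballI impI)
        fix x assume x: "x \<in> space M" and s: "summable (\<lambda>k. norm (u k x))"
        have "Gy y x = Gy (Suc y) x + infsum (\<lambda>a. u a x) ((\<lambda>a. y * a) ` Ay y)"
          unfolding Gy_def by (subst split, rule infsum_Un_disjoint[OF so[OF s] so[OF s] disj])
        also have "infsum (\<lambda>a. u a x) ((\<lambda>a. y * a) ` Ay y) = infsum (\<lambda>a. u (y * a) x) (Ay y)"
          by (subst infsum_reindex[OF inj]) (simp add: o_def)
        also have "\<dots> = infsum (\<lambda>a. cnj (f y) / of_nat y * u a (S y x)) (Ay y)"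
        proof (rule infsum_cong)
          fix a assume "a \<in> Ay y"
          then have a: "a \<in> A" by (simp add: Ay_def)
          have "U (y * a) F x = U (a * y) F x" by (simp add: mult.commute)
          also have "\<dots> = U y (U a F) x" by (rule U_mult[OF y1 A1[OF a] x])
          also have "\<dots> = cnj (f y) * U a F (S y x)" by (rule U_def)
          finally show "u (y * a) x = cnj (f y) / of_nat y * u a (S y x)"
            unfolding uA[OF a] uA[OF mA[OF a]] by simp
        qed
        also have "\<dots> = cnj (f y) / of_nat y * Gy y (S y x)" unfolding Gy_def by (rule infsum_cmult_right')
        finally show "Gy (Suc y) x = Gy y x - cnj (f y) / of_nat y * Gy y (S y x)" by simp
      qed
    qed
    have sAE: "AE x in M. summable (\<lambda>k. norm (u k x))" using GAE by eventually_elim simp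
    have "\<exists>k. AE x in M. Gy y x = k" for y
    proof (induction y)
      case 0
      obtain k where k: "AE x in M. G x = k" using cG by (auto simp: ae_constant_def)
      have "AE x in M. Gy 0 x = k"
        using k GAE
      proof eventually_elim
        case (elim x)
        have "Gy 0 x = infsum (\<lambda>a. u a x) UNIV"
          unfolding Gy_def by (rule infsum_cong_neutral) (auto simp: Ay_def u_def)
        also have "\<dots> = (\<Sum>a. u a x)" by (rule infsum_UNIV_eq_suminf) (use elim in simp)
        finally show ?case using elim by simp
      qed
      then show ?case by blast
    next
      case (Suc y)
      then obtain k where k: "AE x in M. Gy y x = k" by blast
      obtain j where j: "\<forall>x\<in>space M. summable (\<lambda>k. norm (u k x)) \<longrightarrow> Gy (Suc y) x = Gy y x - j * Gy y (S y x)"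
        using step[of y] by (elim exE) (rule that)
      show ?case
      proof (cases "y \<ge> 1")
        case True
        have "AE x in M. Gy y (S y x) = k" by (rule AE_S[OF True k])
        then have "AE x in M. Gy (Suc y) x = k - j * k"
          using k sAE AE_space by eventually_elim (simp add: j)
        then show ?thesis by blast
      next
        \<comment> \<open>Nothing is known about \<open>S 0\<close>, but no prime is 0, so this step
          leaves the set as it is.\<close>
        case False
        then have "y = 0" by simp
        have "Ay (Suc 0) = Ay 0" using prime_gt_0_nat by (auto simp: Ay_def Suc_le_eq)
        then have "Gy (Suc y) x = Gy y x" for x using \<open>y = 0\<close> by (simp add: Gy_def)
        then show ?thesis using k by auto
      qed
    qed
    then obtain k where "\<And>y. AE x in M. Gy y x = k y" by metis
    then have kAE: "AE x in M. \<forall>y. Gy y x = k y" by (simp add: AE_all_countable)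
    have Glim: "(\<lambda>y. Gy y x) \<longlonglongrightarrow> F x" if x: "x \<in> space M" and s: "summable (\<lambda>k. norm (u k x))" for x
    proof -
      have oneA: "1 \<in> A" by (auto simp: A_def Q_set_def)
      have u1: "u 1 x = F x" unfolding uA[OF oneA] using U_1[OF x] by simp
      have "(\<lambda>y. Gy y x - F x) \<longlonglongrightarrow> 0"
      proof (rule Lim_null_comparison)
        show "(\<lambda>y. \<Sum>k. norm (u (k + y) x)) \<longlonglongrightarrow> 0" by (rule suminf_tail_tendsto_0[OF s])
        show "\<forall>\<^sub>F y in sequentially. norm (Gy y x - F x) \<le> (\<Sum>k. norm (u (k + y) x))"
          \<comment> \<open>From 2 on, \<open>a = 1\<close> lies in the initial segment
            \<open>a < y\<close>. It is the only element of \<open>Ay y\<close> there, since any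
            other one has a prime factor of at least \<open>y\<close>.\<close>
          using eventually_ge_at_top[of 2]
        proof eventually_elim
          case (elim y)
          define v where "v a = (if a \<in> Ay y then u a x else 0)" for a
          have vs: "summable (\<lambda>a. norm (v a))"
            by (rule summable_comparison_test'[OF s]) (simp add: v_def)
          have "Gy y x = infsum v UNIV" unfolding Gy_def by (rule infsum_cong_neutral) (auto simp: v_def)
          also have "\<dots> = suminf v" by (rule infsum_UNIV_eq_suminf[OF vs])
          also have "\<dots> = (\<Sum>a. v (a + y)) + (\<Sum>a<y. v a)"
            by (rule suminf_split_initial_segment[OF summable_norm_cancel[OF vs]])
          also have "(\<Sum>a<y. v a) = (\<Sum>a\<in>{1}. v a)"
          proof (rule sum.mono_neutral_right)
            show "\<forall>a\<in>{..<y} - {1}. v a = 0"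
            proof
              fix a assume a: "a \<in> {..<y} - {1}"
              have "a \<notin> Ay y"
              proof
                assume aA: "a \<in> Ay y"
                obtain p where p: "prime p" "p dvd a" using a prime_factor_nat[of a] by auto
                have "a \<ge> 1" using aA A1 by (simp add: Ay_def)
                then have "p \<le> a" using p by (intro dvd_imp_le) auto
                moreover have "y \<le> p" using aA p unfolding Ay_def by blast
                ultimately show False using a by simp
              qed
              then show "v a = 0" by (simp add: v_def)
            qed
          qed (use elim in auto)
          also have "(\<Sum>a\<in>{1}. v a) = F x"
          proof -
            have "1 \<in> Ay y" using oneA by (auto simp: Ay_def)
            then show ?thesis using u1 by (simp add: v_def)
          qed
          finally have "norm (Gy y x - F x) = norm (\<Sum>a. v (a + y))" by simp
          also have "\<dots> \<le> (\<Sum>a. norm (v (a + y)))"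
            by (rule summable_norm[OF summable_ignore_initial_segment[OF vs]])
          also have "\<dots> \<le> (\<Sum>a. norm (u (a + y) x))"
            by (rule suminf_le[OF _ summable_ignore_initial_segment[OF vs] summable_ignore_initial_segment[OF s]]) (simp add: v_def)
          finally show ?case .
        qed
      qed
      then show ?thesis by (simp add: LIM_zero_iff)
    qed
    have "AE x in M. F x = lim k"
      using kAE sAE AE_space
    proof eventually_elim
      case (elim x)
      then have "k \<longlonglongrightarrow> F x" using Glim[of x] by simp
      then show ?case by (simp add: limI)
    qed
    then show ?thesis by (auto simp: ae_constant_def)
  qed
  show ?thesis by (rule that[OF c has_sum tends const])
qed

section \<open>Mean values and the assertions of the theorem\<close>

lemma twisted_avg_const: "twisted_avg S f (\<lambda>_. k) N x = k * ((\<Sum>n=1..N. cnj (f n)) / of_nat N)"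
  by (simp add: twisted_avg_def sum_distrib_right[symmetric])

lemma L2_norm_const: "L2_norm M (\<lambda>_. k) = norm k"
  by (simp add: L2_norm_def prob_space)

text \<open>Existence of the mean value is obtained from the constant function 1. If it is fixed,
  its averages converge by \<open>pretentious_limit\<close>. Otherwise some divergent
  \<open>q\<close> has \<open>f q \<noteq> 1\<close>, the non-zero constant
  \<open>cnj (f q) - 1\<close> is in the range of \<open>U q - 1\<close>, and the mean is 0.\<close>

lemma mean_value_limit:
  "(\<lambda>N. (\<Sum>n=1..N. cnj (f n)) / of_nat N) \<longlonglongrightarrow> mean_value (\<lambda>n. cnj (f n))"
  "(\<lambda>_. 1) \<notin> fixed_space \<Longrightarrow> mean_value (\<lambda>n. cnj (f n)) = 0"
proof -
  define a where "a N = (\<Sum>n=1..N. cnj (f n)) / of_nat N" for N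
  have oneL: "(\<lambda>_. 1) \<in> L2 M" by simp
  have avg: "twisted_avg S f (\<lambda>_. 1) N = (\<lambda>_. a N)" for N
    by (simp add: fun_eq_iff twisted_avg_const a_def)
  have z: "a \<longlonglongrightarrow> 0" if "(\<lambda>_. 1) \<notin> fixed_space"
  proof -
    have "\<not> (\<forall>q\<in>Q. divergent_colour q \<longrightarrow> (AE x in M. U q (\<lambda>_. 1) x = 1))"
      using that oneL unfolding fixed_space_def by blast
    then obtain q where q: "q \<in> Q" "divergent_colour q" "\<not> (AE x in M. U q (\<lambda>_. 1) x = 1)" by blast
    then have fq: "cnj (f q) - 1 \<noteq> 0" by (auto simp: U_def)
    have "(\<lambda>N. L2_norm M (twisted_avg S f (\<lambda>x. U q (\<lambda>_. 1) x - 1) N)) \<longlonglongrightarrow> 0"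
      by (rule twisted_avg_range_tendsto_0[OF oneL q(1)]) (use q(2) in \<open>simp add: divergent_colour_def\<close>)
    moreover have "L2_norm M (twisted_avg S f (\<lambda>x. U q (\<lambda>_. 1) x - 1) N) = norm ((cnj (f q) - 1) * a N)" for N
    proof -
      have "twisted_avg S f (\<lambda>x. U q (\<lambda>_. 1) x - 1) N = (\<lambda>_. (cnj (f q) - 1) * a N)"
        by (simp add: fun_eq_iff U_def twisted_avg_const a_def)
      then show ?thesis by (simp only: L2_norm_const)
    qed
    ultimately have "(\<lambda>N. (cnj (f q) - 1) * a N) \<longlonglongrightarrow> 0" by (simp add: tendsto_norm_zero_iff)
    then have "(\<lambda>N. 1 / (cnj (f q) - 1) * ((cnj (f q) - 1) * a N)) \<longlonglongrightarrow> 1 / (cnj (f q) - 1) * 0"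
      by (rule tendsto_mult_left)
    then show ?thesis using fq by simp
  qed
  have "convergent a"
  proof (cases "(\<lambda>_. 1) \<in> fixed_space")
    case True
    have "summable (\<lambda>p. if p \<in> bad_primes M S f (\<lambda>_. 1) then 1 / real p else 0)"
      using fixed_space_pret_dist[OF True] pret_dist_finite_iff[OF oneL] by blast
    then obtain c G where "L2_tendsto M (twisted_avg S f (\<lambda>_. 1)) (\<lambda>x. c * G x) sequentially"
      using pretentious_limit[OF oneL] by blast
    then have G: "(\<lambda>x. c * G x) \<in> L2 M" "(\<lambda>N. L2_norm M (\<lambda>x. a N - c * G x)) \<longlonglongrightarrow> 0"
      unfolding L2_tendsto_def avg by auto
    \<comment> \<open>The averages of 1 are constant functions, so convergence in L2 makes the
      scalars a Cauchy sequence.\<close>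
    have "Cauchy a"
    proof (rule metric_CauchyI)
      fix e :: real assume "e > 0"
      then have "\<forall>\<^sub>F N in sequentially. L2_norm M (\<lambda>x. a N - c * G x) < e / 2"
        using G(2) by (intro order_tendstoD) auto
      then obtain N0 where N0: "\<And>N. N \<ge> N0 \<Longrightarrow> L2_norm M (\<lambda>x. a N - c * G x) < e / 2" by (auto simp: eventually_sequentially)
      have "dist (a m) (a n) < e" if "m \<ge> N0" "n \<ge> N0" for m n
      proof -
        have "dist (a m) (a n) = L2_norm M (\<lambda>x. a m - a n)" by (simp add: L2_norm_const dist_norm)
        also have "\<dots> \<le> L2_norm M (\<lambda>x. a m - c * G x) + L2_norm M (\<lambda>x. c * G x - a n)"
          by (rule L2_norm_triangle_diff) (use G in auto)
        also have "L2_norm M (\<lambda>x. c * G x - a n) = L2_norm M (\<lambda>x. a n - c * G x)" by (rule L2_norm_minus_commute)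
        finally show ?thesis using N0[OF that(1)] N0[OF that(2)] by linarith
      qed
      then show "\<exists>N0. \<forall>m\<ge>N0. \<forall>n\<ge>N0. dist (a m) (a n) < e" by blast
    qed
    then show ?thesis by (rule Cauchy_convergent)
  next
    case False
    then show ?thesis using z by (auto simp: convergent_def)
  qed
  then have "a \<longlonglongrightarrow> lim a" by (simp add: convergent_LIMSEQ_iff)
  moreover have m: "mean_value (\<lambda>n. cnj (f n)) = lim a" by (simp add: mean_value_def a_def[abs_def])
  ultimately show "(\<lambda>N. (\<Sum>n=1..N. cnj (f n)) / of_nat N) \<longlonglongrightarrow> mean_value (\<lambda>n. cnj (f n))"
    by (simp add: a_def[abs_def])
  show "mean_value (\<lambda>n. cnj (f n)) = 0" if "(\<lambda>_. 1) \<notin> fixed_space"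
    using limI[OF z[OF that]] by (simp add: m)
qed

text \<open>Split \<open>F = (F - g) + g\<close>. If 1 is in the fixed space, the hypothesis
  supplies the right constant; otherwise the mean value vanishes, and with it both \<open>g\<close>
  times the mean and the claimed limit. Both halves of (i) reduce to this.\<close>

lemma twisted_avg_tendsto_mean:
  assumes F: "F \<in> L2 M" and orth: "\<And>P. P \<in> fixed_space \<Longrightarrow> L2_inner M (\<lambda>x. F x - g) P = 0"
    and one: "(\<lambda>_. 1) \<in> fixed_space \<Longrightarrow> g = (\<integral>x. F x \<partial>M)"
  shows "L2_tendsto M (twisted_avg S f F) (\<lambda>_. mean_value (\<lambda>n. cnj (f n)) * (\<integral>x. F x \<partial>M)) sequentially"
proof -
  define a where "a N = (\<Sum>n=1..N. cnj (f n)) / of_nat N" for N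
  define m where "m = mean_value (\<lambda>n. cnj (f n)) * (\<integral>x. F x \<partial>M)"
  have Fg: "(\<lambda>x. F x - g) \<in> L2 M" by (intro L2_diff F L2_const)
  have "(\<lambda>N. g * a N - m) \<longlonglongrightarrow> g * mean_value (\<lambda>n. cnj (f n)) - m"
    unfolding a_def by (intro tendsto_intros mean_value_limit)
  moreover have "g * mean_value (\<lambda>n. cnj (f n)) - m = 0"
    using one mean_value_limit(2) by (cases "(\<lambda>_. 1) \<in> fixed_space") (auto simp: m_def)
  ultimately have 1: "(\<lambda>N. norm (g * a N - m)) \<longlonglongrightarrow> 0" by (simp add: tendsto_norm_zero)
  have "(\<lambda>N. L2_norm M (twisted_avg S f (\<lambda>x. F x - g) N)) \<longlonglongrightarrow> 0"
    by (rule twisted_avg_tendsto_0[OF Fg orth])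
  from tendsto_add[OF this 1] have lim: "(\<lambda>N. L2_norm M (twisted_avg S f (\<lambda>x. F x - g) N) + norm (g * a N - m)) \<longlonglongrightarrow> 0" by simp
  have "L2_norm M (\<lambda>x. twisted_avg S f F N x - m) \<le> L2_norm M (twisted_avg S f (\<lambda>x. F x - g) N) + norm (g * a N - m)" for N
  proof -
    have "(\<lambda>x. twisted_avg S f F N x - m) = (\<lambda>x. twisted_avg S f (\<lambda>x. F x - g) N x + (g * a N - m))"
      by (simp add: fun_eq_iff twisted_avg_diff twisted_avg_const a_def)
    then have "L2_norm M (\<lambda>x. twisted_avg S f F N x - m) \<le> L2_norm M (twisted_avg S f (\<lambda>x. F x - g) N) + L2_norm M (\<lambda>_. g * a N - m)"
      using L2_norm_triangle[OF twisted_avg_L2[OF Fg] L2_const] by simp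
    then show ?thesis by (simp only: L2_norm_const)
  qed
  then have "(\<lambda>N. L2_norm M (\<lambda>x. twisted_avg S f F N x - m)) \<longlonglongrightarrow> 0"
    by (intro Lim_null_comparison[OF always_eventually lim]) simp
  then show ?thesis unfolding L2_tendsto_def m_def by simp
qed

lemma L2_inner_one: "F \<in> L2 M \<Longrightarrow> L2_inner M (\<lambda>x. F x - g) (\<lambda>_. k) = ((\<integral>x. F x \<partial>M) - g) * cnj k"
  using L2_integrable(1) by (simp add: L2_inner_def prob_space)

text \<open>The fixed space lies in \<open>pret_space\<close>, so \<open>F - g\<close> is orthogonal
  to it; if it contains 1, testing against 1 identifies \<open>g\<close> as the integral.\<close>

lemma projection_constant_case:
  assumes F: "F \<in> L2 M" and G: "is_pret_proj M S f F G" "ae_constant M G"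
  shows "L2_tendsto M (twisted_avg S f F) (\<lambda>_. mean_value (\<lambda>n. cnj (f n)) * (\<integral>x. F x \<partial>M)) sequentially"
proof -
  obtain g where g: "AE x in M. G x = g" using G(2) by (auto simp: ae_constant_def)
  have GL: "G \<in> L2 M" using G(1) by (simp add: is_pret_proj_def L2_closure_def)
  have orth: "L2_inner M (\<lambda>x. F x - g) P = 0" if P: "P \<in> fixed_space" for P
  proof -
    have PL: "P \<in> L2 M" using P by (simp add: fixed_space_def)
    have "P \<in> pret_space M S f" using PL fixed_space_pret_dist[OF P] by (simp add: pret_space_def)
    then have "P \<in> L2_closure M (pret_space M S f)"
      using PL by (auto simp: L2_closure_def intro!: bexI[of _ P])
    then have "L2_inner M (\<lambda>x. F x - G x) P = 0" using G(1) by (simp add: is_pret_proj_def)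
    moreover have "L2_inner M (\<lambda>x. F x - G x) P = L2_inner M (\<lambda>x. F x - g) P"
      unfolding L2_inner_def
    proof (rule integral_cong_AE)
      show "(\<lambda>x. (F x - G x) * cnj (P x)) \<in> borel_measurable M"
        using L2_product_integrable(1)[OF L2_diff[OF F GL] PL] by (rule borel_measurable_integrable)
      show "(\<lambda>x. (F x - g) * cnj (P x)) \<in> borel_measurable M"
        using L2_product_integrable(1)[OF L2_diff[OF F L2_const] PL] by (rule borel_measurable_integrable)
      show "AE x in M. (F x - G x) * cnj (P x) = (F x - g) * cnj (P x)" using g by eventually_elim simp
    qed
    ultimately show ?thesis by simp
  qed
  show ?thesis
  proof (rule twisted_avg_tendsto_mean[OF F orth])
    assume "(\<lambda>_. 1) \<in> fixed_space"
    then have "L2_inner M (\<lambda>x. F x - g) (\<lambda>_. 1) = 0" by (rule orth)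
    then show "g = (\<integral>x. F x \<partial>M)" by (simp add: L2_inner_one[OF F])
  qed
qed

text \<open>Under the hypothesis every element of the fixed space is constant, and \<open>F\<close>
  minus its integral is orthogonal to constants.\<close>

lemma no_pretentious_case:
  assumes F: "F \<in> L2 M" and H: "\<And>G. G \<in> L2 M \<Longrightarrow> \<not> ae_constant M G \<Longrightarrow> pret_dist M S f G = \<infinity>"
  shows "L2_tendsto M (twisted_avg S f F) (\<lambda>_. mean_value (\<lambda>n. cnj (f n)) * (\<integral>x. F x \<partial>M)) sequentially"
proof (rule twisted_avg_tendsto_mean[OF F _ refl])
  fix P assume P: "P \<in> fixed_space"
  have PL: "P \<in> L2 M" using P by (simp add: fixed_space_def)
  have "ae_constant M P"
  proof (rule ccontr)
    assume "\<not> ae_constant M P"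
    then show False using H[OF PL] fixed_space_pret_dist[OF P] by simp
  qed
  then obtain k where k: "AE x in M. P x = k" by (auto simp: ae_constant_def)
  let ?g = "\<integral>x. F x \<partial>M"
  have "L2_inner M (\<lambda>x. F x - ?g) P = L2_inner M (\<lambda>x. F x - ?g) (\<lambda>_. k)"
    unfolding L2_inner_def
  proof (rule integral_cong_AE)
    show "(\<lambda>x. (F x - ?g) * cnj (P x)) \<in> borel_measurable M"
      using L2_product_integrable(1)[OF L2_diff[OF F L2_const] PL] by (rule borel_measurable_integrable)
    show "(\<lambda>x. (F x - ?g) * cnj k) \<in> borel_measurable M"
      using L2_product_integrable(1)[OF L2_diff[OF F L2_const] L2_const] by (rule borel_measurable_integrable)
    show "AE x in M. (F x - ?g) * cnj (P x) = (F x - ?g) * cnj k" using k by eventually_elim simp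
  qed
  then show "L2_inner M (\<lambda>x. F x - ?g) P = 0" by (simp add: L2_inner_one[OF F])
qed

end

theorem corollary1p15:
  fixes M :: "'a::metric_space measure"
    and S :: "nat \<Rightarrow> 'a \<Rightarrow> 'a"
    and f :: "nat \<Rightarrow> complex"
  assumes "fg_multiplicative_system M S"
    and "f \<in> M_c_fg"
  shows
    "(\<forall>F \<in> L2 M. (\<exists>G. is_pret_proj M S f F G \<and> ae_constant M G) \<longrightarrow>
        L2_tendsto M (twisted_avg S f F)
          (\<lambda>_. mean_value (\<lambda>n. cnj (f n)) * (\<integral>x. F x \<partial>M)) sequentially)
     \<and> ((\<forall>G \<in> L2 M. \<not> ae_constant M G \<longrightarrow> pret_dist M S f G = \<infinity>) \<longrightarrow>
        (\<forall>F \<in> L2 M. L2_tendsto M (twisted_avg S f F)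
          (\<lambda>_. mean_value (\<lambda>n. cnj (f n)) * (\<integral>x. F x \<partial>M)) sequentially))
     \<and> (\<forall>F \<in> L2 M. \<not> ae_constant M F \<and> pret_dist M S f F < \<infinity> \<longrightarrow>
        (let P = bad_primes M S f F in
         \<exists>c G. (\<lambda>p. if p \<in> P then 1 - 1 / of_nat p else 1) has_prod (c :: complex)
           \<and> L2_has_sum M (\<lambda>n x. cnj (f n) / of_nat n * F (S n x)) (Q_set ({p. prime p} - P)) G
           \<and> L2_tendsto M (twisted_avg S f F) (\<lambda>x. c * G x) sequentially
           \<and> \<not> (AE x in M. c * G x = mean_value (\<lambda>n. cnj (f n)) * (\<integral>x. F x \<partial>M))))"
proof -
  interpret fg_multiplicative_system M S by fact
  interpret twisted_system M S f by unfold_locales fact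
  show ?thesis
  proof (intro conjI ballI impI)
    fix F assume F: "F \<in> L2 M" and "\<exists>G. is_pret_proj M S f F G \<and> ae_constant M G"
    then show "L2_tendsto M (twisted_avg S f F) (\<lambda>_. mean_value (\<lambda>n. cnj (f n)) * (\<integral>x. F x \<partial>M)) sequentially"
      using projection_constant_case[OF F] by blast
  next
    fix F assume H: "\<forall>G \<in> L2 M. \<not> ae_constant M G \<longrightarrow> pret_dist M S f G = \<infinity>" and F: "F \<in> L2 M"
    show "L2_tendsto M (twisted_avg S f F) (\<lambda>_. mean_value (\<lambda>n. cnj (f n)) * (\<integral>x. F x \<partial>M)) sequentially"
      using no_pretentious_case[OF F] H by blast
  next
    fix F assume F: "F \<in> L2 M" and nc: "\<not> ae_constant M F \<and> pret_dist M S f F < \<infinity>"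
    have sm: "summable (\<lambda>p. if p \<in> bad_primes M S f F then 1 / real p else 0)"
      using nc pret_dist_finite_iff[OF F] by blast
    obtain c G where c: "(\<lambda>p. if p \<in> bad_primes M S f F then 1 - 1 / of_nat p else 1) has_prod (c :: complex)" "c \<noteq> 0"
      and G: "L2_has_sum M (\<lambda>n x. cnj (f n) / of_nat n * F (S n x)) (Q_set ({p. prime p} - bad_primes M S f F)) G"
        "L2_tendsto M (twisted_avg S f F) (\<lambda>x. c * G x) sequentially" "ae_constant M G \<Longrightarrow> ae_constant M F"
      using pretentious_limit[OF F sm] by blast
    \<comment> \<open>Stronger than the claim: since \<open>c \<noteq> 0\<close>, the limit is not
      almost everywhere equal to any constant.\<close>
    have "\<not> (AE x in M. c * G x = k)" for k
    proof
      assume "AE x in M. c * G x = k"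
      then have "AE x in M. G x = k / c" by eventually_elim (use c(2) in \<open>simp add: field_simps\<close>)
      then have "ae_constant M G" by (auto simp: ae_constant_def)
      then show False using G(3) nc by blast
    qed
    then show "let P = bad_primes M S f F in
         \<exists>c G. (\<lambda>p. if p \<in> P then 1 - 1 / of_nat p else 1) has_prod (c :: complex)
           \<and> L2_has_sum M (\<lambda>n x. cnj (f n) / of_nat n * F (S n x)) (Q_set ({p. prime p} - P)) G
           \<and> L2_tendsto M (twisted_avg S f F) (\<lambda>x. c * G x) sequentially
           \<and> \<not> (AE x in M. c * G x = mean_value (\<lambda>n. cnj (f n)) * (\<integral>x. F x \<partial>M))"
      unfolding Let_def using c(1) G(1,2) by blast
  qed
qed

end
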